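(* Assume the setting below and suppose moreover that $\kappa/\nu^{2}>6$. Then there exists a constant $C>0$ (independent of $n$) such that for every $n\in\mathbb{N}$, $$ \max_{k=0,1,\ldots,n}\mathbb{E}\big[|Y(t_{k})-Y^{(n)}(t_{k})|^{2}\big]^{1/2}\le \frac{C}{n^{1/2}} \quad\text{and}\quad \mathbb{E}\Big[\max_{k=0,1,\ldots,n}|Y(t_{k})-Y^{(n)}(t_{k})|^{2}\Big]^{1/2}\le \frac{C}{n^{1/4}}. $$
   Context: Standing setting. Let $d\ge 2$, $T>0$, $m=d(d-1)/2$. Let $\mathscr{B}^{d}=\{x\in\mathbb{R}^{d}:|x|\le 1\}$ and $\mathscr{S}^{d-1}=\{x\in\mathbb{R}^d:|x|=1\}$. Let $(\Omega,\mathscr{F},\mathbb{P})$ be a complete probability space with a filtration $(\mathscr{F}(t))_{t\ge0}$ satisfying the usual conditions, carrying a standard $(d+m)$-dimensional Brownian motion $B=(W_{1},\ldots,W_{d},\widehat W_{1},\ldots,\widehat W_{m})^{\top}$; write $W=(W_1,\dots,W_d)^\top$. Let $\kappa\ge 0$, $\nu>0$ be constants with $\kappa/\nu^{2}\ge\sqrt2-1$, and let $A_{0},A_{1},\ldots,A_{m}$ be real skew-symmetric $d\times d$ matrices ($A_p^\top=-A_p$). Let $x(0)\in\mathscr{B}^{d}\setminus\mathscr{S}^{d-1}$ be deterministic and let $X=(X_1,\dots,X_d)^\top$ be the (pathwise unique, strong) solution on $[0,T]$, with values in $\mathscr{B}^d$, of $$ \mathrm{d}X(t)=-\kappa X(t)\,\mathrm{d}t+\nu\sqrt{1-|X(t)|^{2}}\,\mathrm{d}W(t)+A_{0}X(t)\,\mathrm{d}t+\sum_{p=1}^{m}A_{p}X(t)\,\mathrm{d}\widehat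 W_{p}(t)+\frac12\sum_{p=1}^{m}A_{p}^{2}X(t)\,\mathrm{d}t,\qquad X(0)=x(0) $$ (i.e. the Stratonovich equation with terms $A_pX(t)\circ\mathrm{d}\widehat W_p(t)$). Define $Y=(Y_{0},Y_{1},\ldots,Y_{d})^{\top}:=(\sqrt{1-|X|^{2}},X_{1},\ldots,X_{d})^{\top}$. Scheme. For $n\in\mathbb{N}$ let $\Delta t=T/n$, $t_{k}=k\Delta t$, $\Delta_{k}W=W(t_{k+1})-W(t_{k})$, $\Delta_k\widehat W_p=\widehat W_p(t_{k+1})-\widehat W_p(t_k)$. Define $Y^{(n)}=(Y_0^{(n)},X_1^{(n)},\dots,X_d^{(n)})^\top$ by $Y^{(n)}(0)=Y(0)$ and, for $k=0,\ldots,n-1$, with $X^{(n)}=(X^{(n)}_1,\dots,X^{(n)}_d)^\top$: $$ b_{k}=Y_{0}^{(n)}(t_{k})-\nu X^{(n)}(t_{k})^{\top}\Delta_{k}W-\Big(\kappa-\tfrac{\nu^{2}}{2}+\tfrac{d\nu^{2}}{2}\Big)Y_{0}^{(n)}(t_{k})\Delta t,\qquad Y_{0}^{(n)}(t_{k+1})=\tfrac12\Big\{b_{k}+\sqrt{b_{k}^{2}+4(\kappa-\tfrac{\nu^{2}}{2})\Delta t}\Big\}, $$ which is the unique positive solution of $Y_0^{(n)}(t_{k+1})=b_k+(\kappa-\frac{\nu^2}{2})\Delta t/Y_0^{(n)}(t_{k+1})$, and $$ X^{(n)}(t_{k+1})=X^{(n)}(t_{k})-\kappa X^{(n)}(t_{k})\Delta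 t+\nu Y_{0}^{(n)}(t_{k})\Delta_{k}W+A_{0}X^{(n)}(t_{k})\Delta t+\sum_{p=1}^{m}A_{p}X^{(n)}(t_{k})\Delta_{k}\widehat W_{p}+\frac12\sum_{p=1}^{m}A_{p}^{2}X^{(n)}(t_{k})\Delta t. $$ *)

theory Defs
  imports "HOL-Probability.Probability"
begin

text \<open>Vectors in R^d are represented as functions nat => real, only the
components i < d being relevant; d x d matrices as nat => nat => real
(entries i, j < d).  Everything is 0-based: the paper's X_1..X_d are
components 0..d-1; the (d+m)-dimensional Brownian motion B is a process
with components 0..d+m-1, W_{i+1} = component i (i < d), and
hat W_p = component d+p-1 (p = 1..m).  The matrices are AA 0 = A_0 and
AA p = A_p for p = 1..m.\<close>

definition sqn :: "nat \<Rightarrow> (nat \<Rightarrow> real) \<Rightarrow> real" where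
  "sqn d x = (\<Sum>i<d. (x i)\<^sup>2)"

definition mv :: "nat \<Rightarrow> (nat \<Rightarrow> nat \<Rightarrow> real) \<Rightarrow> (nat \<Rightarrow> real) \<Rightarrow> nat \<Rightarrow> real" where
  "mv d A x = (\<lambda>i. \<Sum>j<d. A i j * x j)"

definition skew :: "nat \<Rightarrow> (nat \<Rightarrow> nat \<Rightarrow> real) \<Rightarrow> bool" where
  "skew d A \<longleftrightarrow> (\<forall>i<d. \<forall>j<d. A j i = - A i j)"

definition meas_wrt :: "'w set \<Rightarrow> 'w set set \<Rightarrow> ('w \<Rightarrow> real) \<Rightarrow> bool" where
  "meas_wrt \<Omega> G f \<longleftrightarrow> (\<forall>U\<in>sets borel. f -` U \<inter> \<Omega> \<in> G)"

definition usual_filtration :: "'w measure \<Rightarrow> (real \<Rightarrow> 'w set set) \<Rightarrow> bool" where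
  "usual_filtration M F \<longleftrightarrow>
     prob_space M \<and>
     (\<forall>N A. N \<in> null_sets M \<longrightarrow> A \<subseteq> N \<longrightarrow> A \<in> sets M) \<and>
     (\<forall>t\<ge>0. sigma_algebra (space M) (F t) \<and> F t \<subseteq> sets M) \<and>
     (\<forall>s t. 0 \<le> s \<longrightarrow> s \<le> t \<longrightarrow> F s \<subseteq> F t) \<and>
     (\<forall>t\<ge>0. F t = (\<Inter>u\<in>{t<..}. F u)) \<and>
     null_sets M \<subseteq> F 0"

text \<open>Standard k-dimensional Brownian motion with respect to the filtration F:
B(0)=0, continuous adapted paths, and for 0 <= s <= t the increment
B(t)-B(s) is independent of F(s) with law N(0,(t-s) I), expressed via the
conditional characteristic function:
E[1_A exp(i a.(B(t)-B(s)))] = P(A) exp(-(t-s)|a|^2/2) for all A in F(s), a in R^k.\<close>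
definition std_BM :: "'w measure \<Rightarrow> (real \<Rightarrow> 'w set set) \<Rightarrow> nat \<Rightarrow> (real \<Rightarrow> 'w \<Rightarrow> nat \<Rightarrow> real) \<Rightarrow> bool" where
  "std_BM M F k B \<longleftrightarrow>
     (\<forall>\<omega>\<in>space M. \<forall>i<k. B 0 \<omega> i = 0) \<and>
     (\<forall>\<omega>\<in>space M. \<forall>i<k. continuous_on {0..} (\<lambda>t. B t \<omega> i)) \<and>
     (\<forall>t\<ge>0. \<forall>i<k. meas_wrt (space M) (F t) (\<lambda>\<omega>. B t \<omega> i)) \<and>
     (\<forall>s t A (a::nat \<Rightarrow> real). 0 \<le> s \<longrightarrow> s \<le> t \<longrightarrow> A \<in> F s \<longrightarrow>
        (LINT \<omega>|M. indicator A \<omega> *\<^sub>R cis (\<Sum>i<k. a i * (B t \<omega> i - B s \<omega> i)))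
          = complex_of_real (measure M A * exp (- (t - s) * (\<Sum>i<k. (a i)\<^sup>2) / 2)))"

definition conv_in_prob :: "'w measure \<Rightarrow> (nat \<Rightarrow> 'w \<Rightarrow> real) \<Rightarrow> ('w \<Rightarrow> real) \<Rightarrow> bool" where
  "conv_in_prob M Z L \<longleftrightarrow>
     (\<forall>e>0. (\<lambda>N. measure M {\<omega> \<in> space M. e < \<bar>Z N \<omega> - L \<omega>\<bar>}) \<longlonglongrightarrow> 0)"

definition drift :: "nat \<Rightarrow> nat \<Rightarrow> real \<Rightarrow> (nat \<Rightarrow> nat \<Rightarrow> nat \<Rightarrow> real) \<Rightarrow> (nat \<Rightarrow> real) \<Rightarrow> nat \<Rightarrow> real" where
  "drift d m \<kappa> AA x i =
     - \<kappa> * x i + mv d (AA 0) x i + (1/2) * (\<Sum>p=1..m. mv d (AA p) (mv d (AA p) x) i)"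

definition ito_sum :: "nat \<Rightarrow> nat \<Rightarrow> real \<Rightarrow> (nat \<Rightarrow> nat \<Rightarrow> nat \<Rightarrow> real) \<Rightarrow>
    (real \<Rightarrow> 'w \<Rightarrow> nat \<Rightarrow> real) \<Rightarrow> (real \<Rightarrow> 'w \<Rightarrow> nat \<Rightarrow> real) \<Rightarrow> real \<Rightarrow> nat \<Rightarrow> nat \<Rightarrow> 'w \<Rightarrow> real" where
  "ito_sum d m \<nu> AA B X t i N \<omega> =
     (\<Sum>j<N. let s = real j * t / real N; s' = real (Suc j) * t / real N; x = X s \<omega> in
        \<nu> * sqrt (1 - sqn d x) * (B s' \<omega> i - B s \<omega> i)
        + (\<Sum>p=1..m. mv d (AA p) x i * (B s' \<omega> (d + p - 1) - B s \<omega> (d + p - 1))))"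

text \<open>X is a (strong) solution on [0,T] with values in the closed unit ball:
continuous adapted paths, X(0) = x0, and for every t in [0,T] and every
component i, X_i(t) - x0_i - int_0^t drift_i(X(s)) ds is the Ito integral of
the diffusion part, i.e. the limit in probability of the left-point Riemann
sums (which is the Ito integral for continuous adapted integrands).\<close>
definition is_solution :: "'w measure \<Rightarrow> (real \<Rightarrow> 'w set set) \<Rightarrow> nat \<Rightarrow> nat \<Rightarrow> real \<Rightarrow> real \<Rightarrow>
    (nat \<Rightarrow> nat \<Rightarrow> nat \<Rightarrow> real) \<Rightarrow> real \<Rightarrow> (real \<Rightarrow> 'w \<Rightarrow> nat \<Rightarrow> real) \<Rightarrow> (nat \<Rightarrow> real) \<Rightarrow>
    (real \<Rightarrow> 'w \<Rightarrow> nat \<Rightarrow> real) \<Rightarrow> bool" where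
  "is_solution M F d m \<kappa> \<nu> AA T B x0 X \<longleftrightarrow>
     (\<forall>\<omega>\<in>space M. \<forall>i<d. X 0 \<omega> i = x0 i) \<and>
     (\<forall>t\<in>{0..T}. \<forall>\<omega>\<in>space M. sqn d (X t \<omega>) \<le> 1) \<and>
     (\<forall>\<omega>\<in>space M. \<forall>i<d. continuous_on {0..T} (\<lambda>t. X t \<omega> i)) \<and>
     (\<forall>t\<in>{0..T}. \<forall>i<d. meas_wrt (space M) (F t) (\<lambda>\<omega>. X t \<omega> i)) \<and>
     (\<forall>t\<in>{0..T}. \<forall>i<d.
        conv_in_prob M (ito_sum d m \<nu> AA B X t i)
          (\<lambda>\<omega>. X t \<omega> i - x0 i - integral {0..t} (\<lambda>s. drift d m \<kappa> AA (X s \<omega>) i)))"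

definition scheme_step :: "nat \<Rightarrow> nat \<Rightarrow> real \<Rightarrow> real \<Rightarrow> (nat \<Rightarrow> nat \<Rightarrow> nat \<Rightarrow> real) \<Rightarrow> real \<Rightarrow>
    (nat \<Rightarrow> real) \<Rightarrow> (nat \<Rightarrow> real) \<Rightarrow> real \<times> (nat \<Rightarrow> real) \<Rightarrow> real \<times> (nat \<Rightarrow> real)" where
  "scheme_step d m \<kappa> \<nu> AA dt dW dWh yx =
     (let y0 = fst yx; x = snd yx;
          b = y0 - \<nu> * (\<Sum>i<d. x i * dW i) - (\<kappa> - \<nu>\<^sup>2/2 + real d * \<nu>\<^sup>2/2) * y0 * dt;
          y0' = (b + sqrt (b\<^sup>2 + 4 * (\<kappa> - \<nu>\<^sup>2/2) * dt)) / 2;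
          x' = (\<lambda>i. x i - \<kappa> * x i * dt + \<nu> * y0 * dW i + mv d (AA 0) x i * dt
                    + (\<Sum>p=1..m. mv d (AA p) x i * dWh p)
                    + (1/2) * (\<Sum>p=1..m. mv d (AA p) (mv d (AA p) x) i) * dt)
      in (y0', x'))"

primrec scheme :: "nat \<Rightarrow> nat \<Rightarrow> real \<Rightarrow> real \<Rightarrow> (nat \<Rightarrow> nat \<Rightarrow> nat \<Rightarrow> real) \<Rightarrow> real \<Rightarrow>
    (real \<Rightarrow> 'w \<Rightarrow> nat \<Rightarrow> real) \<Rightarrow> (nat \<Rightarrow> real) \<Rightarrow> nat \<Rightarrow> nat \<Rightarrow> 'w \<Rightarrow> real \<times> (nat \<Rightarrow> real)" where
  "scheme d m \<kappa> \<nu> AA T B x0 n 0 \<omega> = (sqrt (1 - sqn d x0), x0)"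
| "scheme d m \<kappa> \<nu> AA T B x0 n (Suc k) \<omega> =
     scheme_step d m \<kappa> \<nu> AA (T / real n)
       (\<lambda>i. B (real (Suc k) * T / real n) \<omega> i - B (real k * T / real n) \<omega> i)
       (\<lambda>p. B (real (Suc k) * T / real n) \<omega> (d + p - 1) - B (real k * T / real n) \<omega> (d + p - 1))
       (scheme d m \<kappa> \<nu> AA T B x0 n k \<omega>)"

text \<open>|Y(t_k) - Y^{(n)}(t_k)|^2 with Y = (sqrt(1-|X|^2), X).\<close>
definition err_sq :: "nat \<Rightarrow> nat \<Rightarrow> real \<Rightarrow> real \<Rightarrow> (nat \<Rightarrow> nat \<Rightarrow> nat \<Rightarrow> real) \<Rightarrow> real \<Rightarrow>
    (real \<Rightarrow> 'w \<Rightarrow> nat \<Rightarrow> real) \<Rightarrow> (nat \<Rightarrow> real) \<Rightarrow> (real \<Rightarrow> 'w \<Rightarrow> nat \<Rightarrow> real) \<Rightarrow> nat \<Rightarrow> nat \<Rightarrow> 'w \<Rightarrow> real" where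
  "err_sq d m \<kappa> \<nu> AA T B x0 X n k \<omega> =
     (let yx = scheme d m \<kappa> \<nu> AA T B x0 n k \<omega>; t = real k * T / real n in
        (sqrt (1 - sqn d (X t \<omega>)) - fst yx)\<^sup>2 + (\<Sum>i<d. (X t \<omega> i - snd yx i)\<^sup>2))"

end

theory Submission
  imports Defs
begin

text \<open>
  Write \<open>Y0 = \<surd>(1 - |X|\<^sup>2)\<close>.  Then \<open>(Y0, X)\<close> solves an equation with linear noise that is tangential to the
  sphere and with the singular drift \<open>c / Y0\<close>, \<open>c = \<kappa> - \<nu>\<^sup>2 / 2\<close>; the scheme is Euler's method, implicit in this
  drift only.  The noise acting on the error is orthogonal to the error and \<open>y \<mapsto> 1 / y\<close> is decreasing, so the
  squared error obeys a Gronwall recursion driven by the one-step consistency errors, which need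
  second moment \<open>O(\<Delta>\<^sup>2)\<close> and correlation \<open>O(\<Delta>^(3/2))\<close> with the past.  For this, inverse moments of \<open>Y0\<close> up to order 10
  are required, and they propagate because \<open>\<kappa> \<ge> 6 \<nu>\<^sup>2\<close>.  The maximum over the grid is bounded by the sum of the
  absolute error increments, which loses the factor \<open>n^(1/4)\<close>.

  No stochastic calculus is needed beyond the defining Riemann sums: increments of \<open>X\<close> are limits of sums of Euler increments on
  finer grids, moment bounds pass to the limit by Fatou's lemma, and Ito's formula is replaced by a conditional
  Taylor expansion with error \<open>O(\<Delta>^(5/4))\<close>, which vanishes when summed over refined grids.
\<close>

text \<open>The square root is the obstacle. \<open>Y0\<close> is only 1/2-Holder in
  \<open>X\<close>, so a direct expansion gives one-step errors of mean square Delta^(3/2) and mean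
  Delta^(5/4), too poor by a half and by a quarter order. The proof bootstraps: summed over ever
  finer grids, these crude bounds suffice to bound inverse moments; inverse moments give mean-square
  increments of order Delta for both \<open>Y0\<close> and \<open>1 / Y0\<close>; with these, the
  errors of a coarse step, re-expanded on its refinements, reach the required orders. The limits
  have a fixed order: the mesh is refined while \<open>Y0\<^sup>2\<close> is shifted by
  \<open>e > 0\<close>, since the Taylor constants blow up with \<open>e\<close>; only afterwards
  does \<open>e\<close> tend to 0. Origin of the number 10: dividing the expansion of
  \<open>Y0\<^sup>2\<close> by \<open>2 * Y0\<close> costs one inverse power, the squared increments
  in it cost four more, and Cauchy-Schwarz against the error doubles the five. For the matching
  exponent -5 of \<open>Y0\<^sup>2\<close>, the generator compares \<open>60 * \<nu>\<^sup>2\<close>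
  with \<open>10 * \<kappa>\<close>, whence the threshold 6.\<close>

lemma discrete_gronwall:
  fixes g :: "nat \<Rightarrow> real"
  assumes "\<And>j. j < n \<Longrightarrow> g (Suc j) \<le> (1 + a) * g j + b" "0 \<le> a" "0 \<le> b" "0 \<le> g 0"
  shows "j \<le> n \<Longrightarrow> g j \<le> exp (a * real j) * (g 0 + real j * b)"
proof (induction j)
  case (Suc j)
  have e: "exp (a * real (Suc j)) = exp a * exp (a * real j)"
    by (simp add: exp_add[symmetric] algebra_simps)
  have "g (Suc j) \<le> (1 + a) * g j + b" using assms Suc by simp
  also have "(1 + a) * g j + b \<le> exp a * (exp (a * real j) * (g 0 + real j * b)) + b"
  proof -
    have "(1 + a) * g j \<le> (1 + a) * (exp (a * real j) * (g 0 + real j * b))"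
      using Suc assms(2) by (intro mult_left_mono) auto
    also have "\<dots> \<le> exp a * (exp (a * real j) * (g 0 + real j * b))"
      using assms(2-4) exp_ge_add_one_self[of a] by (intro mult_right_mono mult_nonneg_nonneg) auto
    finally show ?thesis by simp
  qed
  also have "\<dots> \<le> exp a * (exp (a * real j) * (g 0 + real j * b)) + exp (a * real (Suc j)) * b"
    using assms(2,3) mult_right_mono[of 1 "exp (a * real (Suc j))" b] by simp
  also have "\<dots> = exp (a * real (Suc j)) * (g 0 + real (Suc j) * b)"
    unfolding e by (simp add: algebra_simps)
  finally show ?case .
qed simp

section \<open>Conditional bounds\<close>

text \<open>\<open>cond_le M G Z K\<close> and \<open>cond_abs_le M G Z K\<close> say \<open>E[Z | G] \<le> K\<close> for \<open>Z \<ge> 0\<close> and \<open>|E[Z | G]| \<le> K\<close>, tested on the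
  events of \<open>G\<close>.\<close>
definition cond_le :: "'w measure \<Rightarrow> 'w measure \<Rightarrow> ('w \<Rightarrow> real) \<Rightarrow> real \<Rightarrow> bool" where
  "cond_le M G Z K \<longleftrightarrow> Z \<in> borel_measurable M \<and> (\<forall>\<omega>\<in>space M. 0 \<le> Z \<omega>) \<and> 0 \<le> K \<and>
     (\<forall>A\<in>sets G. (\<integral>\<^sup>+\<omega>. ennreal (Z \<omega>) * indicator A \<omega> \<partial>M) \<le> ennreal K * emeasure M A)"

definition cond_abs_le :: "'w measure \<Rightarrow> 'w measure \<Rightarrow> ('w \<Rightarrow> real) \<Rightarrow> real \<Rightarrow> bool" where
  "cond_abs_le M G Z K \<longleftrightarrow> integrable M Z \<and> 0 \<le> K \<and>
     (\<forall>A\<in>sets G. \<bar>LINT \<omega>|M. indicator A \<omega> * Z \<omega>\<bar> \<le> K * measure M A)"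

text \<open>Passes from events to all nonnegative \<open>G\<close>-measurable weights by the
  standard induction over measurable functions. With the extended integral, integrability of the
  product becomes a conclusion, drawn in \<open>cond_le_integral\<close>.\<close>

lemma cond_le_ext:
  assumes sub: "subalgebra M G" and Z: "cond_le M G Z K"
    and f: "f \<in> borel_measurable G"
  shows "(\<integral>\<^sup>+\<omega>. f \<omega> * ennreal (Z \<omega>) \<partial>M) \<le> ennreal K * (\<integral>\<^sup>+\<omega>. f \<omega> \<partial>M)"
proof -
  have Zm[measurable]: "Z \<in> borel_measurable M" using Z by (simp add: cond_le_def)
  have GM: "\<And>g. g \<in> borel_measurable G \<Longrightarrow> g \<in> borel_measurable M"
    using sub measurable_from_subalg by blast
  have sp: "space G = space M" using sub by (simp add: subalgebra_def)
  from f show ?thesis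
  proof (induction rule: borel_measurable_induct)
    case (cong f g)
    have "(\<integral>\<^sup>+\<omega>. f \<omega> \<partial>M) = (\<integral>\<^sup>+\<omega>. g \<omega> \<partial>M)" "(\<integral>\<^sup>+\<omega>. f \<omega> * ennreal (Z \<omega>) \<partial>M) = (\<integral>\<^sup>+\<omega>. g \<omega> * ennreal (Z \<omega>) \<partial>M)"
      using cong sp by (auto intro!: nn_integral_cong)
    then show ?case using cong by simp
  next
    case (set A)
    then have "A \<in> sets M" using sub by (auto simp: subalgebra_def)
    then show ?case using set Z unfolding cond_le_def by (simp add: mult.commute)
  next
    case (mult u c)
    have [measurable]: "u \<in> borel_measurable M" using mult GM by blast
    have "(\<integral>\<^sup>+\<omega>. c * u \<omega> * ennreal (Z \<omega>) \<partial>M) = c * (\<integral>\<^sup>+\<omega>. u \<omega> * ennreal (Z \<omega>) \<partial>M)"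
      by (subst nn_integral_cmult[symmetric]) (auto simp: mult.assoc)
    also have "\<dots> \<le> c * (ennreal K * (\<integral>\<^sup>+\<omega>. u \<omega> \<partial>M))" using mult by (intro mult_left_mono) auto
    also have "\<dots> = ennreal K * (\<integral>\<^sup>+\<omega>. c * u \<omega> \<partial>M)" by (subst nn_integral_cmult) (auto simp: ac_simps)
    finally show ?case .
  next
    case (add u v)
    have [measurable]: "u \<in> borel_measurable M" "v \<in> borel_measurable M" using add GM by blast+
    have "(\<integral>\<^sup>+\<omega>. (v \<omega> + u \<omega>) * ennreal (Z \<omega>) \<partial>M) = (\<integral>\<^sup>+\<omega>. v \<omega> * ennreal (Z \<omega>) \<partial>M) + (\<integral>\<^sup>+\<omega>. u \<omega> * ennreal (Z \<omega>) \<partial>M)"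
      by (subst nn_integral_add[symmetric]) (auto simp: distrib_right)
    also have "\<dots> \<le> ennreal K * (\<integral>\<^sup>+\<omega>. v \<omega> \<partial>M) + ennreal K * (\<integral>\<^sup>+\<omega>. u \<omega> \<partial>M)" using add by (intro add_mono) auto
    also have "\<dots> = ennreal K * (\<integral>\<^sup>+\<omega>. v \<omega> + u \<omega> \<partial>M)" by (subst nn_integral_add) (auto simp: distrib_left)
    finally show ?case .
  next
    case (seq U)
    have [measurable]: "\<And>i. U i \<in> borel_measurable M" using seq GM by blast
    have f_eq: "f \<omega> = (SUP i. U i \<omega>)" for \<omega> using seq by (simp add: SUP_apply image_image)
    have "(\<integral>\<^sup>+\<omega>. f \<omega> * ennreal (Z \<omega>) \<partial>M) = (\<integral>\<^sup>+\<omega>. (SUP i. U i \<omega> * ennreal (Z \<omega>)) \<partial>M)"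
      unfolding f_eq by (simp add: SUP_mult_right_ennreal)
    also have "\<dots> = (SUP i. \<integral>\<^sup>+\<omega>. U i \<omega> * ennreal (Z \<omega>) \<partial>M)"
      using seq by (intro nn_integral_monotone_convergence_SUP) (auto simp: incseq_def le_fun_def intro!: mult_right_mono)
    also have "\<dots> \<le> (SUP i. ennreal K * \<integral>\<^sup>+\<omega>. U i \<omega> \<partial>M)" using seq by (intro SUP_mono') auto
    also have "\<dots> = ennreal K * (SUP i. \<integral>\<^sup>+\<omega>. U i \<omega> \<partial>M)" by (simp add: SUP_mult_left_ennreal)
    also have "(SUP i. \<integral>\<^sup>+\<omega>. U i \<omega> \<partial>M) = (\<integral>\<^sup>+\<omega>. f \<omega> \<partial>M)"
      unfolding f_eq using seq by (intro nn_integral_monotone_convergence_SUP[symmetric]) auto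
    finally show ?case using seq by simp
  qed
qed

lemma cond_le_integral:
  assumes sub: "subalgebra M G" and Z: "cond_le M G Z K"
    and f: "f \<in> borel_measurable G" "integrable M f" "\<And>\<omega>. \<omega> \<in> space M \<Longrightarrow> 0 \<le> f \<omega>"
  shows "integrable M (\<lambda>\<omega>. f \<omega> * Z \<omega>)" "(LINT \<omega>|M. f \<omega> * Z \<omega>) \<le> K * (LINT \<omega>|M. f \<omega>)"
proof -
  have Zm[measurable]: "Z \<in> borel_measurable M" and Zn: "\<And>\<omega>. \<omega> \<in> space M \<Longrightarrow> 0 \<le> Z \<omega>" and K: "0 \<le> K" using Z by (auto simp: cond_le_def)
  have [measurable]: "f \<in> borel_measurable M" using f by auto
  have i0: "0 \<le> (LINT \<omega>|M. f \<omega>)" using f by (intro integral_nonneg_AE) auto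
  have eq: "(\<integral>\<^sup>+\<omega>. ennreal (f \<omega>) \<partial>M) = ennreal (LINT \<omega>|M. f \<omega>)"
    using f by (intro nn_integral_eq_integral) auto
  have "(\<integral>\<^sup>+\<omega>. ennreal (f \<omega> * Z \<omega>) \<partial>M) = (\<integral>\<^sup>+\<omega>. ennreal (f \<omega>) * ennreal (Z \<omega>) \<partial>M)"
    using f Zn by (intro nn_integral_cong) (auto simp: ennreal_mult)
  also have "\<dots> \<le> ennreal K * (\<integral>\<^sup>+\<omega>. ennreal (f \<omega>) \<partial>M)"
    using f by (intro cond_le_ext[OF sub Z]) auto
  also have "\<dots> = ennreal (K * (LINT \<omega>|M. f \<omega>))" using K i0 by (simp add: eq ennreal_mult)
  finally have le: "(\<integral>\<^sup>+\<omega>. ennreal (f \<omega> * Z \<omega>) \<partial>M) \<le> ennreal (K * (LINT \<omega>|M. f \<omega>))" .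
  show i: "integrable M (\<lambda>\<omega>. f \<omega> * Z \<omega>)"
    using le f Zn by (intro integrableI_nonneg) (auto simp: less_top[symmetric] top_unique)
  show "(LINT \<omega>|M. f \<omega> * Z \<omega>) \<le> K * (LINT \<omega>|M. f \<omega>)"
  proof -
    have "ennreal (LINT \<omega>|M. f \<omega> * Z \<omega>) = (\<integral>\<^sup>+\<omega>. ennreal (f \<omega> * Z \<omega>) \<partial>M)"
      using f Zn by (intro nn_integral_eq_integral[symmetric] i) auto
    then show ?thesis using le K i0 by (metis ennreal_le_iff mult_nonneg_nonneg)
  qed
qed

text \<open>The test on events bounds the conditional expectation itself: applied to the event where
  \<open>real_cond_exp M G Z\<close> exceeds \<open>K\<close>, or lies below \<open>-K\<close>, it
  forces that event to be null. The claim follows because \<open>Z\<close> may be replaced by its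
  conditional expectation under the \<open>G\<close>-measurable weight \<open>f\<close>.\<close>

lemma cond_abs_le_integral:
  assumes sub: "subalgebra M G" and prob_space_M: "prob_space M" and Z: "cond_abs_le M G Z K"
    and f: "f \<in> borel_measurable G" "integrable M f" "integrable M (\<lambda>\<omega>. f \<omega> * Z \<omega>)"
  shows "\<bar>LINT \<omega>|M. f \<omega> * Z \<omega>\<bar> \<le> K * (LINT \<omega>|M. \<bar>f \<omega>\<bar>)"
proof -
  interpret prob_space M by fact
  interpret S: finite_measure_subalgebra M G by standard fact
  have Zi: "integrable M Z" and K: "0 \<le> K" using Z by (auto simp: cond_abs_le_def)
  let ?E = "real_cond_exp M G Z"
  have Ei: "integrable M ?E" using S.real_cond_exp_int(1)[OF Zi] .
  have Em[measurable]: "?E \<in> borel_measurable G" by simp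
  have EmM[measurable]: "?E \<in> borel_measurable M" by simp
  have GM: "\<And>A. A \<in> sets G \<Longrightarrow> A \<in> sets M" using sub by (auto simp: subalgebra_def)
  have spG: "space G = space M" using sub by (auto simp: subalgebra_def)
  \<comment> \<open>\<open>s\<close> stands for either sign. On \<open>?A\<close> the function
    \<open>s * ?E \<omega> - K\<close> is positive while its integral is at most 0, so it vanishes
    almost everywhere there.\<close>
  have le: "AE \<omega> in M. s * ?E \<omega> \<le> K" if s: "s = 1 \<or> s = (-1::real)" for s
  proof -
    let ?A = "{\<omega>\<in>space M. K < s * ?E \<omega>}"
    have A: "?A \<in> sets G" unfolding spG[symmetric] by measurable
    have AM[measurable]: "?A \<in> sets M" using A GM by blast
    have ii: "integrable M (\<lambda>\<omega>. indicator ?A \<omega> * (s * ?E \<omega> - K))"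
      by (intro integrable_mult_indicator[where 'b=real, simplified] AM) (use Ei in auto)
    have eq: "(LINT \<omega>|M. indicator ?A \<omega> * ?E \<omega>) = (LINT \<omega>|M. indicator ?A \<omega> * Z \<omega>)"
      using S.real_cond_exp_intA[OF Zi A] by (simp add: set_lebesgue_integral_def)
    have "(LINT \<omega>|M. indicator ?A \<omega> * (s * ?E \<omega> - K)) = s * (LINT \<omega>|M. indicator ?A \<omega> * ?E \<omega>) - K * measure M ?A"
    proof -
      have "(\<lambda>\<omega>. indicator ?A \<omega> * (s * ?E \<omega> - K)) = (\<lambda>\<omega>. s * (indicator ?A \<omega> * ?E \<omega>) - K * indicator ?A \<omega>)"
        by (auto simp: algebra_simps)
      moreover have "integrable M (\<lambda>\<omega>. indicator ?A \<omega> * ?E \<omega>)"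
        by (intro integrable_mult_indicator[where 'b=real, simplified] AM Ei)
      ultimately show ?thesis by (simp add: emeasure_eq_measure)
    qed
    also have "\<dots> \<le> 0"
    proof -
      have "\<bar>LINT \<omega>|M. indicator ?A \<omega> * Z \<omega>\<bar> \<le> K * measure M ?A"
        using Z A unfolding cond_abs_le_def by blast
      then show ?thesis using s unfolding eq by auto
    qed
    finally have "(LINT \<omega>|M. indicator ?A \<omega> * (s * ?E \<omega> - K)) = 0"
      by (intro antisym integral_nonneg_AE) (auto simp: indicator_def)
    then have "AE \<omega> in M. indicator ?A \<omega> * (s * ?E \<omega> - K) = 0"
      by (subst (asm) integral_nonneg_eq_0_iff_AE[OF ii]) (auto simp: indicator_def)
    then show ?thesis by (auto simp: indicator_def split: if_splits)
  qed
  have bound: "AE \<omega> in M. \<bar>?E \<omega>\<bar> \<le> K" using le[of 1] le[of "-1"] by auto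
  have "(LINT \<omega>|M. f \<omega> * Z \<omega>) = (LINT \<omega>|M. f \<omega> * ?E \<omega>)"
    using S.real_cond_exp_intg(2)[of f Z] f Zi by auto
  also have "\<bar>\<dots>\<bar> \<le> (LINT \<omega>|M. \<bar>f \<omega> * ?E \<omega>\<bar>)" by (rule integral_abs_bound)
  also have "\<dots> \<le> (LINT \<omega>|M. K * \<bar>f \<omega>\<bar>)"
    using bound f K by (intro integral_mono_AE') (auto simp: abs_mult mult.commute[of _ "\<bar>f _\<bar>"] elim!: eventually_mono intro!: mult_left_mono)
  finally show ?thesis using f by simp
qed

lemma cond_le_mono:
  assumes "cond_le M G Z K" "Z' \<in> borel_measurable M" "\<And>\<omega>. \<omega> \<in> space M \<Longrightarrow> 0 \<le> Z' \<omega>"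
    "\<And>\<omega>. \<omega> \<in> space M \<Longrightarrow> Z' \<omega> \<le> Z \<omega>" "K \<le> K'"
  shows "cond_le M G Z' K'"
  unfolding cond_le_def
proof (intro conjI ballI)
  fix A assume A: "A \<in> sets G"
  have "(\<integral>\<^sup>+\<omega>. ennreal (Z' \<omega>) * indicator A \<omega> \<partial>M) \<le> (\<integral>\<^sup>+\<omega>. ennreal (Z \<omega>) * indicator A \<omega> \<partial>M)"
    using assms by (intro nn_integral_mono mult_right_mono) (auto simp: ennreal_leI)
  also have "\<dots> \<le> ennreal K * emeasure M A" using assms A by (auto simp: cond_le_def)
  also have "\<dots> \<le> ennreal K' * emeasure M A" using assms by (intro mult_right_mono ennreal_leI) auto
  finally show "(\<integral>\<^sup>+\<omega>. ennreal (Z' \<omega>) * indicator A \<omega> \<partial>M) \<le> ennreal K' * emeasure M A" .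
qed (use assms in \<open>auto simp: cond_le_def\<close>)

lemma cond_le_weight:
  assumes sub: "subalgebra M G" and Z: "cond_le M G Z K" and f: "f \<in> borel_measurable G"
    "\<And>\<omega>. \<omega> \<in> space M \<Longrightarrow> 0 \<le> f \<omega>" "\<And>\<omega>. \<omega> \<in> space M \<Longrightarrow> f \<omega> \<le> c" and c: "0 \<le> c"
  shows "cond_le M G (\<lambda>\<omega>. f \<omega> * Z \<omega>) (c * K)"
  unfolding cond_le_def
proof (intro conjI ballI)
  fix A assume A: "A \<in> sets G"
  have AM[measurable]: "A \<in> sets M" using A sub by (auto simp: subalgebra_def)
  have [measurable]: "A \<in> sets G" by fact
  have "(\<integral>\<^sup>+\<omega>. ennreal (f \<omega> * Z \<omega>) * indicator A \<omega> \<partial>M) = (\<integral>\<^sup>+\<omega>. (ennreal (f \<omega>) * indicator A \<omega>) * ennreal (Z \<omega>) \<partial>M)"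
    using Z f by (intro nn_integral_cong) (auto simp: ennreal_mult cond_le_def indicator_def)
  also have "\<dots> \<le> ennreal K * (\<integral>\<^sup>+\<omega>. ennreal (f \<omega>) * indicator A \<omega> \<partial>M)"
    using f(1) A by (intro cond_le_ext[OF sub Z]) auto
  also have "\<dots> \<le> ennreal K * (\<integral>\<^sup>+\<omega>. ennreal c * indicator A \<omega> \<partial>M)"
    using f c by (intro mult_left_mono nn_integral_mono mult_right_mono) (auto simp: ennreal_leI)
  also have "\<dots> = ennreal (c * K) * emeasure M A" using c Z by (simp add: nn_integral_cmult ennreal_mult cond_le_def ac_simps)
  finally show "(\<integral>\<^sup>+\<omega>. ennreal (f \<omega> * Z \<omega>) * indicator A \<omega> \<partial>M) \<le> ennreal (c * K) * emeasure M A" .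
qed (use assms measurable_from_subalg[OF sub f(1)] in \<open>auto simp: cond_le_def\<close>)

lemma cond_le_cmult:
  assumes sub: "subalgebra M G" and "cond_le M G Z K" "0 \<le> c"
  shows "cond_le M G (\<lambda>\<omega>. c * Z \<omega>) (c * K)"
  by (rule cond_le_weight[OF sub assms(2)]) (use assms in auto)

lemma cond_le_add:
  assumes "subalgebra M G" "cond_le M G Z K" "cond_le M G Z' K'"
  shows "cond_le M G (\<lambda>\<omega>. Z \<omega> + Z' \<omega>) (K + K')"
  unfolding cond_le_def
proof (intro conjI ballI)
  fix A assume A: "A \<in> sets G"
  have AM[measurable]: "A \<in> sets M" using A assms(1) by (auto simp: subalgebra_def)
  have [measurable]: "Z \<in> borel_measurable M" "Z' \<in> borel_measurable M" using assms by (auto simp: cond_le_def)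
  have "(\<integral>\<^sup>+\<omega>. ennreal (Z \<omega> + Z' \<omega>) * indicator A \<omega> \<partial>M)
    = (\<integral>\<^sup>+\<omega>. ennreal (Z \<omega>) * indicator A \<omega> + ennreal (Z' \<omega>) * indicator A \<omega> \<partial>M)"
    using assms by (intro nn_integral_cong) (auto simp: cond_le_def distrib_right)
  also have "\<dots> = (\<integral>\<^sup>+\<omega>. ennreal (Z \<omega>) * indicator A \<omega> \<partial>M) + (\<integral>\<^sup>+\<omega>. ennreal (Z' \<omega>) * indicator A \<omega> \<partial>M)"
    by (intro nn_integral_add) auto
  also have "\<dots> \<le> ennreal K * emeasure M A + ennreal K' * emeasure M A"
    using assms A by (intro add_mono) (auto simp: cond_le_def)
  also have "\<dots> = ennreal (K + K') * emeasure M A" using assms by (simp add: cond_le_def distrib_right)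
  finally show "(\<integral>\<^sup>+\<omega>. ennreal (Z \<omega> + Z' \<omega>) * indicator A \<omega> \<partial>M) \<le> ennreal (K + K') * emeasure M A" .
qed (use assms in \<open>auto simp: cond_le_def\<close>)

lemma cond_le_const: "subalgebra M G \<Longrightarrow> 0 \<le> c \<Longrightarrow> cond_le M G (\<lambda>_. c) c"
  by (auto simp: cond_le_def nn_integral_cmult subalgebra_def)

lemma cond_le_sum:
  assumes "subalgebra M G" "\<And>i. i \<in> I \<Longrightarrow> cond_le M G (Z i) (K i)"
  shows "cond_le M G (\<lambda>\<omega>. \<Sum>i\<in>I. Z i \<omega>) (\<Sum>i\<in>I. K i)"
  using assms(2) by (induction I rule: infinite_finite_induct) (auto intro: cond_le_add cond_le_const assms(1))

lemma cond_le_nest: "cond_le M G Z K \<Longrightarrow> sets H \<subseteq> sets G \<Longrightarrow> cond_le M H Z K"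
  by (auto simp: cond_le_def)

lemma cond_le_integrable:
  assumes sub: "subalgebra M G" and prob_space_M: "prob_space M" and Z: "cond_le M G Z K"
  shows "integrable M Z" "(LINT \<omega>|M. Z \<omega>) \<le> K"
proof -
  interpret prob_space M by fact
  have 1: "(\<lambda>_. 1) \<in> borel_measurable G" "integrable M (\<lambda>_. 1::real)" "\<And>\<omega>. \<omega> \<in> space M \<Longrightarrow> 0 \<le> (1::real)" by auto
  show "integrable M Z" using cond_le_integral(1)[OF sub Z 1] by simp
  show "(LINT \<omega>|M. Z \<omega>) \<le> K" using cond_le_integral(2)[OF sub Z 1] by (simp add: prob_space)
qed

lemma cond_leI:
  assumes sub: "subalgebra M G" and prob_space_M: "prob_space M" and "integrable M Z" "\<And>\<omega>. \<omega> \<in> space M \<Longrightarrow> 0 \<le> Z \<omega>" "0 \<le> K"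
    "\<And>A. A \<in> sets G \<Longrightarrow> (LINT \<omega>|M. indicator A \<omega> * Z \<omega>) \<le> K * measure M A"
  shows "cond_le M G Z K"
  unfolding cond_le_def
proof (intro conjI ballI)
  interpret prob_space M by fact
  fix A assume A: "A \<in> sets G"
  have AM[measurable]: "A \<in> sets M" using A sub by (auto simp: subalgebra_def)
  have "(\<integral>\<^sup>+\<omega>. ennreal (Z \<omega>) * indicator A \<omega> \<partial>M) = (\<integral>\<^sup>+\<omega>. ennreal (indicator A \<omega> * Z \<omega>) \<partial>M)"
    by (intro nn_integral_cong) (auto simp: indicator_def)
  also have "\<dots> = ennreal (LINT \<omega>|M. indicator A \<omega> * Z \<omega>)"
    using assms by (intro nn_integral_eq_integral integrable_mult_indicator[where 'b=real, simplified]) (auto simp: indicator_def)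
  also have "\<dots> \<le> ennreal (K * measure M A)" using assms A by (intro ennreal_leI) auto
  also have "\<dots> = ennreal K * emeasure M A" using assms by (simp add: emeasure_eq_measure ennreal_mult)
  finally show "(\<integral>\<^sup>+\<omega>. ennreal (Z \<omega>) * indicator A \<omega> \<partial>M) \<le> ennreal K * emeasure M A" .
qed (use assms in auto)

lemma cond_abs_le_mono: "cond_abs_le M G Z K \<Longrightarrow> K \<le> K' \<Longrightarrow> cond_abs_le M G Z K'"
  unfolding cond_abs_le_def by (auto intro: order_trans[OF _ mult_right_mono])

lemma cond_abs_le_nest: "cond_abs_le M G Z K \<Longrightarrow> sets H \<subseteq> sets G \<Longrightarrow> cond_abs_le M H Z K"
  by (auto simp: cond_abs_le_def)

lemma cond_abs_le_cong: "(\<And>\<omega>. \<omega> \<in> space M \<Longrightarrow> Z \<omega> = Z' \<omega>) \<Longrightarrow> cond_abs_le M G Z K = cond_abs_le M G Z' K"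
proof -
  assume a: "\<And>\<omega>. \<omega> \<in> space M \<Longrightarrow> Z \<omega> = Z' \<omega>"
  have "integrable M Z = integrable M Z'" using a by (intro Bochner_Integration.integrable_cong) auto
  moreover have "(LINT \<omega>|M. indicator A \<omega> * Z \<omega>) = (LINT \<omega>|M. indicator A \<omega> * Z' \<omega>)" for A
    using a by (intro Bochner_Integration.integral_cong) auto
  ultimately show ?thesis by (simp add: cond_abs_le_def)
qed

lemma cond_abs_le_weight:
  assumes sub: "subalgebra M G" and prob_space_M: "prob_space M" and Z: "cond_abs_le M G Z K" and f: "f \<in> borel_measurable G"
    "\<And>\<omega>. \<omega> \<in> space M \<Longrightarrow> \<bar>f \<omega>\<bar> \<le> c"
  shows "cond_abs_le M G (\<lambda>\<omega>. f \<omega> * Z \<omega>) (c * K)"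
proof -
  interpret prob_space M by fact
  have fm[measurable]: "f \<in> borel_measurable M" using measurable_from_subalg[OF sub f(1)] .
  have Zi: "integrable M Z" and K: "0 \<le> K" using Z by (auto simp: cond_abs_le_def)
  have c: "0 \<le> c" using f(2) not_empty by (meson abs_ge_zero ex_in_conv order_trans)
  have i: "integrable M (\<lambda>\<omega>. f \<omega> * Z \<omega>)"
    by (rule Bochner_Integration.integrable_bound[of _ "\<lambda>\<omega>. c * Z \<omega>"])
      (use Zi f c in \<open>auto simp: abs_mult intro!: mult_right_mono\<close>)
  show ?thesis unfolding cond_abs_le_def
  proof (intro conjI ballI i)
    fix A assume A: "A \<in> sets G"
    have AM[measurable]: "A \<in> sets M" using A sub by (auto simp: subalgebra_def)
    have [measurable]: "A \<in> sets G" by fact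
    have fG[measurable]: "f \<in> borel_measurable G" by fact
    have "\<bar>LINT \<omega>|M. (indicator A \<omega> * f \<omega>) * Z \<omega>\<bar> \<le> K * (LINT \<omega>|M. \<bar>indicator A \<omega> * f \<omega>\<bar>)"
    proof (rule cond_abs_le_integral[OF sub prob_space_M Z])
      show "(\<lambda>\<omega>. indicator A \<omega> * f \<omega>) \<in> borel_measurable G" by measurable
      show "integrable M (\<lambda>\<omega>. indicator A \<omega> * f \<omega>)"
        by (rule integrable_const_bound[of _ c]) (use f c in \<open>auto simp: indicator_def\<close>)
      show "integrable M (\<lambda>\<omega>. indicator A \<omega> * f \<omega> * Z \<omega>)"
        using integrable_mult_indicator[where 'b=real, simplified, OF AM i] by (simp add: mult.assoc)
    qed
    also have "\<dots> \<le> K * (LINT \<omega>|M. c * indicator A \<omega>)"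
    proof (intro mult_left_mono integral_mono_AE' AE_I2 K)
      show "integrable M (\<lambda>\<omega>. c * indicator A \<omega>)" by (simp add: emeasure_eq_measure)
    qed (use f c in \<open>auto simp: abs_mult indicator_def\<close>)
    finally show "\<bar>LINT \<omega>|M. indicator A \<omega> * (f \<omega> * Z \<omega>)\<bar> \<le> c * K * measure M A"
      by (simp add: ac_simps)
  qed (use c K in auto)
qed

lemma cond_abs_le_cmult:
  assumes sub: "subalgebra M G" and prob_space_M: "prob_space M" and Z: "cond_abs_le M G Z K"
  shows "cond_abs_le M G (\<lambda>\<omega>. c * Z \<omega>) (\<bar>c\<bar> * K)"
  by (rule cond_abs_le_weight[OF sub prob_space_M Z]) auto

lemma cond_abs_le_add:
  assumes "subalgebra M G" "cond_abs_le M G Z K" "cond_abs_le M G Z' K'"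
  shows "cond_abs_le M G (\<lambda>\<omega>. Z \<omega> + Z' \<omega>) (K + K')"
  unfolding cond_abs_le_def
proof (intro conjI ballI)
  fix A assume A: "A \<in> sets G"
  have AM: "A \<in> sets M" using A assms(1) by (auto simp: subalgebra_def)
  have i: "integrable M (\<lambda>\<omega>. indicator A \<omega> * Z \<omega>)" "integrable M (\<lambda>\<omega>. indicator A \<omega> * Z' \<omega>)"
    using assms by (auto simp: cond_abs_le_def intro!: integrable_mult_indicator[where 'b=real, simplified] AM)
  have "(LINT \<omega>|M. indicator A \<omega> * (Z \<omega> + Z' \<omega>)) = (LINT \<omega>|M. indicator A \<omega> * Z \<omega>) + (LINT \<omega>|M. indicator A \<omega> * Z' \<omega>)"
    using i by (subst Bochner_Integration.integral_add[symmetric]) (auto simp: distrib_left)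
  moreover have "\<bar>LINT \<omega>|M. indicator A \<omega> * Z \<omega>\<bar> \<le> K * measure M A" "\<bar>LINT \<omega>|M. indicator A \<omega> * Z' \<omega>\<bar> \<le> K' * measure M A"
    using assms A by (auto simp: cond_abs_le_def)
  ultimately show "\<bar>LINT \<omega>|M. indicator A \<omega> * (Z \<omega> + Z' \<omega>)\<bar> \<le> (K + K') * measure M A"
    by (simp add: distrib_right)
qed (use assms in \<open>auto simp: cond_abs_le_def\<close>)

lemma cond_abs_le_sum:
  assumes "subalgebra M G" "\<And>i. i \<in> I \<Longrightarrow> cond_abs_le M G (Z i) (K i)"
  shows "cond_abs_le M G (\<lambda>\<omega>. \<Sum>i\<in>I. Z i \<omega>) (\<Sum>i\<in>I. K i)"
  using assms(2)
proof (induction I rule: infinite_finite_induct)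
  case (insert i I)
  then show ?case using cond_abs_le_add[OF assms(1), of "Z i" "K i"] by simp
qed (auto simp: cond_abs_le_def)

lemma cond_abs_le_of_cond_le:
  assumes sub: "subalgebra M G" and prob_space_M: "prob_space M" and Z: "cond_le M G Z' K" and [measurable]: "Z \<in> borel_measurable M"
    and le: "\<And>\<omega>. \<omega> \<in> space M \<Longrightarrow> \<bar>Z \<omega>\<bar> \<le> Z' \<omega>"
  shows "cond_abs_le M G Z K"
proof -
  interpret prob_space M by fact
  have i': "integrable M Z'" using cond_le_integrable[OF sub prob_space_M Z] by simp
  have i: "integrable M Z"
    by (rule Bochner_Integration.integrable_bound[OF i']) (use le in \<open>auto intro!: AE_I2 order_trans[OF le]\<close>)
  show ?thesis unfolding cond_abs_le_def
  proof (intro conjI ballI i)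
    fix A assume A: "A \<in> sets G"
    have AM[measurable]: "A \<in> sets M" using A sub by (auto simp: subalgebra_def)
    have "\<bar>LINT \<omega>|M. indicator A \<omega> * Z \<omega>\<bar> \<le> (LINT \<omega>|M. \<bar>indicator A \<omega> * Z \<omega>\<bar>)" by (rule integral_abs_bound)
    also have "\<dots> \<le> (LINT \<omega>|M. indicator A \<omega> * Z' \<omega>)"
    proof (rule integral_mono)
      show "integrable M (\<lambda>\<omega>. \<bar>indicator A \<omega> * Z \<omega>\<bar>)"
        by (intro integrable_abs integrable_mult_indicator[where 'b=real, simplified] AM i)
      show "integrable M (\<lambda>\<omega>. indicator A \<omega> * Z' \<omega>)"
        by (intro integrable_mult_indicator[where 'b=real, simplified] AM i')
    qed (use le in \<open>auto simp: indicator_def\<close>)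
    also have "\<dots> \<le> K * measure M A"
      using cond_le_integral(2)[OF sub Z, of "indicator A"] A by (auto simp: emeasure_eq_measure)
    finally show "\<bar>LINT \<omega>|M. indicator A \<omega> * Z \<omega>\<bar> \<le> K * measure M A" .
  qed (use Z in \<open>auto simp: cond_le_def\<close>)
qed

text \<open>The second moment serves to make the product with a merely integrable weight integrable,
  through \<open>\<bar>x\<bar> \<le> 1 + x\<^sup>2\<close>; the size of the integral is governed by
  the much smaller \<open>K\<close>.\<close>

lemma cond_abs_le_L1:
  assumes sub: "subalgebra M G" and prob_space_M: "prob_space M" and Z: "cond_abs_le M G Z K" and Z2: "cond_le M G (\<lambda>\<omega>. (Z \<omega>)\<^sup>2) K2"
    and f: "f \<in> borel_measurable G" "integrable M f"
  shows "integrable M (\<lambda>\<omega>. f \<omega> * Z \<omega>)" "\<bar>LINT \<omega>|M. f \<omega> * Z \<omega>\<bar> \<le> K * (LINT \<omega>|M. \<bar>f \<omega>\<bar>)"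
proof -
  have i: "integrable M (\<lambda>\<omega>. \<bar>f \<omega>\<bar> * (Z \<omega>)\<^sup>2)" using f by (intro cond_le_integral[OF sub Z2]) auto
  have [measurable]: "Z \<in> borel_measurable M" "f \<in> borel_measurable M" using Z f by (auto simp: cond_abs_le_def)
  have k: "\<bar>x\<bar> \<le> 1 + x\<^sup>2" for x :: real
    using zero_le_power2[of "\<bar>x\<bar> - 1"] by (simp add: power2_diff)
  show fz: "integrable M (\<lambda>\<omega>. f \<omega> * Z \<omega>)"
  proof (rule Bochner_Integration.integrable_bound)
    show "integrable M (\<lambda>\<omega>. \<bar>f \<omega>\<bar> + \<bar>f \<omega>\<bar> * (Z \<omega>)\<^sup>2)" using i f by auto
    show "AE \<omega> in M. norm (f \<omega> * Z \<omega>) \<le> norm (\<bar>f \<omega>\<bar> + \<bar>f \<omega>\<bar> * (Z \<omega>)\<^sup>2)"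
    proof (rule AE_I2)
      fix \<omega> show "norm (f \<omega> * Z \<omega>) \<le> norm (\<bar>f \<omega>\<bar> + \<bar>f \<omega>\<bar> * (Z \<omega>)\<^sup>2)"
        using mult_left_mono[OF k[of "Z \<omega>"], of "\<bar>f \<omega>\<bar>"] by (simp add: abs_mult distrib_left)
    qed
  qed measurable
  show "\<bar>LINT \<omega>|M. f \<omega> * Z \<omega>\<bar> \<le> K * (LINT \<omega>|M. \<bar>f \<omega>\<bar>)"
    by (rule cond_abs_le_integral[OF sub prob_space_M Z f fz])
qed

lemma cauchy_schwarz_integral:
  fixes f g :: "'w \<Rightarrow> real"
  assumes [measurable]: "f \<in> borel_measurable M" "g \<in> borel_measurable M"
    and f: "integrable M (\<lambda>\<omega>. (f \<omega>)\<^sup>2)" and g: "integrable M (\<lambda>\<omega>. (g \<omega>)\<^sup>2)"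
  shows "integrable M (\<lambda>\<omega>. f \<omega> * g \<omega>)"
    and "(LINT \<omega>|M. \<bar>f \<omega> * g \<omega>\<bar>) \<le> sqrt (LINT \<omega>|M. (f \<omega>)\<^sup>2) * sqrt (LINT \<omega>|M. (g \<omega>)\<^sup>2)"
    and "\<bar>LINT \<omega>|M. f \<omega> * g \<omega>\<bar> \<le> sqrt (LINT \<omega>|M. (f \<omega>)\<^sup>2) * sqrt (LINT \<omega>|M. (g \<omega>)\<^sup>2)"
proof -
  show i: "integrable M (\<lambda>\<omega>. f \<omega> * g \<omega>)"
  proof (rule Bochner_Integration.integrable_bound)
    show "integrable M (\<lambda>\<omega>. (f \<omega>)\<^sup>2 + (g \<omega>)\<^sup>2)" using f g by auto
    have "\<bar>a * b\<bar> \<le> a\<^sup>2 + b\<^sup>2" for a b :: real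

    proof -
      have "2 * (\<bar>a\<bar> * \<bar>b\<bar>) \<le> a\<^sup>2 + b\<^sup>2" using zero_le_power2[of "\<bar>a\<bar> - \<bar>b\<bar>"] by (simp add: power2_diff)
      moreover have "0 \<le> \<bar>a\<bar> * \<bar>b\<bar>" by simp
      ultimately show ?thesis unfolding abs_mult by linarith
    qed
    then show "AE \<omega> in M. norm (f \<omega> * g \<omega>) \<le> norm ((f \<omega>)\<^sup>2 + (g \<omega>)\<^sup>2)" by auto
  qed measurable
  have "(\<integral>\<^sup>+\<omega>. ennreal \<bar>f \<omega>\<bar> * ennreal \<bar>g \<omega>\<bar> \<partial>M) = (\<integral>\<^sup>+\<omega>. ennreal \<bar>f \<omega> * g \<omega>\<bar> \<partial>M)"
    by (intro nn_integral_cong) (simp add: ennreal_mult'[symmetric] abs_mult)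
  also have "\<dots> = ennreal (LINT \<omega>|M. \<bar>f \<omega> * g \<omega>\<bar>)"
    using i by (intro nn_integral_eq_integral) auto
  finally have "ennreal ((LINT \<omega>|M. \<bar>f \<omega> * g \<omega>\<bar>)\<^sup>2) = (\<integral>\<^sup>+\<omega>. ennreal \<bar>f \<omega>\<bar> * ennreal \<bar>g \<omega>\<bar> \<partial>M)\<^sup>2"
    by (simp add: ennreal_power integral_nonneg_AE)
  also have "\<dots> \<le> (\<integral>\<^sup>+\<omega>. (ennreal \<bar>f \<omega>\<bar>)\<^sup>2 \<partial>M) * (\<integral>\<^sup>+\<omega>. (ennreal \<bar>g \<omega>\<bar>)\<^sup>2 \<partial>M)"
    by (rule Cauchy_Schwarz_nn_integral) auto
  also have "\<dots> = ennreal ((LINT \<omega>|M. (f \<omega>)\<^sup>2) * (LINT \<omega>|M. (g \<omega>)\<^sup>2))"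
    using f g by (simp add: ennreal_power nn_integral_eq_integral ennreal_mult integral_nonneg_AE)
  finally have "(LINT \<omega>|M. \<bar>f \<omega> * g \<omega>\<bar>)\<^sup>2 \<le> (LINT \<omega>|M. (f \<omega>)\<^sup>2) * (LINT \<omega>|M. (g \<omega>)\<^sup>2)"
    by (subst (asm) ennreal_le_iff) (auto intro!: mult_nonneg_nonneg integral_nonneg_AE)
  then show *: "(LINT \<omega>|M. \<bar>f \<omega> * g \<omega>\<bar>) \<le> sqrt (LINT \<omega>|M. (f \<omega>)\<^sup>2) * sqrt (LINT \<omega>|M. (g \<omega>)\<^sup>2)"
    by (simp add: real_sqrt_mult[symmetric] real_le_rsqrt)
  then show "\<bar>LINT \<omega>|M. f \<omega> * g \<omega>\<bar> \<le> sqrt (LINT \<omega>|M. (f \<omega>)\<^sup>2) * sqrt (LINT \<omega>|M. (g \<omega>)\<^sup>2)"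
    using integral_abs_bound[of M "\<lambda>\<omega>. f \<omega> * g \<omega>"] by linarith
qed

section \<open>Limits in probability, almost surely convergent subsequences and Fatou's
  lemma\<close>

definition ae_subseq :: "'w measure \<Rightarrow> (nat \<Rightarrow> 'w \<Rightarrow> real) \<Rightarrow> ('w \<Rightarrow> real) \<Rightarrow> bool" where
  "ae_subseq M Z L \<longleftrightarrow> (\<exists>r. strict_mono (r :: nat \<Rightarrow> nat) \<and> (AE \<omega> in M. (\<lambda>n. Z (r n) \<omega>) \<longlonglongrightarrow> L \<omega>))"

text \<open>The truncated distance \<open>min 1 \<bar>Z n \<omega> - L \<omega>\<bar>\<close> tends
  to 0 in L1, which yields an almost surely convergent subsequence. Fatou's lemma asks for no more,
  so the limit theorems below are stated for \<open>ae_subseq\<close>.\<close>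

lemma conv_in_prob_ae_subseq:
  assumes prob_space_M: "prob_space M" and [measurable]: "\<And>n. Z n \<in> borel_measurable M" "L \<in> borel_measurable M"
    and conv: "conv_in_prob M Z L"
  shows "ae_subseq M Z L"
proof -
  interpret prob_space M by fact
  let ?u = "\<lambda>n \<omega>. min 1 \<bar>Z n \<omega> - L \<omega>\<bar>"
  have i: "integrable M (?u n)" for n by (rule integrable_const_bound[of _ 1]) auto
  have "(\<lambda>n. LINT \<omega>|M. norm (?u n \<omega>)) \<longlonglongrightarrow> 0"
  proof (rule LIMSEQ_I)
    fix e :: real assume e: "0 < e"
    let ?S = "\<lambda>n. {\<omega> \<in> space M. e/2 < \<bar>Z n \<omega> - L \<omega>\<bar>}"
    have "(\<lambda>n. measure M (?S n)) \<longlonglongrightarrow> 0" using conv half_gt_zero[OF e] unfolding conv_in_prob_def by blast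
    then obtain N where N: "\<And>n. n \<ge> N \<Longrightarrow> measure M (?S n) < e/2"
      using LIMSEQ_D[of _ 0 "e/2"] e by fastforce
    have "norm ((LINT \<omega>|M. norm (?u n \<omega>)) - 0) < e" if n: "n \<ge> N" for n
    proof -
      have "(LINT \<omega>|M. norm (?u n \<omega>)) \<le> (LINT \<omega>|M. e/2 + indicator (?S n) \<omega>)"
      proof (intro integral_mono)
        show "integrable M (\<lambda>\<omega>. e/2 + indicator (?S n) \<omega>)" by (simp add: emeasure_eq_measure)
        fix \<omega> assume "\<omega> \<in> space M"
        then show "norm (?u n \<omega>) \<le> e/2 + indicator (?S n) \<omega>"
          using e by (cases "e/2 < \<bar>Z n \<omega> - L \<omega>\<bar>") (simp_all add: min_def)
      qed (use i in auto)
      also have "\<dots> = e/2 + measure M (?S n)" by (simp add: prob_space emeasure_eq_measure)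
      finally show ?thesis using N[OF n] by (simp add: integral_nonneg_AE)
    qed
    then show "\<exists>no. \<forall>n\<ge>no. norm ((LINT \<omega>|M. norm (?u n \<omega>)) - 0) < e" by blast
  qed
  from tendsto_L1_AE_subseq[OF i this] obtain r where r: "strict_mono (r::nat\<Rightarrow>nat)" "AE \<omega> in M. (\<lambda>n. ?u (r n) \<omega>) \<longlonglongrightarrow> 0"
    by blast
  have "AE \<omega> in M. (\<lambda>n. Z (r n) \<omega>) \<longlonglongrightarrow> L \<omega>"
    using r(2)
  proof eventually_elim
    case (elim \<omega>)
    have "eventually (\<lambda>n. ?u (r n) \<omega> < 1) sequentially" using order_tendstoD(2)[OF elim, of 1] by simp
    then have "eventually (\<lambda>n. ?u (r n) \<omega> = \<bar>Z (r n) \<omega> - L \<omega>\<bar>) sequentially" by eventually_elim auto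
    then have "(\<lambda>n. \<bar>Z (r n) \<omega> - L \<omega>\<bar>) \<longlonglongrightarrow> 0" using elim by (rule Lim_transform_eventually[rotated])
    then show ?case using LIM_zero_cancel tendsto_rabs_zero_iff by blast
  qed
  then show ?thesis using r(1) by (auto simp: ae_subseq_def)
qed

lemma ae_subseq_add:
  assumes "ae_subseq M Z L" "\<And>\<omega>. \<omega> \<in> space M \<Longrightarrow> (\<lambda>n. Z' n \<omega>) \<longlonglongrightarrow> L' \<omega>"
  shows "ae_subseq M (\<lambda>n \<omega>. Z n \<omega> + Z' n \<omega>) (\<lambda>\<omega>. L \<omega> + L' \<omega>)"
proof -
  obtain r where r: "strict_mono (r::nat\<Rightarrow>nat)" "AE \<omega> in M. (\<lambda>n. Z (r n) \<omega>) \<longlonglongrightarrow> L \<omega>"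
    using assms(1) by (auto simp: ae_subseq_def)
  have "AE \<omega> in M. (\<lambda>n. Z (r n) \<omega> + Z' (r n) \<omega>) \<longlonglongrightarrow> L \<omega> + L' \<omega>"
    using r(2) AE_space
  proof eventually_elim
    case (elim \<omega>)
    show ?case using tendsto_add[OF elim(1) LIMSEQ_subseq_LIMSEQ[OF assms(2)[OF elim(2)] r(1)]] by (simp add: comp_def)
  qed
  then show ?thesis using r(1) by (auto simp: ae_subseq_def)
qed

lemma fatou_ae_subseq:
  assumes [measurable]: "\<And>n. Z n \<in> borel_measurable M" "A \<in> sets M"
    and conv: "ae_subseq M Z L"
    and le: "\<And>n. (\<integral>\<^sup>+\<omega>. ennreal ((Z n \<omega>)\<^sup>2) * indicator A \<omega> \<partial>M) \<le> K"
  shows "(\<integral>\<^sup>+\<omega>. ennreal ((L \<omega>)\<^sup>2) * indicator A \<omega> \<partial>M) \<le> K"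
proof -
  obtain r where r: "strict_mono (r::nat\<Rightarrow>nat)" "AE \<omega> in M. (\<lambda>n. Z (r n) \<omega>) \<longlonglongrightarrow> L \<omega>"
    using conv by (auto simp: ae_subseq_def)
  have "(\<integral>\<^sup>+\<omega>. ennreal ((L \<omega>)\<^sup>2) * indicator A \<omega> \<partial>M)
    = (\<integral>\<^sup>+\<omega>. liminf (\<lambda>n. ennreal ((Z (r n) \<omega>)\<^sup>2) * indicator A \<omega>) \<partial>M)"
  proof (rule nn_integral_cong_AE)
    show "AE \<omega> in M. ennreal ((L \<omega>)\<^sup>2) * indicator A \<omega> = liminf (\<lambda>n. ennreal ((Z (r n) \<omega>)\<^sup>2) * indicator A \<omega>)"
      using r(2)
    proof eventually_elim
      case (elim \<omega>)
      have "(\<lambda>n. ennreal ((Z (r n) \<omega>)\<^sup>2) * indicator A \<omega>) \<longlonglongrightarrow> ennreal ((L \<omega>)\<^sup>2) * indicator A \<omega>"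
        using elim by (cases "\<omega> \<in> A") (auto intro!: tendsto_ennrealI tendsto_power)
      then show ?case by (simp add: lim_imp_Liminf)
    qed
  qed
  also have "\<dots> \<le> liminf (\<lambda>n. \<integral>\<^sup>+\<omega>. ennreal ((Z (r n) \<omega>)\<^sup>2) * indicator A \<omega> \<partial>M)"
    by (rule nn_integral_liminf) measurable
  also have "\<dots> \<le> liminf (\<lambda>n::nat. K)" by (intro Liminf_mono always_eventually allI le)
  finally show ?thesis by (simp add: Liminf_const)
qed

lemma cond_le_fatou:
  assumes sub: "subalgebra M G" and L: "L \<in> borel_measurable M" and Z: "\<And>n. Z n \<in> borel_measurable M" and conv: "ae_subseq M Z L"
    and le: "\<And>n. cond_le M G (\<lambda>\<omega>. (Z n \<omega>)\<^sup>2) K"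
  shows "cond_le M G (\<lambda>\<omega>. (L \<omega>)\<^sup>2) K"
  unfolding cond_le_def
proof (intro conjI ballI)
  fix A assume A: "A \<in> sets G"
  have AM: "A \<in> sets M" using A sub by (auto simp: subalgebra_def)
  show "(\<integral>\<^sup>+\<omega>. ennreal ((L \<omega>)\<^sup>2) * indicator A \<omega> \<partial>M) \<le> ennreal K * emeasure M A"
    by (rule fatou_ae_subseq[OF Z AM conv]) (use le A in \<open>auto simp: cond_le_def\<close>)
qed (use L le in \<open>auto simp: cond_le_def\<close>)

text \<open>Fatou's lemma applied to \<open>(Z + t)\<^sup>2\<close> for every real shift \<open>t\<close> also controls first moments.\<close>
lemma cond_abs_le_fatou:
  assumes sub: "subalgebra M G" and prob_space_M: "prob_space M" and Lm: "L \<in> borel_measurable M" and Z: "\<And>n. Z n \<in> borel_measurable M"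
    and conv: "ae_subseq M Z L"
    and le: "\<And>n. cond_le M G (\<lambda>\<omega>. (Z n \<omega>)\<^sup>2) K" and ca: "\<And>n. cond_abs_le M G (Z n) c"
  shows "cond_abs_le M G L c"
proof -
  interpret prob_space M by fact
  have L2: "cond_le M G (\<lambda>\<omega>. (L \<omega>)\<^sup>2) K" by (rule cond_le_fatou[OF sub Lm Z conv le])
  have iL2: "integrable M (\<lambda>\<omega>. (L \<omega>)\<^sup>2)" using cond_le_integrable[OF sub prob_space_M L2] by simp
  have iL: "integrable M L" using square_integrable_imp_integrable[OF Lm iL2] .
  have iZ2: "integrable M (\<lambda>\<omega>. (Z n \<omega>)\<^sup>2)" for n using cond_le_integrable[OF sub prob_space_M le] by simp
  have iZ: "integrable M (Z n)" for n using square_integrable_imp_integrable[OF Z iZ2] .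
  have c: "0 \<le> c" using ca by (auto simp: cond_abs_le_def)
  have K: "0 \<le> K" using le by (auto simp: cond_le_def)
  show ?thesis unfolding cond_abs_le_def
  proof (intro conjI ballI iL c)
    fix A assume A: "A \<in> sets G"
    have AM[measurable]: "A \<in> sets M" using A sub by (auto simp: subalgebra_def)
    have ind: "\<And>f::'a \<Rightarrow> real. integrable M f \<Longrightarrow> integrable M (\<lambda>\<omega>. indicator A \<omega> * f \<omega>)"
      by (intro integrable_mult_indicator[where 'b=real, simplified] AM)
    let ?P = "measure M A"
    have expand: "(LINT \<omega>|M. indicator A \<omega> * (f \<omega> + t)\<^sup>2) = (LINT \<omega>|M. indicator A \<omega> * (f \<omega>)\<^sup>2) + 2 * t * (LINT \<omega>|M. indicator A \<omega> * f \<omega>) + t\<^sup>2 * ?P"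
      if "integrable M (\<lambda>\<omega>. (f \<omega>)\<^sup>2)" "integrable M f" for f :: "'a \<Rightarrow> real" and t
    proof -
      have "(\<lambda>\<omega>. indicator A \<omega> * (f \<omega> + t)\<^sup>2) = (\<lambda>\<omega>. indicator A \<omega> * (f \<omega>)\<^sup>2 + 2 * t * (indicator A \<omega> * f \<omega>) + t\<^sup>2 * indicator A \<omega>)"
        by (auto simp: power2_sum algebra_simps)
      then show ?thesis using ind[OF that(1)] ind[OF that(2)] by (simp add: emeasure_eq_measure)
    qed
    have nn: "(\<integral>\<^sup>+\<omega>. ennreal ((f \<omega> + t)\<^sup>2) * indicator A \<omega> \<partial>M) = ennreal (LINT \<omega>|M. indicator A \<omega> * (f \<omega> + t)\<^sup>2)"
      if "integrable M (\<lambda>\<omega>. (f \<omega>)\<^sup>2)" "integrable M f" for f :: "'a \<Rightarrow> real" and t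
    proof -
      have "integrable M (\<lambda>\<omega>. (f \<omega> + t)\<^sup>2)" using that by (simp add: power2_sum)
      from ind[OF this] show ?thesis
        by (subst nn_integral_eq_integral[symmetric]) (auto simp: indicator_def intro!: nn_integral_cong)
    qed
    \<comment> \<open>When the shifted squares are expanded, the terms with \<open>t\<^sup>2\<close>
      agree on both sides and cancel. As \<open>t\<close> may have either sign, the first moment is
      bounded from both sides.\<close>
    have main: "2 * t * (LINT \<omega>|M. indicator A \<omega> * L \<omega>) \<le> K * ?P + 2 * \<bar>t\<bar> * (c * ?P)" for t
    proof -
      have "(\<integral>\<^sup>+\<omega>. ennreal ((L \<omega> + t)\<^sup>2) * indicator A \<omega> \<partial>M) \<le> ennreal (K * ?P + 2 * \<bar>t\<bar> * (c * ?P) + t\<^sup>2 * ?P)"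
      proof (rule fatou_ae_subseq[OF _ AM])
        show "ae_subseq M (\<lambda>n \<omega>. Z n \<omega> + t) (\<lambda>\<omega>. L \<omega> + t)" by (rule ae_subseq_add[OF conv]) auto
        fix n
        show "(\<lambda>\<omega>. Z n \<omega> + t) \<in> borel_measurable M" using Z by simp
        have "(LINT \<omega>|M. indicator A \<omega> * (Z n \<omega>)\<^sup>2) \<le> K * ?P"
          using cond_le_integral(2)[OF sub le, of "indicator A"] A by (auto simp: emeasure_eq_measure)
        moreover have "\<bar>LINT \<omega>|M. indicator A \<omega> * Z n \<omega>\<bar> \<le> c * ?P" using ca A by (auto simp: cond_abs_le_def)
        then have "2 * t * (LINT \<omega>|M. indicator A \<omega> * Z n \<omega>) \<le> 2 * \<bar>t\<bar> * (c * ?P)"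
          by (smt (verit) abs_le_D1 abs_le_D2 abs_mult_pos mult_left_mono mult_minus_left mult_minus_right)
        ultimately show "(\<integral>\<^sup>+\<omega>. ennreal ((Z n \<omega> + t)\<^sup>2) * indicator A \<omega> \<partial>M) \<le> ennreal (K * ?P + 2 * \<bar>t\<bar> * (c * ?P) + t\<^sup>2 * ?P)"
          unfolding nn[OF iZ2 iZ] expand[OF iZ2 iZ] by (intro ennreal_leI) auto
      qed
      then have "(LINT \<omega>|M. indicator A \<omega> * (L \<omega>)\<^sup>2) + 2 * t * (LINT \<omega>|M. indicator A \<omega> * L \<omega>) + t\<^sup>2 * ?P \<le> K * ?P + 2 * \<bar>t\<bar> * (c * ?P) + t\<^sup>2 * ?P"
        unfolding nn[OF iL2 iL] expand[OF iL2 iL] using K c by (subst (asm) ennreal_le_iff) auto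
      moreover have "0 \<le> (LINT \<omega>|M. indicator A \<omega> * (L \<omega>)\<^sup>2)" by (intro integral_nonneg_AE) auto
      ultimately show ?thesis by linarith
    qed
    have "\<bar>LINT \<omega>|M. indicator A \<omega> * L \<omega>\<bar> \<le> c * ?P + e" if e: "0 < e" for e
    proof -
      \<comment> \<open>Dividing \<open>main\<close> by \<open>2 * t\<close> leaves the excess
        \<open>K * ?P / (2 * t)\<close>; this choice of \<open>t\<close> pushes it below
        \<open>e\<close>.\<close>
      define t where "t = (K * ?P + 1) / (2 * e)"
      have t: "0 < t" using e K by (auto simp: t_def intro!: divide_pos_pos add_nonneg_pos)
      have te: "2 * t * e = K * ?P + 1" using e by (simp add: t_def)
      have "2 * t * \<bar>LINT \<omega>|M. indicator A \<omega> * L \<omega>\<bar> \<le> 2 * t * (c * ?P + e)"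
        using main[of t] main[of "-t"] t te by (auto simp: abs_if distrib_left)
      then show ?thesis using t by simp
    qed
    then show "\<bar>LINT \<omega>|M. indicator A \<omega> * L \<omega>\<bar> \<le> c * ?P" by (rule field_le_epsilon)
  qed
qed

lemma conv_in_prob_diff:
  assumes prob_space_M: "prob_space M" and [measurable]: "\<And>n. Z n \<in> borel_measurable M" "L \<in> borel_measurable M"
     "\<And>n. Z' n \<in> borel_measurable M" "L' \<in> borel_measurable M"
    and c: "conv_in_prob M Z L" "conv_in_prob M Z' L'"
  shows "conv_in_prob M (\<lambda>n \<omega>. Z n \<omega> - Z' n \<omega>) (\<lambda>\<omega>. L \<omega> - L' \<omega>)"
  unfolding conv_in_prob_def
proof (intro allI impI)
  interpret prob_space M by fact
  fix e :: real assume e: "0 < e"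
  let ?S = "\<lambda>n. {\<omega> \<in> space M. e/2 < \<bar>Z n \<omega> - L \<omega>\<bar>}" and ?S' = "\<lambda>n. {\<omega> \<in> space M. e/2 < \<bar>Z' n \<omega> - L' \<omega>\<bar>}"
  have "(\<lambda>n. measure M (?S n)) \<longlonglongrightarrow> 0" "(\<lambda>n. measure M (?S' n)) \<longlonglongrightarrow> 0"
    using c half_gt_zero[OF e] unfolding conv_in_prob_def by blast+
  from tendsto_add[OF this] have lim: "(\<lambda>n. measure M (?S n) + measure M (?S' n)) \<longlonglongrightarrow> 0" by simp
  show "(\<lambda>n. measure M {\<omega> \<in> space M. e < \<bar>Z n \<omega> - Z' n \<omega> - (L \<omega> - L' \<omega>)\<bar>}) \<longlonglongrightarrow> 0"
  proof (rule tendsto_sandwich[OF _ _ tendsto_const lim])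
    show "\<forall>\<^sub>F n in sequentially. measure M {\<omega> \<in> space M. e < \<bar>Z n \<omega> - Z' n \<omega> - (L \<omega> - L' \<omega>)\<bar>} \<le> measure M (?S n) + measure M (?S' n)"
    proof (intro always_eventually allI)
      fix n
      have "measure M {\<omega> \<in> space M. e < \<bar>Z n \<omega> - Z' n \<omega> - (L \<omega> - L' \<omega>)\<bar>} \<le> measure M (?S n \<union> ?S' n)"
      proof (intro finite_measure_mono subsetI)
        fix \<omega> assume "\<omega> \<in> {\<omega> \<in> space M. e < \<bar>Z n \<omega> - Z' n \<omega> - (L \<omega> - L' \<omega>)\<bar>}"
        then have "\<omega> \<in> space M" "e/2 < \<bar>Z n \<omega> - L \<omega>\<bar> \<or> e/2 < \<bar>Z' n \<omega> - L' \<omega>\<bar>" by auto argo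
        then show "\<omega> \<in> ?S n \<union> ?S' n" by blast
      qed measurable
      also have "\<dots> \<le> measure M (?S n) + measure M (?S' n)" by (intro measure_Un_le) auto
      finally show "measure M {\<omega> \<in> space M. e < \<bar>Z n \<omega> - Z' n \<omega> - (L \<omega> - L' \<omega>)\<bar>} \<le> measure M (?S n) + measure M (?S' n)" .
    qed
  qed auto
qed

lemma conv_in_prob_compose:
  assumes "conv_in_prob M Z L" "filterlim r at_top sequentially"
  shows "conv_in_prob M (\<lambda>n. Z (r n)) L"
  using assms unfolding conv_in_prob_def by (auto intro: filterlim_compose)

lemma sum_power2_le_card:
  fixes f :: "nat \<Rightarrow> real"
  shows "(\<Sum>i<n. f i)\<^sup>2 \<le> real n * (\<Sum>i<n. (f i)\<^sup>2)"
  using Cauchy_Schwarz_ineq_sum[of "\<lambda>_. 1" f "{..<n}"] by simp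

text \<open>Uniform continuity bounds the error on each cell by \<open>e\<close> times its length,
  and these bounds add up along the grid. The grids of mesh \<open>v / real (Suc l)\<close> contain
  all multiples of \<open>v\<close> for every \<open>l\<close>, so one refinement serves all coarse
  grid times at once.\<close>

lemma riemann_left_sum_limit:
  fixes f :: "real \<Rightarrow> real"
  assumes v: "0 < v" and k: "k \<le> k'" and f: "continuous_on {real k * v..real k' * v} f"
  shows "(\<lambda>l. \<Sum>j\<in>{k * Suc l..<k' * Suc l}. f (real j * (v / real (Suc l))) * (v / real (Suc l)))
    \<longlonglongrightarrow> integral {real k * v..real k' * v} f"
proof (rule LIMSEQ_I)
  fix r :: real assume r: "0 < r"
  let ?a = "real k * v" and ?b = "real k' * v"
  have ab: "?a \<le> ?b" using v k by (intro mult_right_mono) auto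
  define e where "e = r / (?b - ?a + 1)"
  have e: "0 < e" "e * (?b - ?a) < r"
    using r ab by (auto simp: e_def field_simps)
  have "uniformly_continuous_on {?a..?b} f" using f by (intro compact_uniformly_continuous) auto
  then obtain \<delta> where \<delta>: "0 < \<delta>" "\<And>x y. x \<in> {?a..?b} \<Longrightarrow> y \<in> {?a..?b} \<Longrightarrow> dist x y < \<delta> \<Longrightarrow> dist (f x) (f y) < e"
    using e(1) unfolding uniformly_continuous_on_def by metis
  obtain N where N: "v / \<delta> < real N" using reals_Archimedean2 by blast
  have "norm ((\<Sum>j\<in>{k * Suc l..<k' * Suc l}. f (real j * (v / real (Suc l))) * (v / real (Suc l))) - integral {?a..?b} f) < r"
    if l: "N \<le> l" for l
  proof -
    define h where "h = v / real (Suc l)"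
    have h: "0 < h" using v by (simp add: h_def)
    have "v < real N * \<delta>" using N \<delta> by (simp add: field_simps)
    also have "\<dots> \<le> real (Suc l) * \<delta>" using l \<delta> by (intro mult_right_mono) auto
    finally have h\<delta>: "h < \<delta>" unfolding h_def by (simp add: field_simps)
    have ka: "real (k * Suc l) * h = ?a" and kb: "real (k' * Suc l) * h = ?b" by (simp_all add: h_def field_simps)
    have main: "\<bar>(\<Sum>j\<in>{k * Suc l..<n}. f (real j * h) * h) - integral {?a..real n * h} f\<bar> \<le> e * (real n * h - ?a)"
      if "k * Suc l \<le> n" "n \<le> k' * Suc l" for n
      using that
    proof (induction n rule: dec_induct)
      case base
      then show ?case unfolding ka by simp
    next
      case (step n)
      have n1: "?a \<le> real n * h" unfolding ka[symmetric] using step h by (intro mult_right_mono) (auto simp del: of_nat_mult of_nat_Suc)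
      have n2: "real (Suc n) * h \<le> ?b" unfolding kb[symmetric] using step h by (intro mult_right_mono) (auto simp del: of_nat_mult of_nat_Suc)
      have n3: "real (Suc n) * h = real n * h + h" by (simp add: algebra_simps)
      have int: "f integrable_on {x..y}" if "?a \<le> x" "y \<le> ?b" for x y
        using that by (intro integrable_continuous_interval continuous_on_subset[OF f]) auto
      have comb: "integral {?a..real (Suc n) * h} f = integral {?a..real n * h} f + integral {real n * h..real (Suc n) * h} f"
        using n1 n2 n3 h by (intro Henstock_Kurzweil_Integration.integral_combine[symmetric] int) auto
      have "\<bar>integral {real n * h..real (Suc n) * h} f - f (real n * h) * h\<bar> = norm (integral {real n * h..real (Suc n) * h} (\<lambda>x. f x - f (real n * h)))"
        using n1 n2 n3 h by (subst Henstock_Kurzweil_Integration.integral_diff) (auto intro!: int simp: mult.commute)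
      also have "\<dots> \<le> e * (real (Suc n) * h - real n * h)"
      proof (rule integral_bound)
        show "continuous_on {real n * h..real (Suc n) * h} (\<lambda>x. f x - f (real n * h))"
          using n1 n2 by (intro continuous_intros continuous_on_subset[OF f]) auto
        fix t assume t: "t \<in> {real n * h..real (Suc n) * h}"
        have "dist (f t) (f (real n * h)) < e"
          using t n1 n2 n3 h\<delta> h by (intro \<delta>) (auto simp: dist_real_def)
        then show "norm (f t - f (real n * h)) \<le> e" by (simp add: dist_real_def)
      qed (use n3 h in auto)
      finally have one: "\<bar>integral {real n * h..real (Suc n) * h} f - f (real n * h) * h\<bar> \<le> e * h" using n3 by simp
      have IH: "\<bar>(\<Sum>j\<in>{k * Suc l..<n}. f (real j * h) * h) - integral {?a..real n * h} f\<bar> \<le> e * (real n * h - ?a)"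
        using step by simp
      have sm: "(\<Sum>j\<in>{k * Suc l..<Suc n}. f (real j * h) * h) = (\<Sum>j\<in>{k * Suc l..<n}. f (real j * h) * h) + f (real n * h) * h"
        using step by simp
      have "e * (real (Suc n) * h - ?a) = e * (real n * h - ?a) + e * h" using n3 by (simp add: algebra_simps)
      then show ?case unfolding sm comb using IH one by linarith
    qed
    have "\<bar>(\<Sum>j\<in>{k * Suc l..<k' * Suc l}. f (real j * h) * h) - integral {?a..?b} f\<bar> \<le> e * (?b - ?a)"
      using main[OF mult_le_mono1[OF k] order_refl] unfolding kb .
    then show ?thesis using e(2) unfolding h_def by simp
  qed
  then show "\<exists>no. \<forall>n\<ge>no. norm ((\<Sum>j\<in>{k * Suc n..<k' * Suc n}. f (real j * (v / real (Suc n))) * (v / real (Suc n))) - integral {?a..?b} f) < r" by blast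
qed

section \<open>The equation and its driving noise\<close>

text \<open>The condition on the ratio is kept multiplied out, as \<open>kappa6\<close>, the form in
  which the generator estimate consumes it.\<close>

locale sde =
  fixes M :: "'w measure" and F :: "real \<Rightarrow> 'w set set"
    and d m :: nat and T \<kappa> \<nu> :: real
    and AA :: "nat \<Rightarrow> nat \<Rightarrow> nat \<Rightarrow> real"
    and B X :: "real \<Rightarrow> 'w \<Rightarrow> nat \<Rightarrow> real" and x0 :: "nat \<Rightarrow> real"
  assumes T: "T > 0"
    and filt: "usual_filtration M F"
    and BM: "std_BM M F (d + m) B"
    and nu: "\<nu> > 0"
    and skewA: "\<forall>p\<le>m. skew d (AA p)"
    and x0: "sqn d x0 < 1"
    and sol: "is_solution M F d m \<kappa> \<nu> AA T B x0 X"
    and kappa6: "6 * \<nu>\<^sup>2 \<le> \<kappa>"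
begin

lemma filtD:
  "0 \<le> t \<Longrightarrow> sigma_algebra (space M) (F t)" "0 \<le> t \<Longrightarrow> F t \<subseteq> sets M"
  "0 \<le> s \<Longrightarrow> s \<le> t \<Longrightarrow> F s \<subseteq> F t"
proof -
  note c = filt[unfolded usual_filtration_def, THEN conjunct2, THEN conjunct2]
  show "0 \<le> t \<Longrightarrow> sigma_algebra (space M) (F t)" "0 \<le> t \<Longrightarrow> F t \<subseteq> sets M"
    "0 \<le> s \<Longrightarrow> s \<le> t \<Longrightarrow> F s \<subseteq> F t"
    using conjunct1[OF c] conjunct1[OF conjunct2[OF c]] by simp_all
qed

sublocale prob_space M using filt unfolding usual_filtration_def by (rule conjunct1)

lemma prob_space_M: "prob_space M" by unfold_locales

text \<open>Turns the set system \<open>F t\<close> into a measure, so that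
  \<open>borel_measurable\<close> and \<open>subalgebra\<close> apply to it.\<close>

definition G :: "real \<Rightarrow> 'w measure" where "G t = sigma (space M) (F t)"

lemma sets_G: "0 \<le> t \<Longrightarrow> sets (G t) = F t"
proof -
  assume "0 \<le> t"
  from filtD(1)[OF this] show ?thesis unfolding G_def by (rule sigma_algebra.sets_measure_of_eq)
qed

lemma space_G [simp]: "space (G t) = space M"
  by (simp add: G_def space_measure_of_conv)

lemma subalgebra_G: "0 \<le> t \<Longrightarrow> subalgebra M (G t)"
  using filtD(2) by (simp add: subalgebra_def sets_G)

lemma G_mono: "0 \<le> s \<Longrightarrow> s \<le> t \<Longrightarrow> sets (G s) \<subseteq> sets (G t)"
  using filtD(3) by (simp add: sets_G)

lemma measurable_G_mono: "f \<in> borel_measurable (G s) \<Longrightarrow> 0 \<le> s \<Longrightarrow> s \<le> t \<Longrightarrow> f \<in> borel_measurable (G t)"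
  using G_mono[of s t] by (auto simp: measurable_def)

lemma measurable_G_M: "f \<in> borel_measurable (G s) \<Longrightarrow> 0 \<le> s \<Longrightarrow> f \<in> borel_measurable M"
  using measurable_from_subalg[OF subalgebra_G] by blast

lemma meas_wrt_G: "0 \<le> t \<Longrightarrow> meas_wrt (space M) (F t) f \<Longrightarrow> f \<in> borel_measurable (G t)"
  by (auto simp: measurable_def meas_wrt_def sets_G)

lemma X_meas: "0 \<le> t \<Longrightarrow> t \<le> T \<Longrightarrow> i < d \<Longrightarrow> (\<lambda>\<omega>. X t \<omega> i) \<in> borel_measurable (G t)"
  using sol by (intro meas_wrt_G) (auto simp: is_solution_def)

lemma B_meas: "0 \<le> t \<Longrightarrow> i < d + m \<Longrightarrow> (\<lambda>\<omega>. B t \<omega> i) \<in> borel_measurable (G t)"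
  using BM by (intro meas_wrt_G) (auto simp: std_BM_def)

lemma sqn_le_1: "0 \<le> t \<Longrightarrow> t \<le> T \<Longrightarrow> \<omega> \<in> space M \<Longrightarrow> sqn d (X t \<omega>) \<le> 1"
  using sol by (auto simp: is_solution_def)

text \<open>Under \<open>M\<close> conditioned on \<open>A\<close>, the normalised \<open>L\<close>
  has the characteristic function of a standard normal variable. Levy's uniqueness theorem
  identifies its law, and all moments follow at once. The event \<open>A\<close> carries the
  independence of the past: the result does not depend on it except through its probability.\<close>

lemma gaussian_moments:
  assumes s: "0 \<le> s" "s < t" and S: "S = (\<Sum>c<d+m. (a c)\<^sup>2)" "0 < S"
  defines "L \<equiv> \<lambda>\<omega>. \<Sum>c<d+m. a c * (B t \<omega> c - B s \<omega> c)"
  shows "A \<in> sets (G s) \<Longrightarrow> integrable M (\<lambda>\<omega>. indicator A \<omega> * L \<omega> ^ n)"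
    "A \<in> sets (G s) \<Longrightarrow> (LINT \<omega>|M. indicator A \<omega> * L \<omega> ^ n) = measure M A * sqrt ((t - s) * S) ^ n * (LINT x|std_normal_distribution. x ^ n)"
proof -
  assume A: "A \<in> sets (G s)"
  have AM[measurable]: "A \<in> sets M" using A subalgebra_G[OF s(1)] by (auto simp: subalgebra_def)
  define \<sigma> where "\<sigma> = sqrt ((t - s) * S)"
  have \<sigma>: "0 < \<sigma>" "\<sigma>\<^sup>2 = (t - s) * S" using s S by (auto simp: \<sigma>_def)
  have Lm[measurable]: "L \<in> borel_measurable M"
    unfolding L_def using s by (intro borel_measurable_sum borel_measurable_times borel_measurable_diff measurable_G_M[OF B_meas]) auto
  have "integrable M (\<lambda>\<omega>. indicator A \<omega> * L \<omega> ^ n) \<and>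
    (LINT \<omega>|M. indicator A \<omega> * L \<omega> ^ n) = measure M A * \<sigma> ^ n * (LINT x|std_normal_distribution. x ^ n)"
  \<comment> \<open>Conditioning on \<open>A\<close> requires positive probability; on a null event
    both sides are 0.\<close>
  proof (cases "measure M A = 0")
    case True
    then have "AE \<omega> in M. \<omega> \<notin> A" by (simp add: AE_iff_measurable[OF AM] emeasure_eq_measure prob_eq_0)
    then have ae: "AE \<omega> in M. indicator A \<omega> * L \<omega> ^ n = 0" by eventually_elim simp
    have "integrable M (\<lambda>\<omega>. indicator A \<omega> * L \<omega> ^ n) = integrable M (\<lambda>\<omega>. 0::real)"
      using ae by (intro integrable_cong_AE) auto
    moreover have "(LINT \<omega>|M. indicator A \<omega> * L \<omega> ^ n) = (LINT \<omega>|M. 0)"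
      using ae by (intro integral_cong_AE) auto
    ultimately show ?thesis using True by simp
  next
    case False
    then have P: "0 < measure M A" by (simp add: zero_less_measure_iff)
    let ?g = "\<lambda>\<omega>. indicator A \<omega> / measure M A :: real"
    define N where "N = density M (\<lambda>\<omega>. ennreal (?g \<omega>))"
    define D where "D = distr N borel (\<lambda>\<omega>. L \<omega> / \<sigma>)"
    have [measurable_cong]: "sets N = sets M" by (simp add: N_def)
    have "prob_space N"
    proof
      have "emeasure N (space N) = (\<integral>\<^sup>+\<omega>. ennreal (?g \<omega>) \<partial>M)"
        unfolding N_def by (subst emeasure_density) (auto intro!: nn_integral_cong simp: indicator_def)
      also have "\<dots> = ennreal (LINT \<omega>|M. ?g \<omega>)"
        by (intro nn_integral_eq_integral) (auto simp: emeasure_eq_measure)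
      also have "\<dots> = 1" using P by simp
      finally show "emeasure N (space N) = 1" .
    qed
    then interpret N: prob_space N .
    have Dr: "real_distribution D" unfolding D_def
      by (intro N.real_distribution_distr) measurable
    \<comment> \<open>Stated for Banach-valued \<open>f\<close>, because it is applied to a complex
      exponential for the characteristic function and to real powers for the moments.\<close>
    have intD: "integrable D f \<longleftrightarrow> integrable M (\<lambda>\<omega>. indicator A \<omega> *\<^sub>R f (L \<omega> / \<sigma>))"
      and intgD: "measure M A *\<^sub>R integral\<^sup>L D f = (LINT \<omega>|M. indicator A \<omega> *\<^sub>R f (L \<omega> / \<sigma>))"
      if [measurable]: "f \<in> borel_measurable borel" for f :: "real \<Rightarrow> 'b::{banach, second_countable_topology}"
    proof -
      have eq: "?g \<omega> *\<^sub>R f (L \<omega> / \<sigma>) = (1 / measure M A) *\<^sub>R (indicator A \<omega> *\<^sub>R f (L \<omega> / \<sigma>))" for \<omega> by simp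
      have "integrable D f \<longleftrightarrow> integrable N (\<lambda>\<omega>. f (L \<omega> / \<sigma>))"
        unfolding D_def by (intro integrable_distr_eq) measurable
      also have "\<dots> \<longleftrightarrow> integrable M (\<lambda>\<omega>. ?g \<omega> *\<^sub>R f (L \<omega> / \<sigma>))"
        unfolding N_def by (intro integrable_density) auto
      also have "\<dots> \<longleftrightarrow> integrable M (\<lambda>\<omega>. indicator A \<omega> *\<^sub>R f (L \<omega> / \<sigma>))" using P unfolding eq
        using integrable_scaleR_right[of "measure M A" M "\<lambda>\<omega>. (1 / measure M A) *\<^sub>R (indicator A \<omega> *\<^sub>R f (L \<omega> / \<sigma>))"]
          integrable_scaleR_right[of "1 / measure M A" M "\<lambda>\<omega>. indicator A \<omega> *\<^sub>R f (L \<omega> / \<sigma>)"] by auto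
      finally show "integrable D f \<longleftrightarrow> integrable M (\<lambda>\<omega>. indicator A \<omega> *\<^sub>R f (L \<omega> / \<sigma>))" .
      have "integral\<^sup>L D f = integral\<^sup>L N (\<lambda>\<omega>. f (L \<omega> / \<sigma>))"
        unfolding D_def by (intro integral_distr) measurable
      also have "\<dots> = integral\<^sup>L M (\<lambda>\<omega>. ?g \<omega> *\<^sub>R f (L \<omega> / \<sigma>))"
        unfolding N_def by (intro integral_density) auto
      also have "\<dots> = (LINT \<omega>|M. (1 / measure M A) *\<^sub>R (indicator A \<omega> *\<^sub>R f (L \<omega> / \<sigma>)))" by (simp only: eq)
      also have "\<dots> = (1 / measure M A) *\<^sub>R (LINT \<omega>|M. indicator A \<omega> *\<^sub>R f (L \<omega> / \<sigma>))"
        using P by (cases "integrable M (\<lambda>\<omega>. indicator A \<omega> *\<^sub>R f (L \<omega> / \<sigma>))")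
          (auto simp del: scaleR_scaleR)
      finally show "measure M A *\<^sub>R integral\<^sup>L D f = (LINT \<omega>|M. indicator A \<omega> *\<^sub>R f (L \<omega> / \<sigma>))"
        using P by simp
    qed
    have "char D \<theta> = char std_normal_distribution \<theta>" for \<theta>
    proof -
      have "(LINT \<omega>|M. indicator A \<omega> *\<^sub>R iexp (\<theta> * (L \<omega> / \<sigma>))) = (LINT \<omega>|M. indicator A \<omega> *\<^sub>R cis (\<Sum>c<d+m. (\<theta> / \<sigma> * a c) * (B t \<omega> c - B s \<omega> c)))"
        by (intro Bochner_Integration.integral_cong) (auto simp: L_def cis_conv_exp sum_distrib_left sum_divide_distrib mult.assoc intro!: arg_cong[where f=exp] sum.cong)
      also have "\<dots> = complex_of_real (measure M A * exp (- (t - s) * (\<Sum>c<d+m. (\<theta> / \<sigma> * a c)\<^sup>2) / 2))"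
      proof -
        have "A \<in> F s" using A sets_G[OF s(1)] by simp
        then show ?thesis using BM s unfolding std_BM_def by (meson less_imp_le)
      qed
      also have "(\<Sum>c<d+m. (\<theta> / \<sigma> * a c)\<^sup>2) = (\<theta> / \<sigma>)\<^sup>2 * S" by (simp add: S power_mult_distrib sum_distrib_left del: times_divide_eq_left)
      also have "- (t - s) * ((\<theta> / \<sigma>)\<^sup>2 * S) / 2 = - (\<theta>\<^sup>2) / 2"
      proof -
        have "(t - s) * ((\<theta> / \<sigma>)\<^sup>2 * S) = \<theta>\<^sup>2" unfolding power_divide \<sigma>(2) using s S(2) by simp
        then show ?thesis by (simp only: mult_minus_left)
      qed
      finally have "measure M A *\<^sub>R char D \<theta> = complex_of_real (measure M A * exp (- (\<theta>\<^sup>2) / 2))"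
        unfolding char_def by (subst intgD) auto
      then show ?thesis using P by (simp add: char_std_normal_distribution scaleR_conv_of_real)
    qed
    then have D: "D = std_normal_distribution"
      by (intro Levy_uniqueness Dr real_dist_normal_dist) auto
    have "integrable M (\<lambda>\<omega>. indicator A \<omega> *\<^sub>R ((L \<omega> / \<sigma>) ^ n))"
      by (subst intD[symmetric]) (auto simp: D integrable_std_normal_distribution_moment)
    then have 1: "integrable M (\<lambda>\<omega>. \<sigma> ^ n * (indicator A \<omega> *\<^sub>R ((L \<omega> / \<sigma>) ^ n)))" by (intro integrable_mult_right)
    have "measure M A * (LINT x|std_normal_distribution. x ^ n) = (LINT \<omega>|M. indicator A \<omega> *\<^sub>R (L \<omega> / \<sigma>) ^ n)"
      using intgD[of "\<lambda>x. x ^ n"] by (simp add: D)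
    then have 2: "\<sigma> ^ n * (measure M A * (LINT x|std_normal_distribution. x ^ n)) = (LINT \<omega>|M. \<sigma> ^ n * (indicator A \<omega> *\<^sub>R (L \<omega> / \<sigma>) ^ n))"
      by (simp only: integral_mult_right_zero)
    have 3: "(\<lambda>\<omega>. \<sigma> ^ n * (indicator A \<omega> *\<^sub>R ((L \<omega> / \<sigma>) ^ n))) = (\<lambda>\<omega>. indicator A \<omega> * L \<omega> ^ n)"
      using \<sigma>(1) by (auto simp: power_divide)
    show ?thesis using 1 2 unfolding 3 by (simp add: ac_simps)
  qed
  then show "integrable M (\<lambda>\<omega>. indicator A \<omega> * L \<omega> ^ n)"
    "(LINT \<omega>|M. indicator A \<omega> * L \<omega> ^ n) = measure M A * sqrt ((t - s) * S) ^ n * (LINT x|std_normal_distribution. x ^ n)"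
    by (auto simp: \<sigma>_def)
qed

lemma std_normal_moments:
  "(LINT x|std_normal_distribution. x ^ 1) = 0" "(LINT x|std_normal_distribution. x ^ 2) = 1" "(LINT x|std_normal_distribution. x ^ 4) = 3"
  using integral_std_normal_distribution_moment_odd[of 1] std_normal_distribution_even_moments(1)[of 1] std_normal_distribution_even_moments(1)[of 2]
  by (simp_all add: fact_numeral)

lemma gaussian_linear:
  assumes s: "0 \<le> s" "s < t" and S: "S = (\<Sum>c<d+m. (a c)\<^sup>2)" "0 < S"
  defines "L \<equiv> \<lambda>\<omega>. \<Sum>c<d+m. a c * (B t \<omega> c - B s \<omega> c)"
  shows "cond_abs_le M (G s) L 0" "cond_abs_le M (G s) (\<lambda>\<omega>. (L \<omega>)\<^sup>2 - (t - s) * S) 0" "cond_le M (G s) (\<lambda>\<omega>. L \<omega> ^ 4) (3 * ((t - s) * S)\<^sup>2)"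
proof -
  have g: "integrable M (\<lambda>\<omega>. indicator A \<omega> * L \<omega> ^ n)"
    "(LINT \<omega>|M. indicator A \<omega> * L \<omega> ^ n) = measure M A * sqrt ((t - s) * S) ^ n * (LINT x|std_normal_distribution. x ^ n)"
    if "A \<in> sets (G s)" for A n
    unfolding L_def using gaussian_moments[OF s S that] by blast+
  have top: "space M \<in> sets (G s)" using sets.top[of "G s"] by simp
  have i: "integrable M (\<lambda>\<omega>. L \<omega> ^ n)" for n
  proof -
    have "integrable M (\<lambda>\<omega>. indicator (space M) \<omega> * L \<omega> ^ n)" using g(1)[OF top] .
    then show ?thesis by (subst (asm) Bochner_Integration.integrable_cong[of _ M _ "\<lambda>\<omega>. L \<omega> ^ n"]) auto
  qed
  have p: "0 \<le> (t - s) * S" using s S by simp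
  have AM: "\<And>A. A \<in> sets (G s) \<Longrightarrow> A \<in> sets M" using subalgebra_G[OF s(1)] by (auto simp: subalgebra_def)
  show "cond_abs_le M (G s) L 0"
    using i[of 1] g(2)[of _ 1] std_normal_moments by (simp add: cond_abs_le_def)
  show "cond_abs_le M (G s) (\<lambda>\<omega>. (L \<omega>)\<^sup>2 - (t - s) * S) 0"
    unfolding cond_abs_le_def
  proof (intro conjI ballI)
    fix A assume A: "A \<in> sets (G s)"
    have "(\<lambda>\<omega>. indicator A \<omega> * ((L \<omega>)\<^sup>2 - (t - s) * S)) = (\<lambda>\<omega>. indicator A \<omega> * (L \<omega>)\<^sup>2 - ((t - s) * S) * indicator A \<omega>)"
      by (auto simp: algebra_simps)
    then have "(LINT \<omega>|M. indicator A \<omega> * ((L \<omega>)\<^sup>2 - (t - s) * S)) = (LINT \<omega>|M. indicator A \<omega> * (L \<omega>)\<^sup>2) - (t - s) * S * measure M A"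
      using g(1)[OF A, of 2] AM[OF A] by (simp add: emeasure_eq_measure)
    also have "\<dots> = 0" using p by (simp add: g(2)[OF A] std_normal_moments)
    finally show "\<bar>LINT \<omega>|M. indicator A \<omega> * ((L \<omega>)\<^sup>2 - (t - s) * S)\<bar> \<le> 0 * measure M A" by simp
  qed (use i[of 2] in auto)
  show "cond_le M (G s) (\<lambda>\<omega>. L \<omega> ^ 4) (3 * ((t - s) * S)\<^sup>2)"
  proof (rule cond_leI[OF subalgebra_G[OF s(1)] prob_space_M i])
    fix A assume A: "A \<in> sets (G s)"
    have "sqrt ((t - s) * S) ^ 4 = ((t - s) * S)\<^sup>2"
      using real_sqrt_pow2[OF p] by (metis mult_2 numeral_Bit0 power_add power2_eq_square)
    then show "(LINT \<omega>|M. indicator A \<omega> * L \<omega> ^ 4) \<le> 3 * ((t - s) * S)\<^sup>2 * measure M A"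
      by (simp add: g(2)[OF A] std_normal_moments)
  qed (use p in auto)
qed

definition dB :: "real \<Rightarrow> real \<Rightarrow> nat \<Rightarrow> 'w \<Rightarrow> real" where "dB s t c \<omega> = B t \<omega> c - B s \<omega> c"

lemma dB_meas [measurable]: "0 \<le> s \<Longrightarrow> 0 \<le> t \<Longrightarrow> c < d + m \<Longrightarrow> dB s t c \<in> borel_measurable M"
  unfolding dB_def by (intro borel_measurable_diff measurable_G_M[OF B_meas])

lemma dB_meas_G: "0 \<le> s \<Longrightarrow> s \<le> t \<Longrightarrow> c < d + m \<Longrightarrow> dB s t c \<in> borel_measurable (G t)"
  unfolding dB_def by (intro borel_measurable_diff measurable_G_mono[OF B_meas]) auto

lemma dB_single:
  assumes s: "0 \<le> s" "s < t" and c: "c < d + m"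
  shows "cond_abs_le M (G s) (dB s t c) 0" "cond_abs_le M (G s) (\<lambda>\<omega>. (dB s t c \<omega>)\<^sup>2 - (t - s)) 0"
    "cond_le M (G s) (\<lambda>\<omega>. (dB s t c \<omega>) ^ 4) (3 * (t - s)\<^sup>2)"
    "cond_le M (G s) (\<lambda>\<omega>. (dB s t c \<omega>)\<^sup>2) (t - s)"
proof -
  have 1: "1 = (\<Sum>c'<d+m. (if c' = c then 1 else 0::real)\<^sup>2)"
    using c by (subst sum.cong[OF refl, of _ _ "\<lambda>c'. if c' = c then 1 else 0"]) auto
  have L: "(\<Sum>c'<d+m. (if c' = c then 1 else 0) * (B t \<omega> c' - B s \<omega> c')) = dB s t c \<omega>" for \<omega>
    using c by (auto simp: dB_def if_distrib[of "\<lambda>x. x * _"] cong: if_cong)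
  note g = gaussian_linear[OF s 1, unfolded L]
  show "cond_abs_le M (G s) (dB s t c) 0" and c2: "cond_abs_le M (G s) (\<lambda>\<omega>. (dB s t c \<omega>)\<^sup>2 - (t - s)) 0"
    "cond_le M (G s) (\<lambda>\<omega>. (dB s t c \<omega>) ^ 4) (3 * (t - s)\<^sup>2)"
    using g by simp_all
  have AM: "\<And>A. A \<in> sets (G s) \<Longrightarrow> A \<in> sets M" using subalgebra_G[OF s(1)] by (auto simp: subalgebra_def)
  have i: "integrable M (\<lambda>\<omega>. (dB s t c \<omega>)\<^sup>2)"
  proof -
    have "integrable M (\<lambda>\<omega>. ((dB s t c \<omega>)\<^sup>2 - (t - s)) + (t - s))" using c2(1) unfolding cond_abs_le_def
      by (intro Bochner_Integration.integrable_add) auto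
    then show ?thesis by simp
  qed
  show "cond_le M (G s) (\<lambda>\<omega>. (dB s t c \<omega>)\<^sup>2) (t - s)"
  proof (rule cond_leI[OF subalgebra_G[OF s(1)] prob_space_M i])
    fix A assume A: "A \<in> sets (G s)"
    have "(\<lambda>\<omega>. indicator A \<omega> * ((dB s t c \<omega>)\<^sup>2 - (t - s))) = (\<lambda>\<omega>. indicator A \<omega> * (dB s t c \<omega>)\<^sup>2 - (t - s) * indicator A \<omega>)"
      by (auto simp: algebra_simps)
    moreover have "integrable M (\<lambda>\<omega>. indicator A \<omega> * (dB s t c \<omega>)\<^sup>2)"
      by (intro integrable_mult_indicator[where 'b=real, simplified] AM A i)
    ultimately have "(LINT \<omega>|M. indicator A \<omega> * ((dB s t c \<omega>)\<^sup>2 - (t - s))) = (LINT \<omega>|M. indicator A \<omega> * (dB s t c \<omega>)\<^sup>2) - (t - s) * measure M A"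
      using AM[OF A] by (simp add: emeasure_eq_measure)
    then show "(LINT \<omega>|M. indicator A \<omega> * (dB s t c \<omega>)\<^sup>2) \<le> (t - s) * measure M A"
      using c2(1) A by (auto simp: cond_abs_le_def)
  qed (use s in auto)
qed

text \<open>Polarisation: the square of \<open>dB s t c \<omega> + dB s t c' \<omega>\<close> has
  conditional mean \<open>2 * (t - s)\<close>, the coefficient vector having squared length 2;
  subtracting the two single squares leaves twice the product, centred.\<close>

lemma dB_cross:
  assumes s: "0 \<le> s" "s < t" and c: "c < d + m" "c' < d + m" "c \<noteq> c'"
  shows "cond_abs_le M (G s) (\<lambda>\<omega>. dB s t c \<omega> * dB s t c' \<omega>) 0"
proof -
  let ?a = "\<lambda>e. if e = c \<or> e = c' then 1 else 0::real"
  have sp: "(\<Sum>e<d+m. (if e = c \<or> e = c' then f e else 0)) = f c + f c'" for f :: "nat \<Rightarrow> real"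
  proof -
    have "(\<Sum>e<d+m. (if e = c \<or> e = c' then f e else 0)) = (\<Sum>e\<in>{c, c'}. f e)"
      using c by (intro sum.mono_neutral_cong_right) auto
    then show ?thesis using c by simp
  qed
  have 2: "2 = (\<Sum>e<d+m. (?a e)\<^sup>2)"
    using sp[of "\<lambda>_. 1"] by (simp add: if_distrib[of "\<lambda>x. x\<^sup>2"] cong: if_cong)
  have L: "(\<Sum>e<d+m. ?a e * (B t \<omega> e - B s \<omega> e)) = dB s t c \<omega> + dB s t c' \<omega>" for \<omega>
    using sp[of "\<lambda>e. B t \<omega> e - B s \<omega> e"] by (simp add: dB_def if_distrib[of "\<lambda>x. x * _"] cong: if_cong)
  have "cond_abs_le M (G s) (\<lambda>\<omega>. (dB s t c \<omega> + dB s t c' \<omega>)\<^sup>2 - (t - s) * 2) 0"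
    using gaussian_linear(2)[OF s 2] unfolding L by simp
  note sums = cond_abs_le_cmult[OF subalgebra_G[OF s(1)] prob_space_M cond_abs_le_add[OF subalgebra_G[OF s(1)] cond_abs_le_add[OF subalgebra_G[OF s(1)] this
     cond_abs_le_cmult[OF subalgebra_G[OF s(1)] prob_space_M dB_single(2)[OF s c(1)], of "-1"]]
     cond_abs_le_cmult[OF subalgebra_G[OF s(1)] prob_space_M dB_single(2)[OF s c(2)], of "-1"]], of "1/2"]
  show ?thesis using sums by (subst cond_abs_le_cong[of M _ "\<lambda>\<omega>. 1/2 * ((dB s t c \<omega> + dB s t c' \<omega>)\<^sup>2 - (t - s) * 2 + - 1 * ((dB s t c \<omega>)\<^sup>2 - (t - s)) + - 1 * ((dB s t c' \<omega>)\<^sup>2 - (t - s)))"])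
     (auto simp: power2_eq_square algebra_simps)
qed

text \<open>Coefficients known at time \<open>s\<close> factor out of the conditional moments. The
  conditional variance is needed exactly, since it produces the Ito correction; in the second and
  fourth moments only the power of \<open>t - s\<close> matters, and Cauchy-Schwarz over the
  \<open>d + m\<close> components is enough.\<close>

lemma linear_gauss:
  assumes s: "0 \<le> s" "s < t" and f: "\<And>c. c < d + m \<Longrightarrow> f c \<in> borel_measurable (G s)"
    "\<And>c \<omega>. c < d + m \<Longrightarrow> \<omega> \<in> space M \<Longrightarrow> \<bar>f c \<omega>\<bar> \<le> K" and K: "0 \<le> K"
  defines "V \<equiv> \<lambda>\<omega>. \<Sum>c<d+m. f c \<omega> * dB s t c \<omega>"
  shows "V \<in> borel_measurable M" "cond_abs_le M (G s) V 0" "cond_abs_le M (G s) (\<lambda>\<omega>. (V \<omega>)\<^sup>2 - (t - s) * (\<Sum>c<d+m. (f c \<omega>)\<^sup>2)) 0"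
    "cond_le M (G s) (\<lambda>\<omega>. (V \<omega>)\<^sup>2) ((real (d+m))\<^sup>2 * K\<^sup>2 * (t - s))"
    "cond_le M (G s) (\<lambda>\<omega>. V \<omega> ^ 4) (3 * real (d+m) ^ 4 * K ^ 4 * (t - s)\<^sup>2)"
proof -
  note S = subalgebra_G[OF s(1)]
  have fM[measurable]: "c < d + m \<Longrightarrow> f c \<in> borel_measurable M" for c using f s measurable_G_M by blast
  have dBM[measurable]: "c < d + m \<Longrightarrow> dB s t c \<in> borel_measurable M" for c using s by (intro dB_meas) auto
  show Vm[measurable]: "V \<in> borel_measurable M" unfolding V_def by (intro borel_measurable_sum borel_measurable_times) auto
  have "cond_abs_le M (G s) V (\<Sum>c<d+m. K * 0)"
    unfolding V_def using f s by (intro cond_abs_le_sum[OF S] cond_abs_le_weight[OF S prob_space_M dB_single(1)]) auto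
  then show "cond_abs_le M (G s) V 0" by simp
  \<comment> \<open>Centred products of increments: \<open>Z c c'\<close> has conditional mean 0 on
    and off the diagonal, and \<open>V\<close> squared minus its variance is a combination of them
    with bounded adapted weights.\<close>
  define Z where "Z = (\<lambda>c c' \<omega>. if c = c' then (dB s t c \<omega>)\<^sup>2 - (t - s) else dB s t c \<omega> * dB s t c' \<omega>)"
  have Z: "cond_abs_le M (G s) (Z c c') 0" if "c < d+m" "c' < d+m" for c c'
    using dB_single(2)[OF s that(1)] dB_cross[OF s that] by (cases "c = c'") (auto simp: Z_def)
  have "cond_abs_le M (G s) (\<lambda>\<omega>. \<Sum>c<d+m. \<Sum>c'<d+m. (f c \<omega> * f c' \<omega>) * Z c c' \<omega>) (\<Sum>c<d+m. \<Sum>c'<d+m. (K * K) * 0)"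
  proof (intro cond_abs_le_sum[OF S])
    fix c c' assume c: "c \<in> {..<d+m}" "c' \<in> {..<d+m}"
    show "cond_abs_le M (G s) (\<lambda>\<omega>. f c \<omega> * f c' \<omega> * Z c c' \<omega>) (K * K * 0)"
      by (rule cond_abs_le_weight[OF S prob_space_M Z]) (use f c K in \<open>auto simp: abs_mult intro!: mult_mono\<close>)
  qed
  moreover have "(\<Sum>c<d+m. \<Sum>c'<d+m. (f c \<omega> * f c' \<omega>) * Z c c' \<omega>) = (V \<omega>)\<^sup>2 - (t - s) * (\<Sum>c<d+m. (f c \<omega>)\<^sup>2)" for \<omega>
  proof -
    have "(V \<omega>)\<^sup>2 = (\<Sum>c<d+m. \<Sum>c'<d+m. (f c \<omega> * dB s t c \<omega>) * (f c' \<omega> * dB s t c' \<omega>))"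
      unfolding V_def power2_eq_square by (rule sum_product)
    moreover have "(t - s) * (\<Sum>c<d+m. (f c \<omega>)\<^sup>2) = (\<Sum>c<d+m. \<Sum>c'<d+m. if c' = c then (t - s) * (f c \<omega>)\<^sup>2 else 0)"
      by (simp add: sum_distrib_left)
    ultimately show ?thesis
      by (simp only: sum_subtractf[symmetric]) (intro sum.cong refl, auto simp: Z_def power2_eq_square algebra_simps)
  qed
  ultimately show "cond_abs_le M (G s) (\<lambda>\<omega>. (V \<omega>)\<^sup>2 - (t - s) * (\<Sum>c<d+m. (f c \<omega>)\<^sup>2)) 0" by simp
  let ?D = "real (d + m)"
  have b2: "(f c \<omega> * dB s t c \<omega>)\<^sup>2 \<le> K\<^sup>2 * (dB s t c \<omega>)\<^sup>2" if "c < d+m" "\<omega> \<in> space M" for c \<omega>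
    unfolding power_mult_distrib using f(2)[OF that] K by (intro mult_right_mono) (auto simp: abs_le_square_iff[symmetric])
  have V2: "(V \<omega>)\<^sup>2 \<le> ?D * (\<Sum>c<d+m. K\<^sup>2 * (dB s t c \<omega>)\<^sup>2)" if "\<omega> \<in> space M" for \<omega>
  proof -
    have "(V \<omega>)\<^sup>2 \<le> ?D * (\<Sum>c<d+m. (f c \<omega> * dB s t c \<omega>)\<^sup>2)" unfolding V_def by (rule sum_power2_le_card)
    also have "\<dots> \<le> ?D * (\<Sum>c<d+m. K\<^sup>2 * (dB s t c \<omega>)\<^sup>2)" using b2 that by (intro mult_left_mono sum_mono) auto
    finally show ?thesis .
  qed
  have c: "cond_le M (G s) (\<lambda>\<omega>. ?D * (\<Sum>c<d+m. K\<^sup>2 * (dB s t c \<omega>)\<^sup>2)) (?D * (\<Sum>c<d+m. K\<^sup>2 * (t - s)))"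
    by (intro cond_le_cmult[OF S] cond_le_sum[OF S] dB_single(4)[OF s]) auto
  show "cond_le M (G s) (\<lambda>\<omega>. (V \<omega>)\<^sup>2) (?D\<^sup>2 * K\<^sup>2 * (t - s))"
    by (rule cond_le_mono[OF c]) (use V2 in \<open>auto simp: power2_eq_square\<close>)
  have V4: "V \<omega> ^ 4 \<le> ?D\<^sup>2 * (?D * (\<Sum>c<d+m. K ^ 4 * (dB s t c \<omega>) ^ 4))" if "\<omega> \<in> space M" for \<omega>
  proof -
    have "V \<omega> ^ 4 = ((V \<omega>)\<^sup>2)\<^sup>2" by simp
    also have "\<dots> \<le> (?D * (\<Sum>c<d+m. K\<^sup>2 * (dB s t c \<omega>)\<^sup>2))\<^sup>2" using V2[OF that] by (intro power_mono) auto
    also have "\<dots> \<le> ?D\<^sup>2 * (?D * (\<Sum>c<d+m. (K\<^sup>2 * (dB s t c \<omega>)\<^sup>2)\<^sup>2))"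
      unfolding power_mult_distrib[of ?D] by (intro mult_left_mono sum_power2_le_card) auto
    finally show ?thesis by (simp add: power_mult_distrib)
  qed
  have c: "cond_le M (G s) (\<lambda>\<omega>. ?D\<^sup>2 * (?D * (\<Sum>c<d+m. K ^ 4 * (dB s t c \<omega>) ^ 4))) (?D\<^sup>2 * (?D * (\<Sum>c<d+m. K ^ 4 * (3 * (t - s)\<^sup>2))))"
    using K by (intro cond_le_cmult[OF S] cond_le_sum[OF S] dB_single(3)[OF s]) auto
  have e: "?D\<^sup>2 * (?D * (\<Sum>c<d+m. K ^ 4 * (3 * (t - s)\<^sup>2))) = 3 * ?D ^ 4 * K ^ 4 * (t - s)\<^sup>2"
    by (simp add: power4_eq_xxxx power2_eq_square)
  show "cond_le M (G s) (\<lambda>\<omega>. V \<omega> ^ 4) (3 * ?D ^ 4 * K ^ 4 * (t - s)\<^sup>2)"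
    unfolding e[symmetric] by (rule cond_le_mono[OF c]) (use V4 in auto)
qed

end

section \<open>Increments of the solution\<close>

text \<open>From \<open>\<bar>x\<bar> \<le> w + x\<^sup>2 / w\<close>. When \<open>w\<close> is the
  natural size of \<open>Z\<close>, both terms have the same order, so this replaces the conditional
  Jensen inequality without a square root.\<close>

lemma cond_le_abs_of_square:
  assumes sub: "subalgebra M G" and Z: "Z \<in> borel_measurable M" "cond_le M G (\<lambda>\<omega>. (Z \<omega>)\<^sup>2) (a * w\<^sup>2)" and l: "0 < w"
  shows "cond_le M G (\<lambda>\<omega>. \<bar>Z \<omega>\<bar>) ((1 + a) * w)"
proof -
  have "cond_le M G (\<lambda>\<omega>. w + (1 / w) * (Z \<omega>)\<^sup>2) (w + (1 / w) * (a * w\<^sup>2))"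
    using l by (intro cond_le_add[OF sub] cond_le_const[OF sub] cond_le_cmult[OF sub] Z) auto
  then show ?thesis
  proof (rule cond_le_mono)
    fix \<omega>
    have "2 * w * \<bar>Z \<omega>\<bar> \<le> w\<^sup>2 + (Z \<omega>)\<^sup>2" using sum_squares_bound[of w "\<bar>Z \<omega>\<bar>"] by simp
    moreover have "0 \<le> w * \<bar>Z \<omega>\<bar>" using l by simp
    ultimately have "w * \<bar>Z \<omega>\<bar> \<le> w\<^sup>2 + (Z \<omega>)\<^sup>2" by linarith
    also have "\<dots> = w * (w + (1 / w) * (Z \<omega>)\<^sup>2)" using l by (simp add: distrib_left power2_eq_square)
    finally have "w * \<bar>Z \<omega>\<bar> \<le> w * (w + (1 / w) * (Z \<omega>)\<^sup>2)" .
    then show "\<bar>Z \<omega>\<bar> \<le> w + (1 / w) * (Z \<omega>)\<^sup>2" using l by simp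
  qed (use Z l in \<open>auto simp: power2_eq_square distrib_right\<close>)
qed

lemma cond_le_bound_mono:
  assumes "cond_le M G Z K" "K \<le> K'" shows "cond_le M G Z K'"
  by (rule cond_le_mono[OF assms(1)]) (use assms in \<open>auto simp: cond_le_def\<close>)

lemma sqn_nonneg: "0 \<le> sqn d x"
  by (auto simp: sqn_def intro: sum_nonneg)

lemma comp_le_sqn: "i < d \<Longrightarrow> (x i)\<^sup>2 \<le> sqn d x"
  unfolding sqn_def by (rule member_le_sum) auto

text \<open>The 1/2-Holder continuity of the square root: the only regularity of \<open>Y0\<close>
  as a function of \<open>X\<close> at hand before inverse moments are known.\<close>

lemma sqrt_diff_square_le:
  assumes "0 \<le> a" "0 \<le> (b::real)"
  shows "(sqrt a - sqrt b)\<^sup>2 \<le> \<bar>a - b\<bar>"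
proof -
  have "\<bar>sqrt a - sqrt b\<bar> * \<bar>sqrt a - sqrt b\<bar> \<le> \<bar>sqrt a - sqrt b\<bar> * (sqrt a + sqrt b)"
    using assms by (intro mult_left_mono) (auto simp: abs_if)
  also have "\<dots> = \<bar>(sqrt a - sqrt b) * (sqrt a + sqrt b)\<bar>" using assms by (simp add: abs_mult)
  also have "(sqrt a - sqrt b) * (sqrt a + sqrt b) = a - b" using assms by (simp add: algebra_simps)
  finally show ?thesis by (simp add: power2_eq_square)
qed

lemma mv_diff: "mv d A (\<lambda>j. x j - x' j) i = mv d A x i - mv d A x' i"
  by (simp add: mv_def right_diff_distrib sum_subtractf)

text \<open>The drift is linear, so its growth bound \<open>drift_sq\<close> serves as a Lipschitz
  bound as well.\<close>

lemma drift_diff: "drift d m k AA (\<lambda>j. x j - x' j) i = drift d m k AA x i - drift d m k AA x' i"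
proof -
  have "mv d A (mv d A (\<lambda>j. x j - x' j)) i = mv d A (mv d A x) i - mv d A (mv d A x') i" for A
    using mv_diff[of d A "mv d A x" "mv d A x'" i] by (simp add: mv_diff[abs_def])
  then show ?thesis unfolding drift_def mv_diff by (simp add: sum_subtractf right_diff_distrib)
qed

context sde begin

text \<open>Columns follow the numbering of \<open>B\<close>: a column \<open>c < d\<close> belongs
  to a component of W, a column \<open>c \<ge> d\<close> to the matrix of index
  \<open>c - d + 1\<close>. The shift by 1 is there because \<open>AA 0\<close> is the drift
  matrix.\<close>

definition diffusion :: "(nat \<Rightarrow> real) \<Rightarrow> nat \<Rightarrow> nat \<Rightarrow> real" where
  "diffusion x i c = (if c < d then (if c = i then \<nu> * sqrt (1 - sqn d x) else 0) else mv d (AA (c - d + 1)) x i)"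

text \<open>Every increment starts from the exact solution, so sums of these over a grid are Riemann
  sums of the equation and not iterates of a scheme.\<close>

definition euler_inc :: "real \<Rightarrow> nat \<Rightarrow> nat \<Rightarrow> 'w \<Rightarrow> real" where
  "euler_inc v j i \<omega> = drift d m \<kappa> AA (X (real j * v) \<omega>) i * v
     + (\<Sum>c<d+m. diffusion (X (real j * v) \<omega>) i c * dB (real j * v) (real (Suc j) * v) c \<omega>)"

lemma sum_noise_split:
  fixes f g :: "nat \<Rightarrow> real"
  shows "(\<Sum>c<d+m. if c < d then f c else g c) = (\<Sum>c<d. f c) + (\<Sum>p=1..m. g (d + p - 1))"
proof -
  have "(\<Sum>c<d+m. if c < d then f c else g c) = (\<Sum>c\<in>{..<d} \<union> {d..<d+m}. if c < d then f c else g c)"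
    by (intro sum.cong) auto
  also have "\<dots> = (\<Sum>c<d. f c) + (\<Sum>c\<in>{d..<d+m}. g c)"
    by (subst sum.union_disjoint) auto
  also have "(\<Sum>c\<in>{d..<d+m}. g c) = (\<Sum>p=1..m. g (d + p - 1))"
    by (rule sum.reindex_bij_witness[of _ "\<lambda>p. d + p - 1" "\<lambda>c. c - d + 1"]) auto
  finally show ?thesis .
qed

lemma diffusion_sum:
  assumes "i < d"
  shows "(\<Sum>c<d+m. diffusion x i c * dB s t c \<omega>) = \<nu> * sqrt (1 - sqn d x) * (B t \<omega> i - B s \<omega> i)
        + (\<Sum>p=1..m. mv d (AA p) x i * (B t \<omega> (d + p - 1) - B s \<omega> (d + p - 1)))"
proof -
  have "(\<Sum>c<d+m. diffusion x i c * dB s t c \<omega>) = (\<Sum>c<d+m. if c < d then (if c = i then \<nu> * sqrt (1 - sqn d x) * dB s t c \<omega> else 0) else mv d (AA (c - d + 1)) x i * dB s t c \<omega>)"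
    by (intro sum.cong) (auto simp: diffusion_def)
  also have "\<dots> = (\<Sum>c<d. (if c = i then \<nu> * sqrt (1 - sqn d x) * dB s t c \<omega> else 0)) + (\<Sum>p=1..m. mv d (AA ((d + p - 1) - d + 1)) x i * dB s t (d + p - 1) \<omega>)"
    by (rule sum_noise_split)
  also have "(\<Sum>p=1..m. mv d (AA ((d + p - 1) - d + 1)) x i * dB s t (d + p - 1) \<omega>) = (\<Sum>p=1..m. mv d (AA p) x i * dB s t (d + p - 1) \<omega>)"
    by (intro sum.cong) auto
  finally show ?thesis using assms by (simp add: dB_def)
qed

lemma X_measM: "0 \<le> t \<Longrightarrow> t \<le> T \<Longrightarrow> i < d \<Longrightarrow> (\<lambda>\<omega>. X t \<omega> i) \<in> borel_measurable M"
  using X_meas measurable_G_M by blast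

lemma mv_meas: "(\<And>j. j < d \<Longrightarrow> (\<lambda>\<omega>. f \<omega> j) \<in> borel_measurable N) \<Longrightarrow> (\<lambda>\<omega>. mv d A (f \<omega>) i) \<in> borel_measurable N"
  unfolding mv_def by (intro borel_measurable_sum borel_measurable_times) auto

lemma drift_meas: "(\<And>j. j < d \<Longrightarrow> (\<lambda>\<omega>. f \<omega> j) \<in> borel_measurable N) \<Longrightarrow> i < d \<Longrightarrow> (\<lambda>\<omega>. drift d m \<kappa> AA (f \<omega>) i) \<in> borel_measurable N"
  unfolding drift_def by (intro borel_measurable_add borel_measurable_times borel_measurable_sum mv_meas) auto

lemma sqn_meas: "(\<And>j. j < d \<Longrightarrow> (\<lambda>\<omega>. f \<omega> j) \<in> borel_measurable N) \<Longrightarrow> (\<lambda>\<omega>. sqn d (f \<omega>)) \<in> borel_measurable N"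
  unfolding sqn_def by (intro borel_measurable_sum borel_measurable_power) auto

lemma diffusion_meas: "(\<And>j. j < d \<Longrightarrow> (\<lambda>\<omega>. f \<omega> j) \<in> borel_measurable N) \<Longrightarrow> (\<lambda>\<omega>. diffusion (f \<omega>) i c) \<in> borel_measurable N"
  unfolding diffusion_def using sqn_meas[of f N] mv_meas[of f N] by (cases "c < d"; cases "c = i") auto

lemma euler_inc_meas:
  assumes "0 \<le> v" "real j * v \<le> T" "i < d"
  shows "euler_inc v j i \<in> borel_measurable M"
  unfolding euler_inc_def using assms
  by (intro borel_measurable_add borel_measurable_times drift_meas borel_measurable_sum diffusion_meas X_measM dB_meas) auto

lemma drift_path_cont: "\<omega> \<in> space M \<Longrightarrow> i < d \<Longrightarrow> continuous_on {0..T} (\<lambda>s. drift d m \<kappa> AA (X s \<omega>) i)"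
proof -
  assume a: "\<omega> \<in> space M" "i < d"
  have X: "\<And>j. j < d \<Longrightarrow> continuous_on {0..T} (\<lambda>t. X t \<omega> j)" using sol a by (auto simp: is_solution_def)
  then show ?thesis using a(2) unfolding drift_def mv_def
    by (intro continuous_on_add continuous_on_mult continuous_on_sum continuous_on_const) auto
qed

definition ito_limit :: "real \<Rightarrow> nat \<Rightarrow> 'w \<Rightarrow> real" where
  "ito_limit t i \<omega> = X t \<omega> i - x0 i - integral {0..t} (\<lambda>s. drift d m \<kappa> AA (X s \<omega>) i)"

lemma drift_riemann:
  assumes v: "0 < v" and k: "k \<le> k'" "real k' * v \<le> T" and i: "i < d" and \<omega>: "\<omega> \<in> space M"
  shows "(\<lambda>l. \<Sum>j\<in>{k * Suc l..<k' * Suc l}. drift d m \<kappa> AA (X (real j * (v / real (Suc l))) \<omega>) i * (v / real (Suc l)))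
    \<longlonglongrightarrow> integral {real k * v..real k' * v} (\<lambda>s. drift d m \<kappa> AA (X s \<omega>) i)"
  using riemann_left_sum_limit[OF v k(1) continuous_on_subset[OF drift_path_cont[OF \<omega> i]]] k v by auto

lemma fine_le:
  assumes "0 < v" "real k' * v \<le> T" "j \<le> k' * Suc l"
  shows "real j * (v / real (Suc l)) \<le> T"
proof -
  have "real j * (v / real (Suc l)) \<le> real (k' * Suc l) * (v / real (Suc l))" using assms by (intro mult_right_mono) (auto simp del: of_nat_mult of_nat_Suc)
  also have "\<dots> = real k' * v" by (simp add: field_simps)
  finally show ?thesis using assms by simp
qed

text \<open>The time integral of the drift is measurable as a pointwise limit of left Riemann
  sums.\<close>

lemma ito_limit_meas:
  assumes v: "0 < v" and k: "real k * v \<le> T" and i: "i < d"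
  shows "ito_limit (real k * v) i \<in> borel_measurable M"
proof -
  have "(\<lambda>\<omega>. integral {real 0 * v..real k * v} (\<lambda>s. drift d m \<kappa> AA (X s \<omega>) i)) \<in> borel_measurable M"
  proof (rule borel_measurable_LIMSEQ_real)
    show "(\<lambda>l. \<Sum>j\<in>{0 * Suc l..<k * Suc l}. drift d m \<kappa> AA (X (real j * (v / real (Suc l))) \<omega>) i * (v / real (Suc l)))
        \<longlonglongrightarrow> integral {real 0 * v..real k * v} (\<lambda>s. drift d m \<kappa> AA (X s \<omega>) i)" if "\<omega> \<in> space M" for \<omega>
      using drift_riemann[OF v _ k i that, of 0] by simp
    show "(\<lambda>\<omega>. \<Sum>j\<in>{0 * Suc l..<k * Suc l}. drift d m \<kappa> AA (X (real j * (v / real (Suc l))) \<omega>) i * (v / real (Suc l))) \<in> borel_measurable M" for l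
      using v k i fine_le[OF v k] by (intro borel_measurable_sum borel_measurable_times drift_meas X_measM) auto
  qed
  then show ?thesis unfolding ito_limit_def using v k i by (intro borel_measurable_diff X_measM) auto
qed

definition ito_riemann :: "real \<Rightarrow> nat \<Rightarrow> nat \<Rightarrow> 'w \<Rightarrow> real" where
  "ito_riemann h n i \<omega> = (\<Sum>j<n. \<Sum>c<d+m. diffusion (X (real j * h) \<omega>) i c * dB (real j * h) (real (Suc j) * h) c \<omega>)"

lemma ito_riemann_meas:
  assumes "0 \<le> h" "real n * h \<le> T"
  shows "ito_riemann h n i \<in> borel_measurable M"
proof -
  have "real j * h \<le> T" if "j < n" for j
    using mult_right_mono[of "real j" "real n" h] assms that by auto
  then show ?thesis unfolding ito_riemann_def using assms
    by (intro borel_measurable_sum borel_measurable_times diffusion_meas X_measM dB_meas) auto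
qed

text \<open>The defining sum at time \<open>real k * v\<close> with \<open>k * Suc l\<close> cells
  has mesh \<open>v / real (Suc l)\<close>. Passing to this subsequence puts the sums for all grid
  times on one common grid, where they can be subtracted. The case \<open>k = 0\<close> is separate
  because \<open>k * Suc l\<close> then fails to tend to infinity.\<close>

lemma ito_riemann_conv:
  assumes v: "0 < v" and k: "real k * v \<le> T" and i: "i < d"
  shows "conv_in_prob M (\<lambda>l. ito_riemann (v / real (Suc l)) (k * Suc l) i) (ito_limit (real k * v) i)"
proof (cases "k = 0")
  case True
  have z: "ito_limit 0 i \<omega> = 0" if "\<omega> \<in> space M" for \<omega> using sol i that by (auto simp: ito_limit_def is_solution_def)
  have "{\<omega> \<in> space M. e < \<bar>0 - ito_limit 0 i \<omega>\<bar>} = {}" if "0 < e" for e using z that by auto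
  then have "measure M {\<omega> \<in> space M. e < \<bar>0 - ito_limit 0 i \<omega>\<bar>} = 0" if "0 < e" for e using that by (simp only: measure_empty)
  then show ?thesis using True unfolding conv_in_prob_def ito_riemann_def by simp
next
  case False
  have "conv_in_prob M (ito_sum d m \<nu> AA B X (real k * v) i) (ito_limit (real k * v) i)"
    using sol v k i unfolding ito_limit_def is_solution_def by auto
  then have "conv_in_prob M (\<lambda>l. ito_sum d m \<nu> AA B X (real k * v) i (k * Suc l)) (ito_limit (real k * v) i)"
  proof (rule conv_in_prob_compose)
    show "filterlim (\<lambda>l. k * Suc l) at_top sequentially"
      by (rule filterlim_subseq) (use False in \<open>auto simp: strict_mono_def\<close>)
  qed
  moreover have "ito_sum d m \<nu> AA B X (real k * v) i (k * Suc l) \<omega> = ito_riemann (v / real (Suc l)) (k * Suc l) i \<omega>" for l \<omega>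
  proof -
    have t: "real j * (real k * v) / real (k * Suc l) = real j * (v / real (Suc l))" for j
      unfolding of_nat_mult using False by (simp add: field_simps del: of_nat_Suc)
    show ?thesis unfolding ito_sum_def ito_riemann_def t Let_def diffusion_sum[OF i] ..
  qed
  then have "(\<lambda>l. ito_sum d m \<nu> AA B X (real k * v) i (k * Suc l)) = (\<lambda>l. ito_riemann (v / real (Suc l)) (k * Suc l) i)" by blast
  ultimately show ?thesis by (simp only:)
qed

text \<open>The difference of the Ito sums at the two end points, plus the Riemann sums of the drift
  between them, is a sum of Euler increments over the refined grid. The moment bounds for increments
  of the solution rest on this and on Fatou's lemma.\<close>

lemma path_conv:
  assumes v: "0 < v" and k: "k \<le> k'" "real k' * v \<le> T" and i: "i < d"
  shows "ae_subseq M (\<lambda>l \<omega>. \<Sum>j\<in>{k * Suc l..<k' * Suc l}. euler_inc (v / real (Suc l)) j i \<omega>) (\<lambda>\<omega>. X (real k' * v) \<omega> i - X (real k * v) \<omega> i)"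
proof -
  have "real k * v \<le> real k' * v" using k v by (intro mult_right_mono) auto
  then have k1: "real k * v \<le> T" using k by simp
  have ISm: "ito_riemann (v / real (Suc l)) (n * Suc l) i \<in> borel_measurable M" if "real n * v \<le> T" for n l
    using fine_le[OF v that order_refl] v by (intro ito_riemann_meas) auto
  have "conv_in_prob M (\<lambda>l \<omega>. ito_riemann (v / real (Suc l)) (k' * Suc l) i \<omega> - ito_riemann (v / real (Suc l)) (k * Suc l) i \<omega>) (\<lambda>\<omega>. ito_limit (real k' * v) i \<omega> - ito_limit (real k * v) i \<omega>)"
    by (intro conv_in_prob_diff prob_space_M ISm ito_limit_meas ito_riemann_conv v k k1 i)
  then have "ae_subseq M (\<lambda>l \<omega>. ito_riemann (v / real (Suc l)) (k' * Suc l) i \<omega> - ito_riemann (v / real (Suc l)) (k * Suc l) i \<omega>) (\<lambda>\<omega>. ito_limit (real k' * v) i \<omega> - ito_limit (real k * v) i \<omega>)"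
    by (intro conv_in_prob_ae_subseq prob_space_M borel_measurable_diff ISm ito_limit_meas v k k1 i)
  from ae_subseq_add[OF this drift_riemann[OF v k i]]
  have a: "ae_subseq M (\<lambda>l \<omega>. (ito_riemann (v / real (Suc l)) (k' * Suc l) i \<omega> - ito_riemann (v / real (Suc l)) (k * Suc l) i \<omega>)
      + (\<Sum>j\<in>{k * Suc l..<k' * Suc l}. drift d m \<kappa> AA (X (real j * (v / real (Suc l))) \<omega>) i * (v / real (Suc l))))
     (\<lambda>\<omega>. (ito_limit (real k' * v) i \<omega> - ito_limit (real k * v) i \<omega>) + integral {real k * v..real k' * v} (\<lambda>s. drift d m \<kappa> AA (X s \<omega>) i))"
    by simp
  have 1: "(ito_riemann h (k' * Suc l) i \<omega> - ito_riemann h (k * Suc l) i \<omega>)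
      + (\<Sum>j\<in>{k * Suc l..<k' * Suc l}. drift d m \<kappa> AA (X (real j * h) \<omega>) i * h) = (\<Sum>j\<in>{k * Suc l..<k' * Suc l}. euler_inc h j i \<omega>)" for h l \<omega>
  proof -
    have "ito_riemann h (k' * Suc l) i \<omega> - ito_riemann h (k * Suc l) i \<omega> = (\<Sum>j\<in>{k * Suc l..<k' * Suc l}. \<Sum>c<d+m. diffusion (X (real j * h) \<omega>) i c * dB (real j * h) (real (Suc j) * h) c \<omega>)"
      unfolding ito_riemann_def lessThan_atLeast0 by (rule sum_diff_nat_ivl[OF zero_le mult_le_mono1[OF k(1)]])
    then show ?thesis unfolding euler_inc_def sum.distrib by simp
  qed
  have 2: "(ito_limit (real k' * v) i \<omega> - ito_limit (real k * v) i \<omega>) + integral {real k * v..real k' * v} (\<lambda>s. drift d m \<kappa> AA (X s \<omega>) i) = X (real k' * v) \<omega> i - X (real k * v) \<omega> i"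
    if \<omega>: "\<omega> \<in> space M" for \<omega>
  proof -
    have "integral {0..real k * v} (\<lambda>s. drift d m \<kappa> AA (X s \<omega>) i) + integral {real k * v..real k' * v} (\<lambda>s. drift d m \<kappa> AA (X s \<omega>) i)
      = integral {0..real k' * v} (\<lambda>s. drift d m \<kappa> AA (X s \<omega>) i)"
      using k v by (intro Henstock_Kurzweil_Integration.integral_combine integrable_continuous_interval continuous_on_subset[OF drift_path_cont[OF \<omega> i]]) auto
    then show ?thesis by (simp add: ito_limit_def)
  qed
  obtain r where r: "strict_mono (r::nat\<Rightarrow>nat)" "AE \<omega> in M. (\<lambda>n. \<Sum>j\<in>{k * Suc (r n)..<k' * Suc (r n)}. euler_inc (v / real (Suc (r n))) j i \<omega>) \<longlonglongrightarrow> (ito_limit (real k' * v) i \<omega> - ito_limit (real k * v) i \<omega>) + integral {real k * v..real k' * v} (\<lambda>s. drift d m \<kappa> AA (X s \<omega>) i)"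
    using a unfolding 1 ae_subseq_def by blast
  have "AE \<omega> in M. (\<lambda>n. \<Sum>j\<in>{k * Suc (r n)..<k' * Suc (r n)}. euler_inc (v / real (Suc (r n))) j i \<omega>) \<longlonglongrightarrow> X (real k' * v) \<omega> i - X (real k * v) \<omega> i"
    using r(2) AE_space by eventually_elim (simp add: 2)
  then show ?thesis using r(1) unfolding ae_subseq_def by blast
qed

text \<open>A discrete Ito isometry with drift. The noise of each step is orthogonal to everything
  before it, so its variances add up; the drift may add up linearly, hence the squared duration in
  front of \<open>A2\<close>. \<open>H\<close> may be coarser than the information at the start:
  later it is either that information or the trivial sigma-algebra, for which a better
  \<open>P2\<close> is known. In the first moment the noise disappears.\<close>

lemma adapted_sum_bounds:
  assumes h: "0 < h" and ab: "a < b"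
    and sub: "subalgebra M H" and HG: "sets H \<subseteq> sets (G (real a * h))"
    and al: "\<And>j. a \<le> j \<Longrightarrow> j < b \<Longrightarrow> \<alpha> j \<in> borel_measurable (G (real j * h))"
      "\<And>j \<omega>. a \<le> j \<Longrightarrow> j < b \<Longrightarrow> \<omega> \<in> space M \<Longrightarrow> \<bar>\<alpha> j \<omega>\<bar> \<le> K"
      "\<And>j. a \<le> j \<Longrightarrow> j < b \<Longrightarrow> cond_le M H (\<lambda>\<omega>. (\<alpha> j \<omega>)\<^sup>2) A2"
    and ph: "\<And>j c. a \<le> j \<Longrightarrow> j < b \<Longrightarrow> c < d + m \<Longrightarrow> \<phi> j c \<in> borel_measurable (G (real j * h))"
      "\<And>j c \<omega>. a \<le> j \<Longrightarrow> j < b \<Longrightarrow> c < d + m \<Longrightarrow> \<omega> \<in> space M \<Longrightarrow> \<bar>\<phi> j c \<omega>\<bar> \<le> K"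
      "\<And>j. a \<le> j \<Longrightarrow> j < b \<Longrightarrow> cond_le M H (\<lambda>\<omega>. \<Sum>c<d+m. (\<phi> j c \<omega>)\<^sup>2) P2"
  defines "S \<equiv> \<lambda>n \<omega>. \<Sum>j\<in>{a..<n}. \<alpha> j \<omega> * h + (\<Sum>c<d+m. \<phi> j c \<omega> * dB (real j * h) (real (Suc j) * h) c \<omega>)"
  shows "S b \<in> borel_measurable M"
    "cond_le M H (\<lambda>\<omega>. (S b \<omega>)\<^sup>2) (3 * (2 * (real (b - a) * h)\<^sup>2 * A2 + real (b - a) * h * P2))"
    "(\<And>j. a \<le> j \<Longrightarrow> j < b \<Longrightarrow> cond_abs_le M H (\<alpha> j) \<beta>) \<Longrightarrow> cond_abs_le M H (S b) (real (b - a) * h * \<beta>)"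
proof -
  define V where "V = (\<lambda>j \<omega>. \<Sum>c<d+m. \<phi> j c \<omega> * dB (real j * h) (real (Suc j) * h) c \<omega>)"
  have S_def': "S n = (\<lambda>\<omega>. \<Sum>j\<in>{a..<n}. \<alpha> j \<omega> * h + V j \<omega>)" for n by (simp add: S_def V_def)
  have tj: "0 \<le> real j * h" "real j * h < real (Suc j) * h" for j using h by auto
  have K: "0 \<le> K" using al(2)[of a] ab not_empty abs_ge_zero by (meson ex_in_conv order_trans order_refl)
  have A2: "0 \<le> A2" using al(3)[of a] ab by (auto simp: cond_le_def)
  have P2: "0 \<le> P2" using ph(3)[of a] ab by (auto simp: cond_le_def)
  have subj: "subalgebra M (G (real j * h))" for j using subalgebra_G h by simp
  have HGj: "sets H \<subseteq> sets (G (real j * h))" if "a \<le> j" for j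
    using HG G_mono[of "real a * h" "real j * h"] that h by (auto simp: mult_right_mono)
  have Vm: "V j \<in> borel_measurable M" and V1: "cond_abs_le M (G (real j * h)) (V j) 0"
     and V2: "cond_abs_le M (G (real j * h)) (\<lambda>\<omega>. (V j \<omega>)\<^sup>2 - (real (Suc j) * h - real j * h) * (\<Sum>c<d+m. (\<phi> j c \<omega>)\<^sup>2)) 0"
     and V3: "cond_le M (G (real j * h)) (\<lambda>\<omega>. (V j \<omega>)\<^sup>2) ((real (d+m))\<^sup>2 * K\<^sup>2 * (real (Suc j) * h - real j * h))"
    if "a \<le> j" "j < b" for j
    unfolding V_def using linear_gauss(1-4)[of "real j * h" "real (Suc j) * h" "\<phi> j" K, OF tj(1)[of j] tj(2)[of j] ph(1)[OF that] ph(2)[OF that] K] by blast+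
  have VG: "V j \<in> borel_measurable (G (real (Suc j) * h))" if "a \<le> j" "j < b" for j
    unfolding V_def using h by (intro borel_measurable_sum borel_measurable_times measurable_G_mono[OF ph(1)[OF that]] dB_meas_G) auto
  have noise_coeff: "S n \<in> borel_measurable (G (real n * h))" if "n \<le> b" for n
    unfolding S_def'
  proof (intro borel_measurable_sum borel_measurable_add borel_measurable_times borel_measurable_const)
    fix j assume j: "j \<in> {a..<n}"
    show "\<alpha> j \<in> borel_measurable (G (real n * h))" using j that h by (intro measurable_G_mono[OF al(1)]) (auto intro!: mult_right_mono)
    show "V j \<in> borel_measurable (G (real n * h))" using j that h by (intro measurable_G_mono[OF VG]) (auto intro!: mult_right_mono simp del: of_nat_Suc)
  qed
  have SM: "S n \<in> borel_measurable M" if "n \<le> b" for n using measurable_G_M[OF noise_coeff[OF that]] h by simp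
  show Sb: "S b \<in> borel_measurable M" by (rule SM) simp
  have alM: "\<alpha> j \<in> borel_measurable M" if "a \<le> j" "j < b" for j using measurable_G_M[OF al(1)[OF that]] h by simp
  have iV2: "integrable M (\<lambda>\<omega>. (V j \<omega>)\<^sup>2)" if "a \<le> j" "j < b" for j using cond_le_integrable[OF subj prob_space_M V3[OF that]] by simp
  have ial2: "integrable M (\<lambda>\<omega>. (\<alpha> j \<omega>)\<^sup>2)" if "a \<le> j" "j < b" for j using cond_le_integrable[OF sub prob_space_M al(3)[OF that]] by simp
  have sq3: "(x + y)\<^sup>2 \<le> 2 * x\<^sup>2 + 2 * y\<^sup>2" for x y :: real using zero_le_power2[of "x - y"] by (simp add: power2_sum power2_diff)
  have Srec: "S (Suc n) \<omega> = S n \<omega> + (\<alpha> n \<omega> * h + V n \<omega>)" if "a \<le> n" for n \<omega> using that by (simp add: S_def')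
  have iS2: "integrable M (\<lambda>\<omega>. (S n \<omega>)\<^sup>2)" if "a \<le> n" "n \<le> b" for n
    using that
  proof (induction n rule: dec_induct)
    case (step n)
    have i: "integrable M (\<lambda>\<omega>. 2 * (S n \<omega>)\<^sup>2 + 2 * (2 * (h\<^sup>2 * (\<alpha> n \<omega>)\<^sup>2) + 2 * (V n \<omega>)\<^sup>2))"
      using step ial2[of n] iV2[of n] by auto
    show ?case
    proof (rule Bochner_Integration.integrable_bound[OF i])
      show "(\<lambda>\<omega>. (S (Suc n) \<omega>)\<^sup>2) \<in> borel_measurable M" using SM step by auto
      show "AE \<omega> in M. norm ((S (Suc n) \<omega>)\<^sup>2) \<le> norm (2 * (S n \<omega>)\<^sup>2 + 2 * (2 * (h\<^sup>2 * (\<alpha> n \<omega>)\<^sup>2) + 2 * (V n \<omega>)\<^sup>2))"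
      proof (rule AE_I2)
        fix \<omega>
        have "(S (Suc n) \<omega>)\<^sup>2 \<le> 2 * (S n \<omega>)\<^sup>2 + 2 * (\<alpha> n \<omega> * h + V n \<omega>)\<^sup>2" unfolding Srec[OF step(1)] by (rule sq3)
        also have "(\<alpha> n \<omega> * h + V n \<omega>)\<^sup>2 \<le> 2 * (\<alpha> n \<omega> * h)\<^sup>2 + 2 * (V n \<omega>)\<^sup>2" by (rule sq3)
        finally show "norm ((S (Suc n) \<omega>)\<^sup>2) \<le> norm (2 * (S n \<omega>)\<^sup>2 + 2 * (2 * (h\<^sup>2 * (\<alpha> n \<omega>)\<^sup>2) + 2 * (V n \<omega>)\<^sup>2))"
          by (simp add: power_mult_distrib mult.commute)
      qed
    qed
  qed (simp add: S_def')
  define N where "N = real (b - a)"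
  have N: "1 \<le> N" using ab by (auto simp: N_def)
  show "cond_le M H (\<lambda>\<omega>. (S b \<omega>)\<^sup>2) (3 * (2 * (real (b - a) * h)\<^sup>2 * A2 + real (b - a) * h * P2))"
  proof (rule cond_leI[OF sub prob_space_M iS2])
    show "0 \<le> 3 * (2 * (real (b - a) * h)\<^sup>2 * A2 + real (b - a) * h * P2)" using A2 P2 h by simp
    fix E assume E: "E \<in> sets H"
    have EM[measurable]: "E \<in> sets M" using E sub by (auto simp: subalgebra_def)
    define P where "P = measure M E"
    have P: "0 \<le> P" by (simp add: P_def)
    have ind: "integrable M f \<Longrightarrow> integrable M (\<lambda>\<omega>. indicator E \<omega> * f \<omega>)" for f :: "'w \<Rightarrow> real"
      by (intro integrable_mult_indicator[where 'b=real, simplified] EM)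
    define g where "g n = (LINT \<omega>|M. indicator E \<omega> * (S (a + n) \<omega>)\<^sup>2)" for n
    have cond_leE: "(LINT \<omega>|M. indicator E \<omega> * Z \<omega>) \<le> c * P" if "cond_le M H Z c" for Z c
      using cond_le_integral(2)[OF sub that, of "indicator E"] E by (auto simp: P_def emeasure_eq_measure)
    have "g (Suc n) \<le> (1 + 1 / N) * g n + ((1 + N) * h\<^sup>2 * A2 + h * P2) * P" if n: "n < b - a" for n
    proof -
      define j where "j = a + n"
      have j: "a \<le> j" "j < b" using n by (auto simp: j_def)
      have EG: "E \<in> sets (G (real j * h))" using E HGj[OF j(1)] by auto
      have iE: "integrable M (\<lambda>\<omega>. indicator E \<omega> * (S j \<omega>)\<^sup>2)" using ind[OF iS2] j by auto
      have iA: "integrable M (\<lambda>\<omega>. indicator E \<omega> * (\<alpha> j \<omega>)\<^sup>2)" using ind[OF ial2] j by auto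
      have iV: "integrable M (\<lambda>\<omega>. indicator E \<omega> * (V j \<omega>)\<^sup>2)" using ind[OF iV2] j by auto
      \<comment> \<open>Collects what is known at the start of the step; its product with the noise
        of the step integrates to 0.\<close>
      let ?f = "\<lambda>\<omega>. indicator E \<omega> * (S j \<omega> + \<alpha> j \<omega> * h)"
      have fG: "?f \<in> borel_measurable (G (real j * h))"
        using noise_coeff[of j] al(1)[OF j] EG j by (intro borel_measurable_times borel_measurable_add borel_measurable_indicator) auto
      have iS: "integrable M (S j)" using square_integrable_imp_integrable[OF SM iS2] j by auto
      have ial: "integrable M (\<alpha> j)" using square_integrable_imp_integrable[OF alM ial2] j by auto
      have fi: "integrable M ?f" by (intro ind Bochner_Integration.integrable_add iS integrable_mult_left ial)
      have ifV: "integrable M (\<lambda>\<omega>. ?f \<omega> * V j \<omega>)" and zero: "\<bar>LINT \<omega>|M. ?f \<omega> * V j \<omega>\<bar> \<le> 0 * (LINT \<omega>|M. \<bar>?f \<omega>\<bar>)"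
        using cond_abs_le_L1[OF subj prob_space_M V1[OF j] V3[OF j] fG fi] by blast+
      have V2le: "(LINT \<omega>|M. indicator E \<omega> * (V j \<omega>)\<^sup>2) \<le> h * P2 * P"
      proof -
        have hh: "real (Suc j) * h - real j * h = h" by (simp add: algebra_simps)
        have "(LINT \<omega>|M. indicator E \<omega> * ((V j \<omega>)\<^sup>2 - h * (\<Sum>c<d+m. (\<phi> j c \<omega>)\<^sup>2))) = 0"
          using V2[OF j] EG unfolding hh cond_abs_le_def by auto
        moreover have "integrable M (\<lambda>\<omega>. indicator E \<omega> * (\<Sum>c<d+m. (\<phi> j c \<omega>)\<^sup>2))"
          by (rule ind) (use cond_le_integrable[OF sub prob_space_M ph(3)[OF j]] in simp)
        ultimately have "(LINT \<omega>|M. indicator E \<omega> * (V j \<omega>)\<^sup>2) = h * (LINT \<omega>|M. indicator E \<omega> * (\<Sum>c<d+m. (\<phi> j c \<omega>)\<^sup>2))"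
          using iV by (simp add: right_diff_distrib mult.left_commute[of _ h])
        also have "\<dots> \<le> h * (P2 * P)" using h by (intro mult_left_mono cond_leE ph(3) j) auto
        finally show ?thesis by (simp add: mult.assoc)
      qed
      have "g (Suc n) = (LINT \<omega>|M. indicator E \<omega> * (S (Suc j) \<omega>)\<^sup>2)" by (simp add: g_def j_def)
      also have "\<dots> \<le> (LINT \<omega>|M. ((1 + 1/N) * (indicator E \<omega> * (S j \<omega>)\<^sup>2) + (1 + N) * h\<^sup>2 * (indicator E \<omega> * (\<alpha> j \<omega>)\<^sup>2)) + 2 * (?f \<omega> * V j \<omega>) + indicator E \<omega> * (V j \<omega>)\<^sup>2)"
      proof (rule integral_mono)
        show "integrable M (\<lambda>\<omega>. indicator E \<omega> * (S (Suc j) \<omega>)\<^sup>2)" using ind[OF iS2] j by auto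
        show "integrable M (\<lambda>\<omega>. ((1 + 1/N) * (indicator E \<omega> * (S j \<omega>)\<^sup>2) + (1 + N) * h\<^sup>2 * (indicator E \<omega> * (\<alpha> j \<omega>)\<^sup>2)) + 2 * (?f \<omega> * V j \<omega>) + indicator E \<omega> * (V j \<omega>)\<^sup>2)"
          by (intro Bochner_Integration.integrable_add integrable_mult_right iE iA ifV iV)
        fix \<omega>
        \<comment> \<open>Young's inequality weighted by the number \<open>N\<close> of steps: the
          factors \<open>1 + 1/N\<close> accumulate to no more than \<open>exp 1\<close>, and the
          drift contributes \<open>N\<close> times \<open>N * h\<^sup>2\<close>, the squared
          duration.\<close>
        have "2 * S j \<omega> * (\<alpha> j \<omega> * h) \<le> (1/N) * (S j \<omega>)\<^sup>2 + N * (\<alpha> j \<omega> * h)\<^sup>2"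
        proof -
          have "0 \<le> (S j \<omega> - N * (\<alpha> j \<omega> * h))\<^sup>2 / N" using N by simp
          also have "\<dots> = (1/N) * (S j \<omega>)\<^sup>2 + N * (\<alpha> j \<omega> * h)\<^sup>2 - 2 * S j \<omega> * (\<alpha> j \<omega> * h)"
            using N by (simp add: power2_eq_square field_simps)
          finally show ?thesis by simp
        qed
        then have "(S (Suc j) \<omega>)\<^sup>2 \<le> (1 + 1/N) * (S j \<omega>)\<^sup>2 + (1 + N) * h\<^sup>2 * (\<alpha> j \<omega>)\<^sup>2 + 2 * ((S j \<omega> + \<alpha> j \<omega> * h) * V j \<omega>) + (V j \<omega>)\<^sup>2"
          unfolding Srec[OF j(1)] by (simp add: power2_eq_square algebra_simps)
        then show "indicator E \<omega> * (S (Suc j) \<omega>)\<^sup>2 \<le> ((1 + 1/N) * (indicator E \<omega> * (S j \<omega>)\<^sup>2) + (1 + N) * h\<^sup>2 * (indicator E \<omega> * (\<alpha> j \<omega>)\<^sup>2)) + 2 * (?f \<omega> * V j \<omega>) + indicator E \<omega> * (V j \<omega>)\<^sup>2"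
          by (simp add: indicator_def)
      qed
      also have "\<dots> = (1 + 1/N) * g n + (1 + N) * h\<^sup>2 * (LINT \<omega>|M. indicator E \<omega> * (\<alpha> j \<omega>)\<^sup>2) + 2 * (LINT \<omega>|M. ?f \<omega> * V j \<omega>) + (LINT \<omega>|M. indicator E \<omega> * (V j \<omega>)\<^sup>2)"
        using iE iA ifV iV by (simp add: g_def j_def)
      also have "\<dots> \<le> (1 + 1/N) * g n + (1 + N) * h\<^sup>2 * (A2 * P) + 2 * 0 + h * P2 * P"
        using N h zero V2le cond_leE[OF al(3)[OF j]] by (intro add_mono mult_left_mono order_refl) auto
      finally show ?thesis by (simp add: algebra_simps)
    qed
    note gstep = this
    have "g (b - a) \<le> exp (1 / N * real (b - a)) * (g 0 + real (b - a) * (((1 + N) * h\<^sup>2 * A2 + h * P2) * P))"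
      by (rule discrete_gronwall[where n="b - a" and g=g and a="1 / N" and b="((1 + N) * h\<^sup>2 * A2 + h * P2) * P", OF gstep]) (use N h A2 P2 P in \<open>auto simp: g_def S_def'\<close>)
    also have "g 0 = 0" by (simp add: g_def S_def')
    also have "exp (1 / N * real (b - a)) = exp 1" using N by (simp add: N_def)
    \<comment> \<open>The constants of the claim come from \<open>exp 1 \<le> 3\<close> and
      \<open>1 + N \<le> 2 * N\<close>.\<close>
    also have "exp 1 * (0 + real (b - a) * (((1 + N) * h\<^sup>2 * A2 + h * P2) * P)) \<le> 3 * (N * (((2 * N) * h\<^sup>2 * A2 + h * P2) * P))"
      unfolding N_def[symmetric] add_0 using exp_le N A2 P2 P h
      by (intro mult_mono add_mono order_refl mult_right_mono) auto
    also have "\<dots> = 3 * (2 * (real (b - a) * h)\<^sup>2 * A2 + real (b - a) * h * P2) * P"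
      by (simp add: N_def power2_eq_square algebra_simps)
    finally show "(LINT \<omega>|M. indicator E \<omega> * (S b \<omega>)\<^sup>2) \<le> 3 * (2 * (real (b - a) * h)\<^sup>2 * A2 + real (b - a) * h * P2) * measure M E"
      using ab by (simp add: g_def P_def)
  qed (use ab in auto)
  assume be: "\<And>j. a \<le> j \<Longrightarrow> j < b \<Longrightarrow> cond_abs_le M H (\<alpha> j) \<beta>"
  have "cond_abs_le M H (S b) (\<Sum>j\<in>{a..<b}. \<bar>h\<bar> * \<beta> + 0)"
    unfolding S_def'
  proof (intro cond_abs_le_sum[OF sub] cond_abs_le_add[OF sub])
    fix j assume j: "j \<in> {a..<b}"
    show "cond_abs_le M H (\<lambda>\<omega>. \<alpha> j \<omega> * h) (\<bar>h\<bar> * \<beta>)" using cond_abs_le_cmult[OF sub prob_space_M be, of j h] j by (simp add: mult.commute[of h])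
    show "cond_abs_le M H (V j) 0" using cond_abs_le_nest[OF V1 HGj] j by auto
  qed
  then show "cond_abs_le M H (S b) (real (b - a) * h * \<beta>)" using h by (simp add: mult.assoc)
qed

end

section \<open>Bounds on the coefficients, the radial component and the crude Euler
  remainder\<close>

context sde begin

text \<open>Sum of the squared Hilbert-Schmidt norms: one number that dominates the squared operator
  norm of every matrix.\<close>

definition mat_sq :: real where "mat_sq = (\<Sum>p\<le>m. \<Sum>i<d. \<Sum>j<d. (AA p i j)\<^sup>2)"

lemma mat_sq_nonneg: "0 \<le> mat_sq" by (auto simp: mat_sq_def intro!: sum_nonneg)

lemma mv_sqn: "p \<le> m \<Longrightarrow> sqn d (mv d (AA p) x) \<le> mat_sq * sqn d x"
proof -
  assume p: "p \<le> m"
  have "sqn d (mv d (AA p) x) \<le> (\<Sum>i<d. (\<Sum>j<d. (AA p i j)\<^sup>2) * sqn d x)"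
    unfolding sqn_def mv_def by (intro sum_mono Cauchy_Schwarz_ineq_sum)
  also have "\<dots> = (\<Sum>i<d. \<Sum>j<d. (AA p i j)\<^sup>2) * sqn d x" by (simp add: sum_distrib_right)
  also have "\<dots> \<le> mat_sq * sqn d x"
    unfolding mat_sq_def using p
    by (intro mult_right_mono sqn_nonneg member_le_sum[of p "{..m}" "\<lambda>p. \<Sum>i<d. \<Sum>j<d. (AA p i j)\<^sup>2"]) (auto intro!: sum_nonneg)
  finally show ?thesis .
qed

definition Kd :: real where "Kd = 3 * (\<kappa>\<^sup>2 + mat_sq + real m * real m * mat_sq\<^sup>2)"

lemma Kd_nonneg: "0 \<le> Kd" using mat_sq_nonneg by (simp add: Kd_def)

lemma drift_sq: assumes i: "i < d" shows "(drift d m \<kappa> AA x i)\<^sup>2 \<le> Kd * sqn d x"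
proof -
  have sq3: "(a + b + c)\<^sup>2 \<le> 3 * (a\<^sup>2 + b\<^sup>2 + c\<^sup>2)" for a b c :: real
    using zero_le_power2[of "a - b"] zero_le_power2[of "a - c"] zero_le_power2[of "b - c"]
    by (simp add: power2_eq_square algebra_simps)
  let ?s = "\<Sum>p=1..m. mv d (AA p) (mv d (AA p) x) i"
  have s: "?s\<^sup>2 \<le> real m * (real m * mat_sq\<^sup>2 * sqn d x)"
  proof -
    have "?s\<^sup>2 \<le> real m * (\<Sum>p=1..m. (mv d (AA p) (mv d (AA p) x) i)\<^sup>2)"
      using Cauchy_Schwarz_ineq_sum[of "\<lambda>_. 1" "\<lambda>p. mv d (AA p) (mv d (AA p) x) i" "{1..m}"] by simp
    also have "(\<Sum>p=1..m. (mv d (AA p) (mv d (AA p) x) i)\<^sup>2) \<le> (\<Sum>p=1..m. mat_sq\<^sup>2 * sqn d x)"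
    proof (intro sum_mono)
      fix p assume p: "p \<in> {1..m}"
      have "(mv d (AA p) (mv d (AA p) x) i)\<^sup>2 \<le> sqn d (mv d (AA p) (mv d (AA p) x))" by (rule comp_le_sqn[OF i])
      also have "\<dots> \<le> mat_sq * sqn d (mv d (AA p) x)" using p by (intro mv_sqn) auto
      also have "\<dots> \<le> mat_sq * (mat_sq * sqn d x)" using p mat_sq_nonneg by (intro mult_left_mono mv_sqn) auto
      finally show "(mv d (AA p) (mv d (AA p) x) i)\<^sup>2 \<le> mat_sq\<^sup>2 * sqn d x" by (simp add: power2_eq_square mult.assoc)
    qed
    finally show ?thesis by (simp add: mult_left_mono)
  qed
  have a: "(mv d (AA 0) x i)\<^sup>2 \<le> mat_sq * sqn d x" using comp_le_sqn[OF i, of "mv d (AA 0) x"] mv_sqn[of 0 x] by simp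
  have b: "(- \<kappa> * x i)\<^sup>2 \<le> \<kappa>\<^sup>2 * sqn d x" using comp_le_sqn[OF i, of x] by (simp add: power_mult_distrib mult_left_mono)
  have c: "(1/2 * ?s)\<^sup>2 \<le> real m * real m * mat_sq\<^sup>2 * sqn d x"
  proof -
    have "(1/2 * ?s)\<^sup>2 \<le> ?s\<^sup>2" by (simp add: power_divide)
    also note s
    finally show ?thesis by (simp only: mult.assoc)
  qed
  have "(drift d m \<kappa> AA x i)\<^sup>2 \<le> 3 * ((- \<kappa> * x i)\<^sup>2 + (mv d (AA 0) x i)\<^sup>2 + (1/2 * ?s)\<^sup>2)"
    unfolding drift_def by (rule sq3)
  also have "\<dots> \<le> 3 * (\<kappa>\<^sup>2 * sqn d x + mat_sq * sqn d x + real m * real m * mat_sq\<^sup>2 * sqn d x)"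
    using a b c by (intro mult_left_mono add_mono) auto
  finally show ?thesis by (simp add: Kd_def algebra_simps)
qed

lemma diffusion_sq:
  assumes "i < d" "c < d + m" "sqn d x \<le> 1" shows "(diffusion x i c)\<^sup>2 \<le> \<nu>\<^sup>2 + mat_sq"
proof (cases "c < d")
  case True
  have "\<nu>\<^sup>2 * (1 - sqn d x) \<le> \<nu>\<^sup>2 * 1" using sqn_nonneg[of d x] by (intro mult_left_mono) auto
  then show ?thesis using True assms mat_sq_nonneg by (auto simp: diffusion_def power_mult_distrib)
next
  case False
  have "(diffusion x i c)\<^sup>2 \<le> sqn d (mv d (AA (c - d + 1)) x)" using False comp_le_sqn[OF assms(1)] by (simp add: diffusion_def)
  also have "\<dots> \<le> mat_sq * sqn d x" using assms False by (intro mv_sqn) auto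
  also have "\<dots> \<le> mat_sq * 1" using assms mat_sq_nonneg by (intro mult_left_mono) auto
  also have "mat_sq * 1 \<le> \<nu>\<^sup>2 + mat_sq" by simp
  finally show ?thesis .
qed

lemma diffusion_diff_sq:
  assumes "i < d" "c < d + m"
  shows "(diffusion x i c - diffusion x' i c)\<^sup>2 \<le> \<nu>\<^sup>2 * (sqrt (1 - sqn d x) - sqrt (1 - sqn d x'))\<^sup>2 + mat_sq * sqn d (\<lambda>j. x j - x' j)"
proof (cases "c < d")
  case True
  then show ?thesis using mat_sq_nonneg sqn_nonneg[of d "\<lambda>j. x j - x' j"]
    by (auto simp: diffusion_def power_mult_distrib[symmetric] right_diff_distrib)
next
  case False
  have "(diffusion x i c - diffusion x' i c)\<^sup>2 \<le> sqn d (mv d (AA (c - d + 1)) (\<lambda>j. x j - x' j))"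
    using False comp_le_sqn[OF assms(1), of "mv d (AA (c - d + 1)) (\<lambda>j. x j - x' j)"] by (simp add: diffusion_def mv_diff)
  also have "\<dots> \<le> mat_sq * sqn d (\<lambda>j. x j - x' j)" using assms False by (intro mv_sqn) auto
  also have "\<dots> \<le> \<nu>\<^sup>2 * (sqrt (1 - sqn d x) - sqrt (1 - sqn d x'))\<^sup>2 + mat_sq * sqn d (\<lambda>j. x j - x' j)" by simp
  finally show ?thesis .
qed

text \<open>The summand 1 gives \<open>K1 \<ge> 1\<close>, hence \<open>K1 \<le> K1\<^sup>2\<close>,
  so that one constant bounds a coefficient whether the square or the absolute value has been
  estimated.\<close>

definition K1 :: real where "K1 = 1 + Kd + \<nu>\<^sup>2 + mat_sq"

lemma K1_ge_1: "1 \<le> K1" using Kd_nonneg mat_sq_nonneg by (simp add: K1_def)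

lemma abs_le_K1: "a\<^sup>2 \<le> K1 \<Longrightarrow> \<bar>a\<bar> \<le> K1"
proof -
  assume "a\<^sup>2 \<le> K1"
  also have "K1 \<le> K1\<^sup>2" using K1_ge_1 by (simp add: power2_eq_square)
  finally show ?thesis using K1_ge_1 by (simp add: abs_le_square_iff[symmetric])
qed

lemma drift_bound: "i < d \<Longrightarrow> sqn d x \<le> 1 \<Longrightarrow> \<bar>drift d m \<kappa> AA x i\<bar> \<le> K1"
proof (rule abs_le_K1)
  assume a: "i < d" "sqn d x \<le> 1"
  have "(drift d m \<kappa> AA x i)\<^sup>2 \<le> Kd * sqn d x" by (rule drift_sq[OF a(1)])
  also have "\<dots> \<le> Kd * 1" using a Kd_nonneg by (intro mult_left_mono) auto
  also have "\<dots> \<le> K1" using mat_sq_nonneg by (simp add: K1_def)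
  finally show "(drift d m \<kappa> AA x i)\<^sup>2 \<le> K1" .
qed

lemma diffusion_bound: "i < d \<Longrightarrow> c < d + m \<Longrightarrow> sqn d x \<le> 1 \<Longrightarrow> \<bar>diffusion x i c\<bar> \<le> K1"
  using diffusion_sq[of i c x] Kd_nonneg by (intro abs_le_K1) (simp add: K1_def)

definition Y0sq :: "real \<Rightarrow> 'w \<Rightarrow> real" where "Y0sq t \<omega> = 1 - sqn d (X t \<omega>)"
definition Y0 :: "real \<Rightarrow> 'w \<Rightarrow> real" where "Y0 t \<omega> = sqrt (Y0sq t \<omega>)"

lemma Y0sq_bounds: "0 \<le> t \<Longrightarrow> t \<le> T \<Longrightarrow> \<omega> \<in> space M \<Longrightarrow> 0 \<le> Y0sq t \<omega>" "Y0sq t \<omega> \<le> 1"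
  using sqn_le_1[of t \<omega>] sqn_nonneg[of d "X t \<omega>"] by (auto simp: Y0sq_def)

lemma Y0_bounds: "0 \<le> t \<Longrightarrow> t \<le> T \<Longrightarrow> \<omega> \<in> space M \<Longrightarrow> 0 \<le> Y0 t \<omega>" "Y0 t \<omega> \<le> 1"
  using Y0sq_bounds[of t \<omega>] by (auto simp: Y0_def)

lemma Y0_sq: "0 \<le> t \<Longrightarrow> t \<le> T \<Longrightarrow> \<omega> \<in> space M \<Longrightarrow> (Y0 t \<omega>)\<^sup>2 = Y0sq t \<omega>"
  using Y0sq_bounds[of t \<omega>] by (simp add: Y0_def)

lemma Y0sq_meas: "0 \<le> t \<Longrightarrow> t \<le> T \<Longrightarrow> Y0sq t \<in> borel_measurable (G t)"
  unfolding Y0sq_def using X_meas by (intro borel_measurable_diff sqn_meas) auto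

lemma Y0_meas: "0 \<le> t \<Longrightarrow> t \<le> T \<Longrightarrow> Y0 t \<in> borel_measurable (G t)"
  unfolding Y0_def using Y0sq_meas by measurable

lemma Y0_measM: "0 \<le> t \<Longrightarrow> t \<le> T \<Longrightarrow> Y0 t \<in> borel_measurable M"
  using Y0_meas measurable_G_M by blast

lemma Y0sq_measM: "0 \<le> t \<Longrightarrow> t \<le> T \<Longrightarrow> Y0sq t \<in> borel_measurable M"
  using Y0sq_meas measurable_G_M by blast

lemma X_abs_le_1: "0 \<le> t \<Longrightarrow> t \<le> T \<Longrightarrow> \<omega> \<in> space M \<Longrightarrow> i < d \<Longrightarrow> \<bar>X t \<omega> i\<bar> \<le> 1"
  using order_trans[OF comp_le_sqn[of i d "X t \<omega>"] sqn_le_1[of t \<omega>]] by (simp add: abs_square_le_1)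

text \<open>Quadratic on the left, linear on the right: the mean square of an increment of
  \<open>Y0\<close> is bounded by the root of the time step instead of the time step.
  \<open>Y_holder\<close> repairs this once inverse moments are available.\<close>

lemma Y0_diff_le:
  assumes "0 \<le> s" "s \<le> T" "0 \<le> t" "t \<le> T" "\<omega> \<in> space M"
  shows "(Y0 t \<omega> - Y0 s \<omega>)\<^sup>2 \<le> (\<Sum>i<d. 2 * \<bar>X t \<omega> i - X s \<omega> i\<bar>)"
proof -
  have "(Y0 t \<omega> - Y0 s \<omega>)\<^sup>2 \<le> \<bar>Y0sq t \<omega> - Y0sq s \<omega>\<bar>"
    unfolding Y0_def using Y0sq_bounds assms by (intro sqrt_diff_square_le) auto
  also have "Y0sq t \<omega> - Y0sq s \<omega> = (\<Sum>i<d. - ((X t \<omega> i + X s \<omega> i) * (X t \<omega> i - X s \<omega> i)))"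
    by (simp add: Y0sq_def sqn_def sum_subtractf[symmetric] power2_eq_square algebra_simps sum_negf)
  also have "\<bar>\<dots>\<bar> \<le> (\<Sum>i<d. \<bar>- ((X t \<omega> i + X s \<omega> i) * (X t \<omega> i - X s \<omega> i))\<bar>)" by (rule sum_abs)
  also have "\<dots> \<le> (\<Sum>i<d. 2 * \<bar>X t \<omega> i - X s \<omega> i\<bar>)"
  proof (intro sum_mono)
    fix i assume "i \<in> {..<d}"
    then have "\<bar>X t \<omega> i\<bar> \<le> 1" "\<bar>X s \<omega> i\<bar> \<le> 1" using assms by (auto intro!: X_abs_le_1)
    then have "\<bar>X t \<omega> i + X s \<omega> i\<bar> \<le> 2" by linarith
    then show "\<bar>- ((X t \<omega> i + X s \<omega> i) * (X t \<omega> i - X s \<omega> i))\<bar> \<le> 2 * \<bar>X t \<omega> i - X s \<omega> i\<bar>"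
      unfolding abs_minus_cancel abs_mult by (intro mult_right_mono) auto
  qed
  finally show ?thesis .
qed

definition C1 :: real where "C1 = 3 * (2 * T * K1\<^sup>2 + real (d + m) * K1\<^sup>2)"

lemma C1_nonneg: "0 \<le> C1" using T by (simp add: C1_def)

lemma grid_le:
  assumes "0 < v" "k \<le> k'" "real k' * v \<le> T"
  shows "0 \<le> real k * v" "real k * v \<le> real k' * v" "real k * v \<le> T"
proof -
  show "0 \<le> real k * v" using assms by simp
  show "real k * v \<le> real k' * v" using assms by (intro mult_right_mono) auto
  then show "real k * v \<le> T" by (rule order_trans[OF _ assms(3)])
qed

lemma step_le_T:
  assumes "0 < v" "real (Suc k) * v \<le> T" shows "v \<le> T"
proof -
  have "1 * v \<le> real (Suc k) * v" using assms by (intro mult_right_mono) auto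
  then show ?thesis using assms(2) by linarith
qed

text \<open>\<open>adapted_sum_bounds\<close> applies to the Euler sums with bounded coefficients,
  uniformly in the refinement, and Fatou's lemma carries the bound to the limit. One power of the
  duration is absorbed into \<open>T\<close>.\<close>

lemma X_increment:
  assumes v: "0 < v" and k: "k \<le> k'" "real k' * v \<le> T" and i: "i < d"
  shows "cond_le M (G (real k * v)) (\<lambda>\<omega>. (X (real k' * v) \<omega> i - X (real k * v) \<omega> i)\<^sup>2) (C1 * (real k' * v - real k * v))"
proof (cases "k = k'")
  case True
  then show ?thesis using v by (auto simp: cond_le_def)
next
  case False
  note g = grid_le[OF v k]
  have sub: "subalgebra M (G (real k * v))" using subalgebra_G g by simp
  have b: "real (k' * Suc l - k * Suc l) * (v / real (Suc l)) = real k' * v - real k * v" for l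
  proof -
    have "k' * Suc l - k * Suc l = (k' - k) * Suc l" by (simp only: diff_mult_distrib)
    then have "real (k' * Suc l - k * Suc l) = (real k' - real k) * real (Suc l)" using k by (simp only: of_nat_mult of_nat_diff)
    then have "real (k' * Suc l - k * Suc l) * (v / real (Suc l)) = (real k' - real k) * (real (Suc l) * (v / real (Suc l)))" by (simp only: mult.assoc)
    then show ?thesis by (simp add: left_diff_distrib del: of_nat_Suc mult_Suc_right)
  qed
  let ?\<tau> = "real k' * v - real k * v"
  have tau: "0 \<le> ?\<tau>" "?\<tau> \<le> T" using g k by auto
  show ?thesis
  proof (rule cond_le_fatou[OF sub _ _ path_conv[OF v k i]])
    show "(\<lambda>\<omega>. X (real k' * v) \<omega> i - X (real k * v) \<omega> i) \<in> borel_measurable M"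
      using g k i by (intro borel_measurable_diff X_measM) auto
    fix l
    let ?h = "v / real (Suc l)"
    have h: "0 < ?h" using v by simp
    have ab: "k * Suc l < k' * Suc l" using k False by (intro mult_strict_right_mono) auto
    have jT: "real j * ?h \<le> T" "0 \<le> real j * ?h" if "j < k' * Suc l" for j using fine_le[OF v k(2)] that v by auto
    have ah: "real (k * Suc l) * ?h = real k * v" by (simp add: field_simps)
    have Hs: "sets (G (real k * v)) \<subseteq> sets (G (real (k * Suc l) * ?h))" unfolding ah ..
    have XG: "c < d \<Longrightarrow> j < k' * Suc l \<Longrightarrow> (\<lambda>\<omega>. X (real j * ?h) \<omega> c) \<in> borel_measurable (G (real j * ?h))" for c j
      using jT by (intro X_meas) auto
    have XM: "c < d \<Longrightarrow> j < k' * Suc l \<Longrightarrow> (\<lambda>\<omega>. X (real j * ?h) \<omega> c) \<in> borel_measurable M" for c j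
      using jT by (intro X_measM) auto
    note A = adapted_sum_bounds[OF h ab sub Hs, of "\<lambda>j \<omega>. drift d m \<kappa> AA (X (real j * ?h) \<omega>) i" K1 "K1\<^sup>2"
       "\<lambda>j c \<omega>. diffusion (X (real j * ?h) \<omega>) i c" "real (d + m) * K1\<^sup>2", folded euler_inc_def]
    have 1: "(\<lambda>\<omega>. drift d m \<kappa> AA (X (real j * ?h) \<omega>) i) \<in> borel_measurable (G (real j * ?h))" if "k * Suc l \<le> j" "j < k' * Suc l" for j
      using XG that i by (intro drift_meas) auto
    have 2: "\<bar>drift d m \<kappa> AA (X (real j * ?h) \<omega>) i\<bar> \<le> K1" if "k * Suc l \<le> j" "j < k' * Suc l" "\<omega> \<in> space M" for j \<omega>
      using jT that i by (intro drift_bound sqn_le_1) auto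
    have sqb: "x\<^sup>2 \<le> K1\<^sup>2" if "\<bar>x\<bar> \<le> K1" for x using that K1_ge_1 by (simp add: abs_le_square_iff[symmetric])
    have 3: "cond_le M (G (real k * v)) (\<lambda>\<omega>. (drift d m \<kappa> AA (X (real j * ?h) \<omega>) i)\<^sup>2) (K1\<^sup>2)" if "k * Suc l \<le> j" "j < k' * Suc l" for j
    proof (rule cond_le_mono[OF cond_le_const[OF sub, of "K1\<^sup>2"]])
      show "(\<lambda>\<omega>. (drift d m \<kappa> AA (X (real j * ?h) \<omega>) i)\<^sup>2) \<in> borel_measurable M"
        using XM that i by (intro borel_measurable_power drift_meas) auto
    qed (use 2[OF that] sqb in auto)
    have 4: "(\<lambda>\<omega>. diffusion (X (real j * ?h) \<omega>) i c) \<in> borel_measurable (G (real j * ?h))" if "k * Suc l \<le> j" "j < k' * Suc l" "c < d + m" for j c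
      using XG that by (intro diffusion_meas) auto
    have 5: "\<bar>diffusion (X (real j * ?h) \<omega>) i c\<bar> \<le> K1" if "k * Suc l \<le> j" "j < k' * Suc l" "c < d + m" "\<omega> \<in> space M" for j c \<omega>
      using jT that i by (intro diffusion_bound sqn_le_1) auto
    have 6: "cond_le M (G (real k * v)) (\<lambda>\<omega>. \<Sum>c<d+m. (diffusion (X (real j * ?h) \<omega>) i c)\<^sup>2) (real (d + m) * K1\<^sup>2)" if "k * Suc l \<le> j" "j < k' * Suc l" for j
    proof (rule cond_le_mono[OF cond_le_const[OF sub, of "real (d + m) * K1\<^sup>2"]])
      show "(\<lambda>\<omega>. \<Sum>c<d+m. (diffusion (X (real j * ?h) \<omega>) i c)\<^sup>2) \<in> borel_measurable M"
        using XM that by (intro borel_measurable_sum borel_measurable_power diffusion_meas) auto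
      fix \<omega> assume "\<omega> \<in> space M"
      then have "(\<Sum>c<d+m. (diffusion (X (real j * ?h) \<omega>) i c)\<^sup>2) \<le> (\<Sum>c<d+m. K1\<^sup>2)"
        using 5[OF that] sqb by (intro sum_mono) auto
      then show "(\<Sum>c<d+m. (diffusion (X (real j * ?h) \<omega>) i c)\<^sup>2) \<le> real (d + m) * K1\<^sup>2" by simp
    qed (auto intro!: sum_nonneg)
    show "(\<lambda>\<omega>. \<Sum>j\<in>{k * Suc l..<k' * Suc l}. euler_inc ?h j i \<omega>) \<in> borel_measurable M"
      using jT h i by (intro borel_measurable_sum euler_inc_meas) auto
    have "cond_le M (G (real k * v)) (\<lambda>\<omega>. (\<Sum>j\<in>{k * Suc l..<k' * Suc l}. euler_inc ?h j i \<omega>)\<^sup>2) (3 * (2 * ?\<tau>\<^sup>2 * K1\<^sup>2 + ?\<tau> * (real (d+m) * K1\<^sup>2)))"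
      using A(2)[OF 1 2 3 4 5 6] unfolding b .
    then show "cond_le M (G (real k * v)) (\<lambda>\<omega>. (\<Sum>j\<in>{k * Suc l..<k' * Suc l}. euler_inc ?h j i \<omega>)\<^sup>2) (C1 * ?\<tau>)"
    proof (rule cond_le_bound_mono)
      have "2 * ?\<tau>\<^sup>2 * K1\<^sup>2 \<le> 2 * (T * ?\<tau>) * K1\<^sup>2" unfolding power2_eq_square[of ?\<tau>] using tau by (intro mult_right_mono mult_left_mono) auto
      then show "3 * (2 * ?\<tau>\<^sup>2 * K1\<^sup>2 + ?\<tau> * (real (d+m) * K1\<^sup>2)) \<le> C1 * ?\<tau>"
        by (simp add: C1_def algebra_simps)
    qed
  qed
qed

definition euler_rem :: "real \<Rightarrow> nat \<Rightarrow> nat \<Rightarrow> 'w \<Rightarrow> real" where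
  "euler_rem v k i \<omega> = X (real (Suc k) * v) \<omega> i - X (real k * v) \<omega> i - euler_inc v k i \<omega>"

lemma euler_rem_meas: "0 < v \<Longrightarrow> real (Suc k) * v \<le> T \<Longrightarrow> i < d \<Longrightarrow> euler_rem v k i \<in> borel_measurable M"
  unfolding euler_rem_def using grid_le[of v k "Suc k"] by (intro borel_measurable_diff X_measM euler_inc_meas) auto

lemma fine_increment_sqn:
  assumes v: "0 < v" and k: "real (Suc k) * v \<le> T" and j: "k * Suc l \<le> j" "j \<le> Suc k * Suc l"
  shows "cond_le M (G (real k * v)) (\<lambda>\<omega>. sqn d (\<lambda>i. X (real j * (v / real (Suc l))) \<omega> i - X (real k * v) \<omega> i)) (real d * C1 * v)"
proof -
  let ?h = "v / real (Suc l)"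
  have h: "0 < ?h" using v by simp
  have ah: "real (k * Suc l) * ?h = real k * v" by (simp add: field_simps)
  have bh: "real (Suc k * Suc l) * ?h = real (Suc k) * v" by (simp add: field_simps)
  have jT: "real j * ?h \<le> T" using fine_le[OF v k j(2)] .
  have jb: "real j * ?h \<le> real (Suc k) * v" unfolding bh[symmetric] using j h by (intro mult_right_mono) (auto simp del: of_nat_mult of_nat_Suc)
  note g = grid_le[OF v le_SucI[OF order_refl] k]
  have sub: "subalgebra M (G (real k * v))" using subalgebra_G g by simp
  have "cond_le M (G (real k * v)) (\<lambda>\<omega>. \<Sum>i<d. (X (real j * ?h) \<omega> i - X (real k * v) \<omega> i)\<^sup>2) (\<Sum>i<d. C1 * (real j * ?h - real k * v))"
  proof (rule cond_le_sum[OF sub])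
    fix i assume "i \<in> {..<d}"
    then show "cond_le M (G (real k * v)) (\<lambda>\<omega>. (X (real j * ?h) \<omega> i - X (real k * v) \<omega> i)\<^sup>2) (C1 * (real j * ?h - real k * v))"
      using X_increment[OF h j(1) jT, of i] unfolding ah by simp
  qed
  then show ?thesis unfolding sqn_def
  proof (rule cond_le_bound_mono)
    have "C1 * (real j * ?h - real k * v) \<le> C1 * v" using jb C1_nonneg by (intro mult_left_mono) (auto simp: algebra_simps)
    then have "real d * (C1 * (real j * ?h - real k * v)) \<le> real d * (C1 * v)" by (rule mult_left_mono) simp
    then show "(\<Sum>i<d. C1 * (real j * ?h - real k * v)) \<le> real d * C1 * v" by (simp add: mult.assoc)
  qed
qed

definition C2 :: real where "C2 = 3 * (2 * T * Kd * real d * C1 + real (d + m) * (\<nu>\<^sup>2 + mat_sq * real d * C1))"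

lemma C2_nonneg: "0 \<le> C2" using T Kd_nonneg C1_nonneg mat_sq_nonneg by (auto simp: C2_def intro!: add_nonneg_nonneg mult_nonneg_nonneg)

text \<open>On a refined grid the remainder is a limit of sums whose coefficients are the
  oscillations of drift and diffusion since the left end point. The mean-square oscillation of
  \<open>Y0\<close> is a parameter \<open>\<Phi>\<close>, and \<open>H\<close> is free, because the
  lemma is used twice: conditionally on the past with the crude \<open>\<Phi>\<close> of order
  \<open>v powr (1/2)\<close>, and under the trivial sigma-algebra with \<open>\<Phi>\<close> of
  order \<open>v\<close>. The first moment sees only the drift, whose oscillation has size
  \<open>w\<^sup>2\<close>; over a step of length \<open>w ^ 4\<close> this gives
  \<open>w ^ 6\<close>.\<close>

lemma euler_rem_bound:
  assumes v: "0 < v" and k: "real (Suc k) * v \<le> T" and i: "i < d"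
    and sub: "subalgebra M H" and HG: "sets H \<subseteq> sets (G (real k * v))"
    and Phi: "\<And>l j. k * Suc l \<le> j \<Longrightarrow> j < Suc k * Suc l \<Longrightarrow>
       cond_le M H (\<lambda>\<omega>. (Y0 (real j * (v / real (Suc l))) \<omega> - Y0 (real k * v) \<omega>)\<^sup>2) \<Phi>"
  shows "cond_le M H (\<lambda>\<omega>. (euler_rem v k i \<omega>)\<^sup>2) (C2 * (v\<^sup>2 + v * \<Phi>))"
    "0 < w \<Longrightarrow> v = w ^ 4 \<Longrightarrow> cond_abs_le M H (euler_rem v k i) ((1 + Kd * real d * C1) * w ^ 6)"
proof -
  note g = grid_le[OF v le_SucI[OF order_refl] k]
  have subk: "subalgebra M (G (real k * v))" using subalgebra_G g by simp
  let ?\<alpha> = "\<lambda>l j \<omega>. drift d m \<kappa> AA (X (real j * (v / real (Suc l))) \<omega>) i - drift d m \<kappa> AA (X (real k * v) \<omega>) i"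
  let ?\<phi> = "\<lambda>l j c \<omega>. diffusion (X (real j * (v / real (Suc l))) \<omega>) i c - diffusion (X (real k * v) \<omega>) i c"
  let ?S = "\<lambda>l \<omega>. \<Sum>j\<in>{k * Suc l..<Suc k * Suc l}. ?\<alpha> l j \<omega> * (v / real (Suc l)) + (\<Sum>c<d+m. ?\<phi> l j c \<omega> * dB (real j * (v / real (Suc l))) (real (Suc j) * (v / real (Suc l))) c \<omega>)"
  have Phi0: "0 \<le> \<Phi>" using Phi[of 0 k] by (auto simp: cond_le_def)
  have vT: "v \<le> T" using step_le_T[OF v k] .
  have tau: "real (Suc k * Suc l - k * Suc l) * (v / real (Suc l)) = v" for l
    by (simp del: of_nat_Suc)
  have S_eq: "?S l \<omega> = (\<Sum>j\<in>{k * Suc l..<Suc k * Suc l}. euler_inc (v / real (Suc l)) j i \<omega>) - euler_inc v k i \<omega>" for l \<omega>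
  proof -
    let ?h = "v / real (Suc l)"
    have ah: "real (k * Suc l) * ?h = real k * v" by (simp add: field_simps)
    have bh: "real (Suc k * Suc l) * ?h = real (Suc k) * v" by (simp add: field_simps)
    have tel: "(\<Sum>j\<in>{k * Suc l..<Suc k * Suc l}. dB (real j * ?h) (real (Suc j) * ?h) c \<omega>) = dB (real k * v) (real (Suc k) * v) c \<omega>" for c
      unfolding dB_def using sum_Suc_diff'[of "k * Suc l" "Suc k * Suc l" "\<lambda>j. B (real j * ?h) \<omega> c"] ah bh by (simp del: of_nat_mult of_nat_Suc mult_Suc mult_Suc_right)
    have "(\<Sum>j\<in>{k * Suc l..<Suc k * Suc l}. euler_inc ?h j i \<omega>) - ?S l \<omega>
      = (\<Sum>j\<in>{k * Suc l..<Suc k * Suc l}. drift d m \<kappa> AA (X (real k * v) \<omega>) i * ?h + (\<Sum>c<d+m. diffusion (X (real k * v) \<omega>) i c * dB (real j * ?h) (real (Suc j) * ?h) c \<omega>))"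
      unfolding sum_subtractf[symmetric] euler_inc_def
    proof (intro sum.cong refl)
      fix j
      have "(\<Sum>c<d+m. ?\<phi> l j c \<omega> * dB (real j * ?h) (real (Suc j) * ?h) c \<omega>) = (\<Sum>c<d+m. diffusion (X (real j * ?h) \<omega>) i c * dB (real j * ?h) (real (Suc j) * ?h) c \<omega>) - (\<Sum>c<d+m. diffusion (X (real k * v) \<omega>) i c * dB (real j * ?h) (real (Suc j) * ?h) c \<omega>)"
        by (simp only: left_diff_distrib sum_subtractf)
      then show "drift d m \<kappa> AA (X (real j * ?h) \<omega>) i * ?h + (\<Sum>c<d+m. diffusion (X (real j * ?h) \<omega>) i c * dB (real j * ?h) (real (Suc j) * ?h) c \<omega>) -
         (?\<alpha> l j \<omega> * ?h + (\<Sum>c<d+m. ?\<phi> l j c \<omega> * dB (real j * ?h) (real (Suc j) * ?h) c \<omega>)) =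
         drift d m \<kappa> AA (X (real k * v) \<omega>) i * ?h + (\<Sum>c<d+m. diffusion (X (real k * v) \<omega>) i c * dB (real j * ?h) (real (Suc j) * ?h) c \<omega>)"
        by (simp only: left_diff_distrib)
    qed
    also have "\<dots> = drift d m \<kappa> AA (X (real k * v) \<omega>) i * v + (\<Sum>c<d+m. diffusion (X (real k * v) \<omega>) i c * dB (real k * v) (real (Suc k) * v) c \<omega>)"
      unfolding sum.distrib
    proof (intro arg_cong2[where f="(+)"])
      show "(\<Sum>j\<in>{k * Suc l..<Suc k * Suc l}. drift d m \<kappa> AA (X (real k * v) \<omega>) i * ?h) = drift d m \<kappa> AA (X (real k * v) \<omega>) i * v"
        by (simp del: of_nat_Suc)
      show "(\<Sum>j\<in>{k * Suc l..<Suc k * Suc l}. \<Sum>c<d+m. diffusion (X (real k * v) \<omega>) i c * dB (real j * ?h) (real (Suc j) * ?h) c \<omega>) = (\<Sum>c<d+m. diffusion (X (real k * v) \<omega>) i c * dB (real k * v) (real (Suc k) * v) c \<omega>)"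
        by (subst sum.swap) (simp only: sum_distrib_left[symmetric] tel)
    qed
    finally show ?thesis unfolding euler_inc_def[of v] by simp
  qed
  have conv: "ae_subseq M ?S (euler_rem v k i)"
  proof -
    have "ae_subseq M (\<lambda>l \<omega>. (\<Sum>j\<in>{k * Suc l..<Suc k * Suc l}. euler_inc (v / real (Suc l)) j i \<omega>) + - euler_inc v k i \<omega>) (\<lambda>\<omega>. X (real (Suc k) * v) \<omega> i - X (real k * v) \<omega> i + - euler_inc v k i \<omega>)"
      by (intro ae_subseq_add path_conv v k i) auto
    then show ?thesis unfolding S_eq by (simp add: euler_rem_def[abs_def])
  qed
  have rm: "euler_rem v k i \<in> borel_measurable M" by (rule euler_rem_meas[OF v k i])
  have ingr: "?S l \<in> borel_measurable M \<and> cond_le M H (\<lambda>\<omega>. (?S l \<omega>)\<^sup>2) (C2 * (v\<^sup>2 + v * \<Phi>)) \<and>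
     (\<forall>w. 0 < w \<longrightarrow> v = w ^ 4 \<longrightarrow> cond_abs_le M H (?S l) ((1 + Kd * real d * C1) * w ^ 6))" for l
  proof -
    let ?h = "v / real (Suc l)"
    have h: "0 < ?h" using v by simp
    have ab: "k * Suc l < Suc k * Suc l" by simp
    have jT: "real j * ?h \<le> T" "0 \<le> real j * ?h" if "j < Suc k * Suc l" for j using fine_le[OF v k] that v by auto
    have ah: "real (k * Suc l) * ?h = real k * v" by (simp add: field_simps)
    have Hs: "sets H \<subseteq> sets (G (real (k * Suc l) * ?h))" unfolding ah by (rule HG)
    have kj: "real k * v \<le> real j * ?h" if "k * Suc l \<le> j" for j unfolding ah[symmetric] using h that by (intro mult_right_mono) (auto simp del: of_nat_mult of_nat_Suc)
    have XG: "c < d \<Longrightarrow> j < Suc k * Suc l \<Longrightarrow> (\<lambda>\<omega>. X (real j * ?h) \<omega> c) \<in> borel_measurable (G (real j * ?h))" for c j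
      using jT by (intro X_meas) auto
    have XkG: "c < d \<Longrightarrow> k * Suc l \<le> j \<Longrightarrow> (\<lambda>\<omega>. X (real k * v) \<omega> c) \<in> borel_measurable (G (real j * ?h))" for c j
      using g kj by (intro measurable_G_mono[OF X_meas]) auto
    have XM: "c < d \<Longrightarrow> j < Suc k * Suc l \<Longrightarrow> (\<lambda>\<omega>. X (real j * ?h) \<omega> c) \<in> borel_measurable M" for c j
      using jT by (intro X_measM) auto
    have XkM: "c < d \<Longrightarrow> (\<lambda>\<omega>. X (real k * v) \<omega> c) \<in> borel_measurable M" for c using g by (intro X_measM) auto
    have 1: "?\<alpha> l j \<in> borel_measurable (G (real j * ?h))" if "k * Suc l \<le> j" "j < Suc k * Suc l" for j
      using XG XkG that i by (intro borel_measurable_diff drift_meas) auto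
    have 2: "\<bar>?\<alpha> l j \<omega>\<bar> \<le> 2 * K1" if "k * Suc l \<le> j" "j < Suc k * Suc l" "\<omega> \<in> space M" for j \<omega>
    proof -
      have "\<bar>drift d m \<kappa> AA (X (real j * ?h) \<omega>) i\<bar> \<le> K1" "\<bar>drift d m \<kappa> AA (X (real k * v) \<omega>) i\<bar> \<le> K1"
        using jT that i g by (intro drift_bound sqn_le_1; simp)+
      then show ?thesis by linarith
    qed
    have inc: "cond_le M (G (real k * v)) (\<lambda>\<omega>. sqn d (\<lambda>i. X (real j * ?h) \<omega> i - X (real k * v) \<omega> i)) (real d * C1 * v)" if "k * Suc l \<le> j" "j < Suc k * Suc l" for j
      using fine_increment_sqn[OF v k] that by simp
    have 3: "cond_le M (G (real k * v)) (\<lambda>\<omega>. (?\<alpha> l j \<omega>)\<^sup>2) (Kd * (real d * C1 * v))" if "k * Suc l \<le> j" "j < Suc k * Suc l" for j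
    proof (rule cond_le_mono[OF cond_le_cmult[OF subk inc[OF that] Kd_nonneg] _ _ _ order_refl])
      show "(\<lambda>\<omega>. (?\<alpha> l j \<omega>)\<^sup>2) \<in> borel_measurable M" using XM XkM that i by (intro borel_measurable_power borel_measurable_diff drift_meas) auto
      show "(?\<alpha> l j \<omega>)\<^sup>2 \<le> Kd * sqn d (\<lambda>i. X (real j * ?h) \<omega> i - X (real k * v) \<omega> i)" for \<omega>
        unfolding drift_diff[symmetric] by (rule drift_sq[OF i])
    qed auto
    have n3: "cond_le M H (\<lambda>\<omega>. (?\<alpha> l j \<omega>)\<^sup>2) (Kd * (real d * C1 * v))" if "k * Suc l \<le> j" "j < Suc k * Suc l" for j
      using cond_le_nest[OF 3[OF that] HG] .
    have 4: "?\<phi> l j c \<in> borel_measurable (G (real j * ?h))" if "k * Suc l \<le> j" "j < Suc k * Suc l" "c < d + m" for j c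
      using XG XkG that by (intro borel_measurable_diff diffusion_meas) auto
    have 5: "\<bar>?\<phi> l j c \<omega>\<bar> \<le> 2 * K1" if "k * Suc l \<le> j" "j < Suc k * Suc l" "c < d + m" "\<omega> \<in> space M" for j c \<omega>
    proof -
      have "\<bar>diffusion (X (real j * ?h) \<omega>) i c\<bar> \<le> K1" "\<bar>diffusion (X (real k * v) \<omega>) i c\<bar> \<le> K1"
        using jT that i g by (intro diffusion_bound sqn_le_1; simp)+
      then show ?thesis by linarith
    qed
    let ?P = "\<nu>\<^sup>2 * \<Phi> + mat_sq * (real d * C1 * v)"
    have 6: "cond_le M H (\<lambda>\<omega>. \<Sum>c<d+m. (?\<phi> l j c \<omega>)\<^sup>2) (\<Sum>c<d+m. ?P)" if j: "k * Suc l \<le> j" "j < Suc k * Suc l" for j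
    proof (rule cond_le_sum[OF sub])
      fix c assume c: "c \<in> {..<d+m}"
      have "cond_le M H (\<lambda>\<omega>. \<nu>\<^sup>2 * (Y0 (real j * ?h) \<omega> - Y0 (real k * v) \<omega>)\<^sup>2 + mat_sq * sqn d (\<lambda>i. X (real j * ?h) \<omega> i - X (real k * v) \<omega> i)) ?P"
        using mat_sq_nonneg by (intro cond_le_add[OF sub] cond_le_cmult[OF sub] Phi j cond_le_nest[OF inc HG]) auto
      then show "cond_le M H (\<lambda>\<omega>. (?\<phi> l j c \<omega>)\<^sup>2) ?P"
      proof (rule cond_le_mono)
        show "(\<lambda>\<omega>. (?\<phi> l j c \<omega>)\<^sup>2) \<in> borel_measurable M" using XM XkM j by (intro borel_measurable_power borel_measurable_diff diffusion_meas) auto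
        show "(?\<phi> l j c \<omega>)\<^sup>2 \<le> \<nu>\<^sup>2 * (Y0 (real j * ?h) \<omega> - Y0 (real k * v) \<omega>)\<^sup>2 + mat_sq * sqn d (\<lambda>i. X (real j * ?h) \<omega> i - X (real k * v) \<omega> i)" for \<omega>
          unfolding Y0_def Y0sq_def using c by (intro diffusion_diff_sq[OF i]) auto
      qed auto
    qed
    note A = adapted_sum_bounds[OF h ab sub Hs, of "?\<alpha> l" "2 * K1" "Kd * (real d * C1 * v)" "?\<phi> l" "\<Sum>c<d+m. ?P", OF 1 2 n3 4 5 6]
    have c2: "cond_le M H (\<lambda>\<omega>. (?S l \<omega>)\<^sup>2) (C2 * (v\<^sup>2 + v * \<Phi>))"
    proof (rule cond_le_bound_mono[OF A(2)], unfold tau)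
      have "2 * v\<^sup>2 * (Kd * (real d * C1 * v)) = v * (2 * v\<^sup>2 * Kd * (real d * C1))" by (simp add: ac_simps)
      also have "\<dots> \<le> T * (2 * v\<^sup>2 * Kd * (real d * C1))"
        using vT Kd_nonneg C1_nonneg by (intro mult_right_mono) auto
      finally have a: "2 * v\<^sup>2 * (Kd * (real d * C1 * v)) \<le> (2 * T * Kd * real d * C1) * v\<^sup>2" by (simp add: ac_simps)
      have p1: "(2 * T * Kd * real d * C1) * v\<^sup>2 \<le> (2 * T * Kd * real d * C1) * (v\<^sup>2 + v * \<Phi>)"
        using v Phi0 T Kd_nonneg C1_nonneg by (intro mult_left_mono) auto
      have "v * ?P = \<nu>\<^sup>2 * (v * \<Phi>) + mat_sq * real d * C1 * v\<^sup>2" by (simp add: power2_eq_square algebra_simps)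
      also have "\<dots> \<le> \<nu>\<^sup>2 * (v\<^sup>2 + v * \<Phi>) + mat_sq * real d * C1 * (v\<^sup>2 + v * \<Phi>)"
        using v Phi0 mat_sq_nonneg C1_nonneg by (intro add_mono mult_left_mono) auto
      finally have "real (d + m) * (v * ?P) \<le> real (d + m) * (\<nu>\<^sup>2 * (v\<^sup>2 + v * \<Phi>) + mat_sq * real d * C1 * (v\<^sup>2 + v * \<Phi>))"
        by (rule mult_left_mono) simp
      then show "3 * (2 * v\<^sup>2 * (Kd * (real d * C1 * v)) + v * (\<Sum>c<d+m. ?P)) \<le> C2 * (v\<^sup>2 + v * \<Phi>)"
        using a p1 unfolding C2_def by (simp add: algebra_simps)
    qed
    have c3: "cond_abs_le M H (?S l) ((1 + Kd * real d * C1) * w ^ 6)" if w: "0 < w" "v = w ^ 4" for w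
    proof -
      have ac: "cond_abs_le M H (?\<alpha> l j) ((1 + Kd * real d * C1) * w\<^sup>2)" if j: "k * Suc l \<le> j" "j < Suc k * Suc l" for j
      proof (rule cond_abs_le_of_cond_le[OF sub prob_space_M])
        show am: "?\<alpha> l j \<in> borel_measurable M" using XM XkM j i by (intro borel_measurable_diff drift_meas) auto
        have e: "Kd * real d * C1 * (w\<^sup>2)\<^sup>2 = Kd * (real d * C1 * v)" using w by (simp add: ac_simps)
        show "cond_le M H (\<lambda>\<omega>. \<bar>?\<alpha> l j \<omega>\<bar>) ((1 + Kd * real d * C1) * w\<^sup>2)"
        proof (rule cond_le_abs_of_square[OF sub am])
          show "cond_le M H (\<lambda>\<omega>. (?\<alpha> l j \<omega>)\<^sup>2) (Kd * real d * C1 * (w\<^sup>2)\<^sup>2)" unfolding e by (rule n3[OF j])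
        qed (use w in auto)
      qed auto
      have "cond_abs_le M H (?S l) (real (Suc k * Suc l - k * Suc l) * (v / real (Suc l)) * ((1 + Kd * real d * C1) * w\<^sup>2))"
        by (rule A(3)) (assumption | rule ac)+
      then have "cond_abs_le M H (?S l) (v * ((1 + Kd * real d * C1) * w\<^sup>2))" unfolding tau .
      then show ?thesis using w by (simp add: ac_simps power_add[symmetric])
    qed
    show ?thesis using A(1) c2 c3 by blast
  qed
  show c: "cond_le M H (\<lambda>\<omega>. (euler_rem v k i \<omega>)\<^sup>2) (C2 * (v\<^sup>2 + v * \<Phi>))"
    by (rule cond_le_fatou[OF sub rm _ conv]) (use ingr in blast)+
  show "0 < w \<Longrightarrow> v = w ^ 4 \<Longrightarrow> cond_abs_le M H (euler_rem v k i) ((1 + Kd * real d * C1) * w ^ 6)"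
    by (rule cond_abs_le_fatou[OF sub prob_space_M rm _ conv]) (use ingr in blast)+
qed

lemma w_le: "0 < w \<Longrightarrow> w ^ 4 \<le> T \<Longrightarrow> w \<le> 1 + T"
proof (cases "w \<le> 1")
  case False
  assume "w ^ 4 \<le> T"
  moreover have "w \<le> w ^ 4" using False by (intro self_le_power) auto
  ultimately show ?thesis by simp
qed (use T in auto)

definition C3 :: real where "C3 = C2 * (1 + T + T\<^sup>2 + 2 * real d * (1 + C1)) + (1 + Kd * real d * C1)"

lemma C3_nonneg: "0 \<le> C3" using C1_nonneg C2_nonneg Kd_nonneg T by (simp add: C3_def)

text \<open>Takes \<open>\<Phi>\<close> from the 1/2-Holder bound on \<open>Y0\<close>, of order
  \<open>w\<^sup>2\<close>. The second moment is therefore of order \<open>v powr (3/2)\<close>,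
  short of the final \<open>v\<^sup>2\<close>, but it holds conditionally on the past, which the
  one-step expansions below require.\<close>

lemma euler_rem_bound_uncond:
  assumes w: "0 < w" and k: "real (Suc k) * w ^ 4 \<le> T" and i: "i < d"
  shows "cond_le M (G (real k * w ^ 4)) (\<lambda>\<omega>. (euler_rem (w ^ 4) k i \<omega>)\<^sup>2) (C3 * w ^ 6)"
    "cond_abs_le M (G (real k * w ^ 4)) (euler_rem (w ^ 4) k i) (C3 * w ^ 6)"
proof -
  define v where "v = w ^ 4"
  have v: "0 < v" using w by (simp add: v_def)
  have k: "real (Suc k) * v \<le> T" using k by (simp add: v_def)
  note g = grid_le[OF v le_SucI[OF order_refl] k]
  have sub: "subalgebra M (G (real k * v))" using subalgebra_G g by simp
  have wT: "w\<^sup>2 \<le> 1 + T + T\<^sup>2"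
  proof -
    have "v \<le> T" using step_le_T[OF v k] .
    then have "w \<le> 1 + T" using w_le[OF w] by (simp add: v_def)
    have "w\<^sup>2 \<le> 1 \<or> w\<^sup>2 \<le> T"
    proof (cases "w \<le> 1")
      case False
      then have "w\<^sup>2 \<le> w ^ 4" by (intro power_increasing) auto
      then show ?thesis using \<open>v \<le> T\<close> by (simp add: v_def)
    qed (use w in \<open>simp add: power_le_one\<close>)
    moreover have "0 \<le> T\<^sup>2" by simp
    ultimately show ?thesis using T by linarith
  qed
  let ?\<Phi> = "\<Sum>i<d. 2 * ((1 + C1) * w\<^sup>2)"
  have Phi: "cond_le M (G (real k * v)) (\<lambda>\<omega>. (Y0 (real j * (v / real (Suc l))) \<omega> - Y0 (real k * v) \<omega>)\<^sup>2) ?\<Phi>"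
    if j: "k * Suc l \<le> j" "j < Suc k * Suc l" for l j
  proof -
    let ?h = "v / real (Suc l)"
    have h: "0 < ?h" using v by simp
    have ah: "real (k * Suc l) * ?h = real k * v" by (simp add: field_simps)
    have bh: "real (Suc k * Suc l) * ?h = real (Suc k) * v" by (simp add: field_simps)
    have jT: "real j * ?h \<le> T" "0 \<le> real j * ?h" using fine_le[OF v k] j v by auto
    have jb: "real j * ?h \<le> real (Suc k) * v" unfolding bh[symmetric] using j h by (intro mult_right_mono) (auto simp del: of_nat_mult of_nat_Suc)
    have "cond_le M (G (real k * v)) (\<lambda>\<omega>. \<bar>X (real j * ?h) \<omega> i - X (real k * v) \<omega> i\<bar>) ((1 + C1) * w\<^sup>2)" if i: "i < d" for i
    proof (rule cond_le_abs_of_square[OF sub])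
      show "(\<lambda>\<omega>. X (real j * ?h) \<omega> i - X (real k * v) \<omega> i) \<in> borel_measurable M"
        using jT g i by (intro borel_measurable_diff X_measM) auto
      have "cond_le M (G (real k * v)) (\<lambda>\<omega>. (X (real j * ?h) \<omega> i - X (real k * v) \<omega> i)\<^sup>2) (C1 * (real j * ?h - real k * v))"
        using X_increment[OF h j(1) jT(1) i] unfolding ah .
      then show "cond_le M (G (real k * v)) (\<lambda>\<omega>. (X (real j * ?h) \<omega> i - X (real k * v) \<omega> i)\<^sup>2) (C1 * (w\<^sup>2)\<^sup>2)"
      proof (rule cond_le_bound_mono)
        have "real j * ?h - real k * v \<le> v" using jb by (simp add: algebra_simps)
        then show "C1 * (real j * ?h - real k * v) \<le> C1 * (w\<^sup>2)\<^sup>2" using C1_nonneg by (intro mult_left_mono) (auto simp: v_def)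
      qed
    qed (use w in auto)
    then have "cond_le M (G (real k * v)) (\<lambda>\<omega>. \<Sum>i<d. 2 * \<bar>X (real j * ?h) \<omega> i - X (real k * v) \<omega> i\<bar>) ?\<Phi>"
      by (intro cond_le_sum[OF sub] cond_le_cmult[OF sub]) auto
    then show ?thesis
      by (rule cond_le_mono) (use Y0_diff_le[of "real k * v" "real j * ?h"] jT g Y0_measM in \<open>auto intro!: borel_measurable_power borel_measurable_diff\<close>)
  qed
  have "cond_le M (G (real k * v)) (\<lambda>\<omega>. (euler_rem v k i \<omega>)\<^sup>2) (C3 * w ^ 6)"
  proof (rule cond_le_bound_mono[OF euler_rem_bound(1)[OF v k i sub order_refl Phi]])
    have "C2 * (v\<^sup>2 + v * ?\<Phi>) = C2 * (w\<^sup>2 + 2 * real d * (1 + C1)) * w ^ 6"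
    proof -
      have "v\<^sup>2 = w\<^sup>2 * w ^ 6" "v * w\<^sup>2 = w ^ 6" unfolding v_def by (simp_all add: power_add[symmetric] power_mult[symmetric])
      moreover have "v * ?\<Phi> = 2 * real d * (1 + C1) * (v * w\<^sup>2)" by simp
      ultimately show ?thesis by (simp add: distrib_right distrib_left)
    qed
    also have "\<dots> \<le> C3 * w ^ 6"
    proof (rule mult_right_mono)
      have "C2 * (w\<^sup>2 + 2 * real d * (1 + C1)) \<le> C2 * (1 + T + T\<^sup>2 + 2 * real d * (1 + C1))"
        using wT C2_nonneg by (intro mult_left_mono) auto
      moreover have "0 \<le> Kd * real d * C1" using Kd_nonneg C1_nonneg by simp
      ultimately show "C2 * (w\<^sup>2 + 2 * real d * (1 + C1)) \<le> C3" unfolding C3_def by linarith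
    qed (use w in auto)
    finally show "C2 * (v\<^sup>2 + v * ?\<Phi>) \<le> C3 * w ^ 6" .
  qed
  then show "cond_le M (G (real k * w ^ 4)) (\<lambda>\<omega>. (euler_rem (w ^ 4) k i \<omega>)\<^sup>2) (C3 * w ^ 6)" unfolding v_def .
  have "cond_abs_le M (G (real k * v)) (euler_rem v k i) (C3 * w ^ 6)"
  proof (rule cond_abs_le_mono[OF euler_rem_bound(2)[OF v k i sub order_refl Phi w v_def]])
    show "(1 + Kd * real d * C1) * w ^ 6 \<le> C3 * w ^ 6"
      using w C2_nonneg C1_nonneg T by (intro mult_right_mono) (auto simp: C3_def)
  qed
  then show "cond_abs_le M (G (real k * w ^ 4)) (euler_rem (w ^ 4) k i) (C3 * w ^ 6)" unfolding v_def .
qed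

end

section \<open>One-step expansion of the squared radial part\<close>

lemma skewD: "skew d A \<Longrightarrow> i < d \<Longrightarrow> j < d \<Longrightarrow> A i j = - A j i"
  unfolding skew_def by blast

text \<open>Exchanging the indices turns the double sum into its own negative. Geometrically,
  \<open>A x\<close> is tangential to the sphere, so a skew term has no radial effect at first
  order.\<close>

lemma skew_quadratic_zero:
  assumes "skew d A" shows "(\<Sum>i<d. x i * mv d A x i) = 0"
proof -
  have "(\<Sum>i<d. x i * mv d A x i) = (\<Sum>i<d. \<Sum>j<d. x i * (A i j * x j))" by (simp add: mv_def sum_distrib_left)
  also have "\<dots> = (\<Sum>j<d. \<Sum>i<d. x i * (A i j * x j))" by (rule sum.swap)
  also have "\<dots> = (\<Sum>j<d. \<Sum>i<d. - (x j * (A j i * x i)))"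
    by (intro sum.cong refl) (subst skewD[OF assms], auto)
  also have "\<dots> = - (\<Sum>i<d. x i * mv d A x i)" by (simp add: mv_def sum_distrib_left sum_negf)
  finally show ?thesis by simp
qed

lemma skew_square_form:
  assumes "skew d A" shows "(\<Sum>i<d. x i * mv d A u i) = - (\<Sum>i<d. mv d A x i * u i)"
proof -
  have "(\<Sum>i<d. x i * mv d A u i) = (\<Sum>i<d. \<Sum>j<d. x i * (A i j * u j))" by (simp add: mv_def sum_distrib_left)
  also have "\<dots> = (\<Sum>j<d. \<Sum>i<d. x i * (A i j * u j))" by (rule sum.swap)
  also have "\<dots> = (\<Sum>j<d. \<Sum>i<d. - (A j i * x i * u j))"
    by (intro sum.cong refl) (subst skewD[OF assms], auto)
  also have "\<dots> = - (\<Sum>i<d. mv d A x i * u i)" by (simp add: mv_def sum_distrib_right sum_negf)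
  finally show ?thesis .
qed

text \<open>For the remainder \<open>e\<close> only second moments will be available, so its fourth
  power has to be avoided: for \<open>\<bar>e\<bar> \<le> 2\<close> it is at most
  \<open>4 * e\<^sup>2\<close>, and for larger \<open>e\<close> the bound on \<open>x\<close>
  already suffices. \<open>bounded_sum_abs3\<close> is the same device for third powers.\<close>

lemma bounded_sum_pow4:
  fixes x u e :: real
  assumes "\<bar>x\<bar> \<le> 2" "x = u + e"
  shows "x ^ 4 \<le> 8 * u ^ 4 + 32 * e\<^sup>2"
proof (cases "\<bar>e\<bar> \<le> 2")
  case True
  have sq: "(a + b)\<^sup>2 \<le> 2 * a\<^sup>2 + 2 * b\<^sup>2" for a b :: real using zero_le_power2[of "a - b"] by (simp add: power2_sum power2_diff)
  have "x ^ 4 = ((u + e)\<^sup>2)\<^sup>2" using assms by simp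
  also have "\<dots> \<le> (2 * u\<^sup>2 + 2 * e\<^sup>2)\<^sup>2" by (intro power_mono sq) auto
  also have "\<dots> \<le> 2 * (2 * u\<^sup>2)\<^sup>2 + 2 * (2 * e\<^sup>2)\<^sup>2" by (rule sq)
  also have "\<dots> = 8 * u ^ 4 + 8 * (e\<^sup>2 * e\<^sup>2)" by (simp add: power2_eq_square power4_eq_xxxx)
  also have "e\<^sup>2 * e\<^sup>2 \<le> 4 * e\<^sup>2" using abs_le_square_iff[of e 2, THEN iffD1] True by (intro mult_right_mono) auto
  finally show ?thesis by simp
next
  case False
  have "x\<^sup>2 \<le> 2\<^sup>2" by (rule abs_le_square_iff[THEN iffD1]) (use assms in simp)
  then have "(x\<^sup>2)\<^sup>2 \<le> (2\<^sup>2)\<^sup>2" by (rule power_mono) simp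
  moreover have "4 \<le> e\<^sup>2" using abs_le_square_iff[of 2 e, THEN iffD1] False by simp
  moreover have "0 \<le> u ^ 4" by simp
  moreover have "(x\<^sup>2)\<^sup>2 = x ^ 4" "((2::real)\<^sup>2)\<^sup>2 = 16" by simp_all
  ultimately show ?thesis by linarith
qed

lemma bounded_sum_abs3:
  fixes x g p :: real
  assumes "\<bar>x\<bar> \<le> 1" "x = g + p"
  shows "\<bar>x\<bar> ^ 3 \<le> 4 * \<bar>g\<bar> ^ 3 + 4 * p\<^sup>2"
proof (cases "\<bar>p\<bar> \<le> 1")
  case True
  have cb: "(a + b) ^ 3 \<le> 4 * a ^ 3 + 4 * b ^ 3" if "0 \<le> a" "0 \<le> b" for a b :: real
  proof -
    have "0 \<le> 3 * (a + b) * (a - b)\<^sup>2" using that by simp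
    then show ?thesis by (simp add: power2_eq_square power3_eq_cube algebra_simps)
  qed
  have "\<bar>x\<bar> ^ 3 \<le> (\<bar>g\<bar> + \<bar>p\<bar>) ^ 3" using assms by (intro power_mono) auto
  also have "\<dots> \<le> 4 * \<bar>g\<bar> ^ 3 + 4 * \<bar>p\<bar> ^ 3" by (rule cb) auto
  also have "\<bar>p\<bar> ^ 3 \<le> \<bar>p\<bar> ^ 2" using True by (intro power_decreasing) auto
  finally show ?thesis by simp
next
  case False
  have "\<bar>x\<bar> ^ 3 \<le> 1" using assms by (intro power_le_one) auto
  moreover have "1 \<le> p\<^sup>2" using abs_le_square_iff[of 1 p, THEN iffD1] False by simp
  moreover have "0 \<le> \<bar>g\<bar> ^ 3" by simp
  ultimately show ?thesis by linarith
qed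

context sde begin

text \<open>The Ito drift of \<open>1 - |X|\<^sup>2\<close> as a function of its value; that the
  matrices drop out is the content of \<open>X_dot_drift\<close>.\<close>

definition Y0sq_drift :: "real \<Rightarrow> real" where "Y0sq_drift z = 2 * \<kappa> - (2 * \<kappa> + real d * \<nu>\<^sup>2) * z"
definition Kb :: real where "Kb = 2 * \<kappa> + real d * \<nu>\<^sup>2"
definition noise_dim :: real where "noise_dim = real (d + m)"
text \<open>Bounds every \<open>w\<close> with \<open>w ^ 4 \<le> T\<close>; surplus powers of
  \<open>w\<close> are traded for powers of this constant.\<close>

definition wmax :: real where "wmax = 1 + T"

lemma kappa_pos: "0 < \<kappa>"
proof -
  have "0 < \<nu>\<^sup>2" using nu by simp
  then show ?thesis using kappa6 by linarith
qed

lemma wmax: "1 \<le> wmax" using T by (simp add: wmax_def)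
lemma Kb: "0 \<le> Kb" using kappa_pos by (simp add: Kb_def)
lemma noise_dim: "0 \<le> noise_dim" by (simp add: noise_dim_def)

lemma Y0sq_drift_bound: "0 \<le> z \<Longrightarrow> z \<le> 1 \<Longrightarrow> \<bar>Y0sq_drift z\<bar> \<le> Kb"
proof -
  assume z: "0 \<le> z" "z \<le> 1"
  have "0 \<le> Kb * z" "Kb * z \<le> Kb * 1" using z Kb mult_left_mono[OF z(2) Kb] by simp_all
  moreover have "0 \<le> real d * \<nu>\<^sup>2" by simp
  moreover have e: "Y0sq_drift z = 2 * \<kappa> - Kb * z" and "Kb = 2 * \<kappa> + real d * \<nu>\<^sup>2" by (simp_all add: Y0sq_drift_def Kb_def)
  ultimately show ?thesis using kappa_pos unfolding e abs_le_iff by (intro conjI; linarith)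
qed

definition C4 :: real where "C4 = 12 * real d * real d * C3 + 3 * real d * (real d * (8 * (3 * noise_dim ^ 4 * K1 ^ 4 * wmax\<^sup>2) + 32 * (2 * K1\<^sup>2 * wmax\<^sup>2 + 2 * C3))) + 3 * (real d * noise_dim * K1\<^sup>2)\<^sup>2 * wmax\<^sup>2"
lemma C4: "0 \<le> C4" using C3_nonneg noise_dim by (auto simp: C4_def intro!: add_nonneg_nonneg mult_nonneg_nonneg)

definition C5 :: real where "C5 = 2 * real d * C3 * wmax + real d * (noise_dim\<^sup>2 * K1\<^sup>2 + (1 + wmax) * (2 * K1\<^sup>2 * wmax\<^sup>2 + 2 * C3))"
lemma C5: "0 \<le> C5" using C3_nonneg noise_dim wmax by (auto simp: C5_def intro!: add_nonneg_nonneg mult_nonneg_nonneg)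

definition C6 :: real where "C6 = 2 * Kb\<^sup>2 * wmax\<^sup>2 + 2 * C4"
lemma C6: "0 \<le> C6" using C4 by (simp add: C6_def)

end

text \<open>The step size is written \<open>w ^ 4\<close>, so that the error orders \<open>5/4\<close> and \<open>3/2\<close> become integer powers of \<open>w\<close>.\<close>
locale sde_step = sde +
  fixes w :: real and k :: nat
  assumes w: "0 < w" and k: "real (Suc k) * w ^ 4 \<le> T"
begin

abbreviation "v \<equiv> w ^ 4"
abbreviation "s \<equiv> real k * w ^ 4"
abbreviation "t \<equiv> real (Suc k) * w ^ 4"

lemma v: "0 < v" using w by simp
lemma s0: "0 \<le> s" using w by simp
lemma st: "s < t" using w by simp
lemma sT: "s \<le> T" using st k by linarith
lemma t0: "0 \<le> t" using w by simp
lemma ts: "t - s = v" by (simp add: algebra_simps)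
lemma subalgebra_Gs: "subalgebra M (G s)" using subalgebra_G s0 by simp
lemma vT: "v \<le> T" using step_le_T[OF v k] .
lemma wW: "w \<le> wmax" using w_le[OF w vT] by (simp add: wmax_def)
lemma w_absorb: "w ^ Suc n \<le> wmax * w ^ n" using wW w by (simp add: mult_right_mono)

definition radial_noise :: "'a \<Rightarrow> real" where "radial_noise \<omega> = (\<Sum>c<d. X s \<omega> c * dB s t c \<omega>)"
definition noise_inc :: "nat \<Rightarrow> 'a \<Rightarrow> real" where "noise_inc i \<omega> = (\<Sum>c<d+m. diffusion (X s \<omega>) i c * dB s t c \<omega>)"
text \<open>All of the step of \<open>X\<close> except the leading noise: drift and Euler remainder
  are kept together because the remainder dominates, with second moment of order
  \<open>w ^ 6\<close> against \<open>w ^ 8\<close> for the drift.\<close>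

definition drift_inc :: "nat \<Rightarrow> 'a \<Rightarrow> real" where "drift_inc i \<omega> = drift d m \<kappa> AA (X s \<omega>) i * v + euler_rem v k i \<omega>"
definition Y0sq_rem :: "'a \<Rightarrow> real" where "Y0sq_rem \<omega> = Y0sq t \<omega> - Y0sq s \<omega> + 2 * \<nu> * Y0 s \<omega> * radial_noise \<omega> - Y0sq_drift (Y0sq s \<omega>) * v"

lemma XsG: "c < d \<Longrightarrow> (\<lambda>\<omega>. X s \<omega> c) \<in> borel_measurable (G s)" using s0 sT by (intro X_meas) auto
lemma XsM: "c < d \<Longrightarrow> (\<lambda>\<omega>. X s \<omega> c) \<in> borel_measurable M" using s0 sT by (intro X_measM) auto
lemma Y0sqsG [measurable]: "Y0sq s \<in> borel_measurable (G s)" and Y0sG [measurable]: "Y0 s \<in> borel_measurable (G s)"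
  using s0 sT by (auto intro: Y0sq_meas Y0_meas)
lemma Y0sqsM [measurable]: "Y0sq s \<in> borel_measurable M" and Y0sM [measurable]: "Y0 s \<in> borel_measurable M"
  and ZtM [measurable]: "Y0sq t \<in> borel_measurable M" and YtM [measurable]: "Y0 t \<in> borel_measurable M"
  using s0 sT t0 k by (auto intro: Y0sq_measM Y0_measM)

lemma Y0sqs: "\<omega> \<in> space M \<Longrightarrow> 0 \<le> Y0sq s \<omega>" "Y0sq s \<omega> \<le> 1" and Y0sqt: "\<omega> \<in> space M \<Longrightarrow> 0 \<le> Y0sq t \<omega>" "Y0sq t \<omega> \<le> 1"
  using Y0sq_bounds s0 sT t0 k by auto
lemma Y0s: "\<omega> \<in> space M \<Longrightarrow> 0 \<le> Y0 s \<omega>" "Y0 s \<omega> \<le> 1" and Y0t: "\<omega> \<in> space M \<Longrightarrow> 0 \<le> Y0 t \<omega>" "Y0 t \<omega> \<le> 1"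
  using Y0_bounds s0 sT t0 k by auto
lemma Y0s_sq: "\<omega> \<in> space M \<Longrightarrow> (Y0 s \<omega>)\<^sup>2 = Y0sq s \<omega>" and Y0t_sq: "\<omega> \<in> space M \<Longrightarrow> (Y0 t \<omega>)\<^sup>2 = Y0sq t \<omega>"
  using Y0_sq s0 sT t0 k by auto
lemma Xs1: "\<omega> \<in> space M \<Longrightarrow> c < d \<Longrightarrow> \<bar>X s \<omega> c\<bar> \<le> 1" and Xt1: "\<omega> \<in> space M \<Longrightarrow> c < d \<Longrightarrow> \<bar>X t \<omega> c\<bar> \<le> 1"
  using X_abs_le_1 s0 sT t0 k by auto
lemma sqn_Xs_le_1: "\<omega> \<in> space M \<Longrightarrow> sqn d (X s \<omega>) \<le> 1" using sqn_le_1 s0 sT by auto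

lemma radial_noise_facts:
  shows radial_noise_meas [measurable]: "radial_noise \<in> borel_measurable M"
    and radial_noise_c: "cond_abs_le M (G s) radial_noise 0" and radial_noise_c2: "cond_abs_le M (G s) (\<lambda>\<omega>. (radial_noise \<omega>)\<^sup>2 - v * sqn d (X s \<omega>)) 0"
    and radial_noise_2: "cond_le M (G s) (\<lambda>\<omega>. (radial_noise \<omega>)\<^sup>2) (noise_dim\<^sup>2 * w ^ 4)" and radial_noise_4: "cond_le M (G s) (\<lambda>\<omega>. radial_noise \<omega> ^ 4) (3 * noise_dim ^ 4 * w ^ 8)"
proof -
  let ?f = "\<lambda>c \<omega>. if c < d then X s \<omega> c else 0"
  have 1: "?f c \<in> borel_measurable (G s)" for c using XsG by (cases "c < d") auto
  have 2: "\<bar>?f c \<omega>\<bar> \<le> 1" if "\<omega> \<in> space M" for c \<omega> using Xs1 that by auto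
  have e1: "(\<Sum>c<d+m. ?f c \<omega> * dB s t c \<omega>) = radial_noise \<omega>" for \<omega>
    unfolding radial_noise_def by (rule sum.mono_neutral_cong_right) auto
  have e2: "(\<Sum>c<d+m. (?f c \<omega>)\<^sup>2) = sqn d (X s \<omega>)" for \<omega>
    unfolding sqn_def by (rule sum.mono_neutral_cong_right) auto
  have e3: "w ^ 8 = (w ^ 4)\<^sup>2" by (simp add: power_mult[symmetric])
  note L = linear_gauss[OF s0 st, of ?f 1, unfolded e1 e2 ts, OF 1 2 zero_le_one]
  show "radial_noise \<in> borel_measurable M" "cond_abs_le M (G s) radial_noise 0" "cond_abs_le M (G s) (\<lambda>\<omega>. (radial_noise \<omega>)\<^sup>2 - v * sqn d (X s \<omega>)) 0"
    "cond_le M (G s) (\<lambda>\<omega>. (radial_noise \<omega>)\<^sup>2) (noise_dim\<^sup>2 * w ^ 4)" "cond_le M (G s) (\<lambda>\<omega>. radial_noise \<omega> ^ 4) (3 * noise_dim ^ 4 * w ^ 8)"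
    using L unfolding noise_dim_def e3 by (simp_all add: ac_simps)
qed

lemma noise_inc_facts:
  assumes i: "i < d"
  shows noise_inc_meas: "noise_inc i \<in> borel_measurable M"
    and noise_inc_c2: "cond_abs_le M (G s) (\<lambda>\<omega>. (noise_inc i \<omega>)\<^sup>2 - v * (\<Sum>c<d+m. (diffusion (X s \<omega>) i c)\<^sup>2)) 0"
    and noise_inc_2: "cond_le M (G s) (\<lambda>\<omega>. (noise_inc i \<omega>)\<^sup>2) (noise_dim\<^sup>2 * K1\<^sup>2 * w ^ 4)" and noise_inc_4: "cond_le M (G s) (\<lambda>\<omega>. noise_inc i \<omega> ^ 4) (3 * noise_dim ^ 4 * K1 ^ 4 * w ^ 8)"
proof -
  have 1: "(\<lambda>\<omega>. diffusion (X s \<omega>) i c) \<in> borel_measurable (G s)" for c using XsG by (intro diffusion_meas) auto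
  have 2: "\<bar>diffusion (X s \<omega>) i c\<bar> \<le> K1" if "c < d + m" "\<omega> \<in> space M" for c \<omega> using that i sqn_Xs_le_1 by (intro diffusion_bound) auto
  have e3: "w ^ 8 = (w ^ 4)\<^sup>2" by (simp add: power_mult[symmetric])
  have K: "0 \<le> K1" using K1_ge_1 by simp
  note L = linear_gauss[OF s0 st, of "\<lambda>c \<omega>. diffusion (X s \<omega>) i c" K1, folded noise_inc_def, unfolded ts, OF 1 2 K]
  show "noise_inc i \<in> borel_measurable M" "cond_abs_le M (G s) (\<lambda>\<omega>. (noise_inc i \<omega>)\<^sup>2 - v * (\<Sum>c<d+m. (diffusion (X s \<omega>) i c)\<^sup>2)) 0"
    "cond_le M (G s) (\<lambda>\<omega>. (noise_inc i \<omega>)\<^sup>2) (noise_dim\<^sup>2 * K1\<^sup>2 * w ^ 4)" "cond_le M (G s) (\<lambda>\<omega>. noise_inc i \<omega> ^ 4) (3 * noise_dim ^ 4 * K1 ^ 4 * w ^ 8)"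
    using L unfolding noise_dim_def e3 by simp_all
qed

lemma X_step: "X t \<omega> i = X s \<omega> i + noise_inc i \<omega> + drift_inc i \<omega>"
  by (simp add: noise_inc_def drift_inc_def euler_rem_def euler_inc_def)

lemma euler_rem_measurable: "i < d \<Longrightarrow> euler_rem v k i \<in> borel_measurable M" by (rule euler_rem_meas[OF v k])

lemma drift_inc_meas: "i < d \<Longrightarrow> drift_inc i \<in> borel_measurable M"
  unfolding drift_inc_def using euler_rem_measurable XsM by (intro borel_measurable_add borel_measurable_times drift_meas) auto

lemma w_pows: "w ^ 8 \<le> wmax\<^sup>2 * w ^ 6" "w ^ 7 \<le> wmax * w ^ 6" "w ^ 6 \<le> wmax * w ^ 5" "w ^ 7 \<le> wmax\<^sup>2 * w ^ 5" "w ^ 8 \<le> wmax ^ 3 * w ^ 5"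
proof -
  show 7: "w ^ 7 \<le> wmax * w ^ 6" and 6: "w ^ 6 \<le> wmax * w ^ 5" using w_absorb[of 6] w_absorb[of 5] by (simp_all add: eval_nat_numeral)
  have W: "0 \<le> wmax" using wmax by simp
  have 8: "w ^ 8 \<le> wmax * w ^ 7" using w_absorb[of 7] by (simp add: eval_nat_numeral)
  have "wmax * w ^ 7 \<le> wmax * (wmax * w ^ 6)" using 7 W by (rule mult_left_mono)
  then show e: "w ^ 8 \<le> wmax\<^sup>2 * w ^ 6" using 8 by (simp add: power2_eq_square)
  have "wmax * w ^ 6 \<le> wmax * (wmax * w ^ 5)" using 6 W by (rule mult_left_mono)
  then show "w ^ 7 \<le> wmax\<^sup>2 * w ^ 5" using 7 by (simp add: power2_eq_square)
  have "wmax\<^sup>2 * w ^ 6 \<le> wmax\<^sup>2 * (wmax * w ^ 5)" using 6 W by (intro mult_left_mono) auto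
  then show "w ^ 8 \<le> wmax ^ 3 * w ^ 5" using e by (simp add: power2_eq_square power3_eq_cube)
qed

lemma cond_le_w6:
  assumes "cond_le M (G s) Z (c * w ^ 8)" "0 \<le> c" shows "cond_le M (G s) Z (c * wmax\<^sup>2 * w ^ 6)"
  by (rule cond_le_bound_mono[OF assms(1)]) (use mult_left_mono[OF w_pows(1) assms(2)] in \<open>simp add: mult.assoc\<close>)

lemma drift_inc_cond_sq:
  assumes i: "i < d"
  shows "cond_le M (G s) (\<lambda>\<omega>. (drift_inc i \<omega>)\<^sup>2) ((2 * K1\<^sup>2 * wmax\<^sup>2 + 2 * C3) * w ^ 6)"
proof -
  have sq: "(a + b)\<^sup>2 \<le> 2 * a\<^sup>2 + 2 * b\<^sup>2" for a b :: real using zero_le_power2[of "a - b"] by (simp add: power2_sum power2_diff)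
  have "cond_le M (G s) (\<lambda>\<omega>. 2 * (K1\<^sup>2 * w ^ 8) + 2 * (euler_rem v k i \<omega>)\<^sup>2) (2 * (K1\<^sup>2 * w ^ 8) + 2 * (C3 * w ^ 6))"
    by (intro cond_le_add[OF subalgebra_Gs] cond_le_cmult[OF subalgebra_Gs] cond_le_const[OF subalgebra_Gs] euler_rem_bound_uncond(1)[OF w k i]) auto
  then show ?thesis
  proof (rule cond_le_mono)
    show "(\<lambda>\<omega>. (drift_inc i \<omega>)\<^sup>2) \<in> borel_measurable M" using drift_inc_meas[OF i] by measurable
    have "K1\<^sup>2 * w ^ 8 \<le> K1\<^sup>2 * (wmax\<^sup>2 * w ^ 6)" using w_pows(1) by (intro mult_left_mono) auto
    then show "2 * (K1\<^sup>2 * w ^ 8) + 2 * (C3 * w ^ 6) \<le> (2 * K1\<^sup>2 * wmax\<^sup>2 + 2 * C3) * w ^ 6" by (simp add: algebra_simps)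
    fix \<omega> assume \<omega>: "\<omega> \<in> space M"
    have "\<bar>drift d m \<kappa> AA (X s \<omega>) i\<bar> \<le> K1" using sqn_Xs_le_1 \<omega> i by (intro drift_bound) auto
    then have "(drift d m \<kappa> AA (X s \<omega>) i)\<^sup>2 \<le> K1\<^sup>2" using K1_ge_1 by (simp add: abs_le_square_iff[symmetric])
    then have "(drift d m \<kappa> AA (X s \<omega>) i)\<^sup>2 * v\<^sup>2 \<le> K1\<^sup>2 * v\<^sup>2" by (rule mult_right_mono) simp
    then have "(drift d m \<kappa> AA (X s \<omega>) i * v)\<^sup>2 \<le> K1\<^sup>2 * w ^ 8" unfolding power_mult_distrib by (simp add: power_mult[symmetric])
    then show "(drift_inc i \<omega>)\<^sup>2 \<le> 2 * (K1\<^sup>2 * w ^ 8) + 2 * (euler_rem v k i \<omega>)\<^sup>2"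
      unfolding drift_inc_def using sq[of "drift d m \<kappa> AA (X s \<omega>) i * v" "euler_rem v k i \<omega>"] by linarith
  qed auto
qed

definition diffusion_energy :: "'a \<Rightarrow> real" where "diffusion_energy \<omega> = (\<Sum>i<d. \<Sum>c<d+m. (diffusion (X s \<omega>) i c)\<^sup>2)"

text \<open>The matrix columns are skew and contribute nothing, so the radial noise comes from W
  alone and carries the factor \<open>Y0\<close>, which vanishes on the sphere.\<close>

lemma X_dot_U: "(\<Sum>i<d. X s \<omega> i * noise_inc i \<omega>) = \<nu> * Y0 s \<omega> * radial_noise \<omega>"
proof -
  let ?x = "X s \<omega>"
  have "(\<Sum>i<d. ?x i * noise_inc i \<omega>) = (\<Sum>i<d. \<Sum>c<d+m. ?x i * diffusion ?x i c * dB s t c \<omega>)"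
    by (simp add: noise_inc_def sum_distrib_left mult.assoc)
  also have "\<dots> = (\<Sum>c<d+m. \<Sum>i<d. ?x i * diffusion ?x i c * dB s t c \<omega>)" by (rule sum.swap)
  also have "\<dots> = (\<Sum>c<d+m. if c < d then \<nu> * Y0 s \<omega> * ?x c * dB s t c \<omega> else 0)"
  proof (intro sum.cong refl)
    fix c assume c: "c \<in> {..<d+m}"
    show "(\<Sum>i<d. ?x i * diffusion ?x i c * dB s t c \<omega>) = (if c < d then \<nu> * Y0 s \<omega> * ?x c * dB s t c \<omega> else 0)"
    proof (cases "c < d")
      case True
      have "(\<Sum>i<d. ?x i * diffusion ?x i c * dB s t c \<omega>) = (\<Sum>i<d. if i = c then \<nu> * Y0 s \<omega> * ?x c * dB s t c \<omega> else 0)"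
        using True by (intro sum.cong) (auto simp: diffusion_def Y0_def Y0sq_def)
      then show ?thesis using True by simp
    next
      case False
      have "(\<Sum>i<d. ?x i * diffusion ?x i c * dB s t c \<omega>) = (\<Sum>i<d. ?x i * mv d (AA (c - d + 1)) ?x i) * dB s t c \<omega>"
        using False by (simp add: diffusion_def sum_distrib_right)
      also have "(\<Sum>i<d. ?x i * mv d (AA (c - d + 1)) ?x i) = 0"
        using skewA c False by (intro skew_quadratic_zero) auto
      finally show ?thesis using False by simp
    qed
  qed
  also have "\<dots> = (\<Sum>c<d. \<nu> * Y0 s \<omega> * ?x c * dB s t c \<omega>)"
    by (rule sum.mono_neutral_cong_right) auto
  finally show ?thesis by (simp add: radial_noise_def sum_distrib_left mult.assoc)
qed

text \<open>The correction with half the squared matrices contributes the sum of the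
  \<open>|A x|\<^sup>2\<close> to the drift of \<open>1 - |X|\<^sup>2\<close>; the same sum is
  contained in \<open>diffusion_energy\<close> and cancels. What remains depends on
  \<open>\<kappa>\<close>, \<open>\<nu>\<close> and \<open>d\<close> only.\<close>

lemma X_dot_drift:
  assumes "\<omega> \<in> space M"
  shows "- 2 * (\<Sum>i<d. X s \<omega> i * drift d m \<kappa> AA (X s \<omega>) i) - diffusion_energy \<omega> = Y0sq_drift (Y0sq s \<omega>)"
proof -
  let ?x = "X s \<omega>"
  let ?A = "\<Sum>p=1..m. sqn d (mv d (AA p) ?x)"
  have "(\<Sum>i<d. ?x i * drift d m \<kappa> AA ?x i) = - \<kappa> * sqn d ?x + (\<Sum>i<d. ?x i * mv d (AA 0) ?x i) + 1/2 * (\<Sum>i<d. \<Sum>p=1..m. ?x i * mv d (AA p) (mv d (AA p) ?x) i)"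
    unfolding drift_def sqn_def by (simp add: distrib_left sum.distrib sum_distrib_left power2_eq_square sum_negf mult.left_commute[of _ \<kappa>] right_diff_distrib sum_subtractf sum_divide_distrib[symmetric])
  also have "(\<Sum>i<d. ?x i * mv d (AA 0) ?x i) = 0" using skewA by (intro skew_quadratic_zero) auto
  also have "(\<Sum>i<d. \<Sum>p=1..m. ?x i * mv d (AA p) (mv d (AA p) ?x) i) = (\<Sum>p=1..m. \<Sum>i<d. ?x i * mv d (AA p) (mv d (AA p) ?x) i)" by (rule sum.swap)
  also have "\<dots> = (\<Sum>p=1..m. - sqn d (mv d (AA p) ?x))"
  proof (intro sum.cong refl)
    fix p assume "p \<in> {1..m}"
    then have "skew d (AA p)" using skewA by auto
    from skew_square_form[OF this, of ?x "mv d (AA p) ?x"] show "(\<Sum>i<d. ?x i * mv d (AA p) (mv d (AA p) ?x) i) = - sqn d (mv d (AA p) ?x)"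
      by (simp add: sqn_def power2_eq_square)
  qed
  finally have 1: "- 2 * (\<Sum>i<d. ?x i * drift d m \<kappa> AA ?x i) = 2 * \<kappa> * sqn d ?x + ?A" by (simp add: sum_negf)
  have sg2: "(\<Sum>c<d+m. (diffusion ?x i c)\<^sup>2) = \<nu>\<^sup>2 * Y0sq s \<omega> + (\<Sum>p=1..m. (mv d (AA p) ?x i)\<^sup>2)" if i: "i < d" for i
  proof -
    have "(\<Sum>c<d+m. (diffusion ?x i c)\<^sup>2) = (\<Sum>c<d+m. if c < d then (if c = i then \<nu>\<^sup>2 * Y0sq s \<omega> else 0) else (mv d (AA (c - d + 1)) ?x i)\<^sup>2)"
      using Y0sqs(1)[OF assms] by (intro sum.cong) (auto simp: diffusion_def Y0sq_def power_mult_distrib)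
    also have "\<dots> = (\<Sum>c<d. if c = i then \<nu>\<^sup>2 * Y0sq s \<omega> else 0) + (\<Sum>p=1..m. (mv d (AA (d + p - 1 - d + 1)) ?x i)\<^sup>2)"
      by (rule sum_noise_split)
    also have "(\<Sum>p=1..m. (mv d (AA (d + p - 1 - d + 1)) ?x i)\<^sup>2) = (\<Sum>p=1..m. (mv d (AA p) ?x i)\<^sup>2)"
      by (intro sum.cong) auto
    finally show ?thesis using i by simp
  qed
  have "diffusion_energy \<omega> = real d * \<nu>\<^sup>2 * Y0sq s \<omega> + (\<Sum>i<d. \<Sum>p=1..m. (mv d (AA p) ?x i)\<^sup>2)"
    unfolding diffusion_energy_def using sg2 by (simp add: sum.distrib)
  also have "(\<Sum>i<d. \<Sum>p=1..m. (mv d (AA p) ?x i)\<^sup>2) = ?A" unfolding sqn_def by (rule sum.swap)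
  finally have 2: "diffusion_energy \<omega> = real d * \<nu>\<^sup>2 * Y0sq s \<omega> + ?A" .
  show ?thesis unfolding 1 2 Y0sq_drift_def by (simp add: Y0sq_def algebra_simps)
qed

lemma Y0sq_rem_eq:
  assumes "\<omega> \<in> space M"
  shows "Y0sq_rem \<omega> = - 2 * (\<Sum>i<d. X s \<omega> i * euler_rem v k i \<omega>) - (\<Sum>i<d. (noise_inc i \<omega> + drift_inc i \<omega>)\<^sup>2) + diffusion_energy \<omega> * v"
proof -
  let ?x = "X s \<omega>"
  have "Y0sq t \<omega> - Y0sq s \<omega> = - (\<Sum>i<d. (?x i + (noise_inc i \<omega> + drift_inc i \<omega>))\<^sup>2 - (?x i)\<^sup>2)"
    unfolding Y0sq_def sqn_def X_step by (simp add: sum_subtractf add.assoc)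
  also have "(\<Sum>i<d. (?x i + (noise_inc i \<omega> + drift_inc i \<omega>))\<^sup>2 - (?x i)\<^sup>2) = (\<Sum>i<d. 2 * (?x i * noise_inc i \<omega>) + (2 * v * (?x i * drift d m \<kappa> AA ?x i) + 2 * (?x i * euler_rem v k i \<omega>)) + (noise_inc i \<omega> + drift_inc i \<omega>)\<^sup>2)"
  proof (intro sum.cong refl)
    fix i
    have e: "drift_inc i \<omega> = drift d m \<kappa> AA ?x i * v + euler_rem v k i \<omega>" by (simp add: drift_inc_def)
    have "(?x i + (noise_inc i \<omega> + drift_inc i \<omega>))\<^sup>2 - (?x i)\<^sup>2 = 2 * ?x i * noise_inc i \<omega> + 2 * ?x i * drift_inc i \<omega> + (noise_inc i \<omega> + drift_inc i \<omega>)\<^sup>2"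
      by (simp add: power2_sum algebra_simps)
    also have "2 * ?x i * drift_inc i \<omega> = 2 * v * (?x i * drift d m \<kappa> AA ?x i) + 2 * (?x i * euler_rem v k i \<omega>)" unfolding e by (simp add: algebra_simps)
    finally show "(?x i + (noise_inc i \<omega> + drift_inc i \<omega>))\<^sup>2 - (?x i)\<^sup>2 = 2 * (?x i * noise_inc i \<omega>) + (2 * v * (?x i * drift d m \<kappa> AA ?x i) + 2 * (?x i * euler_rem v k i \<omega>)) + (noise_inc i \<omega> + drift_inc i \<omega>)\<^sup>2" by simp
  qed
  also have "\<dots> = 2 * (\<Sum>i<d. ?x i * noise_inc i \<omega>) + (2 * v * (\<Sum>i<d. ?x i * drift d m \<kappa> AA ?x i) + 2 * (\<Sum>i<d. ?x i * euler_rem v k i \<omega>)) + (\<Sum>i<d. (noise_inc i \<omega> + drift_inc i \<omega>)\<^sup>2)"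
    by (simp only: sum.distrib sum_distrib_left)
  finally have z: "Y0sq t \<omega> - Y0sq s \<omega> = - (2 * (\<nu> * Y0 s \<omega> * radial_noise \<omega>) + (2 * v * (\<Sum>i<d. ?x i * drift d m \<kappa> AA ?x i) + 2 * (\<Sum>i<d. ?x i * euler_rem v k i \<omega>)) + (\<Sum>i<d. (noise_inc i \<omega> + drift_inc i \<omega>)\<^sup>2))"
    unfolding X_dot_U .
  show ?thesis unfolding Y0sq_rem_def z X_dot_drift[OF assms, symmetric] by (simp add: algebra_simps)
qed

lemma diffusion_energy_bound: "\<omega> \<in> space M \<Longrightarrow> \<bar>diffusion_energy \<omega>\<bar> \<le> real d * noise_dim * K1\<^sup>2"
proof -
  assume \<omega>: "\<omega> \<in> space M"
  have "diffusion_energy \<omega> \<le> (\<Sum>i<d. \<Sum>c<d+m. K1\<^sup>2)" unfolding diffusion_energy_def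
  proof (intro sum_mono)
    fix i c assume "i \<in> {..<d}" "c \<in> {..<d+m}"
    then have "\<bar>diffusion (X s \<omega>) i c\<bar> \<le> \<bar>K1\<bar>" using diffusion_bound[of i c "X s \<omega>"] sqn_Xs_le_1[OF \<omega>] K1_ge_1 by simp
    then show "(diffusion (X s \<omega>) i c)\<^sup>2 \<le> K1\<^sup>2" by (rule abs_le_square_iff[THEN iffD1])
  qed
  then have "diffusion_energy \<omega> \<le> real d * noise_dim * K1\<^sup>2" by (simp add: noise_dim_def mult.assoc)
  moreover have "0 \<le> diffusion_energy \<omega>" unfolding diffusion_energy_def by (intro sum_nonneg) auto
  ultimately show ?thesis by simp
qed

lemma Y0sq_drift_meas [measurable]: "Y0sq_drift \<in> borel_measurable borel" unfolding Y0sq_drift_def[abs_def] by measurable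

lemma Y0sq_rem_meas [measurable]: "Y0sq_rem \<in> borel_measurable M"
  unfolding Y0sq_rem_def[abs_def] by measurable

lemma X_inc_bound: "\<omega> \<in> space M \<Longrightarrow> i < d \<Longrightarrow> \<bar>noise_inc i \<omega> + drift_inc i \<omega>\<bar> \<le> 2"
  using Xs1[of \<omega> i] Xt1[of \<omega> i] X_step[of \<omega> i] by linarith

text \<open>The square of the quadratic term would need fourth moments of \<open>drift_inc\<close>.
  Boundedness of the increments of \<open>X\<close> replaces them by second moments through
  \<open>bounded_sum_pow4\<close>.\<close>

lemma Y0sq_rem_cond_sq: "cond_le M (G s) (\<lambda>\<omega>. (Y0sq_rem \<omega>)\<^sup>2) (C4 * w ^ 6)"
proof -
  have sq3: "(a + b + c)\<^sup>2 \<le> 3 * (a\<^sup>2 + b\<^sup>2 + c\<^sup>2)" for a b c :: real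
    using zero_le_power2[of "a - b"] zero_le_power2[of "a - c"] zero_le_power2[of "b - c"]
    by (simp add: power2_eq_square algebra_simps)
  let ?R = "\<lambda>\<omega>. \<Sum>i<d. (euler_rem v k i \<omega>)\<^sup>2"
  let ?Q = "\<lambda>\<omega>. \<Sum>i<d. 8 * noise_inc i \<omega> ^ 4 + 32 * (drift_inc i \<omega>)\<^sup>2"
  let ?c = "(real d * noise_dim * K1\<^sup>2)\<^sup>2 * w ^ 8"
  have "cond_le M (G s) (\<lambda>\<omega>. (12 * real d) * ?R \<omega> + (3 * real d) * ?Q \<omega> + 3 * ?c)
     ((12 * real d) * (\<Sum>i<d. C3 * w ^ 6) + (3 * real d) * (\<Sum>i<d. 8 * ((3 * noise_dim ^ 4 * K1 ^ 4) * wmax\<^sup>2 * w ^ 6) + 32 * ((2 * K1\<^sup>2 * wmax\<^sup>2 + 2 * C3) * w ^ 6)) + 3 * ((real d * noise_dim * K1\<^sup>2)\<^sup>2 * wmax\<^sup>2 * w ^ 6))"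
  proof (intro cond_le_add[OF subalgebra_Gs] cond_le_cmult[OF subalgebra_Gs] cond_le_sum[OF subalgebra_Gs])
    fix i assume "i \<in> {..<d}"
    then have i: "i < d" by simp
    show "cond_le M (G s) (\<lambda>\<omega>. (euler_rem v k i \<omega>)\<^sup>2) (C3 * w ^ 6)" by (rule euler_rem_bound_uncond(1)[OF w k i])
    show "cond_le M (G s) (\<lambda>\<omega>. noise_inc i \<omega> ^ 4) ((3 * noise_dim ^ 4 * K1 ^ 4) * wmax\<^sup>2 * w ^ 6)"
      using noise_dim by (intro cond_le_w6 noise_inc_4 i) auto
    show "cond_le M (G s) (\<lambda>\<omega>. (drift_inc i \<omega>)\<^sup>2) ((2 * K1\<^sup>2 * wmax\<^sup>2 + 2 * C3) * w ^ 6)" by (rule drift_inc_cond_sq[OF i])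
  next
    show "cond_le M (G s) (\<lambda>\<omega>. ?c) ((real d * noise_dim * K1\<^sup>2)\<^sup>2 * wmax\<^sup>2 * w ^ 6)"
      by (intro cond_le_w6 cond_le_const[OF subalgebra_Gs]) auto
  qed auto
  then show ?thesis
  proof (rule cond_le_mono)
    fix \<omega> assume \<omega>: "\<omega> \<in> space M"
    have a: "(- 2 * (\<Sum>i<d. X s \<omega> i * euler_rem v k i \<omega>))\<^sup>2 \<le> 4 * (real d * ?R \<omega>)"
    proof -
      have "(\<Sum>i<d. X s \<omega> i * euler_rem v k i \<omega>)\<^sup>2 \<le> real d * (\<Sum>i<d. (X s \<omega> i * euler_rem v k i \<omega>)\<^sup>2)" by (rule sum_power2_le_card)
      also have "\<dots> \<le> real d * ?R \<omega>"
      proof (intro mult_left_mono sum_mono)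
        fix i assume "i \<in> {..<d}"
        then have "(X s \<omega> i)\<^sup>2 \<le> 1" using Xs1[OF \<omega>, of i] by (simp add: abs_square_le_1)
        then show "(X s \<omega> i * euler_rem v k i \<omega>)\<^sup>2 \<le> (euler_rem v k i \<omega>)\<^sup>2"
          unfolding power_mult_distrib by (intro mult_left_le_one_le) auto
      qed simp
      finally show ?thesis by (simp add: power_mult_distrib)
    qed
    have b: "(- (\<Sum>i<d. (noise_inc i \<omega> + drift_inc i \<omega>)\<^sup>2))\<^sup>2 \<le> real d * ?Q \<omega>"
    proof -
      have "(\<Sum>i<d. (noise_inc i \<omega> + drift_inc i \<omega>)\<^sup>2)\<^sup>2 \<le> real d * (\<Sum>i<d. ((noise_inc i \<omega> + drift_inc i \<omega>)\<^sup>2)\<^sup>2)" by (rule sum_power2_le_card)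
      also have "\<dots> \<le> real d * ?Q \<omega>"
      proof (intro mult_left_mono sum_mono)
        fix i assume "i \<in> {..<d}"
        then show "((noise_inc i \<omega> + drift_inc i \<omega>)\<^sup>2)\<^sup>2 \<le> 8 * noise_inc i \<omega> ^ 4 + 32 * (drift_inc i \<omega>)\<^sup>2"
          using bounded_sum_pow4[OF X_inc_bound[OF \<omega>, of i] refl] by simp
      qed simp
      finally show ?thesis by simp
    qed
    have c: "(diffusion_energy \<omega> * v)\<^sup>2 \<le> ?c"
    proof -
      have "(diffusion_energy \<omega>)\<^sup>2 \<le> (real d * noise_dim * K1\<^sup>2)\<^sup>2"
        by (rule abs_le_square_iff[THEN iffD1]) (use diffusion_energy_bound[OF \<omega>] in linarith)
      then show ?thesis unfolding power_mult_distrib[of "diffusion_energy \<omega>"] power_mult[symmetric] by (intro mult_mono) auto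
    qed
    have "(Y0sq_rem \<omega>)\<^sup>2 \<le> 3 * ((- 2 * (\<Sum>i<d. X s \<omega> i * euler_rem v k i \<omega>))\<^sup>2 + (- (\<Sum>i<d. (noise_inc i \<omega> + drift_inc i \<omega>)\<^sup>2))\<^sup>2 + (diffusion_energy \<omega> * v)\<^sup>2)"
      using sq3[of "- 2 * (\<Sum>i<d. X s \<omega> i * euler_rem v k i \<omega>)" "- (\<Sum>i<d. (noise_inc i \<omega> + drift_inc i \<omega>)\<^sup>2)" "diffusion_energy \<omega> * v"] unfolding Y0sq_rem_eq[OF \<omega>] by simp
    also have "\<dots> \<le> 3 * (4 * (real d * ?R \<omega>) + real d * ?Q \<omega> + ?c)" by (intro mult_left_mono add_mono a b c) simp
    also have "\<dots> = (12 * real d) * ?R \<omega> + (3 * real d) * ?Q \<omega> + 3 * ?c" by (simp add: distrib_left)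
    finally show "(Y0sq_rem \<omega>)\<^sup>2 \<le> (12 * real d) * ?R \<omega> + (3 * real d) * ?Q \<omega> + 3 * ?c" .
  qed (auto simp: C4_def algebra_simps)
qed

text \<open>The squared noise is centred by \<open>diffusion_energy \<omega> * v\<close>, and the
  Euler remainder has mean of order \<open>w ^ 6\<close>. The order \<open>w ^ 5\<close> comes from
  the product of \<open>noise_inc\<close>, of size \<open>w\<^sup>2\<close>, with
  \<open>drift_inc\<close>, of size \<open>w ^ 3\<close>: this is the origin of the exponent
  5/4.\<close>

lemma Y0sq_rem_cond_mean: "cond_abs_le M (G s) Y0sq_rem (C5 * w ^ 5)"
proof -
  define E where "E = 2 * K1\<^sup>2 * wmax\<^sup>2 + 2 * C3"
  have E: "0 \<le> E" using C3_nonneg by (simp add: E_def)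
  have 1: "cond_abs_le M (G s) (\<lambda>\<omega>. X s \<omega> i * euler_rem v k i \<omega>) (1 * (C3 * w ^ 6))" if i: "i < d" for i
    by (rule cond_abs_le_weight[OF subalgebra_Gs prob_space_M euler_rem_bound_uncond(2)[OF w k i]]) (use XsG Xs1 i in auto)
  have 2: "cond_abs_le M (G s) (\<lambda>\<omega>. drift_inc i \<omega> * (2 * noise_inc i \<omega> + drift_inc i \<omega>)) ((noise_dim\<^sup>2 * K1\<^sup>2 + (1 + wmax) * E) * w ^ 5)" if i: "i < d" for i
  proof (rule cond_abs_le_mono[OF cond_abs_le_of_cond_le[OF subalgebra_Gs prob_space_M]])
    show "cond_le M (G s) (\<lambda>\<omega>. w * (noise_inc i \<omega>)\<^sup>2 + (1 / w + 1) * (drift_inc i \<omega>)\<^sup>2) (w * (noise_dim\<^sup>2 * K1\<^sup>2 * w ^ 4) + (1 / w + 1) * (E * w ^ 6))"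
      using w by (intro cond_le_add[OF subalgebra_Gs] cond_le_cmult[OF subalgebra_Gs] noise_inc_2 drift_inc_cond_sq[folded E_def] i) auto
    show "(\<lambda>\<omega>. drift_inc i \<omega> * (2 * noise_inc i \<omega> + drift_inc i \<omega>)) \<in> borel_measurable M" using drift_inc_meas[OF i] noise_inc_meas[OF i] by measurable
    show "\<bar>drift_inc i \<omega> * (2 * noise_inc i \<omega> + drift_inc i \<omega>)\<bar> \<le> w * (noise_inc i \<omega>)\<^sup>2 + (1 / w + 1) * (drift_inc i \<omega>)\<^sup>2" for \<omega>
    proof -
      \<comment> \<open>Young's inequality with weight \<open>w\<close>, the ratio of the sizes of
        \<open>drift_inc\<close> and \<open>noise_inc\<close>, so that both resulting terms are of
        order \<open>w ^ 5\<close>.\<close>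
      have "0 \<le> (w * \<bar>noise_inc i \<omega>\<bar> - \<bar>drift_inc i \<omega>\<bar>)\<^sup>2 / w" using w by simp
      also have "\<dots> = w * (noise_inc i \<omega>)\<^sup>2 + (1 / w) * (drift_inc i \<omega>)\<^sup>2 - 2 * (\<bar>drift_inc i \<omega>\<bar> * \<bar>noise_inc i \<omega>\<bar>)"
        using w by (simp add: power2_diff power_mult_distrib field_simps power2_eq_square)
      finally have "2 * (\<bar>drift_inc i \<omega>\<bar> * \<bar>noise_inc i \<omega>\<bar>) \<le> w * (noise_inc i \<omega>)\<^sup>2 + (1 / w) * (drift_inc i \<omega>)\<^sup>2" by simp
      moreover have "\<bar>drift_inc i \<omega> * (2 * noise_inc i \<omega> + drift_inc i \<omega>)\<bar> \<le> \<bar>2 * (drift_inc i \<omega> * noise_inc i \<omega>)\<bar> + \<bar>(drift_inc i \<omega>)\<^sup>2\<bar>"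
        unfolding power2_eq_square by (rule order_trans[OF _ abs_triangle_ineq]) (simp add: algebra_simps)
      ultimately show ?thesis by (simp add: abs_mult distrib_right)
    qed
    have le: "E * w ^ 6 \<le> E * (wmax * w ^ 5)" using w_pows(3) E by (rule mult_left_mono)
    have e1: "(1 / w + 1) * (E * w ^ 6) = E * w ^ 5 + E * w ^ 6"
    proof -
      have "(1 / w) * (E * w ^ 6) = (1 / w) * w * (E * w ^ 5)" by (simp add: power_add[of w 5 1, simplified])
      then show ?thesis using w by (simp only: distrib_right) simp
    qed
    have e2: "w * (noise_dim\<^sup>2 * K1\<^sup>2 * w ^ 4) = noise_dim\<^sup>2 * K1\<^sup>2 * w ^ 5" by (simp add: power_add[of w 4 1, simplified])
    show "w * (noise_dim\<^sup>2 * K1\<^sup>2 * w ^ 4) + (1 / w + 1) * (E * w ^ 6) \<le> (noise_dim\<^sup>2 * K1\<^sup>2 + (1 + wmax) * E) * w ^ 5"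
      unfolding e1 e2 using le by (simp add: algebra_simps)
  qed
  \<comment> \<open>With U for \<open>noise_inc\<close> and D for \<open>drift_inc\<close>, the
    square of U + D is split into U^2 and D (2 U + D), which isolates the square whose conditional
    mean is known exactly.\<close>
  let ?D = "\<lambda>i \<omega>. (-2) * (X s \<omega> i * euler_rem v k i \<omega>) + ((-1) * (drift_inc i \<omega> * (2 * noise_inc i \<omega> + drift_inc i \<omega>)) + (-1) * ((noise_inc i \<omega>)\<^sup>2 - v * (\<Sum>c<d+m. (diffusion (X s \<omega>) i c)\<^sup>2)))"
  have "cond_abs_le M (G s) (\<lambda>\<omega>. \<Sum>i<d. ?D i \<omega>) (\<Sum>i<d. \<bar>-2\<bar> * (1 * (C3 * w ^ 6)) + (\<bar>-1\<bar> * ((noise_dim\<^sup>2 * K1\<^sup>2 + (1 + wmax) * E) * w ^ 5) + \<bar>-1\<bar> * 0))"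
    by (intro cond_abs_le_sum[OF subalgebra_Gs] cond_abs_le_add[OF subalgebra_Gs] cond_abs_le_cmult[OF subalgebra_Gs prob_space_M] 1 2 noise_inc_c2) auto
  moreover have "Y0sq_rem \<omega> = (\<Sum>i<d. ?D i \<omega>)" if "\<omega> \<in> space M" for \<omega>
  proof -
    have "?D i \<omega> = (-2) * (X s \<omega> i * euler_rem v k i \<omega>) + ((-1) * (noise_inc i \<omega> + drift_inc i \<omega>)\<^sup>2 + v * (\<Sum>c<d+m. (diffusion (X s \<omega>) i c)\<^sup>2))" for i
      by (simp add: power2_eq_square algebra_simps)
    then have "(\<Sum>i<d. ?D i \<omega>) = (\<Sum>i<d. (-2) * (X s \<omega> i * euler_rem v k i \<omega>)) + ((\<Sum>i<d. (-1) * (noise_inc i \<omega> + drift_inc i \<omega>)\<^sup>2) + (\<Sum>i<d. v * (\<Sum>c<d+m. (diffusion (X s \<omega>) i c)\<^sup>2)))"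
      by (simp only: sum.distrib)
    then show ?thesis unfolding Y0sq_rem_eq[OF that] diffusion_energy_def sum_distrib_left[symmetric] by simp
  qed
  ultimately have "cond_abs_le M (G s) Y0sq_rem (\<Sum>i<d. \<bar>-2\<bar> * (1 * (C3 * w ^ 6)) + (\<bar>-1\<bar> * ((noise_dim\<^sup>2 * K1\<^sup>2 + (1 + wmax) * E) * w ^ 5) + \<bar>-1\<bar> * 0))"
    by (subst cond_abs_le_cong) auto
  then show ?thesis
  proof (rule cond_abs_le_mono)
    have "C3 * w ^ 6 \<le> C3 * (wmax * w ^ 5)" using w_pows(3) C3_nonneg by (rule mult_left_mono)
    then have "real d * (2 * (C3 * w ^ 6) + (noise_dim\<^sup>2 * K1\<^sup>2 + (1 + wmax) * E) * w ^ 5) \<le> real d * (2 * (C3 * (wmax * w ^ 5)) + (noise_dim\<^sup>2 * K1\<^sup>2 + (1 + wmax) * E) * w ^ 5)"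
      by (intro mult_left_mono) auto
    also have "\<dots> = C5 * w ^ 5" unfolding C5_def E_def[symmetric] by (simp add: algebra_simps)
    finally show "(\<Sum>i<d. \<bar>-2\<bar> * (1 * (C3 * w ^ 6)) + (\<bar>-1\<bar> * ((noise_dim\<^sup>2 * K1\<^sup>2 + (1 + wmax) * E) * w ^ 5) + \<bar>-1\<bar> * 0)) \<le> C5 * w ^ 5" by simp
  qed
qed

definition Y0sq_drift_inc :: "'a \<Rightarrow> real" where "Y0sq_drift_inc \<omega> = Y0sq_drift (Y0sq s \<omega>) * v + Y0sq_rem \<omega>"

lemma Y0sq_drift_inc_meas [measurable]: "Y0sq_drift_inc \<in> borel_measurable M" unfolding Y0sq_drift_inc_def[abs_def] by measurable

lemma Y0sq_step: "Y0sq t \<omega> - Y0sq s \<omega> = - 2 * \<nu> * Y0 s \<omega> * radial_noise \<omega> + Y0sq_drift_inc \<omega>"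
  by (simp add: Y0sq_drift_inc_def Y0sq_rem_def)

lemma Y0sq_drift_inc_cond_sq: "cond_le M (G s) (\<lambda>\<omega>. (Y0sq_drift_inc \<omega>)\<^sup>2) (C6 * w ^ 6)"
proof -
  have sq: "(a + b)\<^sup>2 \<le> 2 * a\<^sup>2 + 2 * b\<^sup>2" for a b :: real using zero_le_power2[of "a - b"] by (simp add: power2_sum power2_diff)
  have "cond_le M (G s) (\<lambda>\<omega>. 2 * (Kb\<^sup>2 * w ^ 8) + 2 * (Y0sq_rem \<omega>)\<^sup>2) (2 * (Kb\<^sup>2 * wmax\<^sup>2 * w ^ 6) + 2 * (C4 * w ^ 6))"
    by (intro cond_le_add[OF subalgebra_Gs] cond_le_cmult[OF subalgebra_Gs] Y0sq_rem_cond_sq cond_le_w6 cond_le_const[OF subalgebra_Gs]) auto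
  then show ?thesis
  proof (rule cond_le_mono)
    fix \<omega> assume \<omega>: "\<omega> \<in> space M"
    have "\<bar>Y0sq_drift (Y0sq s \<omega>)\<bar> \<le> \<bar>Kb\<bar>" using Y0sq_drift_bound[OF Y0sqs(1)[OF \<omega>] Y0sqs(2)] Kb by simp
    then have "(Y0sq_drift (Y0sq s \<omega>))\<^sup>2 \<le> Kb\<^sup>2" by (rule abs_le_square_iff[THEN iffD1])
    then have "(Y0sq_drift (Y0sq s \<omega>) * v)\<^sup>2 \<le> Kb\<^sup>2 * w ^ 8" unfolding power_mult_distrib power_mult[symmetric] by (intro mult_mono) auto
    then show "(Y0sq_drift_inc \<omega>)\<^sup>2 \<le> 2 * (Kb\<^sup>2 * w ^ 8) + 2 * (Y0sq_rem \<omega>)\<^sup>2"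
      unfolding Y0sq_drift_inc_def using sq[of "Y0sq_drift (Y0sq s \<omega>) * v" "Y0sq_rem \<omega>"] by linarith
  qed (auto simp: C6_def algebra_simps)
qed

end

section \<open>Ito expansions: smooth functions of the squared radial part, and \<open>Y0\<close>
  itself\<close>

context sde begin

definition C7 :: real where "C7 = 32 * \<nu> ^ 3 * (noise_dim\<^sup>2 + 3 * noise_dim ^ 4 * wmax\<^sup>2) + 4 * C6 * wmax"
lemma C7: "0 \<le> C7" using C6 noise_dim wmax nu by (auto simp: C7_def intro!: add_nonneg_nonneg mult_nonneg_nonneg)

definition C8 :: real where "C8 = C7 + C5 + 2 * \<nu>\<^sup>2 * noise_dim\<^sup>2 + (1 + wmax) * C6"
lemma C8: "0 \<le> C8" using C7 C5 C6 wmax by (auto simp: C8_def intro!: add_nonneg_nonneg mult_nonneg_nonneg)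

definition C9 :: real where "C9 = 5 * C6 + 64 * \<nu> ^ 4 * (3 * noise_dim ^ 4 * wmax\<^sup>2)"
lemma C9: "0 \<le> C9" using C6 noise_dim by (simp add: C9_def)

definition C10 :: real where "C10 = C5 + C9 * wmax + \<nu> * (noise_dim\<^sup>2 + C9)"
lemma C10: "0 \<le> C10" using C5 C9 wmax nu by (auto simp: C10_def intro!: add_nonneg_nonneg mult_nonneg_nonneg)

text \<open>The Ito drift of \<open>Y0\<close>: \<open>Y0sq_drift\<close> transformed by the chain
  rule for the square root, whose second-order term lowers the coefficient of \<open>1 / y\<close>
  by \<open>\<nu>\<^sup>2 / 2\<close>.\<close>

definition Y0_drift :: "real \<Rightarrow> real" where "Y0_drift y = (\<kappa> - \<nu>\<^sup>2 / 2) / y - (\<kappa> - \<nu>\<^sup>2 / 2 + real d * \<nu>\<^sup>2 / 2) * y"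
lemma Y0_drift_meas [measurable]: "Y0_drift \<in> borel_measurable borel" unfolding Y0_drift_def[abs_def] by measurable

end

context sde_step begin

text \<open>Interpolates between the second and the fourth moment with weight \<open>w\<close>. The
  true order is \<open>w ^ 6\<close>; one power is given away, since other parts of the expansion
  are of order \<open>w ^ 5\<close> anyway.\<close>

lemma radial_noise_3: "cond_le M (G s) (\<lambda>\<omega>. \<bar>radial_noise \<omega>\<bar> ^ 3) ((noise_dim\<^sup>2 + 3 * noise_dim ^ 4 * wmax\<^sup>2) * w ^ 5)"
proof -
  have "cond_le M (G s) (\<lambda>\<omega>. w * (radial_noise \<omega>)\<^sup>2 + (1 / w) * radial_noise \<omega> ^ 4) (w * (noise_dim\<^sup>2 * w ^ 4) + (1 / w) * (3 * noise_dim ^ 4 * w ^ 8))"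
    using w by (intro cond_le_add[OF subalgebra_Gs] cond_le_cmult[OF subalgebra_Gs] radial_noise_2 radial_noise_4) auto
  then show ?thesis
  proof (rule cond_le_mono)
    have e1: "w * (noise_dim\<^sup>2 * w ^ 4) = noise_dim\<^sup>2 * w ^ 5" by (simp add: power_add[of w 4 1, simplified])
    have e2: "(1 / w) * (3 * noise_dim ^ 4 * w ^ 8) = 3 * noise_dim ^ 4 * w ^ 7"
      using w by (simp add: power_add[of w 7 1, simplified])
    have "3 * noise_dim ^ 4 * w ^ 7 \<le> 3 * noise_dim ^ 4 * (wmax\<^sup>2 * w ^ 5)" using w_pows(4) noise_dim by (intro mult_left_mono) auto
    then show "w * (noise_dim\<^sup>2 * w ^ 4) + (1 / w) * (3 * noise_dim ^ 4 * w ^ 8) \<le> (noise_dim\<^sup>2 + 3 * noise_dim ^ 4 * wmax\<^sup>2) * w ^ 5"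
      unfolding e1 e2 by (simp add: distrib_right mult.assoc)
    fix \<omega>
    let ?V = "radial_noise \<omega>"
    have "0 \<le> (w - \<bar>?V\<bar>)\<^sup>2 / w" using w by simp
    also have "\<dots> = w + (1 / w) * ?V\<^sup>2 - 2 * \<bar>?V\<bar>" using w by (simp add: power2_diff field_simps power2_eq_square)
    finally have "\<bar>?V\<bar> \<le> w + (1 / w) * ?V\<^sup>2" by linarith
    then have "?V\<^sup>2 * \<bar>?V\<bar> \<le> ?V\<^sup>2 * (w + (1 / w) * ?V\<^sup>2)" by (intro mult_left_mono) auto
    then show "\<bar>?V\<bar> ^ 3 \<le> w * ?V\<^sup>2 + (1 / w) * ?V ^ 4"
      by (simp add: power3_eq_cube power4_eq_xxxx power2_eq_square distrib_left ac_simps)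
  qed auto
qed

lemma dY0sq_3: "cond_le M (G s) (\<lambda>\<omega>. \<bar>Y0sq t \<omega> - Y0sq s \<omega>\<bar> ^ 3) (C7 * w ^ 5)"
proof -
  have "cond_le M (G s) (\<lambda>\<omega>. (32 * \<nu> ^ 3) * \<bar>radial_noise \<omega>\<bar> ^ 3 + 4 * (Y0sq_drift_inc \<omega>)\<^sup>2) ((32 * \<nu> ^ 3) * ((noise_dim\<^sup>2 + 3 * noise_dim ^ 4 * wmax\<^sup>2) * w ^ 5) + 4 * (C6 * w ^ 6))"
    using nu by (intro cond_le_add[OF subalgebra_Gs] cond_le_cmult[OF subalgebra_Gs] radial_noise_3 Y0sq_drift_inc_cond_sq) auto
  then show ?thesis
  proof (rule cond_le_mono)
    have "C6 * w ^ 6 \<le> C6 * (wmax * w ^ 5)" using w_pows(3) C6 by (rule mult_left_mono)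
    then show "(32 * \<nu> ^ 3) * ((noise_dim\<^sup>2 + 3 * noise_dim ^ 4 * wmax\<^sup>2) * w ^ 5) + 4 * (C6 * w ^ 6) \<le> C7 * w ^ 5"
      by (simp add: C7_def algebra_simps)
    fix \<omega> assume \<omega>: "\<omega> \<in> space M"
    have "\<bar>Y0sq t \<omega> - Y0sq s \<omega>\<bar> \<le> 1" using Y0sqs(1)[OF \<omega>] Y0sqs(2)[of \<omega>] Y0sqt(1)[OF \<omega>] Y0sqt(2)[of \<omega>] by linarith
    from bounded_sum_abs3[OF this Y0sq_step]
    have 1: "\<bar>Y0sq t \<omega> - Y0sq s \<omega>\<bar> ^ 3 \<le> 4 * \<bar>- 2 * \<nu> * Y0 s \<omega> * radial_noise \<omega>\<bar> ^ 3 + 4 * (Y0sq_drift_inc \<omega>)\<^sup>2" .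
    have "\<bar>- 2 * \<nu> * Y0 s \<omega> * radial_noise \<omega>\<bar> \<le> 2 * \<nu> * \<bar>radial_noise \<omega>\<bar>"
    proof -
      have "\<bar>- 2 * \<nu> * Y0 s \<omega> * radial_noise \<omega>\<bar> = Y0 s \<omega> * (2 * \<nu> * \<bar>radial_noise \<omega>\<bar>)" using nu Y0s(1)[OF \<omega>] by (simp add: abs_mult)
      also have "\<dots> \<le> 1 * (2 * \<nu> * \<bar>radial_noise \<omega>\<bar>)" using nu Y0s(2) by (intro mult_right_mono) auto
      finally show ?thesis by simp
    qed
    then have "\<bar>- 2 * \<nu> * Y0 s \<omega> * radial_noise \<omega>\<bar> ^ 3 \<le> (2 * \<nu> * \<bar>radial_noise \<omega>\<bar>) ^ 3" by (intro power_mono) auto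
    also have "\<dots> = 8 * \<nu> ^ 3 * \<bar>radial_noise \<omega>\<bar> ^ 3" by (simp add: power_mult_distrib)
    finally show "\<bar>Y0sq t \<omega> - Y0sq s \<omega>\<bar> ^ 3 \<le> (32 * \<nu> ^ 3) * \<bar>radial_noise \<omega>\<bar> ^ 3 + 4 * (Y0sq_drift_inc \<omega>)\<^sup>2" using 1 by simp
  next
    show "(\<lambda>\<omega>. \<bar>Y0sq t \<omega> - Y0sq s \<omega>\<bar> ^ 3) \<in> borel_measurable M" by measurable
  qed auto
qed

text \<open>One-step Ito formula, conditionally on the past, with generator
  \<open>f' b + 2 \<nu>\<^sup>2 z (1 - z) f''\<close> of the squared radial part.\<close>
lemma one_step_ito:
  assumes fm [measurable]: "f \<in> borel_measurable borel" "f1 \<in> borel_measurable borel" "f2 \<in> borel_measurable borel"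
    and Kf: "0 \<le> Kf"
    and rem: "\<And>z z'. 0 \<le> z \<Longrightarrow> z \<le> 1 \<Longrightarrow> 0 \<le> z' \<Longrightarrow> z' \<le> 1 \<Longrightarrow> \<bar>f z' - f z - f1 z * (z' - z) - f2 z / 2 * (z' - z)\<^sup>2\<bar> \<le> Kf * \<bar>z' - z\<bar> ^ 3"
    and b1: "\<And>z. 0 \<le> z \<Longrightarrow> z \<le> 1 \<Longrightarrow> \<bar>f1 z\<bar> \<le> Kf" and b2: "\<And>z. 0 \<le> z \<Longrightarrow> z \<le> 1 \<Longrightarrow> \<bar>f2 z\<bar> \<le> Kf"
  shows "cond_abs_le M (G s) (\<lambda>\<omega>. f (Y0sq t \<omega>) - f (Y0sq s \<omega>) - v * (f1 (Y0sq s \<omega>) * Y0sq_drift (Y0sq s \<omega>) + 2 * \<nu>\<^sup>2 * Y0sq s \<omega> * (1 - Y0sq s \<omega>) * f2 (Y0sq s \<omega>))) (Kf * C8 * w ^ 5)"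
proof -
  let ?z = "Y0sq s" and ?z' = "Y0sq t" and ?y = "Y0 s"
  have B1: "\<bar>f1 (?z \<omega>)\<bar> \<le> Kf" and B2: "\<bar>f2 (?z \<omega>)\<bar> \<le> Kf" if "\<omega> \<in> space M" for \<omega> using b1 b2 Y0sqs that by auto
  \<comment> \<open>\<open>?P1\<close> is the Taylor remainder, \<open>?P2\<close> the noise at
    first order, \<open>?P3\<close> the remainder of the squared radial part, \<open>?P4\<close> the
    centred squared noise at second order and \<open>?P5\<close> the rest of the quadratic term.
    \<open>?P2\<close> and \<open>?P4\<close> have conditional mean 0; the other three are of order
    \<open>w ^ 5\<close>.\<close>
  let ?P1 = "\<lambda>\<omega>. f (?z' \<omega>) - f (?z \<omega>) - f1 (?z \<omega>) * (?z' \<omega> - ?z \<omega>) - f2 (?z \<omega>) / 2 * (?z' \<omega> - ?z \<omega>)\<^sup>2"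
  have P1: "cond_abs_le M (G s) ?P1 (Kf * (C7 * w ^ 5))"
  proof (rule cond_abs_le_of_cond_le[OF subalgebra_Gs prob_space_M cond_le_cmult[OF subalgebra_Gs dY0sq_3 Kf]])
    show "?P1 \<in> borel_measurable M" by measurable
    show "\<omega> \<in> space M \<Longrightarrow> \<bar>?P1 \<omega>\<bar> \<le> Kf * \<bar>?z' \<omega> - ?z \<omega>\<bar> ^ 3" for \<omega> by (intro rem Y0sqs Y0sqt)
  qed
  let ?P2 = "\<lambda>\<omega>. (f1 (?z \<omega>) * (- 2 * \<nu> * ?y \<omega>)) * radial_noise \<omega>"
  have P2: "cond_abs_le M (G s) ?P2 ((Kf * (2 * \<nu>)) * 0)"
  proof (rule cond_abs_le_weight[OF subalgebra_Gs prob_space_M radial_noise_c])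
    fix \<omega> assume \<omega>: "\<omega> \<in> space M"
    show "\<bar>f1 (?z \<omega>) * (- 2 * \<nu> * ?y \<omega>)\<bar> \<le> Kf * (2 * \<nu>)"
    proof -
      have "\<bar>- 2 * \<nu> * ?y \<omega>\<bar> = 2 * \<nu> * ?y \<omega>" using nu Y0s(1)[OF \<omega>] by (simp add: abs_mult)
      also have "\<dots> \<le> 2 * \<nu> * 1" using nu Y0s(2)[of \<omega>] by (intro mult_left_mono) auto
      finally have "\<bar>- 2 * \<nu> * ?y \<omega>\<bar> \<le> 2 * \<nu>" by simp
      then show ?thesis unfolding abs_mult[of "f1 (?z \<omega>)"] using B1[OF \<omega>] Kf by (intro mult_mono) auto
    qed
  qed measurable
  let ?P3 = "\<lambda>\<omega>. f1 (?z \<omega>) * Y0sq_rem \<omega>"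
  have P3: "cond_abs_le M (G s) ?P3 (Kf * (C5 * w ^ 5))"
    by (rule cond_abs_le_weight[OF subalgebra_Gs prob_space_M Y0sq_rem_cond_mean]) (use B1 in auto)
  let ?P4 = "\<lambda>\<omega>. (2 * \<nu>\<^sup>2 * f2 (?z \<omega>) * ?z \<omega>) * ((radial_noise \<omega>)\<^sup>2 - v * sqn d (X s \<omega>))"
  have P4: "cond_abs_le M (G s) ?P4 ((2 * \<nu>\<^sup>2 * Kf * 1) * 0)"
  proof (rule cond_abs_le_weight[OF subalgebra_Gs prob_space_M radial_noise_c2])
    fix \<omega> assume \<omega>: "\<omega> \<in> space M"
    show "\<bar>2 * \<nu>\<^sup>2 * f2 (?z \<omega>) * ?z \<omega>\<bar> \<le> 2 * \<nu>\<^sup>2 * Kf * 1"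
      unfolding abs_mult using B2[OF \<omega>] Kf nu Y0sqs(1)[OF \<omega>] Y0sqs(2)[of \<omega>] by (intro mult_mono) auto
  qed measurable
  let ?G = "\<lambda>\<omega>. - 2 * \<nu> * ?y \<omega> * radial_noise \<omega>"
  let ?P5 = "\<lambda>\<omega>. (f2 (?z \<omega>) / 2) * (Y0sq_drift_inc \<omega> * (2 * ?G \<omega> + Y0sq_drift_inc \<omega>))"
  have P5: "cond_abs_le M (G s) ?P5 (Kf / 2 * (w * (4 * \<nu>\<^sup>2 * (noise_dim\<^sup>2 * w ^ 4)) + (1 / w + 1) * (C6 * w ^ 6)))"
  proof (rule cond_abs_le_of_cond_le[OF subalgebra_Gs prob_space_M])
    show "cond_le M (G s) (\<lambda>\<omega>. Kf / 2 * (w * (4 * \<nu>\<^sup>2 * (radial_noise \<omega>)\<^sup>2) + (1 / w + 1) * (Y0sq_drift_inc \<omega>)\<^sup>2)) (Kf / 2 * (w * (4 * \<nu>\<^sup>2 * (noise_dim\<^sup>2 * w ^ 4)) + (1 / w + 1) * (C6 * w ^ 6)))"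
      using w Kf by (intro cond_le_add[OF subalgebra_Gs] cond_le_cmult[OF subalgebra_Gs] radial_noise_2 Y0sq_drift_inc_cond_sq) auto
    show "?P5 \<in> borel_measurable M" by measurable
    fix \<omega> assume \<omega>: "\<omega> \<in> space M"
    have G2: "(?G \<omega>)\<^sup>2 \<le> 4 * \<nu>\<^sup>2 * (radial_noise \<omega>)\<^sup>2"
    proof -
      have "(?G \<omega>)\<^sup>2 = (?y \<omega>)\<^sup>2 * (4 * \<nu>\<^sup>2 * (radial_noise \<omega>)\<^sup>2)" by (simp add: power_mult_distrib)
      also have "\<dots> \<le> 1 * (4 * \<nu>\<^sup>2 * (radial_noise \<omega>)\<^sup>2)" unfolding Y0s_sq[OF \<omega>] using Y0sqs(2) by (intro mult_right_mono) auto
      finally show ?thesis by simp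
    qed
    have "0 \<le> (w * \<bar>?G \<omega>\<bar> - \<bar>Y0sq_drift_inc \<omega>\<bar>)\<^sup>2 / w" using w by simp
    also have "\<dots> = w * (?G \<omega>)\<^sup>2 + (1 / w) * (Y0sq_drift_inc \<omega>)\<^sup>2 - 2 * (\<bar>Y0sq_drift_inc \<omega>\<bar> * \<bar>?G \<omega>\<bar>)"
      unfolding power2_diff power_mult_distrib power2_abs using w by (simp add: add_divide_distrib diff_divide_distrib power2_eq_square)
    finally have "2 * (\<bar>Y0sq_drift_inc \<omega>\<bar> * \<bar>?G \<omega>\<bar>) \<le> w * (?G \<omega>)\<^sup>2 + (1 / w) * (Y0sq_drift_inc \<omega>)\<^sup>2" by linarith
    moreover have "\<bar>Y0sq_drift_inc \<omega> * (2 * ?G \<omega> + Y0sq_drift_inc \<omega>)\<bar> \<le> 2 * (\<bar>Y0sq_drift_inc \<omega>\<bar> * \<bar>?G \<omega>\<bar>) + (Y0sq_drift_inc \<omega>)\<^sup>2"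
    proof -
      have "\<bar>Y0sq_drift_inc \<omega> * (2 * ?G \<omega> + Y0sq_drift_inc \<omega>)\<bar> \<le> \<bar>Y0sq_drift_inc \<omega>\<bar> * (\<bar>2 * ?G \<omega>\<bar> + \<bar>Y0sq_drift_inc \<omega>\<bar>)"
        unfolding abs_mult[of "Y0sq_drift_inc \<omega>"] by (intro mult_left_mono abs_triangle_ineq) auto
      also have "\<dots> = 2 * (\<bar>Y0sq_drift_inc \<omega>\<bar> * \<bar>?G \<omega>\<bar>) + \<bar>Y0sq_drift_inc \<omega>\<bar>\<^sup>2" by (simp add: abs_mult distrib_left power2_eq_square)
      finally show ?thesis by simp
    qed
    moreover have "w * (?G \<omega>)\<^sup>2 \<le> w * (4 * \<nu>\<^sup>2 * (radial_noise \<omega>)\<^sup>2)" using G2 w by (intro mult_left_mono) auto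
    ultimately have "\<bar>Y0sq_drift_inc \<omega> * (2 * ?G \<omega> + Y0sq_drift_inc \<omega>)\<bar> \<le> w * (4 * \<nu>\<^sup>2 * (radial_noise \<omega>)\<^sup>2) + (1 / w + 1) * (Y0sq_drift_inc \<omega>)\<^sup>2"
      unfolding distrib_right[of "1/w" 1] by linarith
    then show "\<bar>?P5 \<omega>\<bar> \<le> Kf / 2 * (w * (4 * \<nu>\<^sup>2 * (radial_noise \<omega>)\<^sup>2) + (1 / w + 1) * (Y0sq_drift_inc \<omega>)\<^sup>2)"
      unfolding abs_mult[of "f2 (?z \<omega>) / 2"] using B2[OF \<omega>] by (intro mult_mono) auto
  qed
  have sum: "cond_abs_le M (G s) (\<lambda>\<omega>. ?P1 \<omega> + (?P2 \<omega> + (?P3 \<omega> + (?P4 \<omega> + ?P5 \<omega>))))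
     (Kf * (C7 * w ^ 5) + ((Kf * (2 * \<nu>)) * 0 + (Kf * (C5 * w ^ 5) + ((2 * \<nu>\<^sup>2 * Kf * 1) * 0 + (Kf / 2 * (w * (4 * \<nu>\<^sup>2 * (noise_dim\<^sup>2 * w ^ 4)) + (1 / w + 1) * (C6 * w ^ 6)))))))"
    by (intro cond_abs_le_add[OF subalgebra_Gs] P1 P2 P3 P4 P5)
  \<comment> \<open>With \<open>z = y * y\<close> and squared length \<open>1 - z\<close> of
    \<open>X\<close>, the conditional mean of half the squared noise
    \<open>2 * \<nu> * y * V\<close> is \<open>2 * \<nu>\<^sup>2 * z * (1 - z) * v\<close>, the
    second-order part of the generator.\<close>
  have eq: "?P1 \<omega> + (?P2 \<omega> + (?P3 \<omega> + (?P4 \<omega> + ?P5 \<omega>))) = f (?z' \<omega>) - f (?z \<omega>) - v * (f1 (?z \<omega>) * Y0sq_drift (?z \<omega>) + 2 * \<nu>\<^sup>2 * ?z \<omega> * (1 - ?z \<omega>) * f2 (?z \<omega>))"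
    if \<omega>: "\<omega> \<in> space M" for \<omega>
  proof -
    define z q V y where "z = ?z \<omega>" and "q = Y0sq_rem \<omega>" and "V = radial_noise \<omega>" and "y = ?y \<omega>"
    define b f1z f2z where "b = Y0sq_drift z" and "f1z = f1 z" and "f2z = f2 z"
    have y2: "z = y * y" using Y0s_sq[OF \<omega>] by (simp add: z_def y_def power2_eq_square)
    have sq: "sqn d (X s \<omega>) = 1 - z" by (simp add: z_def Y0sq_def)
    have p: "Y0sq_drift_inc \<omega> = b * v + q" by (simp add: Y0sq_drift_inc_def b_def q_def z_def)
    have dz: "?z' \<omega> - ?z \<omega> = - 2 * \<nu> * y * V + (b * v + q)" using Y0sq_step[of \<omega>] by (simp add: p y_def V_def)
    show ?thesis unfolding dz sq p
      unfolding b_def[symmetric] q_def[symmetric] V_def[symmetric] y_def[symmetric] f1z_def[symmetric] f2z_def[symmetric] z_def[symmetric]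
      by (simp add: y2 power2_eq_square algebra_simps)
  qed
  have "cond_abs_le M (G s) (\<lambda>\<omega>. f (?z' \<omega>) - f (?z \<omega>) - v * (f1 (?z \<omega>) * Y0sq_drift (?z \<omega>) + 2 * \<nu>\<^sup>2 * ?z \<omega> * (1 - ?z \<omega>) * f2 (?z \<omega>)))
     (Kf * (C7 * w ^ 5) + ((Kf * (2 * \<nu>)) * 0 + (Kf * (C5 * w ^ 5) + ((2 * \<nu>\<^sup>2 * Kf * 1) * 0 + (Kf / 2 * (w * (4 * \<nu>\<^sup>2 * (noise_dim\<^sup>2 * w ^ 4)) + (1 / w + 1) * (C6 * w ^ 6)))))))"
    using sum by (subst (asm) cond_abs_le_cong[OF eq]) auto
  then show ?thesis
  proof (rule cond_abs_le_mono)
    have e1: "w * (4 * \<nu>\<^sup>2 * (noise_dim\<^sup>2 * w ^ 4)) = 4 * \<nu>\<^sup>2 * noise_dim\<^sup>2 * w ^ 5" by (simp add: power_add[of w 4 1, simplified])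
    have "(1 / w) * (C6 * w ^ 6) = (1 / w) * w * (C6 * w ^ 5)" by (simp add: power_add[of w 5 1, simplified])
    then have e2: "(1 / w + 1) * (C6 * w ^ 6) = C6 * w ^ 5 + C6 * w ^ 6" using w by (simp only: distrib_right) simp
    have "C6 * w ^ 6 \<le> C6 * (wmax * w ^ 5)" using w_pows(3) C6 by (rule mult_left_mono)
    then have "4 * \<nu>\<^sup>2 * noise_dim\<^sup>2 * w ^ 5 + (C6 * w ^ 5 + C6 * w ^ 6) \<le> 2 * ((2 * \<nu>\<^sup>2 * noise_dim\<^sup>2 + (1 + wmax) * C6) * w ^ 5)"
    proof -
      have "0 \<le> C6 * w ^ 5" "0 \<le> C6 * (wmax * w ^ 5)" using C6 w wmax by simp_all
      then show ?thesis using \<open>C6 * w ^ 6 \<le> C6 * (wmax * w ^ 5)\<close> by (simp add: algebra_simps)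
    qed
    then have "Kf / 2 * (4 * \<nu>\<^sup>2 * noise_dim\<^sup>2 * w ^ 5 + (C6 * w ^ 5 + C6 * w ^ 6)) \<le> Kf / 2 * (2 * ((2 * \<nu>\<^sup>2 * noise_dim\<^sup>2 + (1 + wmax) * C6) * w ^ 5))"
      using Kf by (intro mult_left_mono) auto
    then show "Kf * (C7 * w ^ 5) + ((Kf * (2 * \<nu>)) * 0 + (Kf * (C5 * w ^ 5) + ((2 * \<nu>\<^sup>2 * Kf * 1) * 0 + (Kf / 2 * (w * (4 * \<nu>\<^sup>2 * (noise_dim\<^sup>2 * w ^ 4)) + (1 / w + 1) * (C6 * w ^ 6)))))) \<le> Kf * C8 * w ^ 5"
      unfolding e1 e2 by (simp add: C8_def algebra_simps)
  qed
qed

definition Y0_drift_inc :: "'a \<Rightarrow> real" where "Y0_drift_inc \<omega> = Y0 t \<omega> - Y0 s \<omega> + \<nu> * radial_noise \<omega>"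
definition Y0_rem :: "'a \<Rightarrow> real" where "Y0_rem \<omega> = Y0_drift_inc \<omega> - Y0_drift (Y0 s \<omega>) * v"

lemma Y0_drift_inc_meas [measurable]: "Y0_drift_inc \<in> borel_measurable M" unfolding Y0_drift_inc_def[abs_def] by measurable
lemma Y0_rem_meas [measurable]: "Y0_rem \<in> borel_measurable M" unfolding Y0_rem_def[abs_def] by measurable

text \<open>Both identities rest on
  \<open>y' * y' - y * y = 2 * y * (y' - y) + (y' - y)\<^sup>2\<close>. The division by
  \<open>2 * Y0\<close> that leads from the squared radial part to \<open>Y0\<close> is postponed,
  so that its cost in inverse powers remains visible.\<close>

lemma Y0_drift_inc_eq:
  assumes \<omega>: "\<omega> \<in> space M" and y: "0 < Y0 s \<omega>"
  shows "2 * Y0 s \<omega> * Y0_drift_inc \<omega> = Y0sq_drift_inc \<omega> - (Y0 t \<omega> - Y0 s \<omega>)\<^sup>2"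
    "2 * Y0 s \<omega> * Y0_rem \<omega> = Y0sq_rem \<omega> - \<nu>\<^sup>2 * ((radial_noise \<omega>)\<^sup>2 - v * sqn d (X s \<omega>)) - (Y0_drift_inc \<omega>)\<^sup>2 + 2 * \<nu> * (Y0_drift_inc \<omega> * radial_noise \<omega>)"
proof -
  define y y' V p where "y = Y0 s \<omega>" and "y' = Y0 t \<omega>" and "V = radial_noise \<omega>" and "p = Y0sq_drift_inc \<omega>"
  have z: "Y0sq s \<omega> = y * y" "Y0sq t \<omega> = y' * y'" using Y0s_sq[OF \<omega>] Y0t_sq[OF \<omega>] by (simp_all add: y_def y'_def power2_eq_square)
  have st: "y' * y' - y * y = - 2 * \<nu> * y * V + p" using Y0sq_step[of \<omega>] unfolding z y_def[symmetric] V_def[symmetric] p_def[symmetric] .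
  have D: "Y0_drift_inc \<omega> = y' - y + \<nu> * V" by (simp add: Y0_drift_inc_def y_def y'_def V_def)
  show 1: "2 * Y0 s \<omega> * Y0_drift_inc \<omega> = Y0sq_drift_inc \<omega> - (Y0 t \<omega> - Y0 s \<omega>)\<^sup>2"
    using st unfolding D y_def[symmetric] y'_def[symmetric] p_def[symmetric] by (simp add: power2_eq_square algebra_simps)
  have yp: "y \<noteq> 0" using y by (simp add: y_def)
  have pv: "p = Y0sq_drift (y * y) * v + Y0sq_rem \<omega>" by (simp add: p_def Y0sq_drift_inc_def z)
  have gy: "2 * y * Y0_drift y = Y0sq_drift (y * y) - \<nu>\<^sup>2 * (1 - y * y)"
    using yp by (simp add: Y0_drift_def Y0sq_drift_def field_simps power2_eq_square)
  have sq: "sqn d (X s \<omega>) = 1 - y * y" using z by (simp add: Y0sq_def)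
  have r: "Y0_rem \<omega> = Y0_drift_inc \<omega> - Y0_drift y * v" by (simp add: Y0_rem_def y_def)
  have d2: "y' - y = Y0_drift_inc \<omega> - \<nu> * V" by (simp add: D)
  have "2 * y * Y0_rem \<omega> = 2 * y * Y0_drift_inc \<omega> - (2 * y * Y0_drift y) * v" by (simp add: r algebra_simps)
  also have "2 * y * Y0_drift_inc \<omega> = p - (Y0_drift_inc \<omega> - \<nu> * V)\<^sup>2" using 1 unfolding y_def[symmetric] y'_def[symmetric] p_def[symmetric] d2 .
  finally show "2 * Y0 s \<omega> * Y0_rem \<omega> = Y0sq_rem \<omega> - \<nu>\<^sup>2 * ((radial_noise \<omega>)\<^sup>2 - v * sqn d (X s \<omega>)) - (Y0_drift_inc \<omega>)\<^sup>2 + 2 * \<nu> * (Y0_drift_inc \<omega> * radial_noise \<omega>)"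
    unfolding gy pv sq y_def[symmetric] V_def[symmetric] by (simp add: power2_eq_square algebra_simps)
qed

text \<open>The quadratic correction is controlled by
  \<open>y * \<bar>y' - y\<bar> \<le> \<bar>y' * y' - y * y\<bar>\<close>, which trades increments
  of \<open>Y0\<close> for increments of its square. Altogether four inverse powers of
  \<open>Y0\<close> are spent, two of them on the division by \<open>2 * Y0\<close>.\<close>

lemma Y0_drift_inc_sq_le:
  assumes \<omega>: "\<omega> \<in> space M" and y: "0 < Y0 s \<omega>"
  shows "(Y0_drift_inc \<omega>)\<^sup>2 \<le> (1 / Y0 s \<omega> ^ 4) * (5 * (Y0sq_drift_inc \<omega>)\<^sup>2 + 64 * \<nu> ^ 4 * radial_noise \<omega> ^ 4)"
proof -
  define y y' V p where "y = Y0 s \<omega>" and "y' = Y0 t \<omega>" and "V = radial_noise \<omega>" and "p = Y0sq_drift_inc \<omega>"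
  define \<theta> where "\<theta> = y' - y"
  have y: "0 < y" "y \<le> 1" using y Y0s(2) by (auto simp: y_def)
  have y': "0 \<le> y'" "y' \<le> 1" using Y0t \<omega> by (auto simp: y'_def)
  have D: "2 * y * Y0_drift_inc \<omega> = p - \<theta>\<^sup>2" using Y0_drift_inc_eq(1)[OF assms] by (simp add: \<theta>_def y_def y'_def p_def)
  have z: "Y0sq s \<omega> = y * y" "Y0sq t \<omega> = y' * y'" using Y0s_sq[OF \<omega>] Y0t_sq[OF \<omega>] by (simp_all add: y_def y'_def power2_eq_square)
  have st: "y' * y' - y * y = - 2 * \<nu> * y * V + p" using Y0sq_step[of \<omega>] unfolding z y_def[symmetric] V_def[symmetric] p_def[symmetric] .
  have "y * \<bar>\<theta>\<bar> \<le> (y' + y) * \<bar>\<theta>\<bar>" using y' by (intro mult_right_mono) auto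
  also have "\<dots> = \<bar>(y' + y) * \<theta>\<bar>" using y y' by (simp add: abs_mult)
  also have "(y' + y) * \<theta> = y' * y' - y * y" by (simp add: \<theta>_def algebra_simps)
  finally have 1: "y * \<bar>\<theta>\<bar> \<le> 2 * \<nu> * y * \<bar>V\<bar> + \<bar>p\<bar>"
    unfolding st using abs_triangle_ineq[of "- 2 * \<nu> * y * V" p] nu y by (simp add: abs_mult)
  \<comment> \<open>Only the square of \<open>p\<close> has a usable moment. If
    \<open>\<bar>p\<bar> \<le> y\<close>, then \<open>p ^ 4\<close> is at most
    \<open>y\<^sup>2 * p\<^sup>2\<close>; otherwise \<open>\<bar>\<theta>\<bar> \<le> 1\<close> and
    \<open>y\<^sup>2 \<le> p\<^sup>2\<close> give the bound without the expansion.\<close>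
  have yth: "y ^ 4 * \<theta> ^ 4 \<le> 8 * (2 * \<nu> * y * \<bar>V\<bar>) ^ 4 + 8 * y\<^sup>2 * p\<^sup>2"
  proof (cases "\<bar>p\<bar> \<le> y")
    case True
    have sq: "(a + b)\<^sup>2 \<le> 2 * a\<^sup>2 + 2 * b\<^sup>2" for a b :: real using zero_le_power2[of "a - b"] by (simp add: power2_sum power2_diff)
    have p4: "(a + b) ^ 4 \<le> 8 * a ^ 4 + 8 * b ^ 4" for a b :: real
    proof -
      have "(a + b) ^ 4 = ((a + b)\<^sup>2)\<^sup>2" by simp
      also have "\<dots> \<le> (2 * a\<^sup>2 + 2 * b\<^sup>2)\<^sup>2" by (rule power_mono[OF sq]) simp
      also have "\<dots> \<le> 2 * (2 * a\<^sup>2)\<^sup>2 + 2 * (2 * b\<^sup>2)\<^sup>2" by (rule sq)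
      finally show ?thesis by (simp add: power_mult_distrib)
    qed
    have "y ^ 4 * \<theta> ^ 4 = (y * \<bar>\<theta>\<bar>) ^ 4" by (simp add: power_mult_distrib)
    also have "\<dots> \<le> (2 * \<nu> * y * \<bar>V\<bar> + \<bar>p\<bar>) ^ 4" using 1 y by (intro power_mono) auto
    also have "\<dots> \<le> 8 * (2 * \<nu> * y * \<bar>V\<bar>) ^ 4 + 8 * \<bar>p\<bar> ^ 4" by (rule p4)
    also have "\<bar>p\<bar> ^ 4 = p\<^sup>2 * p\<^sup>2" by (simp add: power4_eq_xxxx power2_eq_square)
    also have "p\<^sup>2 * p\<^sup>2 \<le> y\<^sup>2 * p\<^sup>2" using True y by (intro mult_right_mono abs_le_square_iff[THEN iffD1]) auto
    finally show ?thesis by simp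
  next
    case False
    have th1: "\<bar>\<theta>\<bar> \<le> 1" using y y' by (simp add: \<theta>_def)
    have "\<theta> ^ 4 = \<bar>\<theta>\<bar> ^ 4" by simp
    also have "\<dots> \<le> 1" using th1 by (intro power_le_one) auto
    finally have "y ^ 4 * \<theta> ^ 4 \<le> y ^ 4 * 1" by (intro mult_left_mono) auto
    also have "y ^ 4 * 1 = y\<^sup>2 * y\<^sup>2" by (simp add: power4_eq_xxxx power2_eq_square)
    also have "\<dots> \<le> y\<^sup>2 * p\<^sup>2" using False y by (intro mult_left_mono abs_le_square_iff[THEN iffD1]) auto
    finally have a: "y ^ 4 * \<theta> ^ 4 \<le> y\<^sup>2 * p\<^sup>2" .
    have "0 \<le> (2 * \<nu> * y * \<bar>V\<bar>) ^ 4" "0 \<le> y\<^sup>2 * p\<^sup>2" by simp_all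
    then show ?thesis using a by linarith
  qed
  have "4 * y\<^sup>2 * (Y0_drift_inc \<omega>)\<^sup>2 = (p - \<theta>\<^sup>2)\<^sup>2" unfolding D[symmetric] by (simp add: power_mult_distrib)
  also have "\<dots> \<le> 2 * p\<^sup>2 + 2 * \<theta> ^ 4"
  proof -
    have "0 \<le> (p + \<theta>\<^sup>2)\<^sup>2" by simp
    then show ?thesis by (simp add: power2_sum power2_diff)
  qed
  finally have "y\<^sup>2 * (4 * y\<^sup>2 * (Y0_drift_inc \<omega>)\<^sup>2) \<le> y\<^sup>2 * (2 * p\<^sup>2 + 2 * \<theta> ^ 4)" by (intro mult_left_mono) auto
  then have "y\<^sup>2 * (y\<^sup>2 * (4 * y\<^sup>2 * (Y0_drift_inc \<omega>)\<^sup>2)) \<le> y\<^sup>2 * (y\<^sup>2 * (2 * p\<^sup>2 + 2 * \<theta> ^ 4))" by (rule mult_left_mono) simp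
  also have "\<dots> = 2 * y ^ 4 * p\<^sup>2 + 2 * (y ^ 4 * \<theta> ^ 4)" by (simp add: power4_eq_xxxx power2_eq_square algebra_simps)
  also have "\<dots> \<le> 2 * y ^ 4 * p\<^sup>2 + 2 * (8 * (2 * \<nu> * y * \<bar>V\<bar>) ^ 4 + 8 * y\<^sup>2 * p\<^sup>2)" using yth by simp
  also have "\<dots> = y\<^sup>2 * (2 * y\<^sup>2 * p\<^sup>2 + 16 * p\<^sup>2 + y\<^sup>2 * (256 * \<nu> ^ 4 * V ^ 4))" by (simp add: power_mult_distrib power4_eq_xxxx power2_eq_square algebra_simps)
  also have "\<dots> \<le> y\<^sup>2 * (4 * (5 * p\<^sup>2 + 64 * \<nu> ^ 4 * V ^ 4))"
  proof (rule mult_left_mono)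
    have y2: "y\<^sup>2 \<le> 1" using y by (simp add: power_le_one)
    have "y\<^sup>2 * p\<^sup>2 \<le> 1 * p\<^sup>2" using y2 by (intro mult_right_mono) auto
    moreover have "y\<^sup>2 * (256 * \<nu> ^ 4 * V ^ 4) \<le> 1 * (256 * \<nu> ^ 4 * V ^ 4)" using y2 by (intro mult_right_mono) auto
    ultimately show "2 * y\<^sup>2 * p\<^sup>2 + 16 * p\<^sup>2 + y\<^sup>2 * (256 * \<nu> ^ 4 * V ^ 4) \<le> 4 * (5 * p\<^sup>2 + 64 * \<nu> ^ 4 * V ^ 4)"
      using zero_le_power2[of p] unfolding distrib_left by linarith
  qed simp
  finally have "(4 * y\<^sup>2) * (y ^ 4 * (Y0_drift_inc \<omega>)\<^sup>2) \<le> (4 * y\<^sup>2) * (5 * p\<^sup>2 + 64 * \<nu> ^ 4 * V ^ 4)"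
    by (simp add: power4_eq_xxxx power2_eq_square ac_simps)
  then have "y ^ 4 * (Y0_drift_inc \<omega>)\<^sup>2 \<le> 5 * p\<^sup>2 + 64 * \<nu> ^ 4 * V ^ 4" using y by (subst (asm) mult_le_cancel_left_pos) auto
  then show ?thesis using y unfolding y_def[symmetric] V_def[symmetric] p_def[symmetric] by (simp add: field_simps)
qed

lemma Y0_drift_inc_weighted:
  assumes pos: "AE \<omega> in M. 0 < Y0 s \<omega>"
    and h: "h \<in> borel_measurable (G s)" "\<And>\<omega>. \<omega> \<in> space M \<Longrightarrow> 0 \<le> h \<omega>" "integrable M (\<lambda>\<omega>. h \<omega> / Y0 s \<omega> ^ 4)"
  shows "integrable M (\<lambda>\<omega>. h \<omega> * (Y0_drift_inc \<omega>)\<^sup>2)" "(LINT \<omega>|M. h \<omega> * (Y0_drift_inc \<omega>)\<^sup>2) \<le> C9 * w ^ 6 * (LINT \<omega>|M. h \<omega> / Y0 s \<omega> ^ 4)"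
proof -
  have hM [measurable]: "h \<in> borel_measurable M" using measurable_G_M[OF h(1) s0] .
  have [measurable]: "h \<in> borel_measurable (G s)" by fact
  let ?Z = "\<lambda>\<omega>. 5 * (Y0sq_drift_inc \<omega>)\<^sup>2 + 64 * \<nu> ^ 4 * radial_noise \<omega> ^ 4"
  have c: "cond_le M (G s) ?Z (5 * (C6 * w ^ 6) + 64 * \<nu> ^ 4 * ((3 * noise_dim ^ 4) * wmax\<^sup>2 * w ^ 6))"
    using nu noise_dim by (intro cond_le_add[OF subalgebra_Gs] cond_le_cmult[OF subalgebra_Gs] Y0sq_drift_inc_cond_sq cond_le_w6 radial_noise_4) auto
  have e: "5 * (C6 * w ^ 6) + 64 * \<nu> ^ 4 * ((3 * noise_dim ^ 4) * wmax\<^sup>2 * w ^ 6) = C9 * w ^ 6" by (simp add: C9_def algebra_simps)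
  note I = cond_le_integral[OF subalgebra_Gs c[unfolded e], of "\<lambda>\<omega>. h \<omega> / Y0 s \<omega> ^ 4"]
  have nn: "0 \<le> h \<omega> / Y0 s \<omega> ^ 4" if "\<omega> \<in> space M" for \<omega> using h(2) that by simp
  have m: "(\<lambda>\<omega>. h \<omega> / Y0 s \<omega> ^ 4) \<in> borel_measurable (G s)" by measurable
  have i: "integrable M (\<lambda>\<omega>. h \<omega> / Y0 s \<omega> ^ 4 * ?Z \<omega>)" and le: "(LINT \<omega>|M. h \<omega> / Y0 s \<omega> ^ 4 * ?Z \<omega>) \<le> C9 * w ^ 6 * (LINT \<omega>|M. h \<omega> / Y0 s \<omega> ^ 4)"
    using I[OF m h(3) nn] by blast+
  have ae: "AE \<omega> in M. h \<omega> * (Y0_drift_inc \<omega>)\<^sup>2 \<le> h \<omega> / Y0 s \<omega> ^ 4 * ?Z \<omega>"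
    using pos AE_space
  proof eventually_elim
    case (elim \<omega>)
    have "h \<omega> * (Y0_drift_inc \<omega>)\<^sup>2 \<le> h \<omega> * ((1 / Y0 s \<omega> ^ 4) * ?Z \<omega>)" using Y0_drift_inc_sq_le[OF elim(2,1)] h(2) elim by (intro mult_left_mono) auto
    then show ?case by simp
  qed
  show i1: "integrable M (\<lambda>\<omega>. h \<omega> * (Y0_drift_inc \<omega>)\<^sup>2)"
    by (rule Bochner_Integration.integrable_bound[OF i]) (use ae AE_space in \<open>auto elim!: eventually_elim2 simp: h(2)\<close>)
  show "(LINT \<omega>|M. h \<omega> * (Y0_drift_inc \<omega>)\<^sup>2) \<le> C9 * w ^ 6 * (LINT \<omega>|M. h \<omega> / Y0 s \<omega> ^ 4)"
    using integral_mono_AE[OF i1 i ae] le by linarith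
qed

text \<open>Divided by \<open>2 * Y0\<close>, the identity for \<open>Y0_rem\<close> has four terms:
  the remainder of \<open>Y0sq\<close>, a centred noise term that integrates to 0, the square of
  \<open>Y0_drift_inc\<close> and its product with the noise. The last two cost most: one inverse
  power from the division and four from \<open>Y0_drift_inc_sq_le\<close>, whence
  \<open>Y0 ^ 5\<close>. The order \<open>w ^ 5\<close> is set by the product, again split with
  weight \<open>w\<close>.\<close>

lemma Y0_rem_weak:
  assumes pos: "AE \<omega> in M. 0 < Y0 s \<omega>"
    and h: "h \<in> borel_measurable (G s)" "integrable M (\<lambda>\<omega>. h \<omega> / Y0 s \<omega> ^ 5)"
  shows "integrable M (\<lambda>\<omega>. h \<omega> * Y0_rem \<omega>)" "\<bar>LINT \<omega>|M. h \<omega> * Y0_rem \<omega>\<bar> \<le> C10 * w ^ 5 * (LINT \<omega>|M. \<bar>h \<omega>\<bar> / Y0 s \<omega> ^ 5)"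
proof -
  have hM [measurable]: "h \<in> borel_measurable M" using measurable_G_M[OF h(1) s0] .
  have [measurable]: "h \<in> borel_measurable (G s)" by fact
  let ?J = "LINT \<omega>|M. \<bar>h \<omega>\<bar> / Y0 s \<omega> ^ 5"
  let ?h = "\<lambda>\<omega>. h \<omega> / Y0 s \<omega>"
  have absh: "integrable M (\<lambda>\<omega>. \<bar>h \<omega>\<bar> / Y0 s \<omega> ^ 5)"
    by (rule Bochner_Integration.integrable_bound[OF integrable_abs[OF h(2)]]) (use Y0s in auto)
  have hle: "\<bar>?h \<omega>\<bar> \<le> \<bar>h \<omega>\<bar> / Y0 s \<omega> ^ 5" if "\<omega> \<in> space M" for \<omega>
  proof (cases "Y0 s \<omega> = 0")
    case False
    then have y: "0 < Y0 s \<omega>" "Y0 s \<omega> \<le> 1" using Y0s that by (auto simp: less_le)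
    have "Y0 s \<omega> ^ 5 \<le> Y0 s \<omega> ^ 1" using y by (intro power_decreasing) auto
    then have "\<bar>h \<omega>\<bar> / Y0 s \<omega> \<le> \<bar>h \<omega>\<bar> / Y0 s \<omega> ^ 5" using y by (intro divide_left_mono) auto
    then show ?thesis using y by simp
  qed simp
  have hi: "integrable M ?h" by (rule Bochner_Integration.integrable_bound[OF absh]) (use hle Y0s in \<open>auto intro!: AE_I2 order_trans[OF hle]\<close>)
  have hJ: "(LINT \<omega>|M. \<bar>?h \<omega>\<bar>) \<le> ?J" by (intro integral_mono integrable_abs hi absh hle)
  have J0: "0 \<le> ?J" using Y0s by (intro integral_nonneg_AE AE_I2) auto
  have hG: "?h \<in> borel_measurable (G s)" by measurable
  have q1: "integrable M (\<lambda>\<omega>. ?h \<omega> * Y0sq_rem \<omega>)" and q2: "\<bar>LINT \<omega>|M. ?h \<omega> * Y0sq_rem \<omega>\<bar> \<le> C5 * w ^ 5 * (LINT \<omega>|M. \<bar>?h \<omega>\<bar>)"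
    using cond_abs_le_L1[OF subalgebra_Gs prob_space_M Y0sq_rem_cond_mean Y0sq_rem_cond_sq hG hi] by blast+
  have habs: "(\<lambda>\<omega>. \<bar>?h \<omega>\<bar>) \<in> borel_measurable (G s)" by measurable
  have V2i: "integrable M (\<lambda>\<omega>. \<bar>?h \<omega>\<bar> * (radial_noise \<omega>)\<^sup>2)" and V2le: "(LINT \<omega>|M. \<bar>?h \<omega>\<bar> * (radial_noise \<omega>)\<^sup>2) \<le> noise_dim\<^sup>2 * w ^ 4 * (LINT \<omega>|M. \<bar>?h \<omega>\<bar>)"
    using cond_le_integral[OF subalgebra_Gs radial_noise_2 habs integrable_abs[OF hi]] by simp_all
  have sqm [measurable]: "(\<lambda>\<omega>. sqn d (X s \<omega>)) \<in> borel_measurable M" using XsM by (intro sqn_meas) auto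
  have v1: "integrable M (\<lambda>\<omega>. ?h \<omega> * ((radial_noise \<omega>)\<^sup>2 - v * sqn d (X s \<omega>)))"
  proof (rule Bochner_Integration.integrable_bound[OF Bochner_Integration.integrable_add[OF V2i integrable_mult_right[OF integrable_abs[OF hi], of v]]])
    show "AE \<omega> in M. norm (?h \<omega> * ((radial_noise \<omega>)\<^sup>2 - v * sqn d (X s \<omega>))) \<le> norm (\<bar>?h \<omega>\<bar> * (radial_noise \<omega>)\<^sup>2 + v * \<bar>?h \<omega>\<bar>)"
    proof (rule AE_I2)
      fix \<omega> assume \<omega>: "\<omega> \<in> space M"
      have a: "0 \<le> v * sqn d (X s \<omega>)" "v * sqn d (X s \<omega>) \<le> v * 1" using v sqn_nonneg sqn_Xs_le_1[OF \<omega>] by (auto intro!: mult_left_mono mult_nonneg_nonneg)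
      have "\<bar>(radial_noise \<omega>)\<^sup>2 - v * sqn d (X s \<omega>)\<bar> \<le> (radial_noise \<omega>)\<^sup>2 + v" using a zero_le_power2[of "radial_noise \<omega>"] unfolding abs_le_iff by (intro conjI; linarith)
      then have "\<bar>?h \<omega>\<bar> * \<bar>(radial_noise \<omega>)\<^sup>2 - v * sqn d (X s \<omega>)\<bar> \<le> \<bar>?h \<omega>\<bar> * ((radial_noise \<omega>)\<^sup>2 + v)" by (intro mult_left_mono) auto
      also have "\<dots> = \<bar>\<bar>?h \<omega>\<bar> * (radial_noise \<omega>)\<^sup>2 + v * \<bar>?h \<omega>\<bar>\<bar>" using v by (simp add: distrib_left abs_of_nonneg mult.commute[of v])
      finally show "norm (?h \<omega> * ((radial_noise \<omega>)\<^sup>2 - v * sqn d (X s \<omega>))) \<le> norm (\<bar>?h \<omega>\<bar> * (radial_noise \<omega>)\<^sup>2 + v * \<bar>?h \<omega>\<bar>)"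
        unfolding real_norm_def abs_mult[of "?h \<omega>"] .
    qed
  qed measurable
  have v2: "(LINT \<omega>|M. ?h \<omega> * ((radial_noise \<omega>)\<^sup>2 - v * sqn d (X s \<omega>))) = 0"
    using cond_abs_le_integral[OF subalgebra_Gs prob_space_M radial_noise_c2 hG hi v1] by simp
  have eq5: "(\<lambda>\<omega>. \<bar>?h \<omega>\<bar> / Y0 s \<omega> ^ 4) \<in> borel_measurable M" by measurable
  have e5: "\<bar>?h \<omega>\<bar> / Y0 s \<omega> ^ 4 = \<bar>h \<omega>\<bar> / Y0 s \<omega> ^ 5" if "\<omega> \<in> space M" for \<omega>
    using Y0s(1)[OF that] by (simp add: eval_nat_numeral)
  have i5: "integrable M (\<lambda>\<omega>. \<bar>?h \<omega>\<bar> / Y0 s \<omega> ^ 4)"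
  proof -
    have "integrable M (\<lambda>\<omega>. \<bar>?h \<omega>\<bar> / Y0 s \<omega> ^ 4) \<longleftrightarrow> integrable M (\<lambda>\<omega>. \<bar>h \<omega>\<bar> / Y0 s \<omega> ^ 5)"
      by (intro Bochner_Integration.integrable_cong refl e5)
    then show ?thesis using absh by blast
  qed
  have I5: "(LINT \<omega>|M. \<bar>?h \<omega>\<bar> / Y0 s \<omega> ^ 4) = ?J" by (intro Bochner_Integration.integral_cong e5) auto
  have Di: "integrable M (\<lambda>\<omega>. \<bar>?h \<omega>\<bar> * (Y0_drift_inc \<omega>)\<^sup>2)" and Dle: "(LINT \<omega>|M. \<bar>?h \<omega>\<bar> * (Y0_drift_inc \<omega>)\<^sup>2) \<le> C9 * w ^ 6 * ?J"
    using Y0_drift_inc_weighted[OF pos habs _ i5] unfolding I5 by auto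
  have D2i: "integrable M (\<lambda>\<omega>. ?h \<omega> * (Y0_drift_inc \<omega>)\<^sup>2)"
    by (rule Bochner_Integration.integrable_bound[OF Di]) (auto simp: abs_mult)
  have D2le: "\<bar>LINT \<omega>|M. ?h \<omega> * (Y0_drift_inc \<omega>)\<^sup>2\<bar> \<le> C9 * w ^ 6 * ?J"
    using integral_abs_bound[of M "\<lambda>\<omega>. ?h \<omega> * (Y0_drift_inc \<omega>)\<^sup>2"] Dle by (simp add: abs_mult)
  have DVb: "\<bar>?h \<omega> * (Y0_drift_inc \<omega> * radial_noise \<omega>)\<bar> \<le> w * (\<bar>?h \<omega>\<bar> * (radial_noise \<omega>)\<^sup>2) + (1 / w) * (\<bar>?h \<omega>\<bar> * (Y0_drift_inc \<omega>)\<^sup>2)" for \<omega>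
  proof -
    have "0 \<le> (w * \<bar>radial_noise \<omega>\<bar> - \<bar>Y0_drift_inc \<omega>\<bar>)\<^sup>2 / w" using w by simp
    also have "\<dots> = w * (radial_noise \<omega>)\<^sup>2 + (1 / w) * (Y0_drift_inc \<omega>)\<^sup>2 - 2 * (\<bar>Y0_drift_inc \<omega>\<bar> * \<bar>radial_noise \<omega>\<bar>)"
      unfolding power2_diff power_mult_distrib power2_abs using w by (simp add: add_divide_distrib diff_divide_distrib power2_eq_square)
    finally have "\<bar>Y0_drift_inc \<omega> * radial_noise \<omega>\<bar> \<le> w * (radial_noise \<omega>)\<^sup>2 + (1 / w) * (Y0_drift_inc \<omega>)\<^sup>2" unfolding abs_mult using mult_nonneg_nonneg[of "\<bar>Y0_drift_inc \<omega>\<bar>" "\<bar>radial_noise \<omega>\<bar>"] by linarith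
    then have "\<bar>?h \<omega>\<bar> * \<bar>Y0_drift_inc \<omega> * radial_noise \<omega>\<bar> \<le> \<bar>?h \<omega>\<bar> * (w * (radial_noise \<omega>)\<^sup>2 + (1 / w) * (Y0_drift_inc \<omega>)\<^sup>2)" by (intro mult_left_mono) auto
    also have "\<dots> = w * (\<bar>?h \<omega>\<bar> * (radial_noise \<omega>)\<^sup>2) + (1 / w) * (\<bar>?h \<omega>\<bar> * (Y0_drift_inc \<omega>)\<^sup>2)" by (simp only: distrib_left mult.left_commute)
    finally show ?thesis unfolding abs_mult[of "?h \<omega>"] .
  qed
  have DVi0: "integrable M (\<lambda>\<omega>. w * (\<bar>?h \<omega>\<bar> * (radial_noise \<omega>)\<^sup>2) + (1 / w) * (\<bar>?h \<omega>\<bar> * (Y0_drift_inc \<omega>)\<^sup>2))"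
    by (intro Bochner_Integration.integrable_add integrable_mult_right V2i Di)
  have DVi: "integrable M (\<lambda>\<omega>. ?h \<omega> * (Y0_drift_inc \<omega> * radial_noise \<omega>))"
  proof (rule Bochner_Integration.integrable_bound[OF DVi0])
    show "AE \<omega> in M. norm (?h \<omega> * (Y0_drift_inc \<omega> * radial_noise \<omega>)) \<le> norm (w * (\<bar>?h \<omega>\<bar> * (radial_noise \<omega>)\<^sup>2) + (1 / w) * (\<bar>?h \<omega>\<bar> * (Y0_drift_inc \<omega>)\<^sup>2))"
      unfolding real_norm_def by (intro AE_I2 order_trans[OF DVb abs_ge_self])
  qed measurable
  have DVle: "\<bar>LINT \<omega>|M. ?h \<omega> * (Y0_drift_inc \<omega> * radial_noise \<omega>)\<bar> \<le> (noise_dim\<^sup>2 + C9) * w ^ 5 * ?J"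
  proof -
    have "\<bar>LINT \<omega>|M. ?h \<omega> * (Y0_drift_inc \<omega> * radial_noise \<omega>)\<bar> \<le> (LINT \<omega>|M. \<bar>?h \<omega> * (Y0_drift_inc \<omega> * radial_noise \<omega>)\<bar>)" by (rule integral_abs_bound)
    also have "\<dots> \<le> (LINT \<omega>|M. w * (\<bar>?h \<omega>\<bar> * (radial_noise \<omega>)\<^sup>2) + (1 / w) * (\<bar>?h \<omega>\<bar> * (Y0_drift_inc \<omega>)\<^sup>2))"
      by (intro integral_mono integrable_abs DVi DVi0 DVb)
    also have "\<dots> = w * (LINT \<omega>|M. \<bar>?h \<omega>\<bar> * (radial_noise \<omega>)\<^sup>2) + (1 / w) * (LINT \<omega>|M. \<bar>?h \<omega>\<bar> * (Y0_drift_inc \<omega>)\<^sup>2)"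
      by (simp only: Bochner_Integration.integral_add[OF integrable_mult_right[OF V2i] integrable_mult_right[OF Di]] integral_mult_right_zero)
    also have "\<dots> \<le> w * (noise_dim\<^sup>2 * w ^ 4 * ?J) + (1 / w) * (C9 * w ^ 6 * ?J)"
    proof (intro add_mono mult_left_mono)
      have "noise_dim\<^sup>2 * w ^ 4 * (LINT \<omega>|M. \<bar>?h \<omega>\<bar>) \<le> noise_dim\<^sup>2 * w ^ 4 * ?J" using hJ by (intro mult_left_mono) auto
      then show "(LINT \<omega>|M. \<bar>?h \<omega>\<bar> * (radial_noise \<omega>)\<^sup>2) \<le> noise_dim\<^sup>2 * w ^ 4 * ?J" using V2le by linarith
    qed (use w Dle in auto)
    also have "\<dots> = (noise_dim\<^sup>2 + C9) * w ^ 5 * ?J"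
    proof -
      have "w * (noise_dim\<^sup>2 * w ^ 4 * ?J) = noise_dim\<^sup>2 * w ^ 5 * ?J" by (simp add: power_add[of w 4 1, simplified])
      moreover have "(1 / w) * (C9 * w ^ 6 * ?J) = C9 * w ^ 5 * ?J" using w by (simp add: power_add[of w 5 1, simplified])
      ultimately show ?thesis by (simp only: distrib_right)
    qed
    finally show ?thesis .
  qed
  let ?R = "\<lambda>\<omega>. (1/2) * (?h \<omega> * Y0sq_rem \<omega>) - (\<nu>\<^sup>2 / 2) * (?h \<omega> * ((radial_noise \<omega>)\<^sup>2 - v * sqn d (X s \<omega>))) - (1/2) * (?h \<omega> * (Y0_drift_inc \<omega>)\<^sup>2) + \<nu> * (?h \<omega> * (Y0_drift_inc \<omega> * radial_noise \<omega>))"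
  have Ri: "integrable M ?R"
    by (intro Bochner_Integration.integrable_add Bochner_Integration.integrable_diff integrable_mult_right q1 v1 D2i DVi)
  have ae: "AE \<omega> in M. h \<omega> * Y0_rem \<omega> = ?R \<omega>"
    using pos AE_space
  proof eventually_elim
    case (elim \<omega>)
    have "h \<omega> * Y0_rem \<omega> = ?h \<omega> / 2 * (2 * Y0 s \<omega> * Y0_rem \<omega>)" using elim(1) by simp
    also have "\<dots> = ?R \<omega>" unfolding Y0_drift_inc_eq(2)[OF elim(2,1)] by (simp add: algebra_simps)
    finally show ?case .
  qed
  have hr [measurable]: "(\<lambda>\<omega>. h \<omega> * Y0_rem \<omega>) \<in> borel_measurable M" by measurable
  show "integrable M (\<lambda>\<omega>. h \<omega> * Y0_rem \<omega>)" using Ri by (subst integrable_cong_AE[OF hr _ ae]) auto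
  have "(LINT \<omega>|M. h \<omega> * Y0_rem \<omega>) = (LINT \<omega>|M. ?R \<omega>)" using Ri by (intro integral_cong_AE[OF hr _ ae]) auto
  also have "\<dots> = (1/2) * (LINT \<omega>|M. ?h \<omega> * Y0sq_rem \<omega>) - (\<nu>\<^sup>2 / 2) * (LINT \<omega>|M. ?h \<omega> * ((radial_noise \<omega>)\<^sup>2 - v * sqn d (X s \<omega>))) - (1/2) * (LINT \<omega>|M. ?h \<omega> * (Y0_drift_inc \<omega>)\<^sup>2) + \<nu> * (LINT \<omega>|M. ?h \<omega> * (Y0_drift_inc \<omega> * radial_noise \<omega>))"
  proof -
    note i1 = integrable_mult_right[OF q1, of "1/2"] and i2 = integrable_mult_right[OF v1, of "\<nu>\<^sup>2 / 2"]
      and i3 = integrable_mult_right[OF D2i, of "1/2"] and i4 = integrable_mult_right[OF DVi, of \<nu>]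
    note j2 = Bochner_Integration.integrable_diff[OF i1 i2] and j3 = Bochner_Integration.integrable_diff[OF Bochner_Integration.integrable_diff[OF i1 i2] i3]
    show ?thesis
      by (simp only: Bochner_Integration.integral_add[OF j3 i4] Bochner_Integration.integral_diff[OF j2 i3] Bochner_Integration.integral_diff[OF i1 i2] integral_mult_right_zero)
  qed
  finally have e: "(LINT \<omega>|M. h \<omega> * Y0_rem \<omega>) = (1/2) * (LINT \<omega>|M. ?h \<omega> * Y0sq_rem \<omega>) - (1/2) * (LINT \<omega>|M. ?h \<omega> * (Y0_drift_inc \<omega>)\<^sup>2) + \<nu> * (LINT \<omega>|M. ?h \<omega> * (Y0_drift_inc \<omega> * radial_noise \<omega>))"
    unfolding v2 by simp
  have b1: "\<bar>LINT \<omega>|M. ?h \<omega> * Y0sq_rem \<omega>\<bar> \<le> C5 * w ^ 5 * ?J"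
  proof -
    have "C5 * w ^ 5 * (LINT \<omega>|M. \<bar>?h \<omega>\<bar>) \<le> C5 * w ^ 5 * ?J" using hJ C5 w by (intro mult_left_mono) auto
    then show ?thesis using q2 by linarith
  qed
  have b2: "\<bar>LINT \<omega>|M. ?h \<omega> * (Y0_drift_inc \<omega>)\<^sup>2\<bar> \<le> C9 * wmax * w ^ 5 * ?J"
  proof -
    have "C9 * w ^ 6 * ?J \<le> C9 * (wmax * w ^ 5) * ?J" using w_pows(3) C9 J0 by (intro mult_right_mono mult_left_mono) auto
    then show ?thesis using D2le by (simp add: mult.assoc)
  qed
  have b3: "\<bar>\<nu> * (LINT \<omega>|M. ?h \<omega> * (Y0_drift_inc \<omega> * radial_noise \<omega>))\<bar> \<le> \<nu> * ((noise_dim\<^sup>2 + C9) * w ^ 5 * ?J)"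
    unfolding abs_mult using DVle nu by (simp add: mult_left_mono)
  have n: "0 \<le> C5 * w ^ 5 * ?J" "0 \<le> C9 * wmax * w ^ 5 * ?J" using C5 C9 wmax w J0 by simp_all
  have s: "C10 * w ^ 5 * ?J = C5 * w ^ 5 * ?J + C9 * wmax * w ^ 5 * ?J + \<nu> * ((noise_dim\<^sup>2 + C9) * w ^ 5 * ?J)"
    by (simp add: C10_def algebra_simps)
  show "\<bar>LINT \<omega>|M. h \<omega> * Y0_rem \<omega>\<bar> \<le> C10 * w ^ 5 * ?J"
    unfolding e s using b1 b2 b3 n by linarith
qed

end

section \<open>Inverse moments\<close>

lemma fourth_root_seq:
  assumes u: "0 < u"
  obtains W :: "nat \<Rightarrow> real" where "\<And>l. 0 < W l" "\<And>l. W l ^ 4 = u / real (Suc l)" "W \<longlonglongrightarrow> 0"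
proof
  let ?W = "\<lambda>l. root 4 (u / real (Suc l))"
  show "0 < ?W l" for l using u by simp
  show "?W l ^ 4 = u / real (Suc l)" for l using u by (intro real_root_pow_pos2) auto
  have "(\<lambda>l. u / real (Suc l)) \<longlonglongrightarrow> 0" by (rule LIMSEQ_Suc[OF lim_const_over_n])
  then have "?W \<longlonglongrightarrow> root 4 0" by (rule tendsto_real_root)
  then show "?W \<longlonglongrightarrow> 0" by simp
qed

text \<open>Used with the roots of \<open>fourth_root_seq\<close>: the outer quantities refer to
  fixed times and do not change under refinement, so every error with a factor \<open>W l\<close>
  may be dropped.\<close>

lemma le_limit_vanishing:
  fixes a b c :: real
  assumes "\<And>l. a \<le> b + c * W l" "W \<longlonglongrightarrow> 0"
  shows "a \<le> b"
proof -
  have "(\<lambda>l. b + c * W l) \<longlonglongrightarrow> b + c * 0" by (intro tendsto_intros assms)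
  then show ?thesis using assms(1) by (intro LIMSEQ_le_const[of "\<lambda>l. b + c * W l"]) auto
qed

definition falling_factor :: "real \<Rightarrow> nat \<Rightarrow> real" where "falling_factor a n = (\<Prod>i<n. a - real i)"

text \<open>The shift by \<open>e\<close> keeps the third derivative bounded on the unit interval.
  Its bound explodes as \<open>e\<close> tends to 0, which is why the mesh has to vanish before
  \<open>e\<close> does.\<close>

lemma powr_taylor3:
  fixes a e z z' :: real
  assumes e: "0 < e" and z: "0 \<le> z" "z \<le> 1" "0 \<le> z'" "z' \<le> 1" and a: "a \<le> 0"
  shows "\<bar>(z' + e) powr a - (z + e) powr a - a * (z + e) powr (a - 1) * (z' - z) - (a * (a - 1) * (z + e) powr (a - 2)) / 2 * (z' - z)\<^sup>2\<bar>
     \<le> \<bar>a * (a - 1) * (a - 2)\<bar> * e powr (a - 3) * \<bar>z' - z\<bar> ^ 3"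
proof (cases "z' = z")
  case False
  let ?diff = "\<lambda>n x. falling_factor a n * (x + e) powr (a - real n)"
  have D: "\<forall>n t. n < 3 \<and> 0 \<le> t \<and> t \<le> 1 \<longrightarrow> DERIV (?diff n) t :> ?diff (Suc n) t"
  proof (intro allI impI)
    fix n :: nat and t :: real assume "n < 3 \<and> 0 \<le> t \<and> t \<le> 1"
    then have "0 < t + e" using e by auto
    then show "DERIV (?diff n) t :> ?diff (Suc n) t"
      by (auto intro!: derivative_eq_intros simp: falling_factor_def algebra_simps)
  qed
  have "\<exists>t. (if z' < z then z' < t \<and> t < z else z < t \<and> t < z') \<and>
        (z' + e) powr a = (\<Sum>m<3. (?diff m z / fact m) * (z' - z) ^ m) + (?diff 3 t / fact 3) * (z' - z) ^ 3"
    by (rule Taylor[OF _ _ D]) (use z False in \<open>auto simp: falling_factor_def\<close>)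
  then obtain t where t: "if z' < z then z' < t \<and> t < z else z < t \<and> t < z'"
    and eq: "(z' + e) powr a = (\<Sum>m<3. (?diff m z / fact m) * (z' - z) ^ m) + (?diff 3 t / fact 3) * (z' - z) ^ 3" by blast
  have t0: "0 \<le> t" using t z by (auto split: if_splits)
  have s: "(\<Sum>m<3. (?diff m z / fact m) * (z' - z) ^ m) = (z + e) powr a + a * (z + e) powr (a - 1) * (z' - z) + (a * (a - 1) * (z + e) powr (a - 2)) / 2 * (z' - z)\<^sup>2"
    by (simp add: eval_nat_numeral falling_factor_def)
  have "(z' + e) powr a - (z + e) powr a - a * (z + e) powr (a - 1) * (z' - z) - (a * (a - 1) * (z + e) powr (a - 2)) / 2 * (z' - z)\<^sup>2
    = (?diff 3 t / fact 3) * (z' - z) ^ 3" unfolding eq s by simp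
  also have "\<bar>\<dots>\<bar> = \<bar>falling_factor a 3\<bar> * (t + e) powr (a - 3) / 6 * \<bar>z' - z\<bar> ^ 3"
    by (simp add: abs_mult power_abs fact_numeral)
  also have "\<dots> \<le> \<bar>a * (a - 1) * (a - 2)\<bar> * e powr (a - 3) * \<bar>z' - z\<bar> ^ 3"
  proof (intro mult_right_mono)
    have p: "falling_factor a 3 = a * (a - 1) * (a - 2)" by (simp add: falling_factor_def eval_nat_numeral)
    have "(t + e) powr (a - 3) \<le> e powr (a - 3)" using e t0 a by (intro powr_mono2') auto
    then have "\<bar>falling_factor a 3\<bar> * (t + e) powr (a - 3) \<le> \<bar>falling_factor a 3\<bar> * e powr (a - 3)" by (intro mult_left_mono) auto
    moreover have "0 \<le> \<bar>falling_factor a 3\<bar> * (t + e) powr (a - 3)" by simp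
    ultimately show "\<bar>falling_factor a 3\<bar> * (t + e) powr (a - 3) / 6 \<le> \<bar>a * (a - 1) * (a - 2)\<bar> * e powr (a - 3)" unfolding p by linarith
  qed simp
  finally show ?thesis .
qed simp

context sde begin

lemma sde_step_I: "0 < w \<Longrightarrow> real (Suc k) * w ^ 4 \<le> T \<Longrightarrow> sde_step M F d m T \<kappa> \<nu> AA B X x0 w k"
  using sde_axioms by (auto simp: sde_step_def sde_step_axioms_def)

text \<open>Generator of the diffusion \<open>Y0sq\<close>, applied to the function sending
  \<open>z\<close> to \<open>(z + e) powr a\<close>.\<close>

definition powr_generator :: "real \<Rightarrow> real \<Rightarrow> real \<Rightarrow> real" where
  "powr_generator a e z = a * (z + e) powr (a - 1) * Y0sq_drift z + 2 * \<nu>\<^sup>2 * z * (1 - z) * (a * (a - 1) * (z + e) powr (a - 2))"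

definition CL :: "real \<Rightarrow> real" where "CL a = \<bar>a\<bar> * Kb + 2 * \<nu>\<^sup>2 * \<bar>a * (a - 1)\<bar>"

lemma CL: "0 \<le> CL a" using Kb by (simp add: CL_def)

lemma powr_shift: "0 < e \<Longrightarrow> 0 \<le> z \<Longrightarrow> (z + e) powr (a + 1) = (z + e) * (z + e) powr (a::real)"
  by (simp add: powr_add)

text \<open>The second-order coefficient vanishes linearly at \<open>z = 0\<close> and so
  compensates one of the two inverse powers produced by differentiating twice; the generator
  therefore lowers the exponent by 1 only.\<close>

lemma powr_generator_abs:
  assumes z: "0 \<le> z" "z \<le> 1" and e: "0 < e"
  shows "\<bar>powr_generator a e z\<bar> \<le> CL a * (z + e) powr (a - 1)"
proof -
  have 1: "\<bar>a * (z + e) powr (a - 1) * Y0sq_drift z\<bar> \<le> \<bar>a\<bar> * Kb * (z + e) powr (a - 1)"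
  proof -
    have "\<bar>a * (z + e) powr (a - 1) * Y0sq_drift z\<bar> = (\<bar>a\<bar> * (z + e) powr (a - 1)) * \<bar>Y0sq_drift z\<bar>" by (simp add: abs_mult)
    also have "\<dots> \<le> (\<bar>a\<bar> * (z + e) powr (a - 1)) * Kb" using Y0sq_drift_bound[OF z] by (intro mult_left_mono) auto
    finally show ?thesis by (simp add: ac_simps)
  qed
  have 2: "\<bar>2 * \<nu>\<^sup>2 * z * (1 - z) * (a * (a - 1) * (z + e) powr (a - 2))\<bar> \<le> 2 * \<nu>\<^sup>2 * \<bar>a * (a - 1)\<bar> * (z + e) powr (a - 1)"
  proof -
    have "z * (1 - z) \<le> (z + e) * 1" using z e by (intro mult_mono) auto
    then have "z * (1 - z) * (z + e) powr (a - 2) \<le> (z + e) * 1 * (z + e) powr (a - 2)" by (intro mult_right_mono) auto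
    also have "\<dots> = (z + e) powr (a - 1)" using powr_shift[OF e z(1), of "a - 2"] by simp
    finally have "(2 * \<nu>\<^sup>2 * \<bar>a * (a - 1)\<bar>) * (z * (1 - z) * (z + e) powr (a - 2)) \<le> (2 * \<nu>\<^sup>2 * \<bar>a * (a - 1)\<bar>) * (z + e) powr (a - 1)"
      by (intro mult_left_mono) auto
    moreover have "\<bar>2 * \<nu>\<^sup>2 * z * (1 - z) * (a * (a - 1) * (z + e) powr (a - 2))\<bar> = (2 * \<nu>\<^sup>2 * \<bar>a * (a - 1)\<bar>) * (z * (1 - z) * (z + e) powr (a - 2))"
      using z by (simp add: abs_mult)
    ultimately show ?thesis by simp
  qed
  have "\<bar>powr_generator a e z\<bar> \<le> \<bar>a * (z + e) powr (a - 1) * Y0sq_drift z\<bar> + \<bar>2 * \<nu>\<^sup>2 * z * (1 - z) * (a * (a - 1) * (z + e) powr (a - 2))\<bar>"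
    unfolding powr_generator_def by (rule abs_triangle_ineq)
  then show ?thesis using 1 2 by (simp add: CL_def distrib_right)
qed

text \<open>This is where \<open>\<kappa> \<ge> 6 \<nu>\<^sup>2\<close> enters: it makes the fifth inverse moment of \<open>1 - |X|\<^sup>2\<close> propagate.\<close>
lemma powr_generator_neg5:
  assumes z: "0 \<le> z" "z \<le> 1" and e: "0 < e"
  shows "powr_generator (-5) e z \<le> 5 * Kb * (z + e) powr (-5)"
proof -
  define r where "r = z + e"
  have r: "0 < r" "z \<le> r" using z e by (auto simp: r_def)
  define p where "p = r powr (-7)"
  have p: "0 < p" using r by (simp add: p_def)
  have p6: "r powr (-6) = r * p" and p5: "r powr (-5) = r * (r * p)"
    using powr_shift[OF e z(1), of "-7"] powr_shift[OF e z(1), of "-6"] by (simp_all add: r_def p_def)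
  have b: "Y0sq_drift z = 2 * \<kappa> - Kb * z" by (simp add: Y0sq_drift_def Kb_def)
  have L: "powr_generator (-5) e z = -5 * (r * p) * (2 * \<kappa> - Kb * z) + 60 * \<nu>\<^sup>2 * z * (1 - z) * p"
    unfolding powr_generator_def b r_def[symmetric] by (simp add: p6[unfolded p_def] p_def)
  \<comment> \<open>The second derivative contributes \<open>60 = 2 * 5 * 6\<close> times
    \<open>\<nu>\<^sup>2\<close>, the drift at 0 contributes \<open>10 = 5 * 2\<close> times
    \<open>\<kappa>\<close>, with the opposite sign; \<open>kappa6\<close> makes the second
    win.\<close>
  have 1: "60 * \<nu>\<^sup>2 * z * (1 - z) * p \<le> 10 * \<kappa> * (r * p)"
  proof -
    have "z * (1 - z) \<le> r * 1" using z r by (intro mult_mono) auto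
    then have "60 * \<nu>\<^sup>2 * (z * (1 - z)) \<le> 60 * \<nu>\<^sup>2 * r" by (intro mult_left_mono) auto
    also have "\<dots> \<le> 10 * \<kappa> * r" using kappa6 r by (intro mult_right_mono) auto
    finally have "60 * \<nu>\<^sup>2 * (z * (1 - z)) * p \<le> 10 * \<kappa> * r * p" using p by (intro mult_right_mono) auto
    then show ?thesis by (simp add: mult.assoc)
  qed
  have 2: "5 * (r * p) * (Kb * z) \<le> 5 * (r * p) * (Kb * r)"
    using r p Kb by (intro mult_left_mono) auto
  show ?thesis unfolding L r_def[symmetric] p5 using 1 2 by (simp add: algebra_simps)
qed

text \<open>Dominates the first three derivatives of \<open>(z + e) powr a\<close> for
  \<open>z \<ge> 0\<close> and \<open>a \<le> 0\<close>, as required by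
  \<open>one_step_ito\<close>.\<close>

definition KF :: "real \<Rightarrow> real \<Rightarrow> real" where
  "KF a e = \<bar>a\<bar> * e powr (a - 1) + \<bar>a * (a - 1)\<bar> * e powr (a - 2) + \<bar>a * (a - 1) * (a - 2)\<bar> * e powr (a - 3)"

lemma KF: "0 \<le> KF a e" by (simp add: KF_def)

lemma powr_ito_step:
  assumes w: "0 < w" and k: "real (Suc k) * w ^ 4 \<le> T" and e: "0 < e" and a: "a \<le> 0"
  shows "cond_abs_le M (G (real k * w ^ 4)) (\<lambda>\<omega>. (Y0sq (real (Suc k) * w ^ 4) \<omega> + e) powr a - (Y0sq (real k * w ^ 4) \<omega> + e) powr a
      - w ^ 4 * powr_generator a e (Y0sq (real k * w ^ 4) \<omega>)) (KF a e * C8 * w ^ 5)"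
proof -
  interpret S: sde_step M F d m T \<kappa> \<nu> AA B X x0 w k by (rule sde_step_I[OF w k])
  have p: "(z + e) powr b \<le> e powr b" if "0 \<le> z" "b \<le> 0" for z b using e that by (intro powr_mono2') auto
  have "cond_abs_le M (G (real k * w ^ 4)) (\<lambda>\<omega>. (Y0sq (real (Suc k) * w ^ 4) \<omega> + e) powr a - (Y0sq (real k * w ^ 4) \<omega> + e) powr a
      - w ^ 4 * (a * (Y0sq (real k * w ^ 4) \<omega> + e) powr (a - 1) * Y0sq_drift (Y0sq (real k * w ^ 4) \<omega>) + 2 * \<nu>\<^sup>2 * Y0sq (real k * w ^ 4) \<omega> * (1 - Y0sq (real k * w ^ 4) \<omega>) * (a * (a - 1) * (Y0sq (real k * w ^ 4) \<omega> + e) powr (a - 2)))) (KF a e * C8 * w ^ 5)"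
  proof (rule S.one_step_ito[OF _ _ _ KF])
    fix z z' :: real assume z: "0 \<le> z" "z \<le> 1" "0 \<le> z'" "z' \<le> 1"
    have "\<bar>a * (a - 1) * (a - 2)\<bar> * e powr (a - 3) * \<bar>z' - z\<bar> ^ 3 \<le> KF a e * \<bar>z' - z\<bar> ^ 3"
      by (intro mult_right_mono) (auto simp: KF_def)
    then show "\<bar>(z' + e) powr a - (z + e) powr a - a * (z + e) powr (a - 1) * (z' - z) - a * (a - 1) * (z + e) powr (a - 2) / 2 * (z' - z)\<^sup>2\<bar> \<le> KF a e * \<bar>z' - z\<bar> ^ 3"
      using powr_taylor3[OF e z a] by linarith
  next
    fix z :: real assume z: "0 \<le> z" "z \<le> 1"
    have "\<bar>a\<bar> * (z + e) powr (a - 1) \<le> \<bar>a\<bar> * e powr (a - 1)" using p[OF z(1), of "a - 1"] a by (intro mult_left_mono) auto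
    moreover have "0 \<le> \<bar>a * (a - 1)\<bar> * e powr (a - 2)" "0 \<le> \<bar>a * (a - 1) * (a - 2)\<bar> * e powr (a - 3)" by simp_all
    ultimately have "\<bar>a\<bar> * (z + e) powr (a - 1) \<le> KF a e" unfolding KF_def by linarith
    then show "\<bar>a * (z + e) powr (a - 1)\<bar> \<le> KF a e" by (simp add: abs_mult)
    have "\<bar>a * (a - 1)\<bar> * (z + e) powr (a - 2) \<le> \<bar>a * (a - 1)\<bar> * e powr (a - 2)" using p[OF z(1), of "a - 2"] a by (intro mult_left_mono) auto
    moreover have "0 \<le> \<bar>a\<bar> * e powr (a - 1)" "0 \<le> \<bar>a * (a - 1) * (a - 2)\<bar> * e powr (a - 3)" by simp_all
    ultimately have "\<bar>a * (a - 1)\<bar> * (z + e) powr (a - 2) \<le> KF a e" unfolding KF_def by linarith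
    then show "\<bar>a * (a - 1) * (z + e) powr (a - 2)\<bar> \<le> KF a e" by (simp add: abs_mult)
  qed measurable
  then show ?thesis unfolding powr_generator_def .
qed

lemma Y0sq_powr_integrable:
  assumes "0 \<le> t" "t \<le> T" "0 < e" "a \<le> 0"
  shows "integrable M (\<lambda>\<omega>. (Y0sq t \<omega> + e) powr a)" "\<omega> \<in> space M \<Longrightarrow> (Y0sq t \<omega> + e) powr a \<le> e powr a"
proof -
  have le: "\<And>\<omega>. \<omega> \<in> space M \<Longrightarrow> (Y0sq t \<omega> + e) powr a \<le> e powr a"
    using Y0sq_bounds[of t] assms by (intro powr_mono2') auto
  have [measurable]: "Y0sq t \<in> borel_measurable M" using assms by (intro Y0sq_measM)
  show "integrable M (\<lambda>\<omega>. (Y0sq t \<omega> + e) powr a)"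
    by (rule integrable_const_bound[of _ "e powr a"]) (use le in auto)
  show "\<omega> \<in> space M \<Longrightarrow> (Y0sq t \<omega> + e) powr a \<le> e powr a" by (rule le)
qed

lemma powr_generator_meas [measurable]: "powr_generator a e \<in> borel_measurable borel"
proof -
  have [measurable]: "Y0sq_drift \<in> borel_measurable borel" unfolding Y0sq_drift_def[abs_def] by measurable
  show ?thesis unfolding powr_generator_def[abs_def] by measurable
qed

lemma powr_generator_integrable:
  assumes "0 \<le> t" "t \<le> T" "0 < e" "a \<le> 0"
  shows "integrable M (\<lambda>\<omega>. powr_generator a e (Y0sq t \<omega>))" "\<omega> \<in> space M \<Longrightarrow> \<bar>powr_generator a e (Y0sq t \<omega>)\<bar> \<le> CL a * e powr (a - 1)"
proof -
  have le: "\<And>\<omega>. \<omega> \<in> space M \<Longrightarrow> \<bar>powr_generator a e (Y0sq t \<omega>)\<bar> \<le> CL a * e powr (a - 1)"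
  proof -
    fix \<omega> assume \<omega>: "\<omega> \<in> space M"
    have "\<bar>powr_generator a e (Y0sq t \<omega>)\<bar> \<le> CL a * (Y0sq t \<omega> + e) powr (a - 1)" using Y0sq_bounds[of t \<omega>] assms \<omega> by (intro powr_generator_abs) auto
    also have "\<dots> \<le> CL a * e powr (a - 1)" using Y0sq_powr_integrable(2)[OF assms(1-3), of "a - 1" \<omega>] assms(4) \<omega> CL by (intro mult_left_mono) auto
    finally show "\<bar>powr_generator a e (Y0sq t \<omega>)\<bar> \<le> CL a * e powr (a - 1)" .
  qed
  have [measurable]: "Y0sq t \<in> borel_measurable M" using assms by (intro Y0sq_measM)
  show "integrable M (\<lambda>\<omega>. powr_generator a e (Y0sq t \<omega>))"
    by (rule integrable_const_bound[of _ "CL a * e powr (a - 1)"]) (use le in auto)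
  show "\<omega> \<in> space M \<Longrightarrow> \<bar>powr_generator a e (Y0sq t \<omega>)\<bar> \<le> CL a * e powr (a - 1)" by (rule le)
qed

text \<open>A discrete Dynkin formula: the one-step Ito errors are summed under a weight known at
  the start. At most \<open>T / w ^ 4\<close> steps with errors of order \<open>w ^ 5\<close> leave
  an error of order \<open>w\<close>, which refinement removes.\<close>

lemma powr_dynkin_sum:
  assumes w: "0 < w" and e: "0 < e" and a: "a \<le> 0"
    and h: "h \<in> borel_measurable (G (real k * w ^ 4))" "\<And>\<omega>. \<omega> \<in> space M \<Longrightarrow> \<bar>h \<omega>\<bar> \<le> c"
  shows "k \<le> n \<Longrightarrow> real n * w ^ 4 \<le> T \<Longrightarrow>
    \<bar>(LINT \<omega>|M. h \<omega> * ((Y0sq (real n * w ^ 4) \<omega> + e) powr a - (Y0sq (real k * w ^ 4) \<omega> + e) powr a))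
      - (\<Sum>j\<in>{k..<n}. w ^ 4 * (LINT \<omega>|M. h \<omega> * powr_generator a e (Y0sq (real j * w ^ 4) \<omega>)))\<bar> \<le> real (n - k) * (KF a e * C8 * w ^ 5 * c)"
proof (induction n rule: dec_induct)
  case (step n)
  have v: "0 < w ^ 4" using w by simp
  note g = grid_le[OF v le_SucI[OF order_refl] step.prems]
  have kn: "0 \<le> real k * w ^ 4" "real k * w ^ 4 \<le> real n * w ^ 4" using w step(1) by (auto intro: mult_right_mono)
  have sub: "subalgebra M (G (real n * w ^ 4))" using subalgebra_G g by simp
  have hG: "h \<in> borel_measurable (G (real n * w ^ 4))" using measurable_G_mono[OF h(1) kn] .
  have hM [measurable]: "h \<in> borel_measurable M" using measurable_G_M[OF h(1) kn(1)] .
  have kT: "real k * w ^ 4 \<le> T" using kn g by linarith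
  have t0: "0 \<le> real (Suc n) * w ^ 4" using w by simp
  have hi: "integrable M h" by (rule integrable_const_bound[of _ c]) (use h in auto)
  have hb: "(LINT \<omega>|M. \<bar>h \<omega>\<bar>) \<le> c"
  proof -
    have "(LINT \<omega>|M. \<bar>h \<omega>\<bar>) \<le> (LINT \<omega>|M. c)" using hi h by (intro integral_mono) auto
    then show ?thesis by (simp add: prob_space)
  qed
  have hmul: "integrable M f \<Longrightarrow> integrable M (\<lambda>\<omega>. h \<omega> * f \<omega>)" for f :: "'w \<Rightarrow> real"
    by (rule Bochner_Integration.integrable_bound[of _ "\<lambda>\<omega>. c * f \<omega>"]) (use h in \<open>auto simp: abs_mult intro!: AE_I2 mult_right_mono order_trans[OF h(2) abs_ge_self]\<close>)
  let ?f = "\<lambda>n \<omega>. (Y0sq (real n * w ^ 4) \<omega> + e) powr a"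
  have fi: "integrable M (?f n)" "integrable M (?f (Suc n))" "integrable M (?f k)"
    using Y0sq_powr_integrable(1)[OF _ _ e a] g kn kT t0 step.prems by blast+
  have Li: "integrable M (\<lambda>\<omega>. powr_generator a e (Y0sq (real n * w ^ 4) \<omega>))" using powr_generator_integrable(1)[OF g(1,3) e a] .
  let ?D = "\<lambda>\<omega>. ?f (Suc n) \<omega> - ?f n \<omega> - w ^ 4 * powr_generator a e (Y0sq (real n * w ^ 4) \<omega>)"
  have "\<bar>LINT \<omega>|M. h \<omega> * ?D \<omega>\<bar> \<le> (KF a e * C8 * w ^ 5) * (LINT \<omega>|M. \<bar>h \<omega>\<bar>)"
    by (rule cond_abs_le_integral[OF sub prob_space_M powr_ito_step[OF w step.prems e a] hG hi]) (intro hmul Bochner_Integration.integrable_diff integrable_mult_right fi Li)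
  also have "\<dots> \<le> KF a e * C8 * w ^ 5 * c" using hb KF C8 w by (intro mult_left_mono mult_nonneg_nonneg) auto
  finally have one: "\<bar>LINT \<omega>|M. h \<omega> * ?D \<omega>\<bar> \<le> KF a e * C8 * w ^ 5 * c" .
  have IH: "\<bar>(LINT \<omega>|M. h \<omega> * (?f n \<omega> - ?f k \<omega>)) - (\<Sum>j\<in>{k..<n}. w ^ 4 * (LINT \<omega>|M. h \<omega> * powr_generator a e (Y0sq (real j * w ^ 4) \<omega>)))\<bar> \<le> real (n - k) * (KF a e * C8 * w ^ 5 * c)"
    using step.IH g by simp
  have "(LINT \<omega>|M. h \<omega> * (?f (Suc n) \<omega> - ?f k \<omega>)) = (LINT \<omega>|M. h \<omega> * (?f n \<omega> - ?f k \<omega>) + h \<omega> * ?D \<omega> + w ^ 4 * (h \<omega> * powr_generator a e (Y0sq (real n * w ^ 4) \<omega>)))"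
    by (intro Bochner_Integration.integral_cong) (auto simp: algebra_simps)
  also have "\<dots> = (LINT \<omega>|M. h \<omega> * (?f n \<omega> - ?f k \<omega>)) + (LINT \<omega>|M. h \<omega> * ?D \<omega>) + w ^ 4 * (LINT \<omega>|M. h \<omega> * powr_generator a e (Y0sq (real n * w ^ 4) \<omega>))"
  proof -
    have 1: "integrable M (\<lambda>\<omega>. h \<omega> * (?f n \<omega> - ?f k \<omega>))" by (intro hmul Bochner_Integration.integrable_diff fi)
    have 2: "integrable M (\<lambda>\<omega>. h \<omega> * ?D \<omega>)" by (intro hmul Bochner_Integration.integrable_diff integrable_mult_right fi Li)
    have 3: "integrable M (\<lambda>\<omega>. w ^ 4 * (h \<omega> * powr_generator a e (Y0sq (real n * w ^ 4) \<omega>)))" by (intro integrable_mult_right hmul Li)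
    show ?thesis using Bochner_Integration.integral_add[OF Bochner_Integration.integrable_add[OF 1 2] 3] Bochner_Integration.integral_add[OF 1 2] by (simp only: integral_mult_right_zero)
  qed
  finally have e1: "(LINT \<omega>|M. h \<omega> * (?f (Suc n) \<omega> - ?f k \<omega>)) = (LINT \<omega>|M. h \<omega> * (?f n \<omega> - ?f k \<omega>)) + (LINT \<omega>|M. h \<omega> * ?D \<omega>) + w ^ 4 * (LINT \<omega>|M. h \<omega> * powr_generator a e (Y0sq (real n * w ^ 4) \<omega>))" .
  have e2: "(\<Sum>j\<in>{k..<Suc n}. w ^ 4 * (LINT \<omega>|M. h \<omega> * powr_generator a e (Y0sq (real j * w ^ 4) \<omega>))) = (\<Sum>j\<in>{k..<n}. w ^ 4 * (LINT \<omega>|M. h \<omega> * powr_generator a e (Y0sq (real j * w ^ 4) \<omega>))) + w ^ 4 * (LINT \<omega>|M. h \<omega> * powr_generator a e (Y0sq (real n * w ^ 4) \<omega>))"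
    using step(1) by simp
  have e3: "real (Suc n - k) * (KF a e * C8 * w ^ 5 * c) = real (n - k) * (KF a e * C8 * w ^ 5 * c) + KF a e * C8 * w ^ 5 * c"
    using step(1) by (simp add: Suc_diff_le distrib_right)
  show ?case unfolding e1 e2 e3 using IH one by linarith
qed simp

definition inv_moment_const :: real where "inv_moment_const = exp (5 * Kb * T) * (1 - sqn d x0) powr (-5)"

lemma inv_moment_const: "0 \<le> inv_moment_const" by (simp add: inv_moment_const_def)

text \<open>Gronwall with the growth rate \<open>5 * Kb\<close> from
  \<open>powr_generator_neg5\<close>. The rate is free of \<open>e\<close>; only the discretisation
  error depends on it, through \<open>KF\<close>, and that error carries the factor
  \<open>w\<close>.\<close>

lemma inverse_moment_reg_step:
  assumes w: "0 < w" and e: "0 < e" and n: "real n * w ^ 4 \<le> T"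
  shows "(LINT \<omega>|M. (Y0sq (real n * w ^ 4) \<omega> + e) powr (-5)) \<le> inv_moment_const + (exp (5 * Kb * T) * T * KF (-5) e * C8) * w"
proof -
  have v: "0 < w ^ 4" using w by simp
  define g where "g j = (LINT \<omega>|M. (Y0sq (real j * w ^ 4) \<omega> + e) powr (-5))" for j
  define c where "c = KF (-5) e * C8 * w ^ 5"
  have c: "0 \<le> c" using KF C8 w by (simp add: c_def)
  have step: "g (Suc j) \<le> (1 + 5 * Kb * w ^ 4) * g j + c" if j: "j < n" for j
  proof -
    have jT: "real (Suc j) * w ^ 4 \<le> T" using grid_le(3)[OF v _ n, of "Suc j"] j by simp
    note gl = grid_le[OF v le_SucI[OF order_refl] jT]
    let ?f = "\<lambda>n \<omega>. (Y0sq (real n * w ^ 4) \<omega> + e) powr (-5)"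
    have fi: "integrable M (?f j)" "integrable M (?f (Suc j))"
      using Y0sq_powr_integrable(1)[OF _ _ e, of _ "-5"] gl jT w by auto
    have Li: "integrable M (\<lambda>\<omega>. powr_generator (-5) e (Y0sq (real j * w ^ 4) \<omega>))" using powr_generator_integrable(1)[OF gl(1,3) e] by simp
    have "\<bar>(LINT \<omega>|M. 1 * (?f (Suc j) \<omega> - ?f j \<omega>)) - (\<Sum>i\<in>{j..<Suc j}. w ^ 4 * (LINT \<omega>|M. 1 * powr_generator (-5) e (Y0sq (real i * w ^ 4) \<omega>)))\<bar> \<le> real (Suc j - j) * (KF (-5) e * C8 * w ^ 5 * 1)"
      by (rule powr_dynkin_sum[OF w e]) (use jT in auto)
    then have "(LINT \<omega>|M. ?f (Suc j) \<omega> - ?f j \<omega>) - w ^ 4 * (LINT \<omega>|M. powr_generator (-5) e (Y0sq (real j * w ^ 4) \<omega>)) \<le> c"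
      by (simp add: c_def)
    moreover have "(LINT \<omega>|M. ?f (Suc j) \<omega> - ?f j \<omega>) = g (Suc j) - g j" using fi by (simp add: g_def)
    moreover have "(LINT \<omega>|M. powr_generator (-5) e (Y0sq (real j * w ^ 4) \<omega>)) \<le> (LINT \<omega>|M. 5 * Kb * ?f j \<omega>)"
      using fi Li Y0sq_bounds gl e by (intro integral_mono integrable_mult_right powr_generator_neg5) auto
    then have "w ^ 4 * (LINT \<omega>|M. powr_generator (-5) e (Y0sq (real j * w ^ 4) \<omega>)) \<le> w ^ 4 * (5 * Kb * g j)"
      using v by (intro mult_left_mono) (auto simp: g_def)
    ultimately show ?thesis by (simp add: algebra_simps)
  qed
  have g0: "0 \<le> g 0" unfolding g_def by (intro integral_nonneg_AE) auto
  have "g n \<le> exp (5 * Kb * w ^ 4 * real n) * (g 0 + real n * c)"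
    by (rule discrete_gronwall[where n=n and g=g and a="5 * Kb * w ^ 4" and b=c]) (use step Kb c g0 in auto)
  also have "\<dots> \<le> exp (5 * Kb * T) * ((1 - sqn d x0) powr (-5) + T * KF (-5) e * C8 * w)"
  proof (rule mult_mono)
    have "5 * Kb * (real n * w ^ 4) \<le> 5 * Kb * T" using n Kb by (intro mult_left_mono) auto
    then show "exp (5 * Kb * w ^ 4 * real n) \<le> exp (5 * Kb * T)" by (simp add: ac_simps)
    have z0: "Y0sq 0 \<omega> = 1 - sqn d x0" if "\<omega> \<in> space M" for \<omega>
      using sol that unfolding is_solution_def Y0sq_def sqn_def by simp
    have "g 0 = (LINT \<omega>|M. (1 - sqn d x0 + e) powr (-5))" unfolding g_def using z0 by (intro Bochner_Integration.integral_cong) auto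
    also have "\<dots> = (1 - sqn d x0 + e) powr (-5)" by (simp add: prob_space)
    also have "\<dots> \<le> (1 - sqn d x0) powr (-5)" using x0 e by (intro powr_mono2') auto
    finally have a: "g 0 \<le> (1 - sqn d x0) powr (-5)" .
    have "real n * c = (real n * w ^ 4) * (KF (-5) e * C8 * w)" by (simp add: c_def power_add[of w 4 1, simplified])
    also have "\<dots> \<le> T * (KF (-5) e * C8 * w)" using n KF C8 w by (intro mult_right_mono) auto
    finally show "g 0 + real n * c \<le> (1 - sqn d x0) powr (-5) + T * KF (-5) e * C8 * w" using a by (simp add: mult.assoc)
  qed (use g0 c in auto)
  finally show ?thesis unfolding g_def inv_moment_const_def by (simp add: distrib_left mult.assoc)
qed

lemma refine_grid: "real (n * Suc l) * (u / real (Suc l)) = real n * u"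
  by (simp add: field_simps)

lemma inverse_moment_reg:
  assumes u: "0 < u" and n: "real n * u \<le> T" and e: "0 < e"
  shows "(LINT \<omega>|M. (Y0sq (real n * u) \<omega> + e) powr (-5)) \<le> inv_moment_const"
proof -
  obtain W where W: "\<And>l. 0 < W l" "\<And>l. W l ^ 4 = u / real (Suc l)" "W \<longlonglongrightarrow> (0::real)" by (rule fourth_root_seq[OF u]) blast
  show ?thesis
  proof (rule le_limit_vanishing[OF _ W(3)])
    fix l
    have t: "real (n * Suc l) * W l ^ 4 = real n * u" unfolding W(2) by (rule refine_grid)
    show "(LINT \<omega>|M. (Y0sq (real n * u) \<omega> + e) powr (-5)) \<le> inv_moment_const + (exp (5 * Kb * T) * T * KF (-5) e * C8) * W l"
      using inverse_moment_reg_step[OF W(1) e, of "n * Suc l" l] n unfolding t by simp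
  qed
qed

text \<open>The bound \<open>inv_moment_const\<close> is uniform in the shift, so Fatou's lemma
  applies as the shift tends to 0.\<close>

lemma inverse_moment:
  assumes u: "0 < u" and n: "real n * u \<le> T"
  shows Y0sq_pos: "AE \<omega> in M. 0 < Y0sq (real n * u) \<omega>"
    and Y0sq_inv5_integrable: "integrable M (\<lambda>\<omega>. 1 / Y0sq (real n * u) \<omega> ^ 5)" and Y0sq_inv5: "(LINT \<omega>|M. 1 / Y0sq (real n * u) \<omega> ^ 5) \<le> inv_moment_const"
proof -
  let ?Z = "Y0sq (real n * u)"
  have t: "0 \<le> real n * u" using u by simp
  have [measurable]: "?Z \<in> borel_measurable M" using Y0sq_measM[OF t n] .
  let ?e = "\<lambda>i. 1 / real (Suc i)"
  have nn: "(\<integral>\<^sup>+\<omega>. ennreal ((?Z \<omega> + ?e i) powr (-5)) \<partial>M) \<le> ennreal inv_moment_const" for i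
  proof -
    have "(\<integral>\<^sup>+\<omega>. ennreal ((?Z \<omega> + ?e i) powr (-5)) \<partial>M) = ennreal (LINT \<omega>|M. (?Z \<omega> + ?e i) powr (-5))"
      using Y0sq_powr_integrable(1)[OF t n, of "?e i" "-5"] by (intro nn_integral_eq_integral) auto
    then show ?thesis using inverse_moment_reg[OF u n, of "?e i"] by (simp add: ennreal_leI)
  qed
  have "(\<integral>\<^sup>+\<omega>. liminf (\<lambda>i. ennreal ((?Z \<omega> + ?e i) powr (-5))) \<partial>M) \<le> liminf (\<lambda>i. \<integral>\<^sup>+\<omega>. ennreal ((?Z \<omega> + ?e i) powr (-5)) \<partial>M)"
    by (rule nn_integral_liminf) measurable
  also have "\<dots> \<le> liminf (\<lambda>i::nat. ennreal inv_moment_const)" by (intro Liminf_mono always_eventually allI nn)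
  finally have L: "(\<integral>\<^sup>+\<omega>. liminf (\<lambda>i. ennreal ((?Z \<omega> + ?e i) powr (-5))) \<partial>M) \<le> ennreal inv_moment_const" by (simp add: Liminf_const)
  have elim: "?e \<longlonglongrightarrow> 0" by (rule LIMSEQ_Suc[OF lim_const_over_n])
  \<comment> \<open>Positivity needs its own argument, since \<open>1 / 0 = 0\<close> makes the
    integral of \<open>1 / ?Z \<omega> ^ 5\<close> blind to the zero set. On that set the
    regularised power equals \<open>?e i powr (-5)\<close>, which is unbounded in \<open>i\<close>
    while its integral is not.\<close>
  show pos: "AE \<omega> in M. 0 < ?Z \<omega>"
  proof -
    let ?A = "{\<omega> \<in> space M. ?Z \<omega> = 0}"
    have Am: "?A \<in> sets M" by measurable
    have "measure M ?A \<le> 0"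
    proof (rule le_limit_vanishing[OF _ elim])
      fix i
      have "(LINT \<omega>|M. indicator ?A \<omega> * ?e i powr (-5)) \<le> (LINT \<omega>|M. (?Z \<omega> + ?e i) powr (-5))"
      proof (rule integral_mono)
        show "integrable M (\<lambda>\<omega>. indicator ?A \<omega> * ?e i powr (-5))" using Am by (simp add: emeasure_eq_measure)
        show "integrable M (\<lambda>\<omega>. (?Z \<omega> + ?e i) powr (-5))" by (rule Y0sq_powr_integrable(1)[OF t n]) auto
      qed (auto simp: indicator_def)
      also have "\<dots> \<le> inv_moment_const" by (rule inverse_moment_reg[OF u n]) auto
      finally have "measure M ?A * ?e i powr (-5) \<le> inv_moment_const" using Am by simp
      moreover have "?e i powr (-5) = real (Suc i) ^ 5"
        by (simp add: powr_minus powr_numeral inverse_eq_divide power_one_over)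
      moreover have "real (Suc i) \<le> real (Suc i) ^ 5" by (rule self_le_power) auto
      then have "measure M ?A * real (Suc i) \<le> measure M ?A * real (Suc i) ^ 5" by (intro mult_left_mono) auto
      ultimately have "measure M ?A * real (Suc i) \<le> inv_moment_const" by simp
      then show "measure M ?A \<le> 0 + inv_moment_const * ?e i" by (simp add: field_simps)
    qed
    then have "emeasure M ?A = 0" by (simp add: emeasure_eq_measure measure_le_0_iff)
    then have "AE \<omega> in M. ?Z \<omega> \<noteq> 0" using Am by (intro AE_I[of _ _ ?A]) auto
    then show ?thesis using AE_space by eventually_elim (use Y0sq_bounds(1)[OF t n] in \<open>auto simp: less_le\<close>)
  qed
  have "(\<integral>\<^sup>+\<omega>. ennreal (1 / ?Z \<omega> ^ 5) \<partial>M) = (\<integral>\<^sup>+\<omega>. liminf (\<lambda>i. ennreal ((?Z \<omega> + ?e i) powr (-5))) \<partial>M)"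
  proof (rule nn_integral_cong_AE)
    show "AE \<omega> in M. ennreal (1 / ?Z \<omega> ^ 5) = liminf (\<lambda>i. ennreal ((?Z \<omega> + ?e i) powr (-5)))"
      using pos
    proof eventually_elim
      case (elim \<omega>)
      have "(\<lambda>i. (?Z \<omega> + ?e i) powr (-5)) \<longlonglongrightarrow> (?Z \<omega> + 0) powr (-5)"
        using elim by (intro tendsto_intros \<open>?e \<longlonglongrightarrow> 0\<close>) auto
      then have "(\<lambda>i. ennreal ((?Z \<omega> + ?e i) powr (-5))) \<longlonglongrightarrow> ennreal (?Z \<omega> powr (-5))" by (intro tendsto_ennrealI) simp
      moreover have "?Z \<omega> powr (-5) = 1 / ?Z \<omega> ^ 5" using elim by (simp add: powr_minus powr_numeral inverse_eq_divide)
      ultimately show ?case by (simp add: lim_imp_Liminf)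
    qed
  qed
  then have le: "(\<integral>\<^sup>+\<omega>. ennreal (1 / ?Z \<omega> ^ 5) \<partial>M) \<le> ennreal inv_moment_const" using L by simp
  show i: "integrable M (\<lambda>\<omega>. 1 / ?Z \<omega> ^ 5)"
  proof (rule integrableI_nonneg)
    show "AE \<omega> in M. 0 \<le> 1 / ?Z \<omega> ^ 5" using Y0sq_bounds(1)[OF t n] by auto
    show "(\<integral>\<^sup>+\<omega>. ennreal (1 / ?Z \<omega> ^ 5) \<partial>M) < \<infinity>" using le by (auto simp: less_top[symmetric] top_unique)
  qed measurable
  have "ennreal (LINT \<omega>|M. 1 / ?Z \<omega> ^ 5) = (\<integral>\<^sup>+\<omega>. ennreal (1 / ?Z \<omega> ^ 5) \<partial>M)"
    using Y0sq_bounds(1)[OF t n] by (intro nn_integral_eq_integral[symmetric] i) auto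
  then show "(LINT \<omega>|M. 1 / ?Z \<omega> ^ 5) \<le> inv_moment_const" using le inv_moment_const by (metis ennreal_le_iff)
qed

section \<open>Mean-square increments of \<open>1 / Y0\<close> and of \<open>Y0\<close>\<close>

lemma abs_diff_combine:
  fixes x y p q K L :: real
  shows "\<bar>x - p\<bar> \<le> K \<Longrightarrow> \<bar>y - q\<bar> \<le> L \<Longrightarrow> x - 2 * y \<le> \<bar>p\<bar> + K + 2 * (\<bar>q\<bar> + L)"
  using abs_ge_self[of "x - p"] abs_ge_minus_self[of "y - q"] abs_ge_self[of p] abs_ge_minus_self[of q]
  by argo

lemma reg_inv2_le:
  assumes u: "0 < u" and n: "real n * u \<le> T" and e: "0 < e"
  shows "(LINT \<omega>|M. (Y0sq (real n * u) \<omega> + e) powr (-2)) \<le> inv_moment_const"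
proof -
  have t: "0 \<le> real n * u" using u by simp
  have "AE \<omega> in M. (Y0sq (real n * u) \<omega> + e) powr (-2) \<le> 1 / Y0sq (real n * u) \<omega> ^ 5"
    using Y0sq_pos[OF u n]
  proof eventually_elim
    case (elim \<omega>)
    let ?z = "Y0sq (real n * u) \<omega>"
    have "(?z + e) powr (-2) \<le> ?z powr (-2)" using elim e by (intro powr_mono2') auto
    also have "\<dots> = 1 / ?z ^ 2" using elim by (simp add: powr_minus powr_numeral inverse_eq_divide)
    also have "\<dots> \<le> 1 / ?z ^ 5" using elim Y0sq_bounds(2)[of "real n * u" \<omega>] by (intro divide_left_mono power_decreasing) auto
    finally show ?case .
  qed
  then have "(LINT \<omega>|M. (Y0sq (real n * u) \<omega> + e) powr (-2)) \<le> (LINT \<omega>|M. 1 / Y0sq (real n * u) \<omega> ^ 5)"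
    using Y0sq_powr_integrable(1)[OF t n e, of "-2"] Y0sq_inv5_integrable[OF u n] by (intro integral_mono_AE) auto
  then show ?thesis using Y0sq_inv5[OF u n] by linarith
qed

definition holder_const :: real where "holder_const = CL (-1) * inv_moment_const + 4 * CL (-1/2) * inv_moment_const"

lemma holder_const: "0 \<le> holder_const" using CL[of "-1"] CL[of "-1/2"] inv_moment_const by (simp add: holder_const_def)

text \<open>The squared increment equals the increment of \<open>f\<^sup>2\<close> minus twice
  \<open>f k\<close> times the increment of \<open>f\<close>. Dynkin's formula treats the first with
  exponent -1 and the second with exponent -1/2 and weight \<open>f k\<close>, so no martingale part
  has to be squared. By \<open>powr_generator_abs\<close> both generators are controlled by the
  second inverse moment of \<open>Y0sq\<close>.\<close>

lemma inv_Y_reg_step: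
  assumes w: "0 < w" and e: "0 < e" and k: "k \<le> n" and n: "real n * w ^ 4 \<le> T"
  defines "f \<equiv> \<lambda>j \<omega>. (Y0sq (real j * w ^ 4) \<omega> + e) powr (-1/2)"
  shows "(LINT \<omega>|M. (f n \<omega> - f k \<omega>)\<^sup>2) \<le> holder_const * (real (n - k) * w ^ 4) + (T * (KF (-1) e * C8 + 2 * (KF (-1/2) e * C8 * e powr (-1/2)))) * w"
proof -
  have v: "0 < w ^ 4" using w by simp
  let ?v = "w ^ 4"
  let ?N = "real (n - k)"
  note gk = grid_le[OF v k n]
  have jT: "real j * ?v \<le> T" "0 \<le> real j * ?v" if "j \<le> n" for j using grid_le[OF v that n] by auto
  define g where "g = (\<lambda>j \<omega>. (Y0sq (real j * w ^ 4) \<omega> + e) powr (-1))"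
  define q where "q = (\<lambda>j \<omega>. (Y0sq (real j * w ^ 4) \<omega> + e) powr (-2))"
  have fg: "f j \<omega> * f j \<omega> = g j \<omega>" for j \<omega> unfolding f_def g_def powr_add[symmetric] by simp
  have fi: "integrable M (f j)" and gi: "integrable M (g j)" and qi: "integrable M (q j)" if "j \<le> n" for j
    unfolding f_def g_def q_def by (rule Y0sq_powr_integrable(1)[OF jT(2,1)[OF that] e], simp)+
  have fb: "f j \<omega> \<le> e powr (-1/2)" if "j \<le> n" "\<omega> \<in> space M" for j \<omega>
    unfolding f_def by (rule Y0sq_powr_integrable(2)[OF jT(2,1)[OF that(1)] e _ that(2)]) simp
  have fpos: "0 \<le> f j \<omega>" for j \<omega> by (simp add: f_def)
  have qE: "(LINT \<omega>|M. q j \<omega>) \<le> inv_moment_const" if "j \<le> n" for j unfolding q_def by (rule reg_inv2_le[OF v jT(1)[OF that] e])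
  have fG: "f k \<in> borel_measurable (G (real k * ?v))"
    unfolding f_def using Y0sq_meas[OF gk(1,3)] by measurable
  have fm: "f k \<in> borel_measurable M" using measurable_G_M[OF fG gk(1)] .
  have fbk: "\<bar>f k \<omega>\<bar> \<le> e powr (-1/2)" if "\<omega> \<in> space M" for \<omega> using fb[OF k that] fpos[of k \<omega>] by simp
  have fmul: "integrable M h \<Longrightarrow> integrable M (\<lambda>\<omega>. f k \<omega> * h \<omega>)" for h :: "'w \<Rightarrow> real"
    by (rule Bochner_Integration.integrable_bound[of _ "\<lambda>\<omega>. e powr (-1/2) * h \<omega>"])
      (use fm fbk in \<open>auto simp: abs_mult intro!: AE_I2 mult_right_mono\<close>)
  \<comment> \<open>The powers -1/2 and -3/2 belong to different times; replacing both bases by the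
    smaller one merges them into the power -2.\<close>
  have absprod: "(Y0sq (real k * ?v) \<omega> + e) powr (-1/2) * (Y0sq (real j * ?v) \<omega> + e) powr (-3/2) \<le> q k \<omega> + q j \<omega>" if "j \<le> n" "\<omega> \<in> space M" for j \<omega>
  proof -
    let ?a = "Y0sq (real k * ?v) \<omega> + e" and ?b = "Y0sq (real j * ?v) \<omega> + e"
    have ab: "0 < ?a" "0 < ?b" using Y0sq_bounds(1)[OF _ _ that(2)] gk jT[OF that(1)] e by (auto intro!: add_nonneg_pos)
    define c where "c = min ?a ?b"
    have c: "0 < c" "c \<le> ?a" "c \<le> ?b" using ab by (auto simp: c_def)
    have "?a powr (-1/2) * ?b powr (-3/2) \<le> c powr (-1/2) * c powr (-3/2)"
      using c by (intro mult_mono powr_mono2') auto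
    also have "\<dots> = c powr (-2)" unfolding powr_add[symmetric] by simp
    also have "\<dots> \<le> ?a powr (-2) + ?b powr (-2)" by (auto simp: c_def min_def)
    finally show ?thesis by (simp add: q_def)
  qed
  let ?S1 = "\<Sum>j\<in>{k..<n}. ?v * (LINT \<omega>|M. 1 * powr_generator (-1) e (Y0sq (real j * ?v) \<omega>))"
  let ?S2 = "\<Sum>j\<in>{k..<n}. ?v * (LINT \<omega>|M. f k \<omega> * powr_generator (-1/2) e (Y0sq (real j * ?v) \<omega>))"
  have D1: "\<bar>(LINT \<omega>|M. 1 * (g n \<omega> - g k \<omega>)) - ?S1\<bar> \<le> ?N * (KF (-1) e * C8 * w ^ 5 * 1)"
    unfolding g_def by (rule powr_dynkin_sum[OF w e _ _ _ k n]) auto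
  have D2: "\<bar>(LINT \<omega>|M. f k \<omega> * (f n \<omega> - f k \<omega>)) - ?S2\<bar> \<le> ?N * (KF (-1/2) e * C8 * w ^ 5 * e powr (-1/2))"
    using powr_dynkin_sum[OF w e _ fG fbk k n, of "-1/2"] unfolding f_def by auto
  have S1: "\<bar>?S1\<bar> \<le> (\<Sum>j\<in>{k..<n}. ?v * (CL (-1) * inv_moment_const))"
  proof (rule order_trans[OF sum_abs sum_mono])
    fix j assume "j \<in> {k..<n}"
    then have j: "j \<le> n" by simp
    have "\<bar>LINT \<omega>|M. 1 * powr_generator (-1) e (Y0sq (real j * ?v) \<omega>)\<bar> \<le> (LINT \<omega>|M. \<bar>1 * powr_generator (-1) e (Y0sq (real j * ?v) \<omega>)\<bar>)" by (rule integral_abs_bound)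
    also have "\<dots> \<le> (LINT \<omega>|M. CL (-1) * q j \<omega>)"
    proof (rule integral_mono)
      show "integrable M (\<lambda>\<omega>. \<bar>1 * powr_generator (-1) e (Y0sq (real j * ?v) \<omega>)\<bar>)" using powr_generator_integrable(1)[OF jT(2,1)[OF j] e, of "-1"] by simp
      show "integrable M (\<lambda>\<omega>. CL (-1) * q j \<omega>)" using qi[OF j] by simp
      show "\<bar>1 * powr_generator (-1) e (Y0sq (real j * ?v) \<omega>)\<bar> \<le> CL (-1) * q j \<omega>" if "\<omega> \<in> space M" for \<omega>
        using powr_generator_abs[OF Y0sq_bounds(1)[OF jT(2,1)[OF j] that] Y0sq_bounds(2) e, of "-1"] by (simp add: q_def)
    qed
    also have "\<dots> \<le> CL (-1) * inv_moment_const" using qE[OF j] CL[of "-1"] by (simp add: mult_left_mono)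
    finally show "\<bar>?v * (LINT \<omega>|M. 1 * powr_generator (-1) e (Y0sq (real j * ?v) \<omega>))\<bar> \<le> ?v * (CL (-1) * inv_moment_const)"
      unfolding abs_mult using v by (intro mult_mono) auto
  qed
  have S2: "\<bar>?S2\<bar> \<le> (\<Sum>j\<in>{k..<n}. ?v * (CL (-1/2) * (2 * inv_moment_const)))"
  proof (rule order_trans[OF sum_abs sum_mono])
    fix j assume "j \<in> {k..<n}"
    then have j: "j \<le> n" by simp
    have Li: "integrable M (\<lambda>\<omega>. powr_generator (-1/2) e (Y0sq (real j * ?v) \<omega>))" using powr_generator_integrable(1)[OF jT(2,1)[OF j] e, of "-1/2"] by simp
    have "\<bar>LINT \<omega>|M. f k \<omega> * powr_generator (-1/2) e (Y0sq (real j * ?v) \<omega>)\<bar> \<le> (LINT \<omega>|M. \<bar>f k \<omega> * powr_generator (-1/2) e (Y0sq (real j * ?v) \<omega>)\<bar>)" by (rule integral_abs_bound)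
    also have "\<dots> \<le> (LINT \<omega>|M. CL (-1/2) * (q k \<omega> + q j \<omega>))"
    proof (rule integral_mono)
      show "integrable M (\<lambda>\<omega>. \<bar>f k \<omega> * powr_generator (-1/2) e (Y0sq (real j * ?v) \<omega>)\<bar>)" by (intro integrable_abs fmul Li)
      show "integrable M (\<lambda>\<omega>. CL (-1/2) * (q k \<omega> + q j \<omega>))" using qi[OF j] qi[OF k] by simp
      fix \<omega> assume \<omega>: "\<omega> \<in> space M"
      have "\<bar>f k \<omega> * powr_generator (-1/2) e (Y0sq (real j * ?v) \<omega>)\<bar> = f k \<omega> * \<bar>powr_generator (-1/2) e (Y0sq (real j * ?v) \<omega>)\<bar>" using fpos by (simp add: abs_mult)
      also have "\<dots> \<le> f k \<omega> * (CL (-1/2) * (Y0sq (real j * ?v) \<omega> + e) powr (-1/2 - 1))"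
        using powr_generator_abs[OF Y0sq_bounds(1)[OF jT(2,1)[OF j] \<omega>] Y0sq_bounds(2) e, of "-1/2"] fpos by (intro mult_left_mono) auto
      also have "\<dots> = CL (-1/2) * ((Y0sq (real k * ?v) \<omega> + e) powr (-1/2) * (Y0sq (real j * ?v) \<omega> + e) powr (-3/2))" by (simp add: f_def)
      also have "\<dots> \<le> CL (-1/2) * (q k \<omega> + q j \<omega>)" using absprod[OF j \<omega>] CL by (intro mult_left_mono) auto
      finally show "\<bar>f k \<omega> * powr_generator (-1/2) e (Y0sq (real j * ?v) \<omega>)\<bar> \<le> CL (-1/2) * (q k \<omega> + q j \<omega>)" .
    qed
    also have "\<dots> = CL (-1/2) * ((LINT \<omega>|M. q k \<omega>) + (LINT \<omega>|M. q j \<omega>))" using qi[OF j] qi[OF k] by simp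
    also have "\<dots> \<le> CL (-1/2) * (2 * inv_moment_const)" using qE[OF j] qE[OF k] CL[of "-1/2"] by (intro mult_left_mono) auto
    finally show "\<bar>?v * (LINT \<omega>|M. f k \<omega> * powr_generator (-1/2) e (Y0sq (real j * ?v) \<omega>))\<bar> \<le> ?v * (CL (-1/2) * (2 * inv_moment_const))"
      unfolding abs_mult[of ?v] using v by (intro mult_mono) auto
  qed
  have expand: "(f n \<omega> - f k \<omega>)\<^sup>2 = 1 * (g n \<omega> - g k \<omega>) - 2 * (f k \<omega> * (f n \<omega> - f k \<omega>))" for \<omega>
    by (simp add: fg[symmetric] power2_eq_square algebra_simps)
  have "(LINT \<omega>|M. (f n \<omega> - f k \<omega>)\<^sup>2) = (LINT \<omega>|M. 1 * (g n \<omega> - g k \<omega>)) - 2 * (LINT \<omega>|M. f k \<omega> * (f n \<omega> - f k \<omega>))"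
    unfolding expand using gi[OF k] gi[OF order_refl] fi[OF k] fi[OF order_refl] fmul
    by (subst Bochner_Integration.integral_diff) auto
  also have "\<dots> \<le> \<bar>?S1\<bar> + ?N * (KF (-1) e * C8 * w ^ 5 * 1) + 2 * (\<bar>?S2\<bar> + ?N * (KF (-1/2) e * C8 * w ^ 5 * e powr (-1/2)))"
    using abs_diff_combine[OF D1 D2] .
  also have "\<dots> \<le> (\<Sum>j\<in>{k..<n}. ?v * (CL (-1) * inv_moment_const)) + ?N * (KF (-1) e * C8 * w ^ 5 * 1) + 2 * ((\<Sum>j\<in>{k..<n}. ?v * (CL (-1/2) * (2 * inv_moment_const))) + ?N * (KF (-1/2) e * C8 * w ^ 5 * e powr (-1/2)))"
    by (intro add_mono mult_left_mono S1 S2 order_refl) auto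
  also have "\<dots> = holder_const * (?N * ?v) + (?N * ?v) * ((KF (-1) e * C8 + 2 * (KF (-1/2) e * C8 * e powr (-1/2))) * w)"
    by (simp add: holder_const_def power_add[of w 4 1, simplified] algebra_simps)
  also have "(?N * ?v) * ((KF (-1) e * C8 + 2 * (KF (-1/2) e * C8 * e powr (-1/2))) * w) \<le> T * ((KF (-1) e * C8 + 2 * (KF (-1/2) e * C8 * e powr (-1/2))) * w)"
  proof (rule mult_right_mono)
    have "?N * ?v \<le> real n * ?v" using v by (intro mult_right_mono) auto
    then show "?N * ?v \<le> T" using n by linarith
    show "0 \<le> (KF (-1) e * C8 + 2 * (KF (-1/2) e * C8 * e powr (-1/2))) * w" using KF[of "-1"] KF[of "-1/2"] C8 w by simp
  qed
  finally show ?thesis by (simp add: mult.assoc)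
qed

lemma inv_Y_reg:
  assumes u: "0 < u" and e: "0 < e" and k: "k \<le> n" and n: "real n * u \<le> T"
  shows "(LINT \<omega>|M. ((Y0sq (real n * u) \<omega> + e) powr (-1/2) - (Y0sq (real k * u) \<omega> + e) powr (-1/2))\<^sup>2) \<le> holder_const * (real (n - k) * u)"
proof -
  obtain W where W: "\<And>l. 0 < W l" "\<And>l. W l ^ 4 = u / real (Suc l)" "W \<longlonglongrightarrow> (0::real)" by (rule fourth_root_seq[OF u]) blast
  show ?thesis
  proof (rule le_limit_vanishing[OF _ W(3)])
    fix l
    have t: "real (j * Suc l) * W l ^ 4 = real j * u" for j unfolding W(2) by (rule refine_grid)
    have d: "real (n * Suc l - k * Suc l) * W l ^ 4 = real (n - k) * u" unfolding diff_mult_distrib[symmetric] by (rule t)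
    show "(LINT \<omega>|M. ((Y0sq (real n * u) \<omega> + e) powr (-1/2) - (Y0sq (real k * u) \<omega> + e) powr (-1/2))\<^sup>2) \<le> holder_const * (real (n - k) * u) + (T * (KF (-1) e * C8 + 2 * (KF (-1/2) e * C8 * e powr (-1/2)))) * W l"
      using inv_Y_reg_step[OF W(1)[of l] e mult_le_mono1[OF k, of "Suc l"]] n unfolding t d by simp
  qed
qed

text \<open>The limit of \<open>inv_Y_reg\<close> as the shift disappears. Although it is unbounded,
  \<open>1 / Y0\<close> thus has the mean-square time regularity of a process with bounded
  coefficients.\<close>

lemma inv_Y_holder:
  assumes u: "0 < u" and k: "k \<le> n" and n: "real n * u \<le> T"
  shows "integrable M (\<lambda>\<omega>. (1 / Y0 (real n * u) \<omega> - 1 / Y0 (real k * u) \<omega>)\<^sup>2)"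
    "(LINT \<omega>|M. (1 / Y0 (real n * u) \<omega> - 1 / Y0 (real k * u) \<omega>)\<^sup>2) \<le> holder_const * (real (n - k) * u)"
proof -
  note gk = grid_le[OF u k n]
  have t: "0 \<le> real n * u" using u by simp
  let ?e = "\<lambda>i. 1 / real (Suc i)"
  let ?f = "\<lambda>j i \<omega>. (Y0sq (real j * u) \<omega> + ?e i) powr (-1/2)"
  have [measurable]: "Y0sq (real n * u) \<in> borel_measurable M" "Y0sq (real k * u) \<in> borel_measurable M"
    "Y0 (real n * u) \<in> borel_measurable M" "Y0 (real k * u) \<in> borel_measurable M"
    using Y0sq_measM Y0_measM t n gk by auto
  have elim: "?e \<longlonglongrightarrow> 0" by (rule LIMSEQ_Suc[OF lim_const_over_n])
  have nn: "(\<integral>\<^sup>+\<omega>. ennreal ((?f n i \<omega> - ?f k i \<omega>)\<^sup>2) \<partial>M) \<le> ennreal (holder_const * (real (n - k) * u))" for i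
  proof -
    have b: "\<bar>?f j i \<omega>\<bar> \<le> ?e i powr (-1/2)" if "\<omega> \<in> space M" "j = n \<or> j = k" for j \<omega>
      using Y0sq_powr_integrable(2)[of "real j * u" "?e i" "-1/2" \<omega>] that t n gk by auto
    have "\<bar>?f n i \<omega> - ?f k i \<omega>\<bar> \<le> \<bar>2 * ?e i powr (-1/2)\<bar>" if "\<omega> \<in> space M" for \<omega>
      using b[OF that, of n] b[OF that, of k] by linarith
    then have bd: "(?f n i \<omega> - ?f k i \<omega>)\<^sup>2 \<le> (2 * ?e i powr (-1/2))\<^sup>2" if "\<omega> \<in> space M" for \<omega>
      using that by (intro abs_le_square_iff[THEN iffD1])
    have "integrable M (\<lambda>\<omega>. (?f n i \<omega> - ?f k i \<omega>)\<^sup>2)"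
      by (rule integrable_const_bound[of _ "(2 * ?e i powr (-1/2))\<^sup>2"]) (use bd in auto)
    then have "(\<integral>\<^sup>+\<omega>. ennreal ((?f n i \<omega> - ?f k i \<omega>)\<^sup>2) \<partial>M) = ennreal (LINT \<omega>|M. (?f n i \<omega> - ?f k i \<omega>)\<^sup>2)"
      by (intro nn_integral_eq_integral) auto
    then show ?thesis using inv_Y_reg[OF u _ k n, of "?e i"] by (simp add: ennreal_leI)
  qed
  have "(\<integral>\<^sup>+\<omega>. ennreal ((1 / Y0 (real n * u) \<omega> - 1 / Y0 (real k * u) \<omega>)\<^sup>2) \<partial>M) = (\<integral>\<^sup>+\<omega>. liminf (\<lambda>i. ennreal ((?f n i \<omega> - ?f k i \<omega>)\<^sup>2)) \<partial>M)"
  proof (rule nn_integral_cong_AE)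
    show "AE \<omega> in M. ennreal ((1 / Y0 (real n * u) \<omega> - 1 / Y0 (real k * u) \<omega>)\<^sup>2) = liminf (\<lambda>i. ennreal ((?f n i \<omega> - ?f k i \<omega>)\<^sup>2))"
      using Y0sq_pos[OF u n] Y0sq_pos[OF u gk(3)]
    proof eventually_elim
      case (elim \<omega>)
      have y: "1 / Y0 (real j * u) \<omega> = (Y0sq (real j * u) \<omega> + 0) powr (-1/2)" if "0 < Y0sq (real j * u) \<omega>" for j
        using that by (simp add: Y0_def powr_minus powr_half_sqrt inverse_eq_divide)
      have "(\<lambda>i. (?f n i \<omega> - ?f k i \<omega>)\<^sup>2) \<longlonglongrightarrow> ((Y0sq (real n * u) \<omega> + 0) powr (-1/2) - (Y0sq (real k * u) \<omega> + 0) powr (-1/2))\<^sup>2"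
        using elim by (intro tendsto_intros \<open>?e \<longlonglongrightarrow> 0\<close>) auto
      then have "(\<lambda>i. ennreal ((?f n i \<omega> - ?f k i \<omega>)\<^sup>2)) \<longlonglongrightarrow> ennreal ((1 / Y0 (real n * u) \<omega> - 1 / Y0 (real k * u) \<omega>)\<^sup>2)"
        unfolding y[OF elim(1)] y[OF elim(2)] by (rule tendsto_ennrealI)
      from lim_imp_Liminf[OF sequentially_bot this] show ?case by (rule sym)
    qed
  qed
  also have "\<dots> \<le> liminf (\<lambda>i. \<integral>\<^sup>+\<omega>. ennreal ((?f n i \<omega> - ?f k i \<omega>)\<^sup>2) \<partial>M)" by (rule nn_integral_liminf) measurable
  also have "\<dots> \<le> liminf (\<lambda>i::nat. ennreal (holder_const * (real (n - k) * u)))" by (intro Liminf_mono always_eventually allI nn)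
  finally have le: "(\<integral>\<^sup>+\<omega>. ennreal ((1 / Y0 (real n * u) \<omega> - 1 / Y0 (real k * u) \<omega>)\<^sup>2) \<partial>M) \<le> ennreal (holder_const * (real (n - k) * u))" by (simp add: Liminf_const)
  show i: "integrable M (\<lambda>\<omega>. (1 / Y0 (real n * u) \<omega> - 1 / Y0 (real k * u) \<omega>)\<^sup>2)"
  proof (rule integrableI_nonneg)
    show "(\<integral>\<^sup>+\<omega>. ennreal ((1 / Y0 (real n * u) \<omega> - 1 / Y0 (real k * u) \<omega>)\<^sup>2) \<partial>M) < \<infinity>" using le by (auto simp: less_top[symmetric] top_unique)
  qed auto
  have "ennreal (LINT \<omega>|M. (1 / Y0 (real n * u) \<omega> - 1 / Y0 (real k * u) \<omega>)\<^sup>2) = (\<integral>\<^sup>+\<omega>. ennreal ((1 / Y0 (real n * u) \<omega> - 1 / Y0 (real k * u) \<omega>)\<^sup>2) \<partial>M)"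
    by (intro nn_integral_eq_integral[symmetric] i) auto
  moreover have "0 \<le> holder_const * (real (n - k) * u)" using holder_const u by simp
  ultimately show "(LINT \<omega>|M. (1 / Y0 (real n * u) \<omega> - 1 / Y0 (real k * u) \<omega>)\<^sup>2) \<le> holder_const * (real (n - k) * u)" using le by (metis ennreal_le_iff)
qed

lemma Y0_pos:
  assumes "0 < u" "real n * u \<le> T" shows "AE \<omega> in M. 0 < Y0 (real n * u) \<omega>"
  using Y0sq_pos[OF assms] by eventually_elim (simp add: Y0_def)

text \<open>From \<open>\<bar>a - b\<bar> = a * b * \<bar>1 / a - 1 / b\<bar>\<close> and
  \<open>Y0 \<le> 1\<close>. This improves the time order obtained from \<open>Y0_diff_le\<close>
  from 1/2 to 1, though only in expectation and not conditionally on the past.\<close>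

lemma Y_holder:
  assumes u: "0 < u" and k: "k \<le> n" and n: "real n * u \<le> T"
  shows "integrable M (\<lambda>\<omega>. (Y0 (real n * u) \<omega> - Y0 (real k * u) \<omega>)\<^sup>2)"
    "(LINT \<omega>|M. (Y0 (real n * u) \<omega> - Y0 (real k * u) \<omega>)\<^sup>2) \<le> holder_const * (real (n - k) * u)"
proof -
  note gk = grid_le[OF u k n]
  have t: "0 \<le> real n * u" using u by simp
  have [measurable]: "Y0 (real n * u) \<in> borel_measurable M" "Y0 (real k * u) \<in> borel_measurable M"
    using Y0_measM t n gk by auto
  have ae: "AE \<omega> in M. (Y0 (real n * u) \<omega> - Y0 (real k * u) \<omega>)\<^sup>2 \<le> (1 / Y0 (real n * u) \<omega> - 1 / Y0 (real k * u) \<omega>)\<^sup>2"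
    using Y0_pos[OF u n] Y0_pos[OF u gk(3)]
  proof eventually_elim
    case (elim \<omega>)
    let ?a = "Y0 (real n * u) \<omega>" and ?b = "Y0 (real k * u) \<omega>"
    have ab: "?a * ?b \<le> 1 * 1" using elim Y0_bounds(2)[of "real n * u" \<omega>] Y0_bounds(2)[of "real k * u" \<omega>] by (intro mult_mono) auto
    have "\<bar>?a - ?b\<bar> = (?a * ?b) * \<bar>1 / ?a - 1 / ?b\<bar>"
    proof -
      have "?a - ?b = (?a * ?b) * (1 / ?b - 1 / ?a)" using elim by (simp add: field_simps)
      then have "\<bar>?a - ?b\<bar> = (?a * ?b) * \<bar>1 / ?b - 1 / ?a\<bar>" using elim by (simp add: abs_mult)
      then show ?thesis by (simp only: abs_minus_commute)
    qed
    also have "\<dots> \<le> 1 * \<bar>1 / ?a - 1 / ?b\<bar>" using ab by (intro mult_right_mono) auto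
    finally have "\<bar>?a - ?b\<bar> \<le> \<bar>1 / ?a - 1 / ?b\<bar>" by simp
    then show ?case by (rule abs_le_square_iff[THEN iffD1])
  qed
  show i: "integrable M (\<lambda>\<omega>. (Y0 (real n * u) \<omega> - Y0 (real k * u) \<omega>)\<^sup>2)"
    by (rule Bochner_Integration.integrable_bound[OF inv_Y_holder(1)[OF u k n]]) (use ae in auto)
  show "(LINT \<omega>|M. (Y0 (real n * u) \<omega> - Y0 (real k * u) \<omega>)\<^sup>2) \<le> holder_const * (real (n - k) * u)"
    using integral_mono_AE[OF i inv_Y_holder(1)[OF u k n] ae] inv_Y_holder(2)[OF u k n] by linarith
qed

end

section \<open>Consistency errors of one scheme step\<close>

lemma power2_sum3_le: "(a + b + c)\<^sup>2 \<le> 3 * (a\<^sup>2 + b\<^sup>2 + c\<^sup>2)" for a b c :: real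
  using zero_le_power2[of "a - b"] zero_le_power2[of "a - c"] zero_le_power2[of "b - c"]
  by (simp add: power2_eq_square algebra_simps)

lemma power2_sum2_le: "(a + b)\<^sup>2 \<le> 2 * a\<^sup>2 + 2 * b\<^sup>2" for a b :: real
  using zero_le_power2[of "a - b"] by (simp add: power2_sum power2_diff)

lemma power2_diff2_le: "(a - b)\<^sup>2 \<le> 2 * a\<^sup>2 + 2 * b\<^sup>2" for a b :: real
  using power2_sum2_le[of a "- b"] by simp

context sde begin

text \<open>\<open>cK\<close> is the coefficient of the singular drift \<open>1 / Y0\<close> and
  \<open>aK\<close> that of the linear drift; \<open>kappa6\<close> makes \<open>cK\<close>
  positive, which the scheme needs for its implicit step.\<close>

definition cK :: real where "cK = \<kappa> - \<nu>\<^sup>2 / 2"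
definition aK :: real where "aK = \<kappa> - \<nu>\<^sup>2 / 2 + real d * \<nu>\<^sup>2 / 2"
definition L2norm :: "('w \<Rightarrow> real) \<Rightarrow> real" where "L2norm f = sqrt (LINT \<omega>|M. (f \<omega>)\<^sup>2)"
definition Crho :: real where "Crho = 2 * C9 * inv_moment_const + 2 * (cK + aK)\<^sup>2 * inv_moment_const * wmax\<^sup>2"

lemma cK: "0 < cK"
proof -
  have "0 < \<nu>\<^sup>2" using nu by simp
  then show ?thesis using kappa6 unfolding cK_def by linarith
qed

lemma aK: "0 \<le> aK" using cK by (simp add: aK_def cK_def)

lemma L2norm_nonneg: "0 \<le> L2norm f" by (simp add: L2norm_def)

lemma L2norm_le: "(LINT \<omega>|M. (f \<omega>)\<^sup>2) \<le> c \<Longrightarrow> L2norm f \<le> sqrt c" by (simp add: L2norm_def)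

lemma L2norm_sq: "(L2norm f)\<^sup>2 = (LINT \<omega>|M. (f \<omega>)\<^sup>2)" by (simp add: L2norm_def)

lemma pairing:
  assumes "f \<in> borel_measurable M" "g \<in> borel_measurable M" "integrable M (\<lambda>\<omega>. (f \<omega>)\<^sup>2)" "integrable M (\<lambda>\<omega>. (g \<omega>)\<^sup>2)" "(LINT \<omega>|M. (g \<omega>)\<^sup>2) \<le> c"
  shows "integrable M (\<lambda>\<omega>. f \<omega> * g \<omega>)" "\<bar>LINT \<omega>|M. f \<omega> * g \<omega>\<bar> \<le> L2norm f * sqrt c" "(LINT \<omega>|M. \<bar>f \<omega> * g \<omega>\<bar>) \<le> L2norm f * sqrt c"
proof -
  note C = cauchy_schwarz_integral[OF assms(1-4)]
  have "L2norm f * L2norm g \<le> L2norm f * sqrt c" using L2norm_le[OF assms(5)] L2norm_nonneg by (intro mult_left_mono) auto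
  then show "integrable M (\<lambda>\<omega>. f \<omega> * g \<omega>)" "\<bar>LINT \<omega>|M. f \<omega> * g \<omega>\<bar> \<le> L2norm f * sqrt c" "(LINT \<omega>|M. \<bar>f \<omega> * g \<omega>\<bar>) \<le> L2norm f * sqrt c"
    using C unfolding L2norm_def by linarith+
qed

lemma Y0_power10: "0 \<le> t \<Longrightarrow> t \<le> T \<Longrightarrow> \<omega> \<in> space M \<Longrightarrow> Y0 t \<omega> ^ 10 = Y0sq t \<omega> ^ 5"
  using Y0_sq[of t \<omega>] power_mult[of "Y0 t \<omega>" 2 5] by simp

lemma inv_Y_moment:
  assumes u: "0 < u" and n: "real n * u \<le> T" and p: "p \<le> 10"
  shows "integrable M (\<lambda>\<omega>. 1 / Y0 (real n * u) \<omega> ^ p)" "(LINT \<omega>|M. 1 / Y0 (real n * u) \<omega> ^ p) \<le> inv_moment_const"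
proof -
  have t: "0 \<le> real n * u" using u by simp
  have [measurable]: "Y0 (real n * u) \<in> borel_measurable M" using Y0_measM[OF t n] .
  have ae: "AE \<omega> in M. 1 / Y0 (real n * u) \<omega> ^ p \<le> 1 / Y0sq (real n * u) \<omega> ^ 5"
    using Y0_pos[OF u n] AE_space
  proof eventually_elim
    case (elim \<omega>)
    have "1 / Y0 (real n * u) \<omega> ^ p \<le> 1 / Y0 (real n * u) \<omega> ^ 10"
      using elim(1) Y0_bounds(2)[of "real n * u" \<omega>] p by (intro divide_left_mono power_decreasing) auto
    then show ?case using Y0_power10[OF t n elim(2)] by simp
  qed
  show i: "integrable M (\<lambda>\<omega>. 1 / Y0 (real n * u) \<omega> ^ p)"
  proof (rule Bochner_Integration.integrable_bound[OF Y0sq_inv5_integrable[OF u n]])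
    show "AE \<omega> in M. norm (1 / Y0 (real n * u) \<omega> ^ p) \<le> norm (1 / Y0sq (real n * u) \<omega> ^ 5)"
      using ae AE_space by eventually_elim (use Y0_bounds(1)[OF t n] Y0sq_bounds(1)[OF t n] in auto)
  qed measurable
  show "(LINT \<omega>|M. 1 / Y0 (real n * u) \<omega> ^ p) \<le> inv_moment_const"
    using integral_mono_AE[OF i Y0sq_inv5_integrable[OF u n] ae] Y0sq_inv5[OF u n] by linarith
qed

end

context sde_step begin

lemma dB_inc_G: "c < d + m \<Longrightarrow> dB s t c \<in> borel_measurable (G t)"
  using s0 st by (intro dB_meas_G) auto

lemma Y0_rem_G: "Y0_rem \<in> borel_measurable (G t)"
proof -
  have [measurable]: "Y0 s \<in> borel_measurable (G t)" using measurable_G_mono[OF Y0sG s0] st by simp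
  have [measurable]: "Y0 t \<in> borel_measurable (G t)" using Y0_meas[OF t0 k] .
  have [measurable]: "radial_noise \<in> borel_measurable (G t)" unfolding radial_noise_def
    using dB_inc_G measurable_G_mono[OF XsG s0] st by (intro borel_measurable_sum borel_measurable_times) auto
  show ?thesis unfolding Y0_rem_def[abs_def] Y0_drift_inc_def[abs_def] by measurable
qed

lemma Y0s_pos: "AE \<omega> in M. 0 < Y0 s \<omega>" by (rule Y0_pos[OF v sT])

text \<open>Cauchy-Schwarz between \<open>h\<close> and \<open>1 / Y0 ^ 5\<close>: the step that
  calls for the inverse moment of order 10. The result is still one factor \<open>w\<close> short of
  what the error recursion needs.\<close>

lemma Y0_rem_pairing:
  assumes h: "h \<in> borel_measurable (G s)" "integrable M (\<lambda>\<omega>. (h \<omega>)\<^sup>2)"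
  shows "integrable M (\<lambda>\<omega>. h \<omega> * Y0_rem \<omega>)" "\<bar>LINT \<omega>|M. h \<omega> * Y0_rem \<omega>\<bar> \<le> L2norm h * (C10 * sqrt inv_moment_const * w ^ 5)"
proof -
  have hM [measurable]: "h \<in> borel_measurable M" using measurable_G_M[OF h(1) s0] .
  have g2: "(1 / Y0 s \<omega> ^ 5)\<^sup>2 = 1 / Y0 s \<omega> ^ 10" for \<omega> by (simp add: power_divide power_mult[symmetric])
  have gi: "integrable M (\<lambda>\<omega>. (1 / Y0 s \<omega> ^ 5)\<^sup>2)" and gle: "(LINT \<omega>|M. (1 / Y0 s \<omega> ^ 5)\<^sup>2) \<le> inv_moment_const"
    unfolding g2 using inv_Y_moment[OF v sT, of 10] by auto
  have gm: "(\<lambda>\<omega>. 1 / Y0 s \<omega> ^ 5) \<in> borel_measurable M" by measurable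
  note P = pairing[OF hM gm h(2) gi gle]
  have i: "integrable M (\<lambda>\<omega>. h \<omega> / Y0 s \<omega> ^ 5)" using P(1) by simp
  note R = Y0_rem_weak[OF Y0s_pos h(1) i]
  show "integrable M (\<lambda>\<omega>. h \<omega> * Y0_rem \<omega>)" by (rule R(1))
  have "(LINT \<omega>|M. \<bar>h \<omega>\<bar> / Y0 s \<omega> ^ 5) = (LINT \<omega>|M. \<bar>h \<omega> * (1 / Y0 s \<omega> ^ 5)\<bar>)"
    using Y0s(1) by (intro Bochner_Integration.integral_cong) (auto simp: abs_mult)
  then have "C10 * w ^ 5 * (LINT \<omega>|M. \<bar>h \<omega>\<bar> / Y0 s \<omega> ^ 5) \<le> C10 * w ^ 5 * (L2norm h * sqrt inv_moment_const)"
    using P(3) C10 w by (intro mult_left_mono) auto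
  then show "\<bar>LINT \<omega>|M. h \<omega> * Y0_rem \<omega>\<bar> \<le> L2norm h * (C10 * sqrt inv_moment_const * w ^ 5)" using R(2) by (simp add: ac_simps)
qed

lemma Y0_drift_alt: "Y0_drift y = cK / y - aK * y" by (simp add: Y0_drift_def cK_def aK_def)

lemma Y0_rem_L2: "integrable M (\<lambda>\<omega>. (Y0_rem \<omega>)\<^sup>2)" "(LINT \<omega>|M. (Y0_rem \<omega>)\<^sup>2) \<le> Crho * w ^ 6"
proof -
  have i4: "integrable M (\<lambda>\<omega>. 1 / Y0 s \<omega> ^ 4)" and l4: "(LINT \<omega>|M. 1 / Y0 s \<omega> ^ 4) \<le> inv_moment_const" using inv_Y_moment[OF v sT, of 4] by auto
  have i2: "integrable M (\<lambda>\<omega>. 1 / Y0 s \<omega> ^ 2)" and l2: "(LINT \<omega>|M. 1 / Y0 s \<omega> ^ 2) \<le> inv_moment_const" using inv_Y_moment[OF v sT, of 2] by auto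
  have D: "integrable M (\<lambda>\<omega>. (Y0_drift_inc \<omega>)\<^sup>2)" "(LINT \<omega>|M. (Y0_drift_inc \<omega>)\<^sup>2) \<le> C9 * w ^ 6 * inv_moment_const"
  proof -
    note W = Y0_drift_inc_weighted[OF Y0s_pos, of "\<lambda>_. 1"]
    show "integrable M (\<lambda>\<omega>. (Y0_drift_inc \<omega>)\<^sup>2)" using W(1) i4 by simp
    have "(LINT \<omega>|M. (Y0_drift_inc \<omega>)\<^sup>2) \<le> C9 * w ^ 6 * (LINT \<omega>|M. 1 / Y0 s \<omega> ^ 4)" using W(2) i4 by simp
    also have "\<dots> \<le> C9 * w ^ 6 * inv_moment_const" using l4 C9 w by (intro mult_left_mono) auto
    finally show "(LINT \<omega>|M. (Y0_drift_inc \<omega>)\<^sup>2) \<le> C9 * w ^ 6 * inv_moment_const" .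
  qed
  let ?R = "\<lambda>\<omega>. 2 * (Y0_drift_inc \<omega>)\<^sup>2 + (2 * (cK + aK)\<^sup>2 * w ^ 8) * (1 / Y0 s \<omega> ^ 2)"
  have Ri: "integrable M ?R" by (intro Bochner_Integration.integrable_add integrable_mult_right D i2)
  have ae: "AE \<omega> in M. (Y0_rem \<omega>)\<^sup>2 \<le> ?R \<omega>"
    using Y0s_pos
  proof eventually_elim
    case (elim \<omega>)
    define y where "y = Y0 s \<omega>"
    have y: "0 < y" "y \<le> 1" using elim Y0s(2) by (auto simp: y_def)
    have "aK * y \<le> aK / y"
    proof -
      have "aK * y * y \<le> aK * 1 * 1" using y aK by (intro mult_mono) auto
      then show ?thesis using y by (simp add: field_simps)
    qed
    then have "\<bar>Y0_drift y\<bar> \<le> (cK + aK) / y" using y cK aK unfolding Y0_drift_alt add_divide_distrib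
      by (intro abs_leI) (auto intro: order_trans[of _ "cK / y"] simp: add_increasing add_increasing2)
    then have "\<bar>Y0_drift y\<bar> * \<bar>v\<bar> \<le> (cK + aK) / y * \<bar>v\<bar>" by (intro mult_right_mono) auto
    moreover have "0 \<le> (cK + aK) / y" using y cK aK by simp
    ultimately have "\<bar>Y0_drift y * v\<bar> \<le> \<bar>(cK + aK) / y * v\<bar>" by (simp only: abs_mult[of _ v] abs_of_nonneg)
    then have "(Y0_drift y * v)\<^sup>2 \<le> ((cK + aK) / y * v)\<^sup>2" by (rule abs_le_square_iff[THEN iffD1])
    also have "\<dots> = (cK + aK)\<^sup>2 * w ^ 8 * (1 / y ^ 2)" by (simp add: power_mult_distrib power_divide power_mult[symmetric])
    finally show ?case unfolding Y0_rem_def y_def using power2_diff2_le[of "Y0_drift_inc \<omega>" "Y0_drift (Y0 s \<omega>) * v"] by linarith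
  qed
  show i: "integrable M (\<lambda>\<omega>. (Y0_rem \<omega>)\<^sup>2)"
    by (rule Bochner_Integration.integrable_bound[OF Ri]) (use ae in auto)
  have "(LINT \<omega>|M. (Y0_rem \<omega>)\<^sup>2) \<le> (LINT \<omega>|M. ?R \<omega>)" by (rule integral_mono_AE[OF i Ri ae])
  also have "\<dots> = 2 * (LINT \<omega>|M. (Y0_drift_inc \<omega>)\<^sup>2) + (2 * (cK + aK)\<^sup>2 * w ^ 8) * (LINT \<omega>|M. 1 / Y0 s \<omega> ^ 2)"
    by (simp only: Bochner_Integration.integral_add[OF integrable_mult_right[OF D(1)] integrable_mult_right[OF i2]] integral_mult_right_zero)
  also have "\<dots> \<le> 2 * (C9 * w ^ 6 * inv_moment_const) + (2 * (cK + aK)\<^sup>2 * (wmax\<^sup>2 * w ^ 6)) * inv_moment_const"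
    using D(2) l2 w_pows(1) inv_moment_const w by (intro add_mono mult_mono) (auto intro!: integral_nonneg_AE)
  finally show "(LINT \<omega>|M. (Y0_rem \<omega>)\<^sup>2) \<le> Crho * w ^ 6" by (simp add: Crho_def algebra_simps)
qed

text \<open>The remainder relative to coefficients taken at an earlier time \<open>r\<close>. Only
  the linear drift and the noise are frozen; the singular drift stays at the current time.\<close>

definition frozen_rem :: "real \<Rightarrow> 'a \<Rightarrow> real" where
  "frozen_rem r \<omega> = Y0_rem \<omega> - aK * (Y0 s \<omega> - Y0 r \<omega>) * v - \<nu> * (\<Sum>c<d. (X s \<omega> c - X r \<omega> c) * dB s t c \<omega>)"

text \<open>Freezing costs increments of \<open>Y0\<close> in the drift and of \<open>X\<close> in
  the noise. The noise correction is centred given the past, so it enters the mean square but not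
  the pairing with \<open>h\<close>.\<close>

lemma frozen_rem_facts:
  assumes r: "0 \<le> r" "r \<le> s"
    and Y: "integrable M (\<lambda>\<omega>. (Y0 s \<omega> - Y0 r \<omega>)\<^sup>2)" "(LINT \<omega>|M. (Y0 s \<omega> - Y0 r \<omega>)\<^sup>2) \<le> b1"
    and Xd: "\<And>c. c < d \<Longrightarrow> integrable M (\<lambda>\<omega>. (X s \<omega> c - X r \<omega> c)\<^sup>2)" "\<And>c. c < d \<Longrightarrow> (LINT \<omega>|M. (X s \<omega> c - X r \<omega> c)\<^sup>2) \<le> b2"
  shows frozen_rem_G: "frozen_rem r \<in> borel_measurable (G t)"
    and frozen_rem_int: "integrable M (\<lambda>\<omega>. (frozen_rem r \<omega>)\<^sup>2)"
    and frozen_rem_L2: "(LINT \<omega>|M. (frozen_rem r \<omega>)\<^sup>2) \<le> 3 * (Crho * w ^ 6 + aK\<^sup>2 * v\<^sup>2 * b1 + \<nu>\<^sup>2 * (real d)\<^sup>2 * v * b2)"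
    and frozen_rem_pair: "h \<in> borel_measurable (G s) \<Longrightarrow> integrable M (\<lambda>\<omega>. (h \<omega>)\<^sup>2) \<Longrightarrow>
       integrable M (\<lambda>\<omega>. h \<omega> * frozen_rem r \<omega>) \<and> \<bar>LINT \<omega>|M. h \<omega> * frozen_rem r \<omega>\<bar> \<le> L2norm h * (C10 * sqrt inv_moment_const * w ^ 5 + aK * v * sqrt b1)"
proof -
  have rT: "r \<le> T" using r sT by simp
  have XrG: "c < d \<Longrightarrow> (\<lambda>\<omega>. X r \<omega> c) \<in> borel_measurable (G s)" for c using measurable_G_mono[OF X_meas[OF r(1) rT] r] .
  have YrG [measurable]: "Y0 r \<in> borel_measurable (G s)" using measurable_G_mono[OF Y0_meas[OF r(1) rT] r] .
  have YrM [measurable]: "Y0 r \<in> borel_measurable M" using Y0_measM[OF r(1) rT] .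
  let ?y = "\<lambda>\<omega>. Y0 s \<omega> - Y0 r \<omega>"
  let ?x = "\<lambda>c \<omega>. X s \<omega> c - X r \<omega> c"
  have xG: "c < d \<Longrightarrow> ?x c \<in> borel_measurable (G s)" for c using XsG XrG by measurable
  have xb: "c < d \<Longrightarrow> \<omega> \<in> space M \<Longrightarrow> \<bar>?x c \<omega>\<bar> \<le> 2" for c \<omega>
    using Xs1[of \<omega> c] X_abs_le_1[OF r(1) rT, of \<omega> c] by linarith
  let ?N = "\<lambda>\<omega>. \<Sum>c<d. ?x c \<omega> * dB s t c \<omega>"
  let ?f = "\<lambda>c. if c < d then ?x c else (\<lambda>_. 0)"
  have Neq: "(\<Sum>c<d+m. ?f c \<omega> * dB s t c \<omega>) = ?N \<omega>" for \<omega>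
    by (rule sum.mono_neutral_cong_right) auto
  have fG: "?f c \<in> borel_measurable (G s)" for c using xG by auto
  have fb: "\<bar>?f c \<omega>\<bar> \<le> 2" if "\<omega> \<in> space M" for c \<omega> using xb that by auto
  note L = linear_gauss[OF s0 st, of ?f 2, OF fG fb, unfolded Neq]
  have Nm [measurable]: "?N \<in> borel_measurable M" and Nc: "cond_abs_le M (G s) ?N 0" and N2: "cond_le M (G s) (\<lambda>\<omega>. (?N \<omega>)\<^sup>2) ((real (d+m))\<^sup>2 * 2\<^sup>2 * (t - s))"
    using L by simp_all
  show DG: "frozen_rem r \<in> borel_measurable (G t)"
  proof -
    have st': "s \<le> t" using st by simp
    have [measurable]: "Y0 s \<in> borel_measurable (G t)" "Y0 r \<in> borel_measurable (G t)" "Y0_rem \<in> borel_measurable (G t)"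
      using measurable_G_mono[OF Y0sG s0 st'] measurable_G_mono[OF YrG s0 st'] Y0_rem_G by auto
    have [measurable]: "?N \<in> borel_measurable (G t)"
      using dB_inc_G measurable_G_mono[OF xG s0 st'] by (intro borel_measurable_sum borel_measurable_times) auto
    show ?thesis unfolding frozen_rem_def[abs_def] by measurable
  qed
  have Dm [measurable]: "frozen_rem r \<in> borel_measurable M" using measurable_G_M[OF DG t0] .
  have Ni: "integrable M (\<lambda>\<omega>. (?N \<omega>)\<^sup>2)" using cond_le_integrable[OF subalgebra_Gs prob_space_M N2] by simp
  have xdi: "integrable M (\<lambda>\<omega>. (?x c \<omega>)\<^sup>2 * (dB s t c \<omega>)\<^sup>2)" and xdl: "(LINT \<omega>|M. (?x c \<omega>)\<^sup>2 * (dB s t c \<omega>)\<^sup>2) \<le> v * b2" if c: "c < d" for c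
  proof -
    have c': "c < d + m" using c by simp
    have m2: "(\<lambda>\<omega>. (?x c \<omega>)\<^sup>2) \<in> borel_measurable (G s)" using xG[OF c] by measurable
    note I = cond_le_integral[OF subalgebra_Gs dB_single(4)[OF s0 st c'] m2 Xd(1)[OF c]]
    show "integrable M (\<lambda>\<omega>. (?x c \<omega>)\<^sup>2 * (dB s t c \<omega>)\<^sup>2)" using I(1) by simp
    have "(LINT \<omega>|M. (?x c \<omega>)\<^sup>2 * (dB s t c \<omega>)\<^sup>2) \<le> v * (LINT \<omega>|M. (?x c \<omega>)\<^sup>2)" using I(2) unfolding ts by simp
    also have "\<dots> \<le> v * b2" using Xd(2)[OF c] v by (intro mult_left_mono) auto
    finally show "(LINT \<omega>|M. (?x c \<omega>)\<^sup>2 * (dB s t c \<omega>)\<^sup>2) \<le> v * b2" .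
  qed
  have NL: "(LINT \<omega>|M. (?N \<omega>)\<^sup>2) \<le> (real d)\<^sup>2 * v * b2"
  proof -
    have "(LINT \<omega>|M. (?N \<omega>)\<^sup>2) \<le> (LINT \<omega>|M. real d * (\<Sum>c<d. (?x c \<omega>)\<^sup>2 * (dB s t c \<omega>)\<^sup>2))"
    proof (rule integral_mono[OF Ni])
      show "integrable M (\<lambda>\<omega>. real d * (\<Sum>c<d. (?x c \<omega>)\<^sup>2 * (dB s t c \<omega>)\<^sup>2))" by (intro integrable_mult_right Bochner_Integration.integrable_sum xdi) auto
      show "(?N \<omega>)\<^sup>2 \<le> real d * (\<Sum>c<d. (?x c \<omega>)\<^sup>2 * (dB s t c \<omega>)\<^sup>2)" for \<omega>
        using sum_power2_le_card[where f="\<lambda>c. ?x c \<omega> * dB s t c \<omega>" and n=d] by (simp add: power_mult_distrib)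
    qed
    also have "\<dots> = real d * (\<Sum>c<d. LINT \<omega>|M. (?x c \<omega>)\<^sup>2 * (dB s t c \<omega>)\<^sup>2)"
      by (simp only: integral_mult_right_zero) (subst Bochner_Integration.integral_sum, rule xdi, simp, rule refl)
    also have "\<dots> \<le> real d * (\<Sum>c<d. v * b2)" by (intro mult_left_mono sum_mono xdl) auto
    finally show ?thesis by (simp add: power2_eq_square)
  qed
  let ?R = "\<lambda>\<omega>. 3 * (Y0_rem \<omega>)\<^sup>2 + (3 * aK\<^sup>2 * v\<^sup>2) * (?y \<omega>)\<^sup>2 + (3 * \<nu>\<^sup>2) * (?N \<omega>)\<^sup>2"
  have Ri: "integrable M ?R" by (intro Bochner_Integration.integrable_add integrable_mult_right Y0_rem_L2 Y Ni)
  have le: "(frozen_rem r \<omega>)\<^sup>2 \<le> ?R \<omega>" for \<omega>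
  proof -
    have "(frozen_rem r \<omega>)\<^sup>2 \<le> 3 * ((Y0_rem \<omega>)\<^sup>2 + (- (aK * ?y \<omega> * v))\<^sup>2 + (- (\<nu> * ?N \<omega>))\<^sup>2)"
      unfolding frozen_rem_def using power2_sum3_le[of "Y0_rem \<omega>" "- (aK * ?y \<omega> * v)" "- (\<nu> * ?N \<omega>)"] by simp
    also have "(- (aK * ?y \<omega> * v))\<^sup>2 = aK\<^sup>2 * v\<^sup>2 * (?y \<omega>)\<^sup>2" by (simp only: power2_minus power_mult_distrib ac_simps)
    also have "(- (\<nu> * ?N \<omega>))\<^sup>2 = \<nu>\<^sup>2 * (?N \<omega>)\<^sup>2" by (simp only: power2_minus power_mult_distrib)
    finally show ?thesis by (simp only: distrib_left mult.assoc)
  qed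
  show Di: "integrable M (\<lambda>\<omega>. (frozen_rem r \<omega>)\<^sup>2)"
    by (rule Bochner_Integration.integrable_bound[OF Ri]) (use le in \<open>auto intro!: AE_I2 order_trans[OF le]\<close>)
  have "(LINT \<omega>|M. (frozen_rem r \<omega>)\<^sup>2) \<le> (LINT \<omega>|M. ?R \<omega>)" by (rule integral_mono[OF Di Ri le])
  also have "\<dots> = 3 * (LINT \<omega>|M. (Y0_rem \<omega>)\<^sup>2) + (3 * aK\<^sup>2 * v\<^sup>2) * (LINT \<omega>|M. (?y \<omega>)\<^sup>2) + (3 * \<nu>\<^sup>2) * (LINT \<omega>|M. (?N \<omega>)\<^sup>2)"
    by (simp only: Bochner_Integration.integral_add[OF Bochner_Integration.integrable_add[OF integrable_mult_right[OF Y0_rem_L2(1)] integrable_mult_right[OF Y(1)]] integrable_mult_right[OF Ni]]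
       Bochner_Integration.integral_add[OF integrable_mult_right[OF Y0_rem_L2(1)] integrable_mult_right[OF Y(1)]] integral_mult_right_zero)
  also have "\<dots> \<le> 3 * (Crho * w ^ 6) + (3 * aK\<^sup>2 * v\<^sup>2) * b1 + (3 * \<nu>\<^sup>2) * ((real d)\<^sup>2 * v * b2)"
    using Y0_rem_L2(2) Y(2) NL by (intro add_mono mult_left_mono) auto
  finally show "(LINT \<omega>|M. (frozen_rem r \<omega>)\<^sup>2) \<le> 3 * (Crho * w ^ 6 + aK\<^sup>2 * v\<^sup>2 * b1 + \<nu>\<^sup>2 * (real d)\<^sup>2 * v * b2)" by (simp add: algebra_simps)
  assume h: "h \<in> borel_measurable (G s)" "integrable M (\<lambda>\<omega>. (h \<omega>)\<^sup>2)"
  have hM: "h \<in> borel_measurable M" using measurable_G_M[OF h(1) s0] .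
  have hi: "integrable M h" using square_integrable_imp_integrable[OF hM h(2)] .
  note P1 = Y0_rem_pairing[OF h]
  have ym: "?y \<in> borel_measurable M" by measurable
  note P2 = pairing[OF hM ym h(2) Y]
  note P3 = cond_abs_le_L1[OF subalgebra_Gs prob_space_M Nc N2 h(1) hi]
  have eq: "h \<omega> * frozen_rem r \<omega> = h \<omega> * Y0_rem \<omega> - (aK * v) * (h \<omega> * ?y \<omega>) - \<nu> * (h \<omega> * ?N \<omega>)" for \<omega>
    unfolding frozen_rem_def by (simp add: algebra_simps)
  note J = Bochner_Integration.integrable_diff[OF P1(1) integrable_mult_right[OF P2(1), of "aK * v"]]
  have I: "integrable M (\<lambda>\<omega>. h \<omega> * frozen_rem r \<omega>)" unfolding eq
    by (intro Bochner_Integration.integrable_diff integrable_mult_right P1 P2 P3)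
  have "(LINT \<omega>|M. h \<omega> * frozen_rem r \<omega>) = (LINT \<omega>|M. h \<omega> * Y0_rem \<omega>) - (aK * v) * (LINT \<omega>|M. h \<omega> * ?y \<omega>) - \<nu> * (LINT \<omega>|M. h \<omega> * ?N \<omega>)"
    unfolding eq by (simp only: Bochner_Integration.integral_diff[OF J integrable_mult_right[OF P3(1), of \<nu>]] Bochner_Integration.integral_diff[OF P1(1) integrable_mult_right[OF P2(1), of "aK * v"]] integral_mult_right_zero)
  moreover have "(LINT \<omega>|M. h \<omega> * ?N \<omega>) = 0" using P3(2) by simp
  moreover have "\<bar>(aK * v) * (LINT \<omega>|M. h \<omega> * ?y \<omega>)\<bar> \<le> (aK * v) * (L2norm h * sqrt b1)"
  proof -
    have "\<bar>(aK * v) * (LINT \<omega>|M. h \<omega> * ?y \<omega>)\<bar> = (aK * v) * \<bar>LINT \<omega>|M. h \<omega> * ?y \<omega>\<bar>" using aK v by (simp add: abs_mult)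
    also have "\<dots> \<le> (aK * v) * (L2norm h * sqrt b1)" using P2(2) aK v by (intro mult_left_mono) auto
    finally show ?thesis .
  qed
  ultimately have "\<bar>LINT \<omega>|M. h \<omega> * frozen_rem r \<omega>\<bar> \<le> L2norm h * (C10 * sqrt inv_moment_const * w ^ 5) + (aK * v) * (L2norm h * sqrt b1)"
    using P1(2) by simp
  then show "integrable M (\<lambda>\<omega>. h \<omega> * frozen_rem r \<omega>) \<and> \<bar>LINT \<omega>|M. h \<omega> * frozen_rem r \<omega>\<bar> \<le> L2norm h * (C10 * sqrt inv_moment_const * w ^ 5 + aK * v * sqrt b1)"
    using I by (simp add: algebra_simps)
qed

end

section \<open>Sharp consistency errors, by refining one step of the scheme\<close>

context sde begin

text \<open>Local remainder of \<open>Y0\<close> with the regular coefficients frozen at time \<open>r\<close>: on the refinement of a coarse step these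
  remainders, with \<open>r\<close> the left end point, sum up to \<open>implicit_rem\<close> apart from the singular drift.\<close>
definition grid_rem :: "real \<Rightarrow> nat \<Rightarrow> real \<Rightarrow> 'w \<Rightarrow> real" where
  "grid_rem h j r \<omega> = Y0 (real (Suc j) * h) \<omega> - Y0 (real j * h) \<omega> + \<nu> * (\<Sum>c<d. X r \<omega> c * dB (real j * h) (real (Suc j) * h) c \<omega>)
     - cK * h * (1 / Y0 (real j * h) \<omega>) + aK * Y0 r \<omega> * h"

definition CX2 :: real where "CX2 = C2 * (1 + holder_const)"
definition CR1 :: real where "CR1 = (aK + cK) * sqrt holder_const"
definition CR2 :: real where "CR2 = 6 * (5 * aK\<^sup>2 * holder_const * T + 3 * \<nu>\<^sup>2 * (real d)\<^sup>2 * C1) + 2 * cK\<^sup>2 * holder_const * T"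

lemma CR1: "0 \<le> CR1" using aK cK holder_const by (simp add: CR1_def)
lemma CR2: "0 \<le> CR2" using holder_const T C1_nonneg by (simp add: CR2_def)
lemma CX2: "0 \<le> CX2" using C2_nonneg holder_const by (simp add: CX2_def)

end

context sde_step begin

lemma frozen_rem_eq_grid_rem: "frozen_rem r \<omega> = grid_rem v k r \<omega>"
proof -
  have eq: "(\<Sum>c<d. (X s \<omega> c - X r \<omega> c) * dB s t c \<omega>) = radial_noise \<omega> - (\<Sum>c<d. X r \<omega> c * dB s t c \<omega>)"
    by (simp add: radial_noise_def left_diff_distrib sum_subtractf)
  show ?thesis unfolding frozen_rem_def eq grid_rem_def Y0_rem_def Y0_drift_inc_def Y0_drift_alt by (simp add: algebra_simps)
qed

text \<open>The residual of the exact solution in one step of the scheme for \<open>Y0\<close>: as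
  in the implicit step, the singular drift is taken at the right end point.\<close>

definition implicit_rem :: "'a \<Rightarrow> real" where
  "implicit_rem \<omega> = Y0 t \<omega> - Y0 s \<omega> - cK * v / Y0 t \<omega> + aK * Y0 s \<omega> * v + \<nu> * radial_noise \<omega>"

lemma implicit_rem_meas [measurable]: "implicit_rem \<in> borel_measurable M" unfolding implicit_rem_def[abs_def] by measurable

text \<open>The coarse step is split into \<open>Suc l\<close> steps of length \<open>W ^ 4\<close>; the terms with the factor \<open>W\<close> disappear as \<open>l \<rightarrow> \<infinity>\<close>.\<close>
lemma implicit_rem_fine:
  assumes W: "0 < W" "W ^ 4 = v / real (Suc l)"
  shows "integrable M (\<lambda>\<omega>. (implicit_rem \<omega>)\<^sup>2)"
    "(LINT \<omega>|M. (implicit_rem \<omega>)\<^sup>2) \<le> CR2 * v\<^sup>2 + (6 * (2 * C10\<^sup>2 * inv_moment_const * v\<^sup>2 + 3 * Crho * v) * wmax) * W"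
    "h \<in> borel_measurable (G s) \<Longrightarrow> integrable M (\<lambda>\<omega>. (h \<omega>)\<^sup>2) \<Longrightarrow>
       \<bar>LINT \<omega>|M. h \<omega> * implicit_rem \<omega>\<bar> \<le> L2norm h * CR1 * w ^ 6 + (L2norm h * C10 * sqrt inv_moment_const * v) * W"
proof -
  define L where "L = Suc l"
  define H where "H = W ^ 4"
  have L: "0 < real L" by (simp add: L_def)
  have H: "0 < H" using W(1) unfolding H_def by (rule zero_less_power)
  have LH: "real L * H = v" using W(2) L by (simp add: H_def L_def del: of_nat_Suc)
  have Hv: "H \<le> v"
  proof -
    have "1 * H \<le> real L * H" using H L_def by (intro mult_right_mono) auto
    then show ?thesis using LH by simp
  qed
  have sH: "real (k * L) * H = s" and tH: "real (Suc k * L) * H = t" using LH by (simp_all add: mult.assoc algebra_simps)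
  have jT: "real j * H \<le> T" if "j \<le> Suc k * L" for j
  proof -
    have "real j * H \<le> real (Suc k * L) * H" using that H by (intro mult_right_mono) (auto simp del: of_nat_mult of_nat_Suc)
    then show ?thesis unfolding tH using k by linarith
  qed
  have js: "s \<le> real j * H" if "k * L \<le> j" for j
    unfolding sH[symmetric] using that H by (intro mult_right_mono) (auto simp del: of_nat_mult of_nat_Suc)
  have dist1: "real (j - k * L) * H \<le> v" and dist2: "real (Suc k * L - j) * H \<le> v" if "k * L \<le> j" "j \<le> Suc k * L" for j
  proof -
    have "j - k * L \<le> L" "Suc k * L - j \<le> L" using that by auto
    then have "real (j - k * L) * H \<le> real L * H" "real (Suc k * L - j) * H \<le> real L * H" using H by (auto intro!: mult_right_mono simp del: of_nat_diff)
    then show "real (j - k * L) * H \<le> v" "real (Suc k * L - j) * H \<le> v" unfolding LH .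
  qed
  let ?b1 = "holder_const * v" and ?b2 = "C1 * v"
  \<comment> \<open>For each fine step, \<open>A\<close> bounds the correlation with the past and
    \<open>Bq\<close> the mean square, both with coefficients frozen at the left end point
    \<open>s\<close> of the coarse step.\<close>
  define A where "A = C10 * sqrt inv_moment_const * W ^ 5 + aK * H * sqrt ?b1"
  define Bq where "Bq = 3 * (Crho * W ^ 6 + aK\<^sup>2 * H\<^sup>2 * ?b1 + \<nu>\<^sup>2 * (real d)\<^sup>2 * H * ?b2)"
  have A: "0 \<le> A" using C10 inv_moment_const W aK H holder_const v by (simp add: A_def)
  have stp: "grid_rem H j s \<in> borel_measurable (G (real (Suc j) * H)) \<and> integrable M (\<lambda>\<omega>. (grid_rem H j s \<omega>)\<^sup>2) \<and> (LINT \<omega>|M. (grid_rem H j s \<omega>)\<^sup>2) \<le> Bq \<and>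
     (\<forall>h. h \<in> borel_measurable (G (real j * H)) \<longrightarrow> integrable M (\<lambda>\<omega>. (h \<omega>)\<^sup>2) \<longrightarrow>
       integrable M (\<lambda>\<omega>. h \<omega> * grid_rem H j s \<omega>) \<and> \<bar>LINT \<omega>|M. h \<omega> * grid_rem H j s \<omega>\<bar> \<le> L2norm h * A)"
    if j: "k * L \<le> j" "j < Suc k * L" for j
  proof -
    have SjT: "real (Suc j) * W ^ 4 \<le> T" using jT[of "Suc j"] j by (simp add: H_def del: of_nat_Suc)
    interpret fs: sde_step M F d m T \<kappa> \<nu> AA B X x0 W j by (rule sde_step_I[OF W(1) SjT])
    have D: "fs.frozen_rem s = grid_rem H j s" using fs.frozen_rem_eq_grid_rem by (auto simp: H_def)
    have Y1: "integrable M (\<lambda>\<omega>. (Y0 (real j * H) \<omega> - Y0 s \<omega>)\<^sup>2)" and Y2: "(LINT \<omega>|M. (Y0 (real j * H) \<omega> - Y0 s \<omega>)\<^sup>2) \<le> ?b1"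
    proof -
      have jT': "real j * H \<le> T" using j jT by simp
      note Y = Y_holder[OF H j(1) jT', unfolded sH]
      show "integrable M (\<lambda>\<omega>. (Y0 (real j * H) \<omega> - Y0 s \<omega>)\<^sup>2)" by (rule Y(1))
      have "holder_const * (real (j - k * L) * H) \<le> ?b1" using dist1[of j] j holder_const by (intro mult_left_mono) auto
      then show "(LINT \<omega>|M. (Y0 (real j * H) \<omega> - Y0 s \<omega>)\<^sup>2) \<le> ?b1" using Y(2) by linarith
    qed
    have X1: "integrable M (\<lambda>\<omega>. (X (real j * H) \<omega> c - X s \<omega> c)\<^sup>2)" and X2: "(LINT \<omega>|M. (X (real j * H) \<omega> c - X s \<omega> c)\<^sup>2) \<le> ?b2" if c: "c < d" for c
    proof -
      have jT': "real j * H \<le> T" using j jT by simp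
      note I = cond_le_integrable[OF subalgebra_Gs prob_space_M X_increment[OF H j(1) jT' c, unfolded sH]]
      show "integrable M (\<lambda>\<omega>. (X (real j * H) \<omega> c - X s \<omega> c)\<^sup>2)" by (rule I(1))
      have "real j * H - s = real (j - k * L) * H" unfolding sH[symmetric] using j(1) by (simp add: of_nat_diff left_diff_distrib)
      then have "C1 * (real j * H - s) \<le> ?b2" using dist1[of j] j C1_nonneg by (intro mult_left_mono) auto
      then show "(LINT \<omega>|M. (X (real j * H) \<omega> c - X s \<omega> c)\<^sup>2) \<le> ?b2" using I(2) by linarith
    qed
    note F = fs.frozen_rem_facts[OF s0, folded H_def, OF js[OF j(1)] Y1 Y2 X1 X2, unfolded D]
    show ?thesis using F unfolding A_def Bq_def by blast
  qed
  define S where "S n \<omega> = (\<Sum>j\<in>{k * L..<n}. grid_rem H j s \<omega>)" for n \<omega>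
  have noise_coeff: "S n \<in> borel_measurable (G (real n * H))" if "n \<le> Suc k * L" for n
    unfolding S_def[abs_def]
  proof (rule borel_measurable_sum)
    fix j assume j: "j \<in> {k * L..<n}"
    have jn: "k * L \<le> j" "j < Suc k * L" using j that by auto
    have le: "real (Suc j) * H \<le> real n * H" using j H by (intro mult_right_mono) (auto simp del: of_nat_Suc)
    have "0 \<le> real (Suc j) * H" using H by simp
    then show "grid_rem H j s \<in> borel_measurable (G (real n * H))"
      using le by (rule measurable_G_mono[OF conjunct1[OF stp[OF jn]]])
  qed
  have SM: "S n \<in> borel_measurable M" if "n \<le> Suc k * L" for n using measurable_G_M[OF noise_coeff[OF that]] H by simp
  have DM: "grid_rem H j s \<in> borel_measurable M" if "k * L \<le> j" "j < Suc k * L" for j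
  proof -
    have "0 \<le> real (Suc j) * H" using H by simp
    then show ?thesis using measurable_G_M stp[OF that] by blast
  qed
  have Srec: "S (Suc n) \<omega> = S n \<omega> + grid_rem H n s \<omega>" if "k * L \<le> n" for n \<omega> using that by (simp add: S_def)
  have Sint: "integrable M (\<lambda>\<omega>. (S n \<omega>)\<^sup>2)" if "k * L \<le> n" "n \<le> Suc k * L" for n
    using that
  proof (induction n rule: dec_induct)
    case (step n)
    have "integrable M (\<lambda>\<omega>. (S n \<omega>)\<^sup>2 + 2 * (S n \<omega> * grid_rem H n s \<omega>) + (grid_rem H n s \<omega>)\<^sup>2)"
    proof (intro Bochner_Integration.integrable_add integrable_mult_right)
      have n: "k * L \<le> n" "n < Suc k * L" using step.hyps step.prems by auto
      show i: "integrable M (\<lambda>\<omega>. (S n \<omega>)\<^sup>2)" using step.IH n by simp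
      show "integrable M (\<lambda>\<omega>. (grid_rem H n s \<omega>)\<^sup>2)" "integrable M (\<lambda>\<omega>. S n \<omega> * grid_rem H n s \<omega>)"
        using stp[OF n] i noise_coeff[OF less_imp_le[OF n(2)]] by blast+
    qed
    then show ?case unfolding Srec[OF step(1)] by (simp add: power2_sum add_ac mult.assoc)
  qed (simp add: S_def)
  define g where "g n = (LINT \<omega>|M. (S (k * L + n) \<omega>)\<^sup>2)" for n
  \<comment> \<open>The cross term is small but not 0; it is split with the number \<open>L\<close>
    of fine steps as weight, so that the Gronwall factor over all of them is
    \<open>exp 1\<close>.\<close>
  have gstep: "g (Suc n) \<le> (1 + 1 / real L) * g n + (real L * A\<^sup>2 + Bq)" if n: "n < L" for n
  proof -
    define j where "j = k * L + n"
    have j: "k * L \<le> j" "j < Suc k * L" using n by (auto simp: j_def)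
    note st = stp[OF j]
    have i1: "integrable M (\<lambda>\<omega>. (S j \<omega>)\<^sup>2)" using Sint[of j] j by simp
    have i2: "integrable M (\<lambda>\<omega>. S j \<omega> * grid_rem H j s \<omega>)" and b2: "\<bar>LINT \<omega>|M. S j \<omega> * grid_rem H j s \<omega>\<bar> \<le> L2norm (S j) * A"
      using st noise_coeff[OF less_imp_le[OF j(2)]] i1 by blast+
    have i3: "integrable M (\<lambda>\<omega>. (grid_rem H j s \<omega>)\<^sup>2)" using st by simp
    have "g (Suc n) = (LINT \<omega>|M. (S j \<omega>)\<^sup>2 + 2 * (S j \<omega> * grid_rem H j s \<omega>) + (grid_rem H j s \<omega>)\<^sup>2)"
      unfolding g_def add_Suc_right j_def[symmetric] Srec[OF j(1)] by (simp add: power2_sum add_ac mult.assoc)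
    also have "\<dots> = g n + 2 * (LINT \<omega>|M. S j \<omega> * grid_rem H j s \<omega>) + (LINT \<omega>|M. (grid_rem H j s \<omega>)\<^sup>2)"
      unfolding g_def j_def[symmetric]
      by (simp only: Bochner_Integration.integral_add[OF Bochner_Integration.integrable_add[OF i1 integrable_mult_right[OF i2]] i3] Bochner_Integration.integral_add[OF i1 integrable_mult_right[OF i2]] integral_mult_right_zero)
    also have "\<dots> \<le> g n + 2 * (L2norm (S j) * A) + Bq" using b2 st by (intro add_mono) auto
    also have "2 * (L2norm (S j) * A) \<le> (1 / real L) * g n + real L * A\<^sup>2"
    proof -
      have "0 \<le> (L2norm (S j) - real L * A)\<^sup>2 / real L" using L by simp
      also have "\<dots> = (1 / real L) * (L2norm (S j))\<^sup>2 + real L * A\<^sup>2 - 2 * (L2norm (S j) * A)"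
        unfolding power2_diff power_mult_distrib using L by (simp add: diff_divide_distrib add_divide_distrib power2_eq_square)
      finally show ?thesis by (simp add: L2norm_sq g_def j_def)
    qed
    finally show ?thesis by (simp add: distrib_right)
  qed
  have Bq: "0 \<le> Bq"
  proof -
    have "(LINT \<omega>|M. (grid_rem H (k * L) s \<omega>)\<^sup>2) \<le> Bq" using stp[of "k * L"] L_def by simp
    moreover have "0 \<le> (LINT \<omega>|M. (grid_rem H (k * L) s \<omega>)\<^sup>2)" by (intro integral_nonneg_AE) auto
    ultimately show ?thesis by linarith
  qed
  have g0: "g 0 = 0" by (simp add: g_def S_def)
  have "g L \<le> exp (1 / real L * real L) * (g 0 + real L * (real L * A\<^sup>2 + Bq))"
    by (rule discrete_gronwall[where n=L and g=g and a="1 / real L" and b="real L * A\<^sup>2 + Bq"]) (use gstep Bq L g0 in auto)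
  also have "\<dots> = exp 1 * (real L * (real L * A\<^sup>2 + Bq))" using L by (simp add: g0)
  also have "\<dots> \<le> 3 * (real L * (real L * A\<^sup>2 + Bq))" using exp_le Bq L by (intro mult_right_mono) auto
  finally have gL: "g L \<le> 3 * (real L * (real L * A\<^sup>2 + Bq))" .
  let ?e = "Suc k * L"
  have ke: "k * L \<le> ?e" by simp
  have ge: "(LINT \<omega>|M. (S ?e \<omega>)\<^sup>2) = g L" by (simp add: g_def add.commute)
  \<comment> \<open>Local errors of order \<open>W ^ 5\<close> add up to order \<open>v * W\<close>
    and disappear under refinement. The freezing error is insensitive to it and leaves the final
    order \<open>v * sqrt v\<close>.\<close>
  have LA: "real L * A = C10 * sqrt inv_moment_const * v * W + aK * v * sqrt ?b1"
  proof -
    have "real L * W ^ 5 = v * W" using LH by (simp add: H_def power_add[of W 4 1, simplified] mult.assoc[symmetric])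
    moreover have "real L * (C10 * sqrt inv_moment_const * W ^ 5) = C10 * sqrt inv_moment_const * (real L * W ^ 5)" by (simp only: ac_simps)
    moreover have "real L * (aK * H * sqrt ?b1) = aK * (real L * H) * sqrt ?b1" by (simp only: ac_simps)
    ultimately show ?thesis unfolding A_def distrib_left LH by (simp only: mult.assoc)
  qed
  have WW: "W\<^sup>2 \<le> wmax * W"
  proof -
    have "W ^ 4 \<le> T" using Hv vT by (simp add: H_def)
    then have "W \<le> wmax" using w_le[OF W(1)] by (simp add: wmax_def)
    then show ?thesis unfolding power2_eq_square using W by (intro mult_right_mono) auto
  qed
  have Crho0: "0 \<le> Crho" using C9 inv_moment_const by (simp add: Crho_def)
  have v3: "v * v\<^sup>2 \<le> T * v\<^sup>2" using vT by (intro mult_right_mono) auto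
  have E1: "(LINT \<omega>|M. (S ?e \<omega>)\<^sup>2) \<le> 3 * ((5 * aK\<^sup>2 * holder_const * T + 3 * \<nu>\<^sup>2 * (real d)\<^sup>2 * C1) * v\<^sup>2 + (2 * C10\<^sup>2 * inv_moment_const * v\<^sup>2 + 3 * Crho * v) * (wmax * W))"
  proof -
    have a: "(real L * A)\<^sup>2 \<le> 2 * (C10\<^sup>2 * inv_moment_const * v\<^sup>2 * W\<^sup>2) + 2 * (aK\<^sup>2 * holder_const * (v * v\<^sup>2))"
    proof -
      have e1: "(C10 * sqrt inv_moment_const * v * W)\<^sup>2 = C10\<^sup>2 * inv_moment_const * v\<^sup>2 * W\<^sup>2" using inv_moment_const by (simp only: power_mult_distrib real_sqrt_pow2)
      have "(aK * v * sqrt ?b1)\<^sup>2 = aK\<^sup>2 * v\<^sup>2 * ?b1" using holder_const v by (simp only: power_mult_distrib real_sqrt_pow2 mult_nonneg_nonneg less_imp_le)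
      also have "\<dots> = aK\<^sup>2 * holder_const * (v * v\<^sup>2)" by (simp only: ac_simps)
      finally have e2: "(aK * v * sqrt ?b1)\<^sup>2 = aK\<^sup>2 * holder_const * (v * v\<^sup>2)" .
      show ?thesis using power2_sum2_le[of "C10 * sqrt inv_moment_const * v * W" "aK * v * sqrt ?b1"] unfolding LA e1 e2 .
    qed
    have b: "real L * Bq \<le> 3 * (Crho * v * W\<^sup>2 + aK\<^sup>2 * holder_const * (v * v\<^sup>2) + \<nu>\<^sup>2 * (real d)\<^sup>2 * C1 * v\<^sup>2)"
    proof -
      have W6: "W ^ 6 = W ^ 4 * W\<^sup>2" by (simp flip: power_add)
      have e1: "real L * (Crho * W ^ 6) = Crho * v * W\<^sup>2"
        unfolding LH[symmetric] H_def W6 by (simp only: ac_simps)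
      have e2: "real L * (aK\<^sup>2 * H\<^sup>2 * ?b1) = aK\<^sup>2 * holder_const * (v * (v * H))" unfolding LH[symmetric] by (simp add: power2_eq_square ac_simps)
      have e3: "real L * (\<nu>\<^sup>2 * (real d)\<^sup>2 * H * ?b2) = \<nu>\<^sup>2 * (real d)\<^sup>2 * C1 * v\<^sup>2" unfolding LH[symmetric] by (simp add: power2_eq_square ac_simps)
      have "v * (v * H) \<le> v * v\<^sup>2" unfolding power2_eq_square using Hv v by (intro mult_left_mono) auto
      then have "aK\<^sup>2 * holder_const * (v * (v * H)) \<le> aK\<^sup>2 * holder_const * (v * v\<^sup>2)" by (rule mult_left_mono) (use holder_const in simp)
      then show ?thesis unfolding Bq_def mult.left_commute[of "real L" 3] distrib_left[of "real L"] e1 e2 e3 by simp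
    qed
    have "(LINT \<omega>|M. (S ?e \<omega>)\<^sup>2) \<le> 3 * ((real L * A)\<^sup>2 + real L * Bq)" using gL unfolding ge by (simp add: power2_eq_square algebra_simps)
    also have "\<dots> \<le> 3 * ((5 * aK\<^sup>2 * holder_const) * (v * v\<^sup>2) + 3 * \<nu>\<^sup>2 * (real d)\<^sup>2 * C1 * v\<^sup>2 + (2 * C10\<^sup>2 * inv_moment_const * v\<^sup>2 + 3 * Crho * v) * W\<^sup>2)"
      using a b by (simp add: algebra_simps)
    also have "\<dots> \<le> 3 * ((5 * aK\<^sup>2 * holder_const) * (T * v\<^sup>2) + 3 * \<nu>\<^sup>2 * (real d)\<^sup>2 * C1 * v\<^sup>2 + (2 * C10\<^sup>2 * inv_moment_const * v\<^sup>2 + 3 * Crho * v) * (wmax * W))"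
      using holder_const v3 WW Crho0 inv_moment_const v C1_nonneg by (intro mult_left_mono add_mono) auto
    finally show ?thesis by (simp add: algebra_simps)
  qed
  \<comment> \<open>The price of moving the singular drift from the fine left points to the right
    end point \<open>t\<close>; \<open>inv_Y_holder\<close> makes its mean square of order
    \<open>v ^ 3\<close>.\<close>
  define V where "V \<omega> = cK * H * (\<Sum>j\<in>{k * L..<?e}. 1 / Y0 (real j * H) \<omega> - 1 / Y0 t \<omega>)" for \<omega>
  have xi: "integrable M (\<lambda>\<omega>. (1 / Y0 (real j * H) \<omega> - 1 / Y0 t \<omega>)\<^sup>2)" and xl: "(LINT \<omega>|M. (1 / Y0 (real j * H) \<omega> - 1 / Y0 t \<omega>)\<^sup>2) \<le> ?b1"
    if j: "k * L \<le> j" "j < ?e" for j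
  proof -
    note I = inv_Y_holder[OF H less_imp_le[OF j(2)] jT[OF order_refl], unfolded tH]
    show "integrable M (\<lambda>\<omega>. (1 / Y0 (real j * H) \<omega> - 1 / Y0 t \<omega>)\<^sup>2)" using I(1) by (simp only: power2_commute)
    have "holder_const * (real (?e - j) * H) \<le> ?b1" using dist2[of j] j holder_const by (intro mult_left_mono) auto
    then show "(LINT \<omega>|M. (1 / Y0 (real j * H) \<omega> - 1 / Y0 t \<omega>)\<^sup>2) \<le> ?b1" using I(2) by (simp only: power2_commute)
  qed
  have Ym: "(\<lambda>\<omega>. Y0 (real j * H) \<omega>) \<in> borel_measurable M" if "j \<le> ?e" for j using Y0_measM[OF _ jT[OF that]] H by simp
  have Vm [measurable]: "V \<in> borel_measurable M" unfolding V_def[abs_def]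
    using Ym Ym[OF order_refl, unfolded tH] by (intro borel_measurable_times borel_measurable_sum borel_measurable_diff borel_measurable_divide) (auto simp del: of_nat_Suc)
  have V2: "(V \<omega>)\<^sup>2 \<le> cK\<^sup>2 * H\<^sup>2 * (real L * (\<Sum>j\<in>{k * L..<?e}. (1 / Y0 (real j * H) \<omega> - 1 / Y0 t \<omega>)\<^sup>2))" for \<omega>
  proof -
    have "(\<Sum>j\<in>{k * L..<?e}. 1 / Y0 (real j * H) \<omega> - 1 / Y0 t \<omega>)\<^sup>2 \<le> real L * (\<Sum>j\<in>{k * L..<?e}. (1 / Y0 (real j * H) \<omega> - 1 / Y0 t \<omega>)\<^sup>2)"
      using Cauchy_Schwarz_ineq_sum[of "\<lambda>_. 1" "\<lambda>j. 1 / Y0 (real j * H) \<omega> - 1 / Y0 t \<omega>" "{k * L..<?e}"] by simp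
    then show ?thesis unfolding V_def power_mult_distrib by (intro mult_left_mono) auto
  qed
  have Vb: "integrable M (\<lambda>\<omega>. cK\<^sup>2 * H\<^sup>2 * (real L * (\<Sum>j\<in>{k * L..<?e}. (1 / Y0 (real j * H) \<omega> - 1 / Y0 t \<omega>)\<^sup>2)))"
    by (intro integrable_mult_right Bochner_Integration.integrable_sum xi) auto
  have Vi: "integrable M (\<lambda>\<omega>. (V \<omega>)\<^sup>2)"
    by (rule Bochner_Integration.integrable_bound[OF Vb]) (use V2 in \<open>auto intro!: AE_I2 order_trans[OF V2]\<close>)
  have VL: "(LINT \<omega>|M. (V \<omega>)\<^sup>2) \<le> cK\<^sup>2 * v\<^sup>2 * ?b1"
  proof -
    have "(LINT \<omega>|M. (V \<omega>)\<^sup>2) \<le> (LINT \<omega>|M. cK\<^sup>2 * H\<^sup>2 * (real L * (\<Sum>j\<in>{k * L..<?e}. (1 / Y0 (real j * H) \<omega> - 1 / Y0 t \<omega>)\<^sup>2)))"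
      by (rule integral_mono[OF Vi Vb V2])
    also have "\<dots> = cK\<^sup>2 * H\<^sup>2 * (real L * (\<Sum>j\<in>{k * L..<?e}. LINT \<omega>|M. (1 / Y0 (real j * H) \<omega> - 1 / Y0 t \<omega>)\<^sup>2))"
      by (simp only: integral_mult_right_zero) (subst Bochner_Integration.integral_sum, rule xi, simp, simp, rule refl)
    also have "\<dots> \<le> cK\<^sup>2 * H\<^sup>2 * (real L * (\<Sum>j\<in>{k * L..<?e}. ?b1))"
      by (intro mult_left_mono sum_mono xl) auto
    also have "(\<Sum>j\<in>{k * L..<?e}. ?b1) = real L * ?b1" by simp
    also have "cK\<^sup>2 * H\<^sup>2 * (real L * (real L * ?b1)) = cK\<^sup>2 * (real L * H)\<^sup>2 * ?b1" by (simp add: power2_eq_square ac_simps)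
    finally show ?thesis unfolding LH .
  qed
  have R0eq: "implicit_rem \<omega> = S ?e \<omega> + V \<omega>" for \<omega>
  proof -
    let ?I = "{k * L..<?e}"
    have "S ?e \<omega> = (\<Sum>j\<in>?I. Y0 (real (Suc j) * H) \<omega> - Y0 (real j * H) \<omega>) + \<nu> * (\<Sum>j\<in>?I. \<Sum>c<d. X s \<omega> c * dB (real j * H) (real (Suc j) * H) c \<omega>)
       - cK * H * (\<Sum>j\<in>?I. 1 / Y0 (real j * H) \<omega>) + (\<Sum>j\<in>?I. aK * Y0 s \<omega> * H)"
      unfolding S_def grid_rem_def by (simp only: sum.distrib sum_subtractf sum_distrib_left)
    also have "(\<Sum>j\<in>?I. Y0 (real (Suc j) * H) \<omega> - Y0 (real j * H) \<omega>) = Y0 t \<omega> - Y0 s \<omega>"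
      using sum_Suc_diff'[OF ke, of "\<lambda>j. Y0 (real j * H) \<omega>"] unfolding sH tH .
    also have "(\<Sum>j\<in>?I. \<Sum>c<d. X s \<omega> c * dB (real j * H) (real (Suc j) * H) c \<omega>) = radial_noise \<omega>"
    proof -
      have "(\<Sum>j\<in>?I. dB (real j * H) (real (Suc j) * H) c \<omega>) = dB s t c \<omega>" for c
        using sum_Suc_diff'[OF ke, of "\<lambda>j. B (real j * H) \<omega> c"] unfolding sH tH dB_def .
      then show ?thesis unfolding radial_noise_def by (subst sum.swap) (simp only: sum_distrib_left[symmetric])
    qed
    also have "(\<Sum>j\<in>?I. aK * Y0 s \<omega> * H) = aK * Y0 s \<omega> * v" unfolding LH[symmetric] by simp
    finally have Se: "S ?e \<omega> = Y0 t \<omega> - Y0 s \<omega> + \<nu> * radial_noise \<omega> - cK * H * (\<Sum>j\<in>?I. 1 / Y0 (real j * H) \<omega>) + aK * Y0 s \<omega> * v" .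
    have "V \<omega> = cK * H * (\<Sum>j\<in>?I. 1 / Y0 (real j * H) \<omega>) - cK * v / Y0 t \<omega>"
      unfolding V_def sum_subtractf right_diff_distrib LH[symmetric] by simp
    then show ?thesis unfolding Se implicit_rem_def by simp
  qed
  have Si: "integrable M (\<lambda>\<omega>. (S ?e \<omega>)\<^sup>2)" by (rule Sint[OF ke order_refl])
  have Rb: "integrable M (\<lambda>\<omega>. 2 * (S ?e \<omega>)\<^sup>2 + 2 * (V \<omega>)\<^sup>2)" using Si Vi by auto
  have Rle: "(implicit_rem \<omega>)\<^sup>2 \<le> 2 * (S ?e \<omega>)\<^sup>2 + 2 * (V \<omega>)\<^sup>2" for \<omega> unfolding R0eq by (rule power2_sum2_le)
  show Ri: "integrable M (\<lambda>\<omega>. (implicit_rem \<omega>)\<^sup>2)"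
    by (rule Bochner_Integration.integrable_bound[OF Rb]) (use Rle in \<open>auto intro!: AE_I2 order_trans[OF Rle]\<close>)
  have "(LINT \<omega>|M. (implicit_rem \<omega>)\<^sup>2) \<le> (LINT \<omega>|M. 2 * (S ?e \<omega>)\<^sup>2 + 2 * (V \<omega>)\<^sup>2)" by (rule integral_mono[OF Ri Rb Rle])
  also have "\<dots> = 2 * (LINT \<omega>|M. (S ?e \<omega>)\<^sup>2) + 2 * (LINT \<omega>|M. (V \<omega>)\<^sup>2)" using Si Vi by simp
  also have "\<dots> \<le> 2 * (3 * ((5 * aK\<^sup>2 * holder_const * T + 3 * \<nu>\<^sup>2 * (real d)\<^sup>2 * C1) * v\<^sup>2 + (2 * C10\<^sup>2 * inv_moment_const * v\<^sup>2 + 3 * Crho * v) * (wmax * W))) + 2 * (cK\<^sup>2 * holder_const * (T * v\<^sup>2))"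
  proof (intro add_mono mult_left_mono E1)
    have "cK\<^sup>2 * v\<^sup>2 * ?b1 = cK\<^sup>2 * holder_const * (v * v\<^sup>2)" by (simp add: ac_simps)
    also have "\<dots> \<le> cK\<^sup>2 * holder_const * (T * v\<^sup>2)" using v3 by (rule mult_left_mono) (use holder_const in simp)
    finally show "(LINT \<omega>|M. (V \<omega>)\<^sup>2) \<le> cK\<^sup>2 * holder_const * (T * v\<^sup>2)" using VL by linarith
  qed auto
  also have "\<dots> = CR2 * v\<^sup>2 + (6 * (2 * C10\<^sup>2 * inv_moment_const * v\<^sup>2 + 3 * Crho * v) * wmax) * W" by (simp add: CR2_def algebra_simps)
  finally show "(LINT \<omega>|M. (implicit_rem \<omega>)\<^sup>2) \<le> CR2 * v\<^sup>2 + (6 * (2 * C10\<^sup>2 * inv_moment_const * v\<^sup>2 + 3 * Crho * v) * wmax) * W" .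
  assume h: "h \<in> borel_measurable (G s)" "integrable M (\<lambda>\<omega>. (h \<omega>)\<^sup>2)"
  have hM: "h \<in> borel_measurable M" using measurable_G_M[OF h(1) s0] .
  have hD: "integrable M (\<lambda>\<omega>. h \<omega> * grid_rem H j s \<omega>)" "\<bar>LINT \<omega>|M. h \<omega> * grid_rem H j s \<omega>\<bar> \<le> L2norm h * A" if j: "k * L \<le> j" "j < ?e" for j
    using stp[OF j] measurable_G_mono[OF h(1) s0 js[OF j(1)]] h(2) by blast+
  note P = pairing[OF hM Vm h(2) Vi VL]
  have hS: "(LINT \<omega>|M. h \<omega> * S ?e \<omega>) = (\<Sum>j\<in>{k * L..<?e}. LINT \<omega>|M. h \<omega> * grid_rem H j s \<omega>)" and hSi: "integrable M (\<lambda>\<omega>. h \<omega> * S ?e \<omega>)"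
    unfolding S_def sum_distrib_left using hD(1) by (auto intro!: Bochner_Integration.integral_sum Bochner_Integration.integrable_sum)
  have "\<bar>LINT \<omega>|M. h \<omega> * S ?e \<omega>\<bar> \<le> (\<Sum>j\<in>{k * L..<?e}. L2norm h * A)"
    unfolding hS by (rule order_trans[OF sum_abs sum_mono]) (use hD(2) in auto)
  also have "\<dots> = L2norm h * (real L * A)" by simp
  finally have b1: "\<bar>LINT \<omega>|M. h \<omega> * S ?e \<omega>\<bar> \<le> L2norm h * (C10 * sqrt inv_moment_const * v * W + aK * v * sqrt ?b1)" unfolding LA .
  have sq: "sqrt ?b1 = sqrt holder_const * w\<^sup>2"
  proof -
    have "sqrt v = w\<^sup>2" using w real_sqrt_abs[of "w\<^sup>2"] by (simp add: power_mult[symmetric])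
    then show ?thesis by (simp add: real_sqrt_mult)
  qed
  have sq2: "sqrt (cK\<^sup>2 * v\<^sup>2 * ?b1) = cK * v * sqrt ?b1" using cK v by (simp only: real_sqrt_mult real_sqrt_abs abs_of_pos)
  have "(LINT \<omega>|M. h \<omega> * implicit_rem \<omega>) = (LINT \<omega>|M. h \<omega> * S ?e \<omega>) + (LINT \<omega>|M. h \<omega> * V \<omega>)"
    unfolding R0eq distrib_left using hSi P(1) by simp
  then have "\<bar>LINT \<omega>|M. h \<omega> * implicit_rem \<omega>\<bar> \<le> L2norm h * (C10 * sqrt inv_moment_const * v * W + aK * v * sqrt ?b1) + L2norm h * (cK * v * sqrt ?b1)"
    using b1 P(2) unfolding sq2 by linarith
  also have "\<dots> = L2norm h * CR1 * w ^ 6 + (L2norm h * C10 * sqrt inv_moment_const * v) * W"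
    unfolding sq CR1_def by (simp add: power_add[of w 4 2, simplified] algebra_simps)
  finally show "\<bar>LINT \<omega>|M. h \<omega> * implicit_rem \<omega>\<bar> \<le> L2norm h * CR1 * w ^ 6 + (L2norm h * C10 * sqrt inv_moment_const * v) * W" .
qed

lemma implicit_rem_L2: "integrable M (\<lambda>\<omega>. (implicit_rem \<omega>)\<^sup>2)" "(LINT \<omega>|M. (implicit_rem \<omega>)\<^sup>2) \<le> CR2 * v\<^sup>2"
  and implicit_rem_pair: "h \<in> borel_measurable (G s) \<Longrightarrow> integrable M (\<lambda>\<omega>. (h \<omega>)\<^sup>2) \<Longrightarrow> \<bar>LINT \<omega>|M. h \<omega> * implicit_rem \<omega>\<bar> \<le> L2norm h * CR1 * w ^ 6"
proof -
  obtain W where W: "\<And>l. 0 < W l" "\<And>l. W l ^ 4 = v / real (Suc l)" "W \<longlonglongrightarrow> (0::real)" by (rule fourth_root_seq[OF v]) blast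
  show "integrable M (\<lambda>\<omega>. (implicit_rem \<omega>)\<^sup>2)" by (rule implicit_rem_fine(1)[OF W(1) W(2)])
  show "(LINT \<omega>|M. (implicit_rem \<omega>)\<^sup>2) \<le> CR2 * v\<^sup>2" by (rule le_limit_vanishing[OF implicit_rem_fine(2)[OF W(1) W(2)] W(3)])
  assume h: "h \<in> borel_measurable (G s)" "integrable M (\<lambda>\<omega>. (h \<omega>)\<^sup>2)"
  show "\<bar>LINT \<omega>|M. h \<omega> * implicit_rem \<omega>\<bar> \<le> L2norm h * CR1 * w ^ 6" by (rule le_limit_vanishing[OF implicit_rem_fine(3)[OF W(1) W(2) h] W(3)])
qed

text \<open>\<open>Y_holder\<close> controls the oscillation of \<open>Y0\<close> in expectation
  only, so \<open>euler_rem_bound\<close> is applied under the trivial sigma-algebra. With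
  \<open>\<Phi>\<close> of order \<open>v\<close> the second moment reaches
  \<open>v\<^sup>2\<close>.\<close>

lemma euler_rem_L2:
  assumes i: "i < d"
  shows "integrable M (\<lambda>\<omega>. (euler_rem v k i \<omega>)\<^sup>2)" "(LINT \<omega>|M. (euler_rem v k i \<omega>)\<^sup>2) \<le> CX2 * v\<^sup>2"
proof -
  define H where "H = sigma (space M) ({} :: 'a set set)"
  have sH: "sets H = {{}, space M}" by (simp add: H_def sigma_sets_empty_eq)
  have subH: "subalgebra M H" unfolding subalgebra_def by (intro conjI) (simp add: H_def space_measure_of_conv, auto simp: sH)
  have HG: "sets H \<subseteq> sets (G s)" using sets.top[of "G s"] by (auto simp: sH)
  have Phi: "cond_le M H (\<lambda>\<omega>. (Y0 (real j * (v / real (Suc l))) \<omega> - Y0 (real k * v) \<omega>)\<^sup>2) (holder_const * v)"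
    if j: "k * Suc l \<le> j" "j < Suc k * Suc l" for l j
  proof -
    let ?h = "v / real (Suc l)"
    have h: "0 < ?h" using v by simp
    have jT: "real j * ?h \<le> T" using fine_le[OF v k] j by simp
    have kh: "real (k * Suc l) * ?h = s" by (rule refine_grid)
    note Y = Y_holder[OF h j(1) jT, unfolded kh]
    have "real (j - k * Suc l) * ?h \<le> real (Suc l) * ?h" using j h by (intro mult_right_mono) (auto simp del: of_nat_Suc of_nat_diff)
    then have le: "holder_const * (real (j - k * Suc l) * ?h) \<le> holder_const * v" using holder_const by (intro mult_left_mono) (auto simp del: of_nat_Suc)
    show ?thesis
    proof (rule cond_leI[OF subH prob_space_M Y(1)])
      fix E assume "E \<in> sets H"
      then consider "E = {}" | "E = space M" using sH by auto
      then show "(LINT \<omega>|M. indicator E \<omega> * (Y0 (real j * ?h) \<omega> - Y0 s \<omega>)\<^sup>2) \<le> holder_const * v * measure M E"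
      proof cases
        case 2
        have "(LINT \<omega>|M. indicator (space M) \<omega> * (Y0 (real j * ?h) \<omega> - Y0 s \<omega>)\<^sup>2) = (LINT \<omega>|M. (Y0 (real j * ?h) \<omega> - Y0 s \<omega>)\<^sup>2)"
          by (intro Bochner_Integration.integral_cong) auto
        then show ?thesis using Y(2) le by (simp add: 2 prob_space)
      qed simp
    qed (use holder_const v in auto)
  qed
  have c: "cond_le M H (\<lambda>\<omega>. (euler_rem v k i \<omega>)\<^sup>2) (C2 * (v\<^sup>2 + v * (holder_const * v)))"
    by (rule euler_rem_bound(1)[OF v k i subH HG Phi])
  have e: "C2 * (v\<^sup>2 + v * (holder_const * v)) = CX2 * v\<^sup>2" by (simp add: CX2_def power2_eq_square algebra_simps)
  show "integrable M (\<lambda>\<omega>. (euler_rem v k i \<omega>)\<^sup>2)" "(LINT \<omega>|M. (euler_rem v k i \<omega>)\<^sup>2) \<le> CX2 * v\<^sup>2"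
    using cond_le_integrable[OF subH prob_space_M c] unfolding e by auto
qed

text \<open>For the correlation the crude bound is already sharp enough: the conditional mean of the
  remainder involves the drift alone and not the oscillation of \<open>Y0\<close>.\<close>

lemma euler_rem_pair:
  assumes i: "i < d" and h: "h \<in> borel_measurable (G s)" "integrable M (\<lambda>\<omega>. (h \<omega>)\<^sup>2)"
  shows "\<bar>LINT \<omega>|M. h \<omega> * euler_rem v k i \<omega>\<bar> \<le> L2norm h * C3 * w ^ 6"
proof -
  have hM: "h \<in> borel_measurable M" using measurable_G_M[OF h(1) s0] .
  have hi: "integrable M h" using square_integrable_imp_integrable[OF hM h(2)] .
  have "\<bar>LINT \<omega>|M. h \<omega> * euler_rem v k i \<omega>\<bar> \<le> C3 * w ^ 6 * (LINT \<omega>|M. \<bar>h \<omega>\<bar>)"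
    by (rule cond_abs_le_L1(2)[OF subalgebra_Gs prob_space_M euler_rem_bound_uncond(2)[OF w k i] euler_rem_bound_uncond(1)[OF w k i] h(1) hi])
  also have "\<dots> \<le> C3 * w ^ 6 * L2norm h"
  proof (rule mult_left_mono)
    have "(LINT \<omega>|M. \<bar>h \<omega> * 1\<bar>) \<le> L2norm h * sqrt 1"
      by (rule pairing(3)) (use hM h in \<open>auto simp: prob_space\<close>)
    then show "(LINT \<omega>|M. \<bar>h \<omega>\<bar>) \<le> L2norm h" by simp
  qed (use C3_nonneg w in auto)
  finally show ?thesis by (simp add: ac_simps)
qed

end

section \<open>Error of the scheme\<close>

locale sde_scheme = sde +
  fixes n :: nat
  assumes n: "0 < n"
begin

text \<open>The fourth root of the step size, so that \<open>h\<close> takes the place of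
  \<open>w\<close> in \<open>sde_step\<close>.\<close>

definition h :: real where "h = root 4 (T / real n)"
definition Y_scheme :: "nat \<Rightarrow> 'a \<Rightarrow> real" where "Y_scheme k \<omega> = fst (scheme d m \<kappa> \<nu> AA T B x0 n k \<omega>)"
definition X_scheme :: "nat \<Rightarrow> 'a \<Rightarrow> nat \<Rightarrow> real" where "X_scheme k \<omega> = snd (scheme d m \<kappa> \<nu> AA T B x0 n k \<omega>)"
text \<open>\<open>diffusion\<close> with the radial component as a separate argument. In this form
  it is linear in the pair \<open>(y, x)\<close>, and the difference of two noise terms is the noise
  term of the error.\<close>

definition noise_coeff :: "real \<Rightarrow> (nat \<Rightarrow> real) \<Rightarrow> nat \<Rightarrow> nat \<Rightarrow> real" where
  "noise_coeff y x i c = (if c < d then (if c = i then \<nu> * y else 0) else mv d (AA (c - d + 1)) x i)"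
abbreviation "tm k \<equiv> real k * h ^ 4"
abbreviation "b k c \<equiv> dB (tm k) (tm (Suc k)) c"
definition err_Y :: "nat \<Rightarrow> 'a \<Rightarrow> real" where "err_Y k \<omega> = Y0 (tm k) \<omega> - Y_scheme k \<omega>"
definition err_X :: "nat \<Rightarrow> 'a \<Rightarrow> nat \<Rightarrow> real" where "err_X k \<omega> i = X (tm k) \<omega> i - X_scheme k \<omega> i"
definition err :: "nat \<Rightarrow> 'a \<Rightarrow> real" where "err k \<omega> = (err_Y k \<omega>)\<^sup>2 + (\<Sum>i<d. (err_X k \<omega> i)\<^sup>2)"

lemma h: "0 < h" using T n by (simp add: h_def)
lemma h4: "h ^ 4 = T / real n" unfolding h_def using T n by (intro real_root_pow_pos2) auto
lemma tm_eq: "real k * T / real n = tm k" by (simp add: h4)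
lemma h4pos: "0 < h ^ 4" using h by simp
lemma tm_le: "k \<le> n \<Longrightarrow> tm k \<le> T"
proof -
  assume "k \<le> n"
  then have "tm k \<le> real n * h ^ 4" using h4pos by (intro mult_right_mono) auto
  also have "\<dots> = T" using n by (simp add: h4)
  finally show ?thesis .
qed
lemma tm0: "0 \<le> tm k" using h4pos by simp
lemma h4T: "h ^ 4 \<le> T" using tm_le[of 1] n by simp

lemma err_sq_eq: "err_sq d m \<kappa> \<nu> AA T B x0 X n k \<omega> = err k \<omega>"
  by (simp add: err_sq_def Let_def err_def err_Y_def err_X_def Y_scheme_def X_scheme_def Y0_def Y0sq_def h4)

lemma scheme_rec:
  "Y_scheme (Suc k) \<omega> = ((Y_scheme k \<omega> - \<nu> * (\<Sum>c<d. X_scheme k \<omega> c * b k c \<omega>) - aK * Y_scheme k \<omega> * h ^ 4)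
     + sqrt ((Y_scheme k \<omega> - \<nu> * (\<Sum>c<d. X_scheme k \<omega> c * b k c \<omega>) - aK * Y_scheme k \<omega> * h ^ 4)\<^sup>2 + 4 * cK * h ^ 4)) / 2"
  "i < d \<Longrightarrow> X_scheme (Suc k) \<omega> i = X_scheme k \<omega> i + drift d m \<kappa> AA (X_scheme k \<omega>) i * h ^ 4 + (\<Sum>c<d+m. noise_coeff (Y_scheme k \<omega>) (X_scheme k \<omega>) i c * b k c \<omega>)"
proof -
  have t: "real (Suc k) * T / real n = tm (Suc k)" "real k * T / real n = tm k" by (rule tm_eq)+
  show "Y_scheme (Suc k) \<omega> = ((Y_scheme k \<omega> - \<nu> * (\<Sum>c<d. X_scheme k \<omega> c * b k c \<omega>) - aK * Y_scheme k \<omega> * h ^ 4)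
     + sqrt ((Y_scheme k \<omega> - \<nu> * (\<Sum>c<d. X_scheme k \<omega> c * b k c \<omega>) - aK * Y_scheme k \<omega> * h ^ 4)\<^sup>2 + 4 * cK * h ^ 4)) / 2"
    unfolding Y_scheme_def X_scheme_def scheme.simps scheme_step_def Let_def fst_conv t dB_def h4[symmetric] aK_def cK_def by (simp only: mult.assoc)
  assume i: "i < d"
  have "(\<Sum>c<d+m. noise_coeff (Y_scheme k \<omega>) (X_scheme k \<omega>) i c * b k c \<omega>) = (\<Sum>c<d+m. if c < d then (if c = i then \<nu> * Y_scheme k \<omega> * b k c \<omega> else 0) else mv d (AA (c - d + 1)) (X_scheme k \<omega>) i * b k c \<omega>)"
    by (intro sum.cong) (auto simp: noise_coeff_def)
  also have "\<dots> = (\<Sum>c<d. if c = i then \<nu> * Y_scheme k \<omega> * b k c \<omega> else 0) + (\<Sum>p=1..m. mv d (AA (d + p - 1 - d + 1)) (X_scheme k \<omega>) i * b k (d + p - 1) \<omega>)"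
    by (rule sum_noise_split)
  also have "(\<Sum>p=1..m. mv d (AA (d + p - 1 - d + 1)) (X_scheme k \<omega>) i * b k (d + p - 1) \<omega>) = (\<Sum>p=1..m. mv d (AA p) (X_scheme k \<omega>) i * b k (d + p - 1) \<omega>)"
    by (intro sum.cong) auto
  finally have n: "(\<Sum>c<d+m. noise_coeff (Y_scheme k \<omega>) (X_scheme k \<omega>) i c * b k c \<omega>) = \<nu> * Y_scheme k \<omega> * b k i \<omega> + (\<Sum>p=1..m. mv d (AA p) (X_scheme k \<omega>) i * b k (d + p - 1) \<omega>)"
    using i by simp
  have "X_scheme (Suc k) \<omega> i = X_scheme k \<omega> i - \<kappa> * X_scheme k \<omega> i * h ^ 4 + \<nu> * Y_scheme k \<omega> * b k i \<omega> + mv d (AA 0) (X_scheme k \<omega>) i * h ^ 4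
     + (\<Sum>p=1..m. mv d (AA p) (X_scheme k \<omega>) i * b k (d + p - 1) \<omega>) + (1/2) * (\<Sum>p=1..m. mv d (AA p) (mv d (AA p) (X_scheme k \<omega>)) i) * h ^ 4"
    unfolding Y_scheme_def X_scheme_def scheme.simps scheme_step_def Let_def snd_conv t dB_def h4[symmetric] ..
  then show "X_scheme (Suc k) \<omega> i = X_scheme k \<omega> i + drift d m \<kappa> AA (X_scheme k \<omega>) i * h ^ 4 + (\<Sum>c<d+m. noise_coeff (Y_scheme k \<omega>) (X_scheme k \<omega>) i c * b k c \<omega>)"
    unfolding n drift_def by (simp add: algebra_simps)
qed

text \<open>Recovers from the root formula the implicit equation on which the monotonicity argument
  acts. The root is positive because \<open>cK > 0\<close> makes the square root exceed the absolute
  value of \<open>bb k \<omega>\<close>.\<close>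

lemma Y_scheme_implicit:
  defines "bb \<equiv> \<lambda>k \<omega>. Y_scheme k \<omega> - \<nu> * (\<Sum>c<d. X_scheme k \<omega> c * b k c \<omega>) - aK * Y_scheme k \<omega> * h ^ 4"
  shows "0 < Y_scheme (Suc k) \<omega>" "Y_scheme (Suc k) \<omega> = bb k \<omega> + cK * h ^ 4 / Y_scheme (Suc k) \<omega>"
proof -
  let ?b = "bb k \<omega>" and ?y = "Y_scheme (Suc k) \<omega>" and ?r = "sqrt ((bb k \<omega>)\<^sup>2 + 4 * cK * h ^ 4)"
  have y: "?y = (?b + ?r) / 2" unfolding bb_def by (rule scheme_rec(1))
  have p: "0 < cK * h ^ 4" using cK h4pos by simp
  have "\<bar>?b\<bar> = sqrt (?b\<^sup>2)" by simp
  also have "\<dots> < ?r" using p by (intro real_sqrt_less_mono) simp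
  finally have "\<bar>?b\<bar> < ?r" .
  moreover have "0 < (x + r) / 2" if "\<bar>x\<bar> < r" for x r :: real using that by (auto simp: abs_less_iff)
  ultimately show pos: "0 < ?y" unfolding y by blast
  have "?r\<^sup>2 = ?b\<^sup>2 + 4 * cK * h ^ 4" using p by (intro real_sqrt_pow2) (auto intro: add_nonneg_nonneg)
  moreover have "?r = 2 * ?y - ?b" using y by simp
  ultimately have "(2 * ?y - ?b)\<^sup>2 = ?b\<^sup>2 + 4 * cK * h ^ 4" by simp
  then have "?y * ?y = ?b * ?y + cK * h ^ 4" by (simp add: power2_eq_square algebra_simps)
  then have "?y * ?y / ?y = (?b * ?y + cK * h ^ 4) / ?y" by simp
  then show "?y = ?b + cK * h ^ 4 / ?y" using pos by (simp add: add_divide_distrib)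
qed

lemma incr_measurable_G: "c < d + m \<Longrightarrow> b k c \<in> borel_measurable (G (tm (Suc k)))"
  using tm0 h4pos by (intro dB_meas_G) (auto intro: mult_right_mono)

lemma tm_mono: "tm k \<le> tm (Suc k)" using h4pos by (intro mult_right_mono) auto

lemma noise_coeff_meas: "y \<in> borel_measurable N \<Longrightarrow> (\<And>j. j < d \<Longrightarrow> (\<lambda>\<omega>. f \<omega> j) \<in> borel_measurable N) \<Longrightarrow> (\<lambda>\<omega>. noise_coeff (y \<omega>) (f \<omega>) i c) \<in> borel_measurable N"
  unfolding noise_coeff_def using mv_meas[of f N] by (cases "c < d"; cases "c = i") auto

lemma scheme_meas: "Y_scheme k \<in> borel_measurable (G (tm k)) \<and> (\<forall>i<d. (\<lambda>\<omega>. X_scheme k \<omega> i) \<in> borel_measurable (G (tm k)))"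
proof (induction k)
  case 0
  then show ?case by (simp add: Y_scheme_def[abs_def] X_scheme_def[abs_def])
next
  case (Suc k)
  let ?N = "G (tm (Suc k))"
  have ym [measurable]: "Y_scheme k \<in> borel_measurable ?N" using measurable_G_mono[OF _ tm0 tm_mono] Suc by blast
  have xm: "\<And>i. i < d \<Longrightarrow> (\<lambda>\<omega>. X_scheme k \<omega> i) \<in> borel_measurable ?N" using measurable_G_mono[OF _ tm0 tm_mono] Suc by blast
  have [measurable]: "(\<lambda>\<omega>. \<Sum>c<d. X_scheme k \<omega> c * b k c \<omega>) \<in> borel_measurable ?N"
    using xm incr_measurable_G by (intro borel_measurable_sum borel_measurable_times) auto
  have 1: "Y_scheme (Suc k) \<in> borel_measurable ?N" unfolding scheme_rec(1)[abs_def] by measurable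
  have 2: "(\<lambda>\<omega>. X_scheme (Suc k) \<omega> i) \<in> borel_measurable ?N" if i: "i < d" for i
    unfolding scheme_rec(2)[OF i] using xm ym incr_measurable_G i
    by (intro borel_measurable_add borel_measurable_times drift_meas borel_measurable_sum noise_coeff_meas) (auto simp del: of_nat_Suc)
  show ?case using 1 2 by blast
qed

lemma err_Y_G: "k \<le> n \<Longrightarrow> err_Y k \<in> borel_measurable (G (tm k))"
  unfolding err_Y_def[abs_def] using scheme_meas Y0_meas[OF tm0 tm_le] by (intro borel_measurable_diff) auto

lemma err_X_G: "k \<le> n \<Longrightarrow> i < d \<Longrightarrow> (\<lambda>\<omega>. err_X k \<omega> i) \<in> borel_measurable (G (tm k))"
  unfolding err_X_def[abs_def] using scheme_meas X_meas[OF tm0 tm_le] by (intro borel_measurable_diff) auto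

lemma err_G: "k \<le> n \<Longrightarrow> err k \<in> borel_measurable (G (tm k))"
  unfolding err_def[abs_def] using err_Y_G err_X_G by (intro borel_measurable_add borel_measurable_power borel_measurable_sum) auto

lemma err_M: "k \<le> n \<Longrightarrow> err k \<in> borel_measurable M" using measurable_G_M[OF err_G tm0] .

lemma err_nonneg: "0 \<le> err k \<omega>" unfolding err_def by (intro add_nonneg_nonneg sum_nonneg) auto

lemma err_Y_le: "(err_Y k \<omega>)\<^sup>2 \<le> err k \<omega>" unfolding err_def by (simp add: sum_nonneg)
lemma err_X_sqn: "sqn d (err_X k \<omega>) \<le> err k \<omega>" unfolding err_def sqn_def by simp
lemma err_X_le: "i < d \<Longrightarrow> (err_X k \<omega> i)\<^sup>2 \<le> err k \<omega>" using comp_le_sqn[of i d "err_X k \<omega>"] err_X_sqn[of k \<omega>] by linarith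

lemma noise_coeff_diff: "noise_coeff (y - y') (\<lambda>j. x j - x' j) i c = noise_coeff y x i c - noise_coeff y' x' i c"
  by (simp add: noise_coeff_def mv_diff right_diff_distrib)

text \<open>The skew columns drop out. The remainder is the negative of \<open>y\<close> times the
  noise of the radial component, so the full noise vector is orthogonal to \<open>(y, x)\<close>, on
  the sphere and off it.\<close>

lemma noise_coeff_dot:
  "(\<Sum>i<d. x i * (\<Sum>c<d+m. noise_coeff y x i c * r c)) = \<nu> * y * (\<Sum>c<d. x c * r c)"
proof -
  have "(\<Sum>i<d. x i * (\<Sum>c<d+m. noise_coeff y x i c * r c)) = (\<Sum>i<d. \<Sum>c<d+m. x i * noise_coeff y x i c * r c)"
    by (simp add: sum_distrib_left mult.assoc)
  also have "\<dots> = (\<Sum>c<d+m. \<Sum>i<d. x i * noise_coeff y x i c * r c)" by (rule sum.swap)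
  also have "\<dots> = (\<Sum>c<d+m. if c < d then \<nu> * y * x c * r c else 0)"
  proof (intro sum.cong refl)
    fix c assume c: "c \<in> {..<d+m}"
    show "(\<Sum>i<d. x i * noise_coeff y x i c * r c) = (if c < d then \<nu> * y * x c * r c else 0)"
    proof (cases "c < d")
      case True
      have "(\<Sum>i<d. x i * noise_coeff y x i c * r c) = (\<Sum>i<d. if i = c then \<nu> * y * x c * r c else 0)"
        using True by (intro sum.cong) (auto simp: noise_coeff_def)
      then show ?thesis using True by simp
    next
      case False
      have "(\<Sum>i<d. x i * noise_coeff y x i c * r c) = (\<Sum>i<d. x i * mv d (AA (c - d + 1)) x i) * r c"
        using False by (simp add: noise_coeff_def sum_distrib_right)
      also have "(\<Sum>i<d. x i * mv d (AA (c - d + 1)) x i) = 0"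
        using skewA c False by (intro skew_quadratic_zero) auto
      finally show ?thesis using False by simp
    qed
  qed
  also have "\<dots> = (\<Sum>c<d. \<nu> * y * x c * r c)"
    by (rule sum.mono_neutral_cong_right) auto
  finally show ?thesis by (simp add: sum_distrib_left mult.assoc)
qed

lemma noise_coeff_sq:
  assumes "i < d" "c < d + m" shows "(noise_coeff y x i c)\<^sup>2 \<le> (\<nu>\<^sup>2 + mat_sq) * (y\<^sup>2 + sqn d x)"
proof (cases "c < d")
  case True
  have "(noise_coeff y x i c)\<^sup>2 \<le> \<nu>\<^sup>2 * y\<^sup>2" using True by (auto simp: noise_coeff_def power_mult_distrib)
  also have "\<dots> \<le> (\<nu>\<^sup>2 + mat_sq) * (y\<^sup>2 + sqn d x)" using mat_sq_nonneg sqn_nonneg[of d x] by (intro mult_mono) auto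
  finally show ?thesis .
next
  case False
  have "(noise_coeff y x i c)\<^sup>2 \<le> sqn d (mv d (AA (c - d + 1)) x)" using False comp_le_sqn[OF assms(1)] by (simp add: noise_coeff_def)
  also have "\<dots> \<le> mat_sq * sqn d x" using assms False by (intro mv_sqn) auto
  also have "\<dots> \<le> (\<nu>\<^sup>2 + mat_sq) * (y\<^sup>2 + sqn d x)" using mat_sq_nonneg sqn_nonneg[of d x] by (intro mult_mono) auto
  finally show ?thesis .
qed

definition implicit_rem_at :: "nat \<Rightarrow> 'a \<Rightarrow> real" where
  "implicit_rem_at k \<omega> = Y0 (tm (Suc k)) \<omega> - Y0 (tm k) \<omega> - cK * h ^ 4 / Y0 (tm (Suc k)) \<omega> + aK * Y0 (tm k) \<omega> * h ^ 4 + \<nu> * (\<Sum>c<d. X (tm k) \<omega> c * b k c \<omega>)"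

definition cross_term :: "nat \<Rightarrow> 'a \<Rightarrow> real" where "cross_term k \<omega> = err_Y k \<omega> * implicit_rem_at k \<omega> + (\<Sum>i<d. err_X k \<omega> i * euler_rem (h ^ 4) k i \<omega>)"
definition rem_sq :: "nat \<Rightarrow> 'a \<Rightarrow> real" where "rem_sq k \<omega> = (implicit_rem_at k \<omega>)\<^sup>2 + (\<Sum>i<d. (euler_rem (h ^ 4) k i \<omega>)\<^sup>2)"
definition noise_sq :: "nat \<Rightarrow> 'a \<Rightarrow> real" where "noise_sq k \<omega> = (\<Sum>c<d+m. (b k c \<omega>)\<^sup>2)"

lemma noise_sq_nonneg: "0 \<le> noise_sq k \<omega>" unfolding noise_sq_def by (intro sum_nonneg) auto
lemma rem_sq_nonneg: "0 \<le> rem_sq k \<omega>" unfolding rem_sq_def by (intro add_nonneg_nonneg sum_nonneg) auto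

end

context sde begin

definition KL :: real where "KL = aK\<^sup>2 + real d * Kd"
definition KE :: real where "KE = 1 + KL + 3 * T * KL"
definition KN :: real where "KN = \<nu>\<^sup>2 * real d + real d * (real (d + m) * (\<nu>\<^sup>2 + mat_sq))"

lemma KL: "0 \<le> KL" using Kd_nonneg by (simp add: KL_def)
lemma KE: "0 \<le> KE" using KL T by (simp add: KE_def)
lemma KN: "0 \<le> KN" using mat_sq_nonneg by (simp add: KN_def)

end

context sde_scheme begin

text \<open>Pathwise error recursion.  The implicit term drops out because \<open>y \<mapsto> 1 / y\<close> is decreasing, and the
  noise is orthogonal to the error because the diffusion is tangential to the sphere.\<close>
lemma error_step:
  assumes pos: "0 < Y0 (tm (Suc k)) \<omega>"
  shows "err (Suc k) \<omega> \<le> err k \<omega> + KE * h ^ 4 * err k \<omega> + 2 * cross_term k \<omega> + 3 * KN * (err k \<omega> * noise_sq k \<omega>) + 3 * rem_sq k \<omega>"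
proof -
  define u where "u = h ^ 4"
  have u: "0 < u" "u \<le> T" using h4pos h4T by (auto simp: u_def)
  let ?e = "err_Y k \<omega>" and ?x = "err_X k \<omega>"
  let ?E = "err k \<omega>"
  define N0 where "N0 = - \<nu> * (\<Sum>c<d. ?x c * b k c \<omega>)"
  define N where "N i = (\<Sum>c<d+m. noise_coeff ?e ?x i c * b k c \<omega>)" for i
  define L0 where "L0 = - aK * ?e"
  define L where "L i = drift d m \<kappa> AA ?x i" for i
  let ?Z = "implicit_rem_at k \<omega>" and ?R = "\<lambda>i. euler_rem u k i \<omega>"
  \<comment> \<open>With \<open>q\<close> the difference of the two reciprocals, the new error minus
    \<open>cK * u * q\<close> equals the explicit expression on the right. The new error and
    \<open>q\<close> have opposite signs, so subtracting \<open>cK * u * q\<close> can only enlarge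
    the square.\<close>
  have e1: "(err_Y (Suc k) \<omega>)\<^sup>2 \<le> (?e + (N0 + u * L0 + ?Z))\<^sup>2"
  proof -
    define y' yn' where "y' = Y0 (tm (Suc k)) \<omega>" and "yn' = Y_scheme (Suc k) \<omega>"
    have yp: "0 < y'" "0 < yn'" using pos Y_scheme_implicit(1) by (auto simp: y'_def yn'_def)
    define q where "q = 1 / y' - 1 / yn'"
    define SX where "SX = (\<Sum>c<d. X (tm k) \<omega> c * b k c \<omega>)"
    define Sx where "Sx = (\<Sum>c<d. X_scheme k \<omega> c * b k c \<omega>)"
    define y z where "y = Y0 (tm k) \<omega>" and "z = Y_scheme k \<omega>"
    have N0: "N0 = - \<nu> * (SX - Sx)" unfolding N0_def SX_def Sx_def by (simp only: err_X_def left_diff_distrib sum_subtractf)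
    have e: "?e = y - z" by (simp only: err_Y_def y_def z_def)
    have implicit_rem: "?Z = y' - y - cK * u / y' + aK * y * u + \<nu> * SX" by (simp only: implicit_rem_at_def y'_def y_def u_def SX_def)
    have im: "yn' = z - \<nu> * Sx - aK * z * u + cK * u / yn'"
      using Y_scheme_implicit(2)[of k \<omega>] unfolding yn'_def u_def Sx_def z_def .
    have a: "?e + (N0 + u * L0 + ?Z) = (y' - yn') - cK * u * q"
      unfolding N0 L0_def e implicit_rem q_def using im by (simp add: algebra_simps)
    have "(y' - yn') * q \<le> 0"
    proof -
      have "(y' - yn') * q = - ((y' - yn')\<^sup>2 / (y' * yn'))" using yp by (simp add: q_def field_simps power2_eq_square)
      then show ?thesis using yp by simp
    qed
    then have "0 \<le> - 2 * (cK * u) * ((y' - yn') * q)" using cK u by (simp add: mult_nonneg_nonpos)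
    moreover have "((y' - yn') - cK * u * q)\<^sup>2 = (y' - yn')\<^sup>2 + (- 2 * (cK * u) * ((y' - yn') * q)) + (cK * u * q)\<^sup>2"
      by (simp add: power2_eq_square algebra_simps)
    ultimately have "(y' - yn')\<^sup>2 \<le> ((y' - yn') - cK * u * q)\<^sup>2" using zero_le_power2[of "cK * u * q"] by linarith
    then show ?thesis unfolding a by (simp add: err_Y_def y'_def yn'_def)
  qed
  have e2: "err_X (Suc k) \<omega> i = ?x i + (N i + u * L i + ?R i)" if i: "i < d" for i
  proof -
    have X: "X (tm (Suc k)) \<omega> i = X (tm k) \<omega> i + drift d m \<kappa> AA (X (tm k) \<omega>) i * u + (\<Sum>c<d+m. diffusion (X (tm k) \<omega>) i c * b k c \<omega>) + ?R i"
      unfolding euler_rem_def euler_inc_def u_def by (simp del: of_nat_Suc)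
    have sgS: "diffusion (X (tm k) \<omega>) i c = noise_coeff (Y0 (tm k) \<omega>) (X (tm k) \<omega>) i c" for c by (simp add: diffusion_def noise_coeff_def Y0_def Y0sq_def)
    have xe: "?x = (\<lambda>j. X (tm k) \<omega> j - X_scheme k \<omega> j)" by (rule ext) (simp add: err_X_def)
    have Ni: "N i = (\<Sum>c<d+m. diffusion (X (tm k) \<omega>) i c * b k c \<omega>) - (\<Sum>c<d+m. noise_coeff (Y_scheme k \<omega>) (X_scheme k \<omega>) i c * b k c \<omega>)"
      unfolding N_def sgS xe err_Y_def noise_coeff_diff by (simp only: left_diff_distrib sum_subtractf)
    have Li: "L i = drift d m \<kappa> AA (X (tm k) \<omega>) i - drift d m \<kappa> AA (X_scheme k \<omega>) i" unfolding L_def xe by (rule drift_diff)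
    show ?thesis unfolding err_X_def[of "Suc k"] X scheme_rec(2)[OF i] Ni Li u_def by (simp add: err_X_def algebra_simps del: of_nat_Suc)
  qed
  have orth: "?e * N0 + (\<Sum>i<d. ?x i * N i) = 0" unfolding N_def noise_coeff_dot N0_def by simp
  \<comment> \<open>The product of \<open>e\<close> with the noise \<open>a\<close> is kept exactly,
    since summed over the components it vanishes by \<open>orth\<close>. The product with the drift
    \<open>l\<close> is absorbed into terms with a factor \<open>u\<close>; the product with the
    remainder \<open>r\<close> is kept for the correlation estimate.\<close>
  have one: "(e + (a + u * l + r))\<^sup>2 \<le> e\<^sup>2 + 2 * (e * a) + u * (e\<^sup>2 + l\<^sup>2) + 2 * (e * r) + 3 * a\<^sup>2 + 3 * T * u * l\<^sup>2 + 3 * r\<^sup>2" for e a l r :: real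
  proof -
    have m: "u * (2 * e * l) \<le> u * (e\<^sup>2 + l\<^sup>2)" by (rule mult_left_mono[OF sum_squares_bound]) (use u in simp)
    have "(u * l)\<^sup>2 \<le> T * u * l\<^sup>2" unfolding power_mult_distrib power2_eq_square[of u] using u by (intro mult_right_mono) auto
    then have q: "(a + u * l + r)\<^sup>2 \<le> 3 * (a\<^sup>2 + T * u * l\<^sup>2 + r\<^sup>2)" using power2_sum3_le[of a "u * l" r] by simp
    have "(e + (a + u * l + r))\<^sup>2 = e\<^sup>2 + 2 * (e * a) + u * (2 * e * l) + 2 * (e * r) + (a + u * l + r)\<^sup>2" by (simp add: power2_eq_square algebra_simps)
    also have "\<dots> \<le> e\<^sup>2 + 2 * (e * a) + u * (e\<^sup>2 + l\<^sup>2) + 2 * (e * r) + 3 * (a\<^sup>2 + T * u * l\<^sup>2 + r\<^sup>2)"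
      by (rule add_mono[OF add_mono[OF add_mono[OF order_refl m] order_refl] q])
    finally show ?thesis by (simp add: algebra_simps)
  qed
  have E1: "err (Suc k) \<omega> \<le> (?e\<^sup>2 + 2 * (?e * N0) + u * (?e\<^sup>2 + L0\<^sup>2) + 2 * (?e * ?Z) + 3 * N0\<^sup>2 + 3 * T * u * L0\<^sup>2 + 3 * ?Z\<^sup>2)
     + (\<Sum>i<d. (?x i)\<^sup>2 + 2 * (?x i * N i) + u * ((?x i)\<^sup>2 + (L i)\<^sup>2) + 2 * (?x i * ?R i) + 3 * (N i)\<^sup>2 + 3 * T * u * (L i)\<^sup>2 + 3 * (?R i)\<^sup>2)"
    unfolding err_def[of "Suc k"]
  proof (intro add_mono sum_mono)
    show "(err_Y (Suc k) \<omega>)\<^sup>2 \<le> ?e\<^sup>2 + 2 * (?e * N0) + u * (?e\<^sup>2 + L0\<^sup>2) + 2 * (?e * ?Z) + 3 * N0\<^sup>2 + 3 * T * u * L0\<^sup>2 + 3 * ?Z\<^sup>2"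
      by (rule order_trans[OF e1 one])
    fix i assume "i \<in> {..<d}"
    then show "(err_X (Suc k) \<omega> i)\<^sup>2 \<le> (?x i)\<^sup>2 + 2 * (?x i * N i) + u * ((?x i)\<^sup>2 + (L i)\<^sup>2) + 2 * (?x i * ?R i) + 3 * (N i)\<^sup>2 + 3 * T * u * (L i)\<^sup>2 + 3 * (?R i)\<^sup>2"
      using e2[of i] one[of "?x i" "N i" "L i" "?R i"] by simp
  qed
  define sx sn sl sr sxn sxr where "sx = (\<Sum>i<d. (?x i)\<^sup>2)" and "sn = (\<Sum>i<d. (N i)\<^sup>2)" and "sl = (\<Sum>i<d. (L i)\<^sup>2)"
    and "sr = (\<Sum>i<d. (?R i)\<^sup>2)" and "sxn = (\<Sum>i<d. ?x i * N i)" and "sxr = (\<Sum>i<d. ?x i * ?R i)"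
  note defs = sx_def sn_def sl_def sr_def sxn_def sxr_def
  define SN where "SN = N0\<^sup>2 + sn"
  define SL where "SL = L0\<^sup>2 + sl"
  have RTu: "rem_sq k \<omega> = ?Z\<^sup>2 + sr" and CTu: "cross_term k \<omega> = ?e * ?Z + sxr" and Eu: "?E = ?e\<^sup>2 + sx"
    unfolding defs rem_sq_def cross_term_def err_def[of k] u_def by (rule refl)+
  have S: "(\<Sum>i<d. (?x i)\<^sup>2 + 2 * (?x i * N i) + u * ((?x i)\<^sup>2 + (L i)\<^sup>2) + 2 * (?x i * ?R i) + 3 * (N i)\<^sup>2 + 3 * T * u * (L i)\<^sup>2 + 3 * (?R i)\<^sup>2)
    = sx + 2 * sxn + u * (sx + sl) + 2 * sxr + 3 * sn + 3 * T * u * sl + 3 * sr"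
    unfolding defs by (simp only: sum.distrib sum_distrib_left distrib_left)
  have o: "?e * N0 = - sxn" using orth unfolding sxn_def by linarith
  have E2: "err (Suc k) \<omega> \<le> ?E + u * (?E + SL) + 2 * cross_term k \<omega> + 3 * SN + 3 * T * u * SL + 3 * rem_sq k \<omega>"
    using E1 unfolding S SN_def SL_def RTu CTu Eu o by (simp add: algebra_simps)
  have SL: "SL \<le> KL * ?E"
  proof -
    have "L0\<^sup>2 \<le> aK\<^sup>2 * ?E" unfolding L0_def power_mult_distrib power2_minus using err_Y_le by (intro mult_left_mono) auto
    moreover have "(\<Sum>i<d. (L i)\<^sup>2) \<le> (\<Sum>i<d. Kd * ?E)"
    proof (rule sum_mono)
      fix i assume "i \<in> {..<d}"
      then have "(L i)\<^sup>2 \<le> Kd * sqn d ?x" unfolding L_def by (intro drift_sq) auto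
      also have "\<dots> \<le> Kd * ?E" using err_X_sqn Kd_nonneg by (intro mult_left_mono) auto
      finally show "(L i)\<^sup>2 \<le> Kd * ?E" .
    qed
    ultimately show ?thesis unfolding SL_def sl_def KL_def by (simp add: distrib_right)
  qed
  have SN: "SN \<le> KN * (?E * noise_sq k \<omega>)"
  proof -
    have "N0\<^sup>2 = \<nu>\<^sup>2 * (\<Sum>c<d. ?x c * b k c \<omega>)\<^sup>2" by (simp add: N0_def power_mult_distrib)
    also have "\<dots> \<le> \<nu>\<^sup>2 * (real d * (\<Sum>c<d. (?x c * b k c \<omega>)\<^sup>2))" by (intro mult_left_mono sum_power2_le_card) auto
    also have "\<dots> \<le> \<nu>\<^sup>2 * (real d * (?E * noise_sq k \<omega>))"
    proof (intro mult_left_mono)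
      have "(\<Sum>c<d. (?x c * b k c \<omega>)\<^sup>2) \<le> (\<Sum>c<d. ?E * (b k c \<omega>)\<^sup>2)"
        unfolding power_mult_distrib by (intro sum_mono mult_right_mono err_X_le) auto
      also have "\<dots> \<le> (\<Sum>c<d+m. ?E * (b k c \<omega>)\<^sup>2)" using err_nonneg by (intro sum_mono2) auto
      finally show "(\<Sum>c<d. (?x c * b k c \<omega>)\<^sup>2) \<le> ?E * noise_sq k \<omega>" unfolding noise_sq_def sum_distrib_left .
    qed auto
    finally have n0: "N0\<^sup>2 \<le> \<nu>\<^sup>2 * (real d * (?E * noise_sq k \<omega>))" .
    have "(\<Sum>i<d. (N i)\<^sup>2) \<le> (\<Sum>i<d. real (d + m) * ((\<nu>\<^sup>2 + mat_sq) * (?E * noise_sq k \<omega>)))"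
    proof (rule sum_mono)
      fix i assume i: "i \<in> {..<d}"
      have "(N i)\<^sup>2 \<le> real (d + m) * (\<Sum>c<d+m. (noise_coeff ?e ?x i c * b k c \<omega>)\<^sup>2)" unfolding N_def by (rule sum_power2_le_card)
      also have "(\<Sum>c<d+m. (noise_coeff ?e ?x i c * b k c \<omega>)\<^sup>2) \<le> (\<Sum>c<d+m. ((\<nu>\<^sup>2 + mat_sq) * ?E) * (b k c \<omega>)\<^sup>2)"
        unfolding power_mult_distrib
      proof (intro sum_mono mult_right_mono)
        fix c assume "c \<in> {..<d+m}"
        then show "(noise_coeff ?e ?x i c)\<^sup>2 \<le> (\<nu>\<^sup>2 + mat_sq) * ?E" using noise_coeff_sq[of i c ?e ?x] i by (simp add: err_def sqn_def)
      qed auto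
      finally show "(N i)\<^sup>2 \<le> real (d + m) * ((\<nu>\<^sup>2 + mat_sq) * (?E * noise_sq k \<omega>))"
        unfolding noise_sq_def sum_distrib_left[symmetric] by (simp add: mult.assoc mult_left_mono)
    qed
    then show ?thesis using n0 unfolding SN_def sn_def KN_def by (simp add: distrib_right distrib_left mult.assoc)
  qed
  have "u * SL \<le> u * (KL * ?E)" "3 * T * u * SL \<le> 3 * T * u * (KL * ?E)" using SL u T by (auto intro!: mult_left_mono)
  then have "err (Suc k) \<omega> \<le> ?E + u * (?E + KL * ?E) + 2 * cross_term k \<omega> + 3 * (KN * (?E * noise_sq k \<omega>)) + 3 * T * u * (KL * ?E) + 3 * rem_sq k \<omega>"
    using E2 SN unfolding distrib_left[of u] by linarith
  then show ?thesis unfolding u_def[symmetric] KE_def by (simp add: algebra_simps)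
qed

end

section \<open>Expectation of the recursion and the rate at fixed grid times\<close>

context sde begin

definition Ka :: real where "Ka = KE + 1 + 3 * KN * real (d + m)"
definition KR :: real where "KR = CR1 + real d * C3"
definition KS :: real where "KS = CR2 + real d * CX2"
definition Kg :: real where "Kg = KR\<^sup>2 + 3 * KS"
definition Cg :: real where "Cg = exp (Ka * T) * (T * Kg)"
definition KT :: real where "KT = sqrt CR2 + real d * sqrt CX2"
definition Cm :: real where "Cm = T * ((KE * Cg + 3 * KN * real (d + m) * Cg + 3 * KS) * wmax\<^sup>2 + 2 * KT * sqrt Cg)"

lemma Ka: "0 \<le> Ka" using KE KN by (simp add: Ka_def)
lemma KS: "0 \<le> KS" using CR2 CX2 by (simp add: KS_def)
lemma Kg: "0 \<le> Kg" using KS by (simp add: Kg_def)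
lemma Cg: "0 \<le> Cg" using Kg T by (simp add: Cg_def)
lemma KT: "0 \<le> KT" using CR2 CX2 by (simp add: KT_def)
lemma Cm: "0 \<le> Cm" using T KE KN KS KT Cg by (simp add: Cm_def)

end

context sde_scheme begin

lemma sde_step_h: "k < n \<Longrightarrow> sde_step M F d m T \<kappa> \<nu> AA B X x0 h k"
  using tm_le[of "Suc k"] by (intro sde_step_I[OF h]) (simp del: of_nat_Suc)

lemma implicit_rem_at_facts:
  assumes k: "k < n"
  shows "implicit_rem_at k \<in> borel_measurable M" "integrable M (\<lambda>\<omega>. (implicit_rem_at k \<omega>)\<^sup>2)" "(LINT \<omega>|M. (implicit_rem_at k \<omega>)\<^sup>2) \<le> CR2 * (h ^ 4)\<^sup>2"
    "f \<in> borel_measurable (G (tm k)) \<Longrightarrow> integrable M (\<lambda>\<omega>. (f \<omega>)\<^sup>2) \<Longrightarrow> \<bar>LINT \<omega>|M. f \<omega> * implicit_rem_at k \<omega>\<bar> \<le> L2norm f * CR1 * h ^ 6"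
proof -
  interpret st: sde_step M F d m T \<kappa> \<nu> AA B X x0 h k by (rule sde_step_h[OF k])
  have eq: "implicit_rem_at k = st.implicit_rem" by (rule ext) (simp only: st.implicit_rem_def implicit_rem_at_def st.radial_noise_def)
  show "implicit_rem_at k \<in> borel_measurable M" "integrable M (\<lambda>\<omega>. (implicit_rem_at k \<omega>)\<^sup>2)" "(LINT \<omega>|M. (implicit_rem_at k \<omega>)\<^sup>2) \<le> CR2 * (h ^ 4)\<^sup>2"
    "f \<in> borel_measurable (G (tm k)) \<Longrightarrow> integrable M (\<lambda>\<omega>. (f \<omega>)\<^sup>2) \<Longrightarrow> \<bar>LINT \<omega>|M. f \<omega> * implicit_rem_at k \<omega>\<bar> \<le> L2norm f * CR1 * h ^ 6"
    unfolding eq using st.implicit_rem_meas st.implicit_rem_L2 st.implicit_rem_pair by blast+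
qed

lemma euler_rem_facts:
  assumes k: "k < n" and i: "i < d"
  shows "euler_rem (h ^ 4) k i \<in> borel_measurable M" "integrable M (\<lambda>\<omega>. (euler_rem (h ^ 4) k i \<omega>)\<^sup>2)" "(LINT \<omega>|M. (euler_rem (h ^ 4) k i \<omega>)\<^sup>2) \<le> CX2 * (h ^ 4)\<^sup>2"
    "f \<in> borel_measurable (G (tm k)) \<Longrightarrow> integrable M (\<lambda>\<omega>. (f \<omega>)\<^sup>2) \<Longrightarrow> \<bar>LINT \<omega>|M. f \<omega> * euler_rem (h ^ 4) k i \<omega>\<bar> \<le> L2norm f * C3 * h ^ 6"
proof -
  interpret st: sde_step M F d m T \<kappa> \<nu> AA B X x0 h k by (rule sde_step_h[OF k])
  show "euler_rem (h ^ 4) k i \<in> borel_measurable M" "integrable M (\<lambda>\<omega>. (euler_rem (h ^ 4) k i \<omega>)\<^sup>2)" "(LINT \<omega>|M. (euler_rem (h ^ 4) k i \<omega>)\<^sup>2) \<le> CX2 * (h ^ 4)\<^sup>2"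
    "f \<in> borel_measurable (G (tm k)) \<Longrightarrow> integrable M (\<lambda>\<omega>. (f \<omega>)\<^sup>2) \<Longrightarrow> \<bar>LINT \<omega>|M. f \<omega> * euler_rem (h ^ 4) k i \<omega>\<bar> \<le> L2norm f * C3 * h ^ 6"
    using euler_rem_meas[OF st.v st.k i] st.euler_rem_L2[OF i] st.euler_rem_pair[OF i] by blast+
qed

lemma err_Y_M: "k \<le> n \<Longrightarrow> err_Y k \<in> borel_measurable M" using measurable_G_M[OF err_Y_G tm0] .
lemma err_X_M: "k \<le> n \<Longrightarrow> i < d \<Longrightarrow> (\<lambda>\<omega>. err_X k \<omega> i) \<in> borel_measurable M" using measurable_G_M[OF err_X_G tm0] .

lemma square_integrable_of_err:
  assumes f: "f \<in> borel_measurable M" "\<And>\<omega>. (f \<omega>)\<^sup>2 \<le> err k \<omega>" and E: "integrable M (err k)"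
  shows "integrable M (\<lambda>\<omega>. (f \<omega>)\<^sup>2)" "L2norm f \<le> sqrt (LINT \<omega>|M. err k \<omega>)"
proof -
  show i: "integrable M (\<lambda>\<omega>. (f \<omega>)\<^sup>2)"
    by (rule Bochner_Integration.integrable_bound[OF E]) (use f err_nonneg[of k] in auto)
  show "L2norm f \<le> sqrt (LINT \<omega>|M. err k \<omega>)" by (rule L2norm_le[OF integral_mono[OF i E f(2)]])
qed

text \<open>Two bounds for one term. Its expectation profits from the weak correlation of the
  remainders with the past and has the factor \<open>h ^ 6\<close>; the expectation of its absolute
  value has only Cauchy-Schwarz and the factor \<open>h ^ 4\<close>. The former decides the rate at
  fixed times, the latter the rate of the maximum.\<close>

lemma cross_term_facts:
  assumes k: "k < n" and E: "integrable M (err k)"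
  shows "integrable M (cross_term k)" "\<bar>LINT \<omega>|M. cross_term k \<omega>\<bar> \<le> KR * h ^ 6 * sqrt (LINT \<omega>|M. err k \<omega>)"
    "(LINT \<omega>|M. \<bar>cross_term k \<omega>\<bar>) \<le> KT * h ^ 4 * sqrt (LINT \<omega>|M. err k \<omega>)"
proof -
  define q where "q = sqrt (LINT \<omega>|M. err k \<omega>)"
  have kn: "k \<le> n" using k by simp
  have q: "0 \<le> q" unfolding q_def by (intro real_sqrt_ge_zero integral_nonneg_AE) (auto simp: err_nonneg)
  note e = square_integrable_of_err[OF err_Y_M[OF kn] err_Y_le E, folded q_def]
  note x = square_integrable_of_err[OF err_X_M[OF kn] err_X_le E, folded q_def]
  note P0 = pairing[OF err_Y_M[OF kn] implicit_rem_at_facts(1)[OF k] e(1) implicit_rem_at_facts(2,3)[OF k]]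
  have PX: "integrable M (\<lambda>\<omega>. err_X k \<omega> i * euler_rem (h ^ 4) k i \<omega>)"
    "(LINT \<omega>|M. \<bar>err_X k \<omega> i * euler_rem (h ^ 4) k i \<omega>\<bar>) \<le> L2norm (\<lambda>\<omega>. err_X k \<omega> i) * sqrt (CX2 * (h ^ 4)\<^sup>2)" if i: "i < d" for i
    using pairing[OF err_X_M[OF kn i] euler_rem_facts(1)[OF k i] x(1)[OF i i] euler_rem_facts(2,3)[OF k i]] by blast+
  have sI: "integrable M (\<lambda>\<omega>. \<Sum>i<d. err_X k \<omega> i * euler_rem (h ^ 4) k i \<omega>)" using PX(1) by (intro Bochner_Integration.integrable_sum) auto
  show I: "integrable M (cross_term k)" unfolding cross_term_def[abs_def] by (intro Bochner_Integration.integrable_add P0(1) sI)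
  have "(LINT \<omega>|M. cross_term k \<omega>) = (LINT \<omega>|M. err_Y k \<omega> * implicit_rem_at k \<omega>) + (\<Sum>i<d. LINT \<omega>|M. err_X k \<omega> i * euler_rem (h ^ 4) k i \<omega>)"
    unfolding cross_term_def Bochner_Integration.integral_add[OF P0(1) sI] using PX(1) by (subst Bochner_Integration.integral_sum) auto
  then have "\<bar>LINT \<omega>|M. cross_term k \<omega>\<bar> \<le> \<bar>LINT \<omega>|M. err_Y k \<omega> * implicit_rem_at k \<omega>\<bar> + (\<Sum>i<d. \<bar>LINT \<omega>|M. err_X k \<omega> i * euler_rem (h ^ 4) k i \<omega>\<bar>)"
    using sum_abs[of "\<lambda>i. LINT \<omega>|M. err_X k \<omega> i * euler_rem (h ^ 4) k i \<omega>" "{..<d}"] by linarith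
  also have "\<dots> \<le> q * CR1 * h ^ 6 + (\<Sum>i<d. q * C3 * h ^ 6)"
  proof (intro add_mono sum_mono)
    have "L2norm (err_Y k) * (CR1 * h ^ 6) \<le> q * (CR1 * h ^ 6)" using e(2) CR1 h by (intro mult_right_mono) auto
    then show "\<bar>LINT \<omega>|M. err_Y k \<omega> * implicit_rem_at k \<omega>\<bar> \<le> q * CR1 * h ^ 6" using implicit_rem_at_facts(4)[OF k err_Y_G[OF kn] e(1)] by simp
    fix i assume "i \<in> {..<d}" then have i: "i < d" by simp
    have "L2norm (\<lambda>\<omega>. err_X k \<omega> i) * (C3 * h ^ 6) \<le> q * (C3 * h ^ 6)" using x(2)[OF i i] C3_nonneg h by (intro mult_right_mono) auto
    then show "\<bar>LINT \<omega>|M. err_X k \<omega> i * euler_rem (h ^ 4) k i \<omega>\<bar> \<le> q * C3 * h ^ 6" using euler_rem_facts(4)[OF k i err_X_G[OF kn i] x(1)[OF i i]] by simp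
  qed
  finally show "\<bar>LINT \<omega>|M. cross_term k \<omega>\<bar> \<le> KR * h ^ 6 * sqrt (LINT \<omega>|M. err k \<omega>)" by (simp add: KR_def q_def algebra_simps)
  have aI: "integrable M (\<lambda>\<omega>. \<Sum>i<d. \<bar>err_X k \<omega> i * euler_rem (h ^ 4) k i \<omega>\<bar>)" using PX(1) by (intro Bochner_Integration.integrable_sum integrable_abs) auto
  have "(LINT \<omega>|M. \<bar>cross_term k \<omega>\<bar>) \<le> (LINT \<omega>|M. \<bar>err_Y k \<omega> * implicit_rem_at k \<omega>\<bar> + (\<Sum>i<d. \<bar>err_X k \<omega> i * euler_rem (h ^ 4) k i \<omega>\<bar>))"
  proof (rule integral_mono)
    show "integrable M (\<lambda>\<omega>. \<bar>cross_term k \<omega>\<bar>)" using I by simp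
    show "integrable M (\<lambda>\<omega>. \<bar>err_Y k \<omega> * implicit_rem_at k \<omega>\<bar> + (\<Sum>i<d. \<bar>err_X k \<omega> i * euler_rem (h ^ 4) k i \<omega>\<bar>))" using P0(1) aI by simp
    show "\<bar>cross_term k \<omega>\<bar> \<le> \<bar>err_Y k \<omega> * implicit_rem_at k \<omega>\<bar> + (\<Sum>i<d. \<bar>err_X k \<omega> i * euler_rem (h ^ 4) k i \<omega>\<bar>)" for \<omega>
      using sum_abs[of "\<lambda>i. err_X k \<omega> i * euler_rem (h ^ 4) k i \<omega>" "{..<d}"] unfolding cross_term_def by linarith
  qed
  also have "\<dots> = (LINT \<omega>|M. \<bar>err_Y k \<omega> * implicit_rem_at k \<omega>\<bar>) + (\<Sum>i<d. LINT \<omega>|M. \<bar>err_X k \<omega> i * euler_rem (h ^ 4) k i \<omega>\<bar>)"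
    unfolding Bochner_Integration.integral_add[OF integrable_abs[OF P0(1)] aI] using PX(1) by (subst Bochner_Integration.integral_sum) auto
  also have "\<dots> \<le> q * (sqrt CR2 * h ^ 4) + (\<Sum>i<d. q * (sqrt CX2 * h ^ 4))"
  proof (intro add_mono sum_mono)
    have s: "sqrt (c * (h ^ 4)\<^sup>2) = sqrt c * h ^ 4" for c unfolding real_sqrt_mult real_sqrt_abs using h by simp
    have "L2norm (err_Y k) * (sqrt CR2 * h ^ 4) \<le> q * (sqrt CR2 * h ^ 4)" using e(2) CR2 h by (intro mult_right_mono) auto
    then show "(LINT \<omega>|M. \<bar>err_Y k \<omega> * implicit_rem_at k \<omega>\<bar>) \<le> q * (sqrt CR2 * h ^ 4)" using P0(3) unfolding s by linarith
    fix i assume "i \<in> {..<d}" then have i: "i < d" by simp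
    have "L2norm (\<lambda>\<omega>. err_X k \<omega> i) * (sqrt CX2 * h ^ 4) \<le> q * (sqrt CX2 * h ^ 4)" using x(2)[OF i i] CX2 h by (intro mult_right_mono) auto
    then show "(LINT \<omega>|M. \<bar>err_X k \<omega> i * euler_rem (h ^ 4) k i \<omega>\<bar>) \<le> q * (sqrt CX2 * h ^ 4)" using PX(2)[OF i] unfolding s by linarith
  qed
  finally show "(LINT \<omega>|M. \<bar>cross_term k \<omega>\<bar>) \<le> KT * h ^ 4 * sqrt (LINT \<omega>|M. err k \<omega>)" by (simp add: KT_def q_def algebra_simps)
qed

lemma rem_sq_facts:
  assumes k: "k < n"
  shows "integrable M (rem_sq k)" "(LINT \<omega>|M. rem_sq k \<omega>) \<le> KS * (h ^ 4)\<^sup>2"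
proof -
  have sI: "integrable M (\<lambda>\<omega>. \<Sum>i<d. (euler_rem (h ^ 4) k i \<omega>)\<^sup>2)" using euler_rem_facts(2)[OF k] by (intro Bochner_Integration.integrable_sum) auto
  show "integrable M (rem_sq k)" unfolding rem_sq_def[abs_def] by (intro Bochner_Integration.integrable_add implicit_rem_at_facts(2)[OF k] sI)
  have "(LINT \<omega>|M. rem_sq k \<omega>) = (LINT \<omega>|M. (implicit_rem_at k \<omega>)\<^sup>2) + (\<Sum>i<d. LINT \<omega>|M. (euler_rem (h ^ 4) k i \<omega>)\<^sup>2)"
    unfolding rem_sq_def Bochner_Integration.integral_add[OF implicit_rem_at_facts(2)[OF k] sI] using euler_rem_facts(2)[OF k] by (subst Bochner_Integration.integral_sum) auto
  also have "\<dots> \<le> CR2 * (h ^ 4)\<^sup>2 + (\<Sum>i<d. CX2 * (h ^ 4)\<^sup>2)"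
    by (intro add_mono sum_mono implicit_rem_at_facts(3)[OF k] euler_rem_facts(3)[OF k]) simp
  finally show "(LINT \<omega>|M. rem_sq k \<omega>) \<le> KS * (h ^ 4)\<^sup>2" by (simp add: KS_def distrib_right)
qed

lemma noise_sq_facts:
  assumes k: "k < n" and E: "integrable M (err k)"
  shows "integrable M (\<lambda>\<omega>. err k \<omega> * noise_sq k \<omega>)" "(LINT \<omega>|M. err k \<omega> * noise_sq k \<omega>) \<le> real (d + m) * h ^ 4 * (LINT \<omega>|M. err k \<omega>)"
proof -
  have lt: "tm k < tm (Suc k)" using h by simp
  have diff: "tm (Suc k) - tm k = h ^ 4" by (simp add: algebra_simps)
  have 1: "integrable M (\<lambda>\<omega>. err k \<omega> * (b k c \<omega>)\<^sup>2)" "(LINT \<omega>|M. err k \<omega> * (b k c \<omega>)\<^sup>2) \<le> h ^ 4 * (LINT \<omega>|M. err k \<omega>)" if c: "c < d + m" for c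
    using cond_le_integral[OF subalgebra_G[OF tm0] dB_single(4)[OF tm0 lt c] err_G E err_nonneg] k unfolding diff by auto
  have eq: "err k \<omega> * noise_sq k \<omega> = (\<Sum>c<d+m. err k \<omega> * (b k c \<omega>)\<^sup>2)" for \<omega> by (simp only: noise_sq_def sum_distrib_left)
  show "integrable M (\<lambda>\<omega>. err k \<omega> * noise_sq k \<omega>)" unfolding eq using 1(1) by (intro Bochner_Integration.integrable_sum) auto
  have "(LINT \<omega>|M. err k \<omega> * noise_sq k \<omega>) = (\<Sum>c<d+m. LINT \<omega>|M. err k \<omega> * (b k c \<omega>)\<^sup>2)"
    unfolding eq using 1(1) by (intro Bochner_Integration.integral_sum) auto
  also have "\<dots> \<le> (\<Sum>c<d+m. h ^ 4 * (LINT \<omega>|M. err k \<omega>))" using 1(2) by (intro sum_mono) auto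
  finally show "(LINT \<omega>|M. err k \<omega> * noise_sq k \<omega>) \<le> real (d + m) * h ^ 4 * (LINT \<omega>|M. err k \<omega>)" by (simp add: mult.assoc)
qed

text \<open>\<open>error_step\<close> requires \<open>Y0\<close> to be positive at the right end
  point, which the inverse moments guarantee almost surely.\<close>

lemma err_step_AE:
  assumes k: "k < n"
  shows "AE \<omega> in M. err (Suc k) \<omega> \<le> err k \<omega> + KE * h ^ 4 * err k \<omega> + 2 * cross_term k \<omega> + 3 * KN * (err k \<omega> * noise_sq k \<omega>) + 3 * rem_sq k \<omega>"
  using Y0_pos[OF h4pos tm_le[of "Suc k"]] k by (auto elim!: eventually_mono intro: error_step simp del: of_nat_Suc)

lemma err_0: "\<omega> \<in> space M \<Longrightarrow> err 0 \<omega> = 0"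
proof -
  assume w: "\<omega> \<in> space M"
  have X0: "X 0 \<omega> i = x0 i" if "i < d" for i using sol w that by (simp add: is_solution_def)
  have "sqn d (X 0 \<omega>) = sqn d x0" unfolding sqn_def using X0 by (intro sum.cong) auto
  then show ?thesis using X0 by (simp add: err_def err_Y_def err_X_def Y_scheme_def X_scheme_def Y0_def Y0sq_def)
qed

text \<open>The cross term \<open>2 * KR * h ^ 6 * sqrt g\<close> is split into
  \<open>h ^ 4 * g\<close>, a bounded growth rate per unit time, and
  \<open>KR\<^sup>2 * h ^ 8\<close>, the size of the squared remainders. Correlation of order 3/2
  and mean square of order 2 are matched in this way.\<close>

lemma err_step_integral:
  assumes k: "k < n" and E: "integrable M (err k)"
  shows "integrable M (err (Suc k))"
    "(LINT \<omega>|M. err (Suc k) \<omega>) \<le> (1 + Ka * h ^ 4) * (LINT \<omega>|M. err k \<omega>) + Kg * (h ^ 4)\<^sup>2"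
proof -
  define g where "g = (LINT \<omega>|M. err k \<omega>)"
  have g: "0 \<le> g" unfolding g_def by (intro integral_nonneg_AE) (auto simp: err_nonneg)
  note i1 = E and i2 = integrable_mult_right[OF E, of "KE * h ^ 4"] and i3 = integrable_mult_right[OF cross_term_facts(1)[OF k E], of 2]
    and i4 = integrable_mult_right[OF noise_sq_facts(1)[OF k E], of "3 * KN"] and i5 = integrable_mult_right[OF rem_sq_facts(1)[OF k], of 3]
  note j2 = Bochner_Integration.integrable_add[OF i1 i2]
  note j3 = Bochner_Integration.integrable_add[OF j2 i3]
  note j4 = Bochner_Integration.integrable_add[OF j3 i4]
  note j5 = Bochner_Integration.integrable_add[OF j4 i5]
  show I: "integrable M (err (Suc k))"
  proof (rule Bochner_Integration.integrable_bound[OF j5])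
    show "err (Suc k) \<in> borel_measurable M" using k by (intro err_M) simp
    show "AE \<omega> in M. norm (err (Suc k) \<omega>) \<le> norm (err k \<omega> + KE * h ^ 4 * err k \<omega> + 2 * cross_term k \<omega> + 3 * KN * (err k \<omega> * noise_sq k \<omega>) + 3 * rem_sq k \<omega>)"
      using err_step_AE[OF k] by eventually_elim (use err_nonneg[of "Suc k"] in simp)
  qed
  have "(LINT \<omega>|M. err (Suc k) \<omega>) \<le> g + KE * h ^ 4 * g + 2 * (LINT \<omega>|M. cross_term k \<omega>) + 3 * KN * (LINT \<omega>|M. err k \<omega> * noise_sq k \<omega>) + 3 * (LINT \<omega>|M. rem_sq k \<omega>)"
    using integral_mono_AE[OF I j5 err_step_AE[OF k]]
    unfolding g_def Bochner_Integration.integral_add[OF j4 i5] Bochner_Integration.integral_add[OF j3 i4] Bochner_Integration.integral_add[OF j2 i3] Bochner_Integration.integral_add[OF i1 i2] integral_mult_right_zero .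
  also have "\<dots> \<le> g + KE * h ^ 4 * g + 2 * (KR * h ^ 6 * sqrt g) + 3 * KN * (real (d + m) * h ^ 4 * g) + 3 * (KS * (h ^ 4)\<^sup>2)"
  proof (intro add_mono order_refl)
    show "2 * (LINT \<omega>|M. cross_term k \<omega>) \<le> 2 * (KR * h ^ 6 * sqrt g)" using cross_term_facts(2)[OF k E] by (simp add: g_def)
    show "3 * KN * (LINT \<omega>|M. err k \<omega> * noise_sq k \<omega>) \<le> 3 * KN * (real (d + m) * h ^ 4 * g)"
      using noise_sq_facts(2)[OF k E, folded g_def] by (rule mult_left_mono) (use KN in simp)
    show "3 * (LINT \<omega>|M. rem_sq k \<omega>) \<le> 3 * (KS * (h ^ 4)\<^sup>2)" using rem_sq_facts(2)[OF k] by simp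
  qed
  also have "2 * (KR * h ^ 6 * sqrt g) \<le> h ^ 4 * g + KR\<^sup>2 * (h ^ 4)\<^sup>2"
  proof -
    have e: "h\<^sup>2 * h ^ 4 = h ^ 6" "(h\<^sup>2)\<^sup>2 = h ^ 4" by (simp_all flip: power_add power_mult)
    have "2 * (h\<^sup>2 * sqrt g) * (KR * h ^ 4) \<le> (h\<^sup>2 * sqrt g)\<^sup>2 + (KR * h ^ 4)\<^sup>2" by (rule sum_squares_bound)
    moreover have "2 * (h\<^sup>2 * sqrt g) * (KR * h ^ 4) = 2 * (KR * (h\<^sup>2 * h ^ 4) * sqrt g)" by (simp only: ac_simps)
    moreover have "(h\<^sup>2 * sqrt g)\<^sup>2 = h ^ 4 * g" using g by (simp only: power_mult_distrib e real_sqrt_pow2)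
    ultimately show ?thesis unfolding e power_mult_distrib by simp
  qed
  finally show "(LINT \<omega>|M. err (Suc k) \<omega>) \<le> (1 + Ka * h ^ 4) * (LINT \<omega>|M. err k \<omega>) + Kg * (h ^ 4)\<^sup>2"
    unfolding g_def[symmetric] Ka_def Kg_def by (simp add: algebra_simps)
qed

lemma err_integrable: "k \<le> n \<Longrightarrow> integrable M (err k)"
proof (induction k)
  case 0
  have "integrable M (err 0) \<longleftrightarrow> integrable M (\<lambda>\<omega>. 0 :: real)" by (rule Bochner_Integration.integrable_cong) (auto simp: err_0)
  then show ?case by simp
next
  case (Suc k)
  then show ?case by (intro err_step_integral(1)) auto
qed

text \<open>At most \<open>n = T / h ^ 4\<close> contributions of order \<open>h ^ 8\<close>
  accumulate to order \<open>h ^ 4\<close>, that is to the first power of the step size for the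
  squared error.\<close>

lemma err_bound: assumes k: "k \<le> n" shows "(LINT \<omega>|M. err k \<omega>) \<le> Cg * h ^ 4"
proof -
  have E0: "(LINT \<omega>|M. err 0 \<omega>) = 0"
  proof -
    have "(LINT \<omega>|M. err 0 \<omega>) = (LINT \<omega>|M. 0)" by (rule Bochner_Integration.integral_cong) (auto simp: err_0)
    then show ?thesis by simp
  qed
  have p: "0 \<le> Ka * h ^ 4" "0 \<le> Kg * (h ^ 4)\<^sup>2" using Ka Kg h by auto
  have "(LINT \<omega>|M. err k \<omega>) \<le> exp (Ka * h ^ 4 * real k) * ((LINT \<omega>|M. err 0 \<omega>) + real k * (Kg * (h ^ 4)\<^sup>2))"
    by (rule discrete_gronwall[where n = n and g = "\<lambda>k. LINT \<omega>|M. err k \<omega>"])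
      (use err_step_integral(2) err_integrable E0 p k in auto)
  also have "\<dots> = exp (Ka * tm k) * (tm k * (Kg * h ^ 4))" unfolding E0 by (simp add: power2_eq_square ac_simps)
  also have "\<dots> \<le> exp (Ka * T) * (T * (Kg * h ^ 4))"
  proof (rule mult_mono)
    have "Ka * tm k \<le> Ka * T" using tm_le[OF k] Ka by (rule mult_left_mono)
    then show "exp (Ka * tm k) \<le> exp (Ka * T)" by simp
    show "tm k * (Kg * h ^ 4) \<le> T * (Kg * h ^ 4)" using tm_le[OF k] Kg h by (intro mult_right_mono) auto
  qed (use Kg h in auto)
  finally show ?thesis by (simp add: Cg_def mult.assoc)
qed

section \<open>The maximum over the grid\<close>

definition err_inc :: "nat \<Rightarrow> 'a \<Rightarrow> real" where
  "err_inc j \<omega> = KE * h ^ 4 * err j \<omega> + 2 * \<bar>cross_term j \<omega>\<bar> + 3 * KN * (err j \<omega> * noise_sq j \<omega>) + 3 * rem_sq j \<omega>"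

lemma err_inc_nonneg: "0 \<le> err_inc j \<omega>"
  unfolding err_inc_def using KE KN h err_nonneg[of j \<omega>] noise_sq_nonneg[of j \<omega>] rem_sq_nonneg[of j \<omega>] by (intro add_nonneg_nonneg mult_nonneg_nonneg) auto

text \<open>The absolute cross term dominates: it is of order \<open>h ^ 4 * sqrt (h ^ 4)\<close>
  per step, and \<open>real n * h ^ 4 = T\<close> turns this into a total of order
  \<open>h\<^sup>2\<close>, against \<open>h ^ 4\<close> at fixed times.\<close>

lemma err_inc_facts:
  assumes k: "k < n"
  shows "integrable M (err_inc k)" "real n * (LINT \<omega>|M. err_inc k \<omega>) \<le> Cm * h\<^sup>2"
proof -
  have E: "integrable M (err k)" and g: "(LINT \<omega>|M. err k \<omega>) \<le> Cg * h ^ 4" using err_integrable err_bound k by auto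
  define g where "g = (LINT \<omega>|M. err k \<omega>)"
  note i2 = integrable_mult_right[OF E, of "KE * h ^ 4"] and i3 = integrable_mult_right[OF integrable_abs[OF cross_term_facts(1)[OF k E]], of 2]
    and i4 = integrable_mult_right[OF noise_sq_facts(1)[OF k E], of "3 * KN"] and i5 = integrable_mult_right[OF rem_sq_facts(1)[OF k], of 3]
  note j3 = Bochner_Integration.integrable_add[OF i2 i3]
  note j4 = Bochner_Integration.integrable_add[OF j3 i4]
  note j5 = Bochner_Integration.integrable_add[OF j4 i5]
  show "integrable M (err_inc k)" unfolding err_inc_def[abs_def] by (rule j5)
  define r where "r = h\<^sup>2"
  have hs: "h ^ 4 = r * r" unfolding r_def by (simp flip: power_add)
  have h22: "h\<^sup>2 \<le> wmax\<^sup>2"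
  proof -
    have "h \<le> wmax" using w_le[OF h h4T] by (simp add: wmax_def)
    then show ?thesis using h by (intro power_mono) auto
  qed
  have sq: "sqrt g \<le> sqrt Cg * h\<^sup>2"
  proof -
    have "sqrt (h ^ 4) = h\<^sup>2" using h real_sqrt_abs[of "h\<^sup>2"] by (simp add: power_mult[symmetric])
    then show ?thesis using real_sqrt_le_mono[OF g, folded g_def] by (simp add: real_sqrt_mult)
  qed
  have "(LINT \<omega>|M. err_inc k \<omega>) = KE * h ^ 4 * g + 2 * (LINT \<omega>|M. \<bar>cross_term k \<omega>\<bar>) + 3 * KN * (LINT \<omega>|M. err k \<omega> * noise_sq k \<omega>) + 3 * (LINT \<omega>|M. rem_sq k \<omega>)"
    unfolding g_def err_inc_def Bochner_Integration.integral_add[OF j4 i5] Bochner_Integration.integral_add[OF j3 i4] Bochner_Integration.integral_add[OF i2 i3] integral_mult_right_zero ..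
  also have "\<dots> \<le> KE * h ^ 4 * (Cg * h ^ 4) + 2 * (KT * h ^ 4 * (sqrt Cg * h\<^sup>2)) + 3 * KN * (real (d + m) * h ^ 4 * (Cg * h ^ 4)) + 3 * (KS * (h ^ 4)\<^sup>2)"
  proof (intro add_mono)
    show "KE * h ^ 4 * g \<le> KE * h ^ 4 * (Cg * h ^ 4)" using g[folded g_def] by (rule mult_left_mono) (use KE h in simp)
    have "KT * h ^ 4 * sqrt g \<le> KT * h ^ 4 * (sqrt Cg * h\<^sup>2)" using sq by (rule mult_left_mono) (use KT h in simp)
    then show "2 * (LINT \<omega>|M. \<bar>cross_term k \<omega>\<bar>) \<le> 2 * (KT * h ^ 4 * (sqrt Cg * h\<^sup>2))" using cross_term_facts(3)[OF k E, folded g_def] by linarith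
    have "real (d + m) * h ^ 4 * g \<le> real (d + m) * h ^ 4 * (Cg * h ^ 4)" using g[folded g_def] by (rule mult_left_mono) (use h in simp)
    then have "(LINT \<omega>|M. err k \<omega> * noise_sq k \<omega>) \<le> real (d + m) * h ^ 4 * (Cg * h ^ 4)" using noise_sq_facts(2)[OF k E, folded g_def] by linarith
    then show "3 * KN * (LINT \<omega>|M. err k \<omega> * noise_sq k \<omega>) \<le> 3 * KN * (real (d + m) * h ^ 4 * (Cg * h ^ 4))"
      by (rule mult_left_mono) (use KN in simp)
    show "3 * (LINT \<omega>|M. rem_sq k \<omega>) \<le> 3 * (KS * (h ^ 4)\<^sup>2)" using rem_sq_facts(2)[OF k] by simp
  qed
  also have "\<dots> = h ^ 4 * h\<^sup>2 * ((KE * Cg + 3 * KN * real (d + m) * Cg + 3 * KS) * h\<^sup>2 + 2 * KT * sqrt Cg)"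
    unfolding hs power2_eq_square[of "r * r"] r_def[symmetric] by (simp add: algebra_simps)
  also have "\<dots> \<le> h ^ 4 * h\<^sup>2 * ((KE * Cg + 3 * KN * real (d + m) * Cg + 3 * KS) * wmax\<^sup>2 + 2 * KT * sqrt Cg)"
  proof (rule mult_left_mono)
    have "(KE * Cg + 3 * KN * real (d + m) * Cg + 3 * KS) * h\<^sup>2 \<le> (KE * Cg + 3 * KN * real (d + m) * Cg + 3 * KS) * wmax\<^sup>2"
      using h22 by (rule mult_left_mono) (use KE Cg KN KS in simp)
    then show "(KE * Cg + 3 * KN * real (d + m) * Cg + 3 * KS) * h\<^sup>2 + 2 * KT * sqrt Cg \<le> (KE * Cg + 3 * KN * real (d + m) * Cg + 3 * KS) * wmax\<^sup>2 + 2 * KT * sqrt Cg" by simp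
  qed (use h in simp)
  finally have "real n * (LINT \<omega>|M. err_inc k \<omega>) \<le> real n * (h ^ 4 * h\<^sup>2 * ((KE * Cg + 3 * KN * real (d + m) * Cg + 3 * KS) * wmax\<^sup>2 + 2 * KT * sqrt Cg))"
    by (rule mult_left_mono) simp
  also have "\<dots> = (real n * h ^ 4) * h\<^sup>2 * ((KE * Cg + 3 * KN * real (d + m) * Cg + 3 * KS) * wmax\<^sup>2 + 2 * KT * sqrt Cg)" by (simp only: mult.assoc)
  also have "real n * h ^ 4 = T" using n by (simp add: h4)
  finally show "real n * (LINT \<omega>|M. err_inc k \<omega>) \<le> Cm * h\<^sup>2" unfolding Cm_def by (simp only: ac_simps)
qed

text \<open>The error starts at 0, so along almost every path all its grid values lie below the sum
  of the nonnegative \<open>err_inc\<close>. This takes the place of a maximal inequality; it is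
  affordable because orthogonality has removed the leading noise from the recursion.\<close>

lemma Max_err:
  shows "integrable M (\<lambda>\<omega>. Max ((\<lambda>k. err k \<omega>) ` {0..n}))" "(LINT \<omega>|M. Max ((\<lambda>k. err k \<omega>) ` {0..n})) \<le> Cm * h\<^sup>2"
proof -
  let ?S = "\<lambda>\<omega>. \<Sum>j<n. err_inc j \<omega>"
  have SI: "integrable M ?S" using err_inc_facts(1) by (intro Bochner_Integration.integrable_sum) auto
  have "AE \<omega> in M. \<forall>j\<in>{..<n}. err (Suc j) \<omega> \<le> err j \<omega> + err_inc j \<omega>"
  proof (rule AE_finite_allI)
    fix j assume "j \<in> {..<n}"
    then have j: "j < n" by simp
    show "AE \<omega> in M. err (Suc j) \<omega> \<le> err j \<omega> + err_inc j \<omega>"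
      using err_step_AE[OF j]
    proof eventually_elim
      case (elim \<omega>)
      then show ?case unfolding err_inc_def using abs_ge_self[of "cross_term j \<omega>"] by linarith
    qed
  qed simp
  then have ae: "AE \<omega> in M. Max ((\<lambda>k. err k \<omega>) ` {0..n}) \<le> ?S \<omega>"
    using AE_space
  proof eventually_elim
    case (elim \<omega>)
    have "k \<le> n \<Longrightarrow> err k \<omega> \<le> (\<Sum>j<k. err_inc j \<omega>)" for k
    proof (induction k)
      case (Suc k)
      then have "err (Suc k) \<omega> \<le> err k \<omega> + err_inc k \<omega>" using elim(1) by auto
      then show ?case using Suc by simp
    qed (use err_0[OF elim(2)] in simp)
    moreover have "(\<Sum>j<k. err_inc j \<omega>) \<le> ?S \<omega>" if "k \<le> n" for k using that err_inc_nonneg by (intro sum_mono2) auto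
    ultimately have "err k \<omega> \<le> ?S \<omega>" if "k \<le> n" for k using that by (meson order_trans)
    then show ?case by (subst Max_le_iff) auto
  qed
  have nn: "0 \<le> Max ((\<lambda>k. err k \<omega>) ` {0..n})" for \<omega>
    by (rule order_trans[OF err_nonneg[of 0] Max_ge]) auto
  show I: "integrable M (\<lambda>\<omega>. Max ((\<lambda>k. err k \<omega>) ` {0..n}))"
  proof (rule Bochner_Integration.integrable_bound[OF SI])
    show "(\<lambda>\<omega>. Max ((\<lambda>k. err k \<omega>) ` {0..n})) \<in> borel_measurable M" using err_M by (intro borel_measurable_Max) auto
    show "AE \<omega> in M. norm (Max ((\<lambda>k. err k \<omega>) ` {0..n})) \<le> norm (?S \<omega>)"
      unfolding real_norm_def abs_of_nonneg[OF nn] using ae by eventually_elim (rule order_trans[OF _ abs_ge_self])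
  qed
  have "(LINT \<omega>|M. Max ((\<lambda>k. err k \<omega>) ` {0..n})) \<le> (LINT \<omega>|M. ?S \<omega>)" by (rule integral_mono_AE[OF I SI ae])
  also have "\<dots> = (\<Sum>j<n. LINT \<omega>|M. err_inc j \<omega>)" using err_inc_facts(1) by (intro Bochner_Integration.integral_sum) auto
  also have "\<dots> \<le> (\<Sum>j<n. Cm * h\<^sup>2 / real n)" using err_inc_facts(2) n by (intro sum_mono) (simp add: field_simps)
  also have "\<dots> = Cm * h\<^sup>2" using n by simp
  finally show "(LINT \<omega>|M. Max ((\<lambda>k. err k \<omega>) ` {0..n})) \<le> Cm * h\<^sup>2" .
qed

lemma h_squared: "h\<^sup>2 = sqrt T / sqrt (real n)"
proof -
  have "(h\<^sup>2)\<^sup>2 = T / real n" unfolding h4[symmetric] by (simp flip: power_mult)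
  then have "h\<^sup>2 = sqrt (T / real n)" using h by (metis abs_of_nonneg real_sqrt_abs zero_le_power2)
  then show ?thesis by (simp add: real_sqrt_divide)
qed

lemma err_rate: "k \<le> n \<Longrightarrow> sqrt (LINT \<omega>|M. err k \<omega>) \<le> sqrt (Cg * T) / sqrt (real n)"
  using real_sqrt_le_mono[OF err_bound[of k]] by (simp add: h4 real_sqrt_divide)

lemma Max_err_rate: "sqrt (LINT \<omega>|M. Max ((\<lambda>k. err k \<omega>) ` {0..n})) \<le> sqrt (Cm * sqrt T) / real n powr (1/4)"
proof -
  have "sqrt (sqrt (real n)) = real n powr (1/4)" using n by (simp add: powr_half_sqrt[symmetric] powr_powr)
  then show ?thesis using real_sqrt_le_mono[OF Max_err(2)] by (simp add: h_squared real_sqrt_divide)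
qed

end

theorem mainTheorem1:
  fixes M :: "'w measure" and F :: "real \<Rightarrow> 'w set set"
    and d m :: nat and T \<kappa> \<nu> :: real
    and AA :: "nat \<Rightarrow> nat \<Rightarrow> nat \<Rightarrow> real"
    and B X :: "real \<Rightarrow> 'w \<Rightarrow> nat \<Rightarrow> real" and x0 :: "nat \<Rightarrow> real"
  assumes d: "d \<ge> 2" and T: "T > 0" and m: "m = d * (d - 1) div 2"
    and filt: "usual_filtration M F"
    and BM: "std_BM M F (d + m) B"
    and kappa: "\<kappa> \<ge> 0" and nu: "\<nu> > 0" and ratio: "\<kappa> / \<nu>\<^sup>2 \<ge> sqrt 2 - 1"
    and skewA: "\<forall>p\<le>m. skew d (AA p)"
    and x0: "sqn d x0 < 1"
    and sol: "is_solution M F d m \<kappa> \<nu> AA T B x0 X"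
    and ratio6: "\<kappa> / \<nu>\<^sup>2 > 6"
  shows "\<exists>C>0. \<forall>n::nat. n > 0 \<longrightarrow>
           (\<forall>k\<le>n. integrable M (err_sq d m \<kappa> \<nu> AA T B x0 X n k) \<and>
                   sqrt (LINT \<omega>|M. err_sq d m \<kappa> \<nu> AA T B x0 X n k \<omega>) \<le> C / sqrt (real n)) \<and>
           integrable M (\<lambda>\<omega>. Max ((\<lambda>k. err_sq d m \<kappa> \<nu> AA T B x0 X n k \<omega>) ` {0..n})) \<and>
           sqrt (LINT \<omega>|M. Max ((\<lambda>k. err_sq d m \<kappa> \<nu> AA T B x0 X n k \<omega>) ` {0..n}))
             \<le> C / real n powr (1/4)"
proof -
  have "0 < \<nu>\<^sup>2" using nu by simp
  then have kappa6: "6 * \<nu>\<^sup>2 \<le> \<kappa>" using ratio6 by (simp add: field_simps)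
  interpret sde M F d m T \<kappa> \<nu> AA B X x0
    by unfold_locales (fact T filt BM nu skewA x0 sol kappa6)+
  \<comment> \<open>Each rate has its own constant; the sum dominates both, and the summand 1 makes
    it positive.\<close>
  define C where "C = sqrt (Cg * T) + sqrt (Cm * sqrt T) + 1"
  have p: "0 \<le> sqrt (Cg * T)" "0 \<le> sqrt (Cm * sqrt T)" using Cg Cm T by simp_all
  then have C: "0 < C" "sqrt (Cg * T) \<le> C" "sqrt (Cm * sqrt T) \<le> C" unfolding C_def by linarith+
  show ?thesis
  proof (intro exI[of _ C] conjI allI impI C(1))
    fix n :: nat assume n: "0 < n"
    interpret s: sde_scheme M F d m T \<kappa> \<nu> AA B X x0 n by unfold_locales (fact n)
    have eq: "err_sq d m \<kappa> \<nu> AA T B x0 X n k = s.err k" for k by (rule ext) (rule s.err_sq_eq)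
    show "integrable M (err_sq d m \<kappa> \<nu> AA T B x0 X n k)" if "k \<le> n" for k unfolding eq by (rule s.err_integrable[OF that])
    show "sqrt (LINT \<omega>|M. err_sq d m \<kappa> \<nu> AA T B x0 X n k \<omega>) \<le> C / sqrt (real n)" if "k \<le> n" for k
      unfolding eq by (rule order_trans[OF s.err_rate[OF that] divide_right_mono[OF C(2)]]) simp
    show "integrable M (\<lambda>\<omega>. Max ((\<lambda>k. err_sq d m \<kappa> \<nu> AA T B x0 X n k \<omega>) ` {0..n}))" unfolding eq by (rule s.Max_err(1))
    show "sqrt (LINT \<omega>|M. Max ((\<lambda>k. err_sq d m \<kappa> \<nu> AA T B x0 X n k \<omega>) ` {0..n})) \<le> C / real n powr (1/4)"
      unfolding eq by (rule order_trans[OF s.Max_err_rate divide_right_mono[OF C(3)]]) simp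
  qed
qed

end
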